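(* Fix a multiprojective Seshadri stratification on $X\subseteq\prod_{i=1}^m\mathbb P(V_i)$ with underlying poset $A$ and let $\underline d\in\mathbb N_0^m$. The following statements hold for each maximal chain $\mathfrak C$ in $A$: (a) For any two subchains $C,D\subseteq\mathfrak C$ we have $\Delta_C^{(\underline d)}\subseteq\Delta_D^{(\underline d)}$ if and only if $C_{\underline d}\subseteq D_{\underline d}$. (b) The map $F_{\mathfrak C}^{(\underline d)}:\{C\in\Delta^{(\underline d)}(A)\mid C\subseteq\mathfrak C\}\to L(\Delta_{\mathfrak C}^{(\underline d)})$, $C\mapsto\Delta_C^{(\underline d)}$, is an isomorphism of posets, where $L(\Delta_{\mathfrak C}^{(\underline d)})$ is the face lattice of the polytope $\Delta_{\mathfrak C}^{(\underline d)}$, i.e. the set of all its faces (including the empty face), and both sides are ordered by inclusion. (c) For all $C\subseteq\mathfrak C$ the face $\Delta_C^{(\underline d)}$ is of dimension $|C_{\underline d}|-\dim\sigma_{C_{\underline d}}$ and its vertices lie in the $\mathbb Q$-span of the lattice $\mathcal L^{C,(\underline d)}$.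
   Context: Multicones. $\mathbb K$ is an algebraically closed field, $V_1,\dots,V_m$ ($m\ge1$) are finite-dimensional $\mathbb K$-vector spaces, $V=V_1\times\dots\times V_m$, $[m]=\{1,\dots,m\}$, $\mathbb N=\{1,2,\dots\}$. For $\varnothing\ne I\subseteq[m]$ and a closed subvariety $Y\subseteq\prod_{i\in I}\mathbb P(V_i)$, the multicone $\hat Y\subseteq\prod_{i\in I}V_i$ is the set of tuples $(v_i)$ for which there are non-zero $w_i\in V_i$ with $v_i\in\mathbb Kw_i$ and $([w_i])_i\in Y$. We view $\prod_{i\in I}V_i\subseteq V$ (remaining coordinates zero), so all multicones are closed subvarieties of $V$. $X\subseteq\prod_{i=1}^m\mathbb P(V_i)$ is closed, $R=\mathbb K[X]=\mathbb K[\hat X]$ is its $\mathbb N_0^m$-graded multihomogeneous coordinate ring, $X_I$ is the image of $X$ in $\prod_{i\in I}\mathbb P(V_i)$, and $\mathbb K[X_I]\subseteq R$ is the subalgebra $\bigoplus_{\underline d:\,d_j=0\,\forall j\notin I}R_{\underline d}$. Seshadri stratification. A (multiprojective) Seshadri stratification on $X$ consists of a finite set $A$ and, for each $p\in A$, a non-empty index set $I_p\subseteq[m]$, an irreducible closed subvariety $X_p\subseteq X_{I_p}$ which is smooth in codimension one, and a non-constant multihomogeneous $f_p\in\mathbb K[X_{I_p}]\subseteq R$ (extremal function), where $A$ is partially ordered by $q\le p\Leftrightarrow\hat X_q\subseteq\hat X_p$; there is $p_{\max}\in A$ with $I_{p_{\max}}=[m]$, $X_{p_{\max}}=X$; and (S1)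 if $q<p$ is a covering relation then $\hat X_q\subseteq\hat X_p$ has codimension one; (S2) $f_q$ vanishes on $\hat X_p$ if $q\nleq p$; (S3) $\{x\in\hat X\mid f_p(x)=0\}\cap\hat X_p=\{0\}\cup\bigcup_{p\text{ covers }q}\hat X_q$ for each $p\in A$. Quasi-valuation. All maximal chains of $A$ have length $s=\dim\hat X-1$. Add to $A$ a least element $p_{-1}$ with $\hat X_{p_{-1}}=\{0\}$. For a covering relation $q<p$ in $A\cup\{p_{-1}\}$ let $\nu_{p,q}:\mathbb K(\hat X_p)\setminus\{0\}\to\mathbb Z$ be the discrete valuation sending a rational function to its vanishing multiplicity at the prime divisor $\hat X_q\subseteq\hat X_p$, and let $b_{p,q}=\nu_{p,q}(f_p|_{\hat X_p})$ be the bond. For a maximal chain $\mathfrak C:p_s>\dots>p_0$ and $g\in R\setminus\{0\}$ put $g_s=g$, $g_{i-1}=\bigl(g_i^{b_{p_i,p_{i-1}}}/f_{p_i}^{\nu_{p_i,p_{i-1}}(g_i)}\bigr)\big|_{\hat X_{p_{i-1}}}$ for $i=s,\dots,1$, and $\mathcal V_{\mathfrak C}(g)=\sum_{j=0}^s\frac{\nu_{p_j,p_{j-1}}(g_j)}{\prod_{k=j}^sb_{p_k,p_{k-1}}}e_{p_j}\in\mathbb Q^{\mathfrak C}\subseteq\mathbb Q^A$, where $\mathbb Q^S$ has basis $\{e_p\mid p\in S\}$. Fix a total order $\ge^t$ on $A$ refining the partial order and order $\mathbb Q^A$ lexicographically (compare coefficients at the $\ge^t$-largest element where they differ). Set $\mathcal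 V(g)=\min_{\mathfrak C}\mathcal V_{\mathfrak C}(g)$ over all maximal chains, $\Gamma=\{\mathcal V(g)\mid g\in R\setminus\{0\}\}$, and for a chain $C$, $\Gamma_C=\{\underline a\in\Gamma\mid\operatorname{supp}\underline a\subseteq C\}$ (a monoid). The degree map is the linear map $\deg:\mathbb R^A\to\mathbb R^m$, $e_p\mapsto\deg f_p$. Chains and cones. Chains may be empty. $\sigma_C=\operatorname{Cone}\{\deg\underline a\mid\underline a\in\Gamma_C\}\subseteq\mathbb R^m$, which is generated by the vectors $\deg f_p$, $p\in C$. If $\underline d\notin\sigma_C$ put $C_{\underline d}=\varnothing$; otherwise let $\tau$ be the unique face of $\sigma_C$ with $\underline d\in\operatorname{relint}\tau$ and put $C_{\underline d}=\{p\in C\mid\mathbb R_{\ge0}\deg f_p\text{ is an edge (one-dimensional face) of }\tau\}$. $\Delta^{(\underline d)}(A)$ is the image of the map $C\mapsto C_{\underline d}$ on the set of all chains in $A$. $\mathcal L^{C,(\underline d)}\subseteq\mathbb Q^A$ is the lattice generated by $\Gamma_C^{(\underline d)}=\{\underline a\in\Gamma_C\mid\deg\underline a\in\mathbb N_0\underline d\}$. $\Delta_C^{(\underline d)}=\overline{\bigcup_{n\in\mathbb N}\frac1n\{\underline a\in\Gamma_C\mid\deg\underline a=n\underline d\}}\subseteq\mathbb R^A$, which is the (possibly empty) polytope $\{\underline a\in\mathbb R^C_{\ge0}\mid\deg\underline a=\underline d\}$.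
   Formalization: Assumed: the local rings at the divisors are discrete valuation rings (so ν is defined); for each subchain D of the maximal chain with d in σ_D, every deg f_p (p in D) in τ spans an edge of τ (otherwise (a)–(c) fail); d≠0 in (b). The empty polytope has dimension 0. *)

theory Defs
  imports "HOL-Analysis.Analysis" "HOL-Library.Function_Algebras" "HOL-Algebra.Ideal"
begin

section \<open>Fraction fields, localizations and vanishing multiplicities\<close>

definition fraction :: "('r, 'z) ring_scheme \<Rightarrow> 'r \<Rightarrow> 'r \<Rightarrow> ('r \<times> 'r) set" where
  "fraction R a b =
     {(c, d). c \<in> carrier R \<and> d \<in> carrier R - {\<zero>\<^bsub>R\<^esub>} \<and> c \<otimes>\<^bsub>R\<^esub> b = a \<otimes>\<^bsub>R\<^esub> d}"

text \<open>The unions below are the usual way of lifting an operation to equivalence classes: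
  for a domain all members of the union coincide.\<close>

definition fraction_field :: "('r, 'z) ring_scheme \<Rightarrow> ('r \<times> 'r) set ring" where
  "fraction_field R =
     \<lparr>carrier = {fraction R a b | a b. a \<in> carrier R \<and> b \<in> carrier R - {\<zero>\<^bsub>R\<^esub>}},
      mult = (\<lambda>F G. \<Union>(a, b)\<in>F. \<Union>(c, d)\<in>G. fraction R (a \<otimes>\<^bsub>R\<^esub> c) (b \<otimes>\<^bsub>R\<^esub> d)),
      one = fraction R \<one>\<^bsub>R\<^esub> \<one>\<^bsub>R\<^esub>,
      zero = fraction R \<zero>\<^bsub>R\<^esub> \<one>\<^bsub>R\<^esub>,
      add = (\<lambda>F G. \<Union>(a, b)\<in>F. \<Union>(c, d)\<in>G.
               fraction R (a \<otimes>\<^bsub>R\<^esub> d \<oplus>\<^bsub>R\<^esub> c \<otimes>\<^bsub>R\<^esub> b) (b \<otimes>\<^bsub>R\<^esub> d))\<rparr>"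

text \<open>Localization of a domain at a prime ideal, as a subring of the fraction field.\<close>

definition localization :: "('r, 'z) ring_scheme \<Rightarrow> 'r set \<Rightarrow> ('r \<times> 'r) set ring" where
  "localization R P =
     (fraction_field R)\<lparr>carrier := {fraction R a b | a b. a \<in> carrier R \<and> b \<in> carrier R - P}\<rparr>"

definition localization_max :: "('r, 'z) ring_scheme \<Rightarrow> 'r set \<Rightarrow> ('r \<times> 'r) set set" where
  "localization_max R P = {fraction R a b | a b. a \<in> P \<and> b \<in> carrier R - P}"

definition discrete_valuation_ring :: "('r, 'z) ring_scheme \<Rightarrow> bool" where
  "discrete_valuation_ring R \<longleftrightarrow>
     domain R \<and> \<not> field R \<and> (\<forall>J. ideal J R \<longrightarrow> principalideal J R) \<and> (\<exists>!M. maximalideal M R)"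

text \<open>The exponent \<open>n\<close> in \<open>F = t ^ n * u\<close>, where \<open>t\<close> is a uniformizer and \<open>u\<close> a unit of the
  localization; meaningful if the localization is a discrete valuation ring and \<open>F\<close> is non-zero.\<close>

definition multiplicity_at ::
    "('r, 'z) ring_scheme \<Rightarrow> 'r set \<Rightarrow> ('r \<times> 'r) set \<Rightarrow> int" where
  "multiplicity_at R P F =
     (THE n. \<exists>t\<in>carrier (localization R P). \<exists>u\<in>Units (localization R P).
        localization_max R P = PIdl\<^bsub>localization R P\<^esub> t \<and>
        F = t [^]\<^bsub>fraction_field R\<^esub> (n::int) \<otimes>\<^bsub>fraction_field R\<^esub> u)"


section \<open>Closed subsets of products of vector spaces and of projective spaces\<close>

text \<open>The index set \<open>{1, \<dots>, m}\<close> is the finite type \<open>'m\<close>. The spaces \<open>V\<^sub>i\<close> are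
  finite-dimensional subspaces of one vector space with carrier type \<open>'v\<close>, which is no restriction:
  take for \<open>'v\<close> their direct sum.\<close>

record ('k, 'v, 'm) ambient =
  scl :: "'k \<Rightarrow> 'v \<Rightarrow> 'v"
  VS :: "'m \<Rightarrow> 'v set"

definition ambient_space ::
    "('k::alg_closed_field, 'v::ab_group_add, 'm::finite, 'z) ambient_scheme \<Rightarrow> bool" where
  "ambient_space M \<longleftrightarrow>
     vector_space (scl M) \<and> (\<forall>i. \<exists>B. finite B \<and> VS M i = Modules.module.span (scl M) B)"

text \<open>The product of the \<open>V\<^sub>i\<close> with \<open>i \<in> I\<close>, embedded in the product of all \<open>V\<^sub>i\<close>.\<close>

definition prod_space ::
    "('k::alg_closed_field, 'v::ab_group_add, 'm::finite, 'z) ambient_scheme \<Rightarrow> 'm set \<Rightarrow>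
     ('m \<Rightarrow> 'v) set" where
  "prod_space M I = {v. (\<forall>i\<in>I. v i \<in> VS M i) \<and> (\<forall>i. i \<notin> I \<longrightarrow> v i = 0)}"

inductive_set polyfun ::
    "('k::alg_closed_field, 'v::ab_group_add, 'm::finite, 'z) ambient_scheme \<Rightarrow>
     (('m \<Rightarrow> 'v) \<Rightarrow> 'k) set"
  for M where
    const: "(\<lambda>_. c) \<in> polyfun M"
  | coord: "Vector_Spaces.linear (scl M) (*) l \<Longrightarrow> (\<lambda>v. l (v i)) \<in> polyfun M"
  | add: "\<phi> \<in> polyfun M \<Longrightarrow> \<psi> \<in> polyfun M \<Longrightarrow> (\<lambda>v. \<phi> v + \<psi> v) \<in> polyfun M"
  | mult: "\<phi> \<in> polyfun M \<Longrightarrow> \<psi> \<in> polyfun M \<Longrightarrow> (\<lambda>v. \<phi> v * \<psi> v) \<in> polyfun M"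

definition multihom ::
    "('k::alg_closed_field, 'v::ab_group_add, 'm::finite, 'z) ambient_scheme \<Rightarrow> ('m \<Rightarrow> nat) \<Rightarrow>
     (('m \<Rightarrow> 'v) \<Rightarrow> 'k) set" where
  "multihom M d =
     {\<phi> \<in> polyfun M. \<forall>t. \<forall>v\<in>prod_space M UNIV.
        \<phi> (\<lambda>i. scl M (t i) (v i)) = (\<Prod>i\<in>UNIV. t i ^ d i) * \<phi> v}"

definition affine_closed ::
    "('k::alg_closed_field, 'v::ab_group_add, 'm::finite, 'z) ambient_scheme \<Rightarrow>
     ('m \<Rightarrow> 'v) set \<Rightarrow> bool" where
  "affine_closed M Z \<longleftrightarrow>
     (\<exists>E\<subseteq>polyfun M. Z = {v \<in> prod_space M UNIV. \<forall>\<phi>\<in>E. \<phi> v = 0})"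

text \<open>A point of the product of the \<open>\<P>(V\<^sub>i)\<close>, \<open>i \<in> I\<close>, is a tuple of lines, extensional
  on \<open>I\<close>; it is represented by tuples of non-zero vectors.\<close>

definition nonzero_tuples ::
    "('k::alg_closed_field, 'v::ab_group_add, 'm::finite, 'z) ambient_scheme \<Rightarrow> 'm set \<Rightarrow>
     ('m \<Rightarrow> 'v) set" where
  "nonzero_tuples M I = {w \<in> prod_space M I. \<forall>i\<in>I. w i \<noteq> 0}"

definition lines ::
    "('k::alg_closed_field, 'v::ab_group_add, 'm::finite, 'z) ambient_scheme \<Rightarrow> 'm set \<Rightarrow>
     ('m \<Rightarrow> 'v) \<Rightarrow> ('m \<Rightarrow> 'v set)" where
  "lines M I w = (\<lambda>i\<in>I. Modules.module.span (scl M) {w i})"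

definition proj_closed ::
    "('k::alg_closed_field, 'v::ab_group_add, 'm::finite, 'z) ambient_scheme \<Rightarrow> 'm set \<Rightarrow>
     ('m \<Rightarrow> 'v set) set \<Rightarrow> bool" where
  "proj_closed M I Y \<longleftrightarrow>
     (\<exists>E\<subseteq>(\<Union>d. multihom M d). Y = lines M I ` {w \<in> nonzero_tuples M I. \<forall>\<phi>\<in>E. \<phi> w = 0})"

definition multicone ::
    "('k::alg_closed_field, 'v::ab_group_add, 'm::finite, 'z) ambient_scheme \<Rightarrow> 'm set \<Rightarrow>
     ('m \<Rightarrow> 'v set) set \<Rightarrow> ('m \<Rightarrow> 'v) set" where
  "multicone M I Y =
     {v \<in> prod_space M I. \<exists>w\<in>nonzero_tuples M I.
        (\<forall>i\<in>I. \<exists>c. v i = scl M c (w i)) \<and> lines M I w \<in> Y}"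

text \<open>Irreducibility, codimension and dimension relative to a family \<open>cl\<close> of closed sets.\<close>

definition irreducible_closed :: "('p set \<Rightarrow> bool) \<Rightarrow> 'p set \<Rightarrow> bool" where
  "irreducible_closed cl Z \<longleftrightarrow>
     cl Z \<and> Z \<noteq> {} \<and> (\<forall>Z1 Z2. cl Z1 \<and> cl Z2 \<and> Z = Z1 \<union> Z2 \<longrightarrow> Z = Z1 \<or> Z = Z2)"

definition irreducible_chain :: "('p set \<Rightarrow> bool) \<Rightarrow> nat \<Rightarrow> (nat \<Rightarrow> 'p set) \<Rightarrow> bool" where
  "irreducible_chain cl n W \<longleftrightarrow>
     (\<forall>k\<le>n. irreducible_closed cl (W k)) \<and> (\<forall>k<n. W k \<subset> W (Suc k))"

definition codimension :: "('p set \<Rightarrow> bool) \<Rightarrow> 'p set \<Rightarrow> 'p set \<Rightarrow> enat" where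
  "codimension cl Z Y = Sup {enat n | n W. irreducible_chain cl n W \<and> W 0 = Z \<and> W n = Y}"

definition krull_dimension :: "('p set \<Rightarrow> bool) \<Rightarrow> 'p set \<Rightarrow> enat" where
  "krull_dimension cl Y = Sup {enat n | n W. irreducible_chain cl n W \<and> W n \<subseteq> Y}"

text \<open>The algebraic directional derivative: the coefficient of \<open>t\<close> in \<open>\<phi> (w + t u)\<close>.\<close>

definition directional_derivative ::
    "('k::alg_closed_field, 'v::ab_group_add, 'm::finite, 'z) ambient_scheme \<Rightarrow>
     (('m \<Rightarrow> 'v) \<Rightarrow> 'k) \<Rightarrow> ('m \<Rightarrow> 'v) \<Rightarrow> ('m \<Rightarrow> 'v) \<Rightarrow> 'k" where
  "directional_derivative M \<phi> w u =
     coeff (THE p. \<forall>t. poly p t = \<phi> (\<lambda>i. w i + scl M t (u i))) 1"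

definition tangent_space ::
    "('k::alg_closed_field, 'v::ab_group_add, 'm::finite, 'z) ambient_scheme \<Rightarrow>
     ('m \<Rightarrow> 'v) set \<Rightarrow> ('m \<Rightarrow> 'v) \<Rightarrow> ('m \<Rightarrow> 'v) set" where
  "tangent_space M Z w =
     {u \<in> prod_space M UNIV. \<forall>\<phi>\<in>polyfun M. (\<forall>v\<in>Z. \<phi> v = 0) \<longrightarrow> directional_derivative M \<phi> w u = 0}"

text \<open>The singular points of an irreducible closed \<open>Y\<close> in a product of projective spaces, by the
  Jacobian criterion in multihomogeneous coordinates. Over the tuples with all coordinates non-zero
  the multicone is a torus bundle over \<open>Y\<close>, so both the dimension and the dimension of
  the tangent space grow by the number of factors.\<close>

definition singular_locus ::
    "('k::alg_closed_field, 'v::ab_group_add, 'm::finite, 'z) ambient_scheme \<Rightarrow> 'm set \<Rightarrow>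
     ('m \<Rightarrow> 'v set) set \<Rightarrow> ('m \<Rightarrow> 'v set) set" where
  "singular_locus M I Y =
     lines M I ` {w \<in> nonzero_tuples M I. lines M I w \<in> Y \<and>
       krull_dimension (affine_closed M) (multicone M I Y)
         < enat (vector_space.dim (\<lambda>c u i. scl M c (u i)) (tangent_space M (multicone M I Y) w))}"

definition smooth_in_codimension_one ::
    "('k::alg_closed_field, 'v::ab_group_add, 'm::finite, 'z) ambient_scheme \<Rightarrow> 'm set \<Rightarrow>
     ('m \<Rightarrow> 'v set) set \<Rightarrow> bool" where
  "smooth_in_codimension_one M I Y \<longleftrightarrow>
     (\<forall>Z. irreducible_closed (proj_closed M I) Z \<and> Z \<subseteq> singular_locus M I Y
        \<longrightarrow> codimension (proj_closed M I) Z Y \<ge> 2)"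

text \<open>Coordinate rings are rings of functions (the ground field is algebraically closed).\<close>

definition coordinate_ring ::
    "('k::alg_closed_field, 'v::ab_group_add, 'm::finite, 'z) ambient_scheme \<Rightarrow>
     ('m \<Rightarrow> 'v) set \<Rightarrow> (('m \<Rightarrow> 'v) \<Rightarrow> 'k) ring" where
  "coordinate_ring M Z =
     \<lparr>carrier = (\<lambda>\<phi>. restrict \<phi> Z) ` polyfun M,
      mult = (\<lambda>g h. \<lambda>v\<in>Z. g v * h v),
      one = (\<lambda>v\<in>Z. 1),
      zero = (\<lambda>v\<in>Z. 0),
      add = (\<lambda>g h. \<lambda>v\<in>Z. g v + h v)\<rparr>"

definition vanishing_ideal ::
    "('k::alg_closed_field, 'v::ab_group_add, 'm::finite, 'z) ambient_scheme \<Rightarrow>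
     ('m \<Rightarrow> 'v) set \<Rightarrow> ('m \<Rightarrow> 'v) set \<Rightarrow> (('m \<Rightarrow> 'v) \<Rightarrow> 'k) set" where
  "vanishing_ideal M Z W = {g \<in> carrier (coordinate_ring M Z). \<forall>v\<in>W. g v = 0}"

text \<open>Restriction to \<open>W \<subseteq> Z\<close> of a rational function on \<open>Z\<close> that is regular at the generic point
  of \<open>W\<close>; the result is a rational function on \<open>W\<close>.\<close>

definition restrict_rational ::
    "('k::alg_closed_field, 'v::ab_group_add, 'm::finite, 'z) ambient_scheme \<Rightarrow>
     ('m \<Rightarrow> 'v) set \<Rightarrow> ('m \<Rightarrow> 'v) set \<Rightarrow>
     ((('m \<Rightarrow> 'v) \<Rightarrow> 'k) \<times> (('m \<Rightarrow> 'v) \<Rightarrow> 'k)) set \<Rightarrow> ((('m \<Rightarrow> 'v) \<Rightarrow> 'k) \<times> (('m \<Rightarrow> 'v) \<Rightarrow> 'k)) set" where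
  "restrict_rational M Z W F =
     (\<Union>(a, b) \<in> {(a, b) \<in> F. b \<notin> vanishing_ideal M Z W}.
        fraction (coordinate_ring M W) (restrict a W) (restrict b W))"


section \<open>Seshadri stratifications\<close>

text \<open>The finite set \<open>A\<close> is the finite type \<open>'a\<close>; the additional least element is \<open>None\<close> in
  \<open>'a option\<close>. The fields are \<open>X\<close>, \<open>I\<^sub>p\<close>, \<open>X\<^sub>p\<close> and \<open>f\<^sub>p\<close>.\<close>

record ('k, 'v, 'm, 'a) stratification = "('k, 'v, 'm) ambient" +
  var :: "('m \<Rightarrow> 'v set) set"
  idx :: "'a \<Rightarrow> 'm set"
  stratum :: "'a \<Rightarrow> ('m \<Rightarrow> 'v set) set"
  extr :: "'a \<Rightarrow> ('m \<Rightarrow> 'v) \<Rightarrow> 'k"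

context
  fixes S :: "('k::alg_closed_field, 'v::ab_group_add, 'm::finite, 'a::finite) stratification"
begin

definition var_cone :: "('m \<Rightarrow> 'v) set" where
  "var_cone = multicone S UNIV (var S)"

definition cone_of :: "'a option \<Rightarrow> ('m \<Rightarrow> 'v) set" where
  "cone_of p = (case p of None \<Rightarrow> {\<lambda>_. 0} | Some p \<Rightarrow> multicone S (idx S p) (stratum S p))"

definition covers :: "'a option \<Rightarrow> 'a option \<Rightarrow> bool" where
  "covers p q \<longleftrightarrow> cone_of q \<subset> cone_of p \<and> (\<nexists>r. cone_of q \<subset> cone_of r \<and> cone_of r \<subset> cone_of p)"

definition hom_component :: "('m \<Rightarrow> nat) \<Rightarrow> (('m \<Rightarrow> 'v) \<Rightarrow> 'k) set" where
  "hom_component d = (\<lambda>\<phi>. restrict \<phi> var_cone) ` multihom S d"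

definition multidegree :: "(('m \<Rightarrow> 'v) \<Rightarrow> 'k) \<Rightarrow> 'm \<Rightarrow> nat" where
  "multidegree g = (THE d. g \<in> hom_component d)"

definition seshadri_stratification :: bool where
  "seshadri_stratification \<longleftrightarrow>
     ambient_space S \<and>
     proj_closed S UNIV (var S) \<and>
     (\<forall>p. idx S p \<noteq> {} \<and>
          irreducible_closed (proj_closed S (idx S p)) (stratum S p) \<and>
          stratum S p \<subseteq> (\<lambda>y. restrict y (idx S p)) ` var S \<and>
          smooth_in_codimension_one S (idx S p) (stratum S p)) \<and>
     (\<forall>p. (\<exists>d. extr S p \<in> hom_component d \<and> (\<forall>j. j \<notin> idx S p \<longrightarrow> d j = 0)) \<and>
          \<not> (\<exists>c. \<forall>v\<in>var_cone. extr S p v = c)) \<and>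
     inj (\<lambda>p. cone_of (Some p)) \<and>
     (\<exists>p. idx S p = UNIV \<and> stratum S p = var S) \<and>
     (\<forall>p q. covers (Some p) (Some q) \<longrightarrow>
          codimension (affine_closed S) (cone_of (Some q)) (cone_of (Some p)) = 1) \<and>
     (\<forall>p q. \<not> cone_of (Some q) \<subseteq> cone_of (Some p) \<longrightarrow> (\<forall>v\<in>cone_of (Some p). extr S q v = 0)) \<and>
     (\<forall>p. {v \<in> var_cone. extr S p v = 0} \<inter> cone_of (Some p) =
          {\<lambda>_. 0} \<union> (\<Union>q\<in>{q. covers (Some p) (Some q)}. cone_of (Some q)))"

text \<open>The local rings at the divisors given by the covering relations (including those with the
  least element \<open>None\<close>) are discrete valuation rings. The vanishing multiplicities and the
  restrictions to the smaller cone in the definition of the quasi-valuation make sense only under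
  this condition. It is not automatic: smoothness in codimension one of \<open>Y\<close> controls its multicone only at points
  with all coordinates non-zero, but a divisor in the multicone may lie in the locus where one
  coordinate vanishes.\<close>

definition has_divisorial_valuations :: bool where
  "has_divisorial_valuations \<longleftrightarrow>
     (\<forall>p q. covers (Some p) q \<longrightarrow>
        discrete_valuation_ring
          (localization (coordinate_ring S (cone_of (Some p)))
             (vanishing_ideal S (cone_of (Some p)) (cone_of q))))"

definition val :: "'a \<Rightarrow> 'a option \<Rightarrow> ((('m \<Rightarrow> 'v) \<Rightarrow> 'k) \<times> (('m \<Rightarrow> 'v) \<Rightarrow> 'k)) set \<Rightarrow> int" where
  "val p q F =
     multiplicity_at (coordinate_ring S (cone_of (Some p)))
       (vanishing_ideal S (cone_of (Some p)) (cone_of q)) F"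

definition extr_on :: "'a \<Rightarrow> ((('m \<Rightarrow> 'v) \<Rightarrow> 'k) \<times> (('m \<Rightarrow> 'v) \<Rightarrow> 'k)) set" where
  "extr_on p =
     fraction (coordinate_ring S (cone_of (Some p)))
       (restrict (extr S p) (cone_of (Some p))) \<one>\<^bsub>coordinate_ring S (cone_of (Some p))\<^esub>"

definition bond :: "'a \<Rightarrow> 'a option \<Rightarrow> int" where
  "bond p q = val p q (extr_on p)"

definition poset_chain :: "'a set \<Rightarrow> bool" where
  "poset_chain C \<longleftrightarrow>
     (\<forall>p\<in>C. \<forall>q\<in>C. cone_of (Some p) \<subseteq> cone_of (Some q) \<or> cone_of (Some q) \<subseteq> cone_of (Some p))"

definition maximal_chain :: "'a set \<Rightarrow> bool" where
  "maximal_chain C \<longleftrightarrow> poset_chain C \<and> (\<forall>D. poset_chain D \<and> C \<subseteq> D \<longrightarrow> D = C)"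

text \<open>A chain \<open>C\<close> is indexed as \<open>p\<^sub>s > \<dots> > p\<^sub>0\<close>, where \<open>p\<^sub>i\<close> has exactly \<open>i\<close> elements of \<open>C\<close>
  below it and \<open>s = card C - 1\<close>.\<close>

definition nth_elem :: "'a set \<Rightarrow> nat \<Rightarrow> 'a" where
  "nth_elem C i = (THE p. p \<in> C \<and> card {q \<in> C. cone_of (Some q) \<subset> cone_of (Some p)} = i)"

definition pred_elem :: "'a set \<Rightarrow> nat \<Rightarrow> 'a option" where
  "pred_elem C i = (if i = 0 then None else Some (nth_elem C (i - 1)))"

definition chain_bond :: "'a set \<Rightarrow> nat \<Rightarrow> int" where
  "chain_bond C i = bond (nth_elem C i) (pred_elem C i)"

text \<open>\<open>descend C g k\<close> is \<open>g\<^sub>s\<^sub>-\<^sub>k\<close>, and \<open>chain_val C g i\<close> is the integer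
  \<open>\<nu> (g\<^sub>i)\<close> for the valuation of \<open>p\<^sub>i > p\<^sub>i\<^sub>-\<^sub>1\<close>.\<close>

primrec descend ::
    "'a set \<Rightarrow> (('m \<Rightarrow> 'v) \<Rightarrow> 'k) \<Rightarrow> nat \<Rightarrow>
     ((('m \<Rightarrow> 'v) \<Rightarrow> 'k) \<times> (('m \<Rightarrow> 'v) \<Rightarrow> 'k)) set" where
  "descend C g 0 = fraction (coordinate_ring S var_cone) g \<one>\<^bsub>coordinate_ring S var_cone\<^esub>"
| "descend C g (Suc k) =
     (let i = card C - 1 - k; p = nth_elem C i; q = pred_elem C i;
          K = fraction_field (coordinate_ring S (cone_of (Some p)));
          G = descend C g k
      in restrict_rational S (cone_of (Some p)) (cone_of q)
           (G [^]\<^bsub>K\<^esub> bond p q \<otimes>\<^bsub>K\<^esub> inv\<^bsub>K\<^esub> (extr_on p [^]\<^bsub>K\<^esub> val p q G)))"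

definition chain_val :: "'a set \<Rightarrow> (('m \<Rightarrow> 'v) \<Rightarrow> 'k) \<Rightarrow> nat \<Rightarrow> int" where
  "chain_val C g i = val (nth_elem C i) (pred_elem C i) (descend C g (card C - 1 - i))"

text \<open>Values live in \<open>\<rat>\<^sup>A\<close>, regarded inside \<open>\<real>\<^sup>A\<close>.\<close>

definition chain_valuation :: "'a set \<Rightarrow> (('m \<Rightarrow> 'v) \<Rightarrow> 'k) \<Rightarrow> real ^ 'a" where
  "chain_valuation C g =
     (\<Sum>j<card C. (of_int (chain_val C g j) / of_int (\<Prod>k=j..card C - 1. chain_bond C k))
        *\<^sub>R axis (nth_elem C j) 1)"

definition lex_le :: "('a \<times> 'a) set \<Rightarrow> real ^ 'a \<Rightarrow> real ^ 'a \<Rightarrow> bool" where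
  "lex_le r a b \<longleftrightarrow>
     a = b \<or> (\<exists>p. a $ p < b $ p \<and> (\<forall>q. (p, q) \<in> r \<and> q \<noteq> p \<longrightarrow> a $ q = b $ q))"

text \<open>\<open>(q, p) \<in> r\<close> stands for \<open>q \<le>\<^sup>t p\<close>.\<close>

definition refines_order :: "('a \<times> 'a) set \<Rightarrow> bool" where
  "refines_order r \<longleftrightarrow>
     linear_order r \<and> (\<forall>p q. cone_of (Some q) \<subseteq> cone_of (Some p) \<longrightarrow> (q, p) \<in> r)"

definition quasi_valuation :: "('a \<times> 'a) set \<Rightarrow> (('m \<Rightarrow> 'v) \<Rightarrow> 'k) \<Rightarrow> real ^ 'a" where
  "quasi_valuation r g =
     (THE a. a \<in> {chain_valuation C g | C. maximal_chain C} \<and>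
        (\<forall>b\<in>{chain_valuation C g | C. maximal_chain C}. lex_le r a b))"

definition Gamma :: "('a \<times> 'a) set \<Rightarrow> (real ^ 'a) set" where
  "Gamma r =
     quasi_valuation r ` (carrier (coordinate_ring S var_cone) - {\<zero>\<^bsub>coordinate_ring S var_cone\<^esub>})"

definition Gamma_on :: "('a \<times> 'a) set \<Rightarrow> 'a set \<Rightarrow> (real ^ 'a) set" where
  "Gamma_on r C = {a \<in> Gamma r. {p. a $ p \<noteq> 0} \<subseteq> C}"


section \<open>Newton-Okounkov polytopes\<close>

definition real_degree :: "('m \<Rightarrow> nat) \<Rightarrow> real ^ 'm" where
  "real_degree d = (\<chi> i. real (d i))"

definition extr_degree :: "'a \<Rightarrow> real ^ 'm" where
  "extr_degree p = real_degree (multidegree (extr S p))"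

definition degree_map :: "real ^ 'a \<Rightarrow> real ^ 'm" where
  "degree_map a = (\<Sum>p\<in>UNIV. a $ p *\<^sub>R extr_degree p)"

definition degree_cone :: "('a \<times> 'a) set \<Rightarrow> 'a set \<Rightarrow> (real ^ 'm) set" where
  "degree_cone r C = convex_cone hull (degree_map ` Gamma_on r C)"

definition degree_ray :: "'a \<Rightarrow> (real ^ 'm) set" where
  "degree_ray p = {c *\<^sub>R extr_degree p | c. c \<ge> 0}"

definition minimal_face :: "('a \<times> 'a) set \<Rightarrow> ('m \<Rightarrow> nat) \<Rightarrow> 'a set \<Rightarrow> (real ^ 'm) set" where
  "minimal_face r d C =
     (THE \<tau>. \<tau> face_of degree_cone r C \<and> real_degree d \<in> rel_interior \<tau>)"

definition subchain :: "('a \<times> 'a) set \<Rightarrow> ('m \<Rightarrow> nat) \<Rightarrow> 'a set \<Rightarrow> 'a set" where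
  "subchain r d C =
     (if real_degree d \<in> degree_cone r C
      then {p \<in> C. degree_ray p edge_of minimal_face r d C} else {})"

definition subchain_complex :: "('a \<times> 'a) set \<Rightarrow> ('m \<Rightarrow> nat) \<Rightarrow> 'a set set" where
  "subchain_complex r d = subchain r d ` {C. poset_chain C}"

definition value_lattice :: "('a \<times> 'a) set \<Rightarrow> ('m \<Rightarrow> nat) \<Rightarrow> 'a set \<Rightarrow> (real ^ 'a) set" where
  "value_lattice r d C =
     Modules.module.span (\<lambda>k::int. (*\<^sub>R) (of_int k))
       {a \<in> Gamma_on r C. \<exists>n::nat. degree_map a = real n *\<^sub>R real_degree d}"

definition NO_polytope :: "('a \<times> 'a) set \<Rightarrow> ('m \<Rightarrow> nat) \<Rightarrow> 'a set \<Rightarrow> (real ^ 'a) set" where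
  "NO_polytope r d C =
     closure (\<Union>n\<in>{1::nat..}.
       {(1 / real n) *\<^sub>R a | a. a \<in> Gamma_on r C \<and> degree_map a = real n *\<^sub>R real_degree d})"

text \<open>For every subchain \<open>D\<close> of \<open>C\<close>, the degrees \<open>deg f\<^sub>p\<close>, \<open>p \<in> D\<close>, in the face
  \<open>\<tau>\<close> of the degree cone that defines \<open>subchain r d D\<close> lie on edges of \<open>\<tau>\<close>. In general a degree
  can lie in the interior of \<open>\<tau>\<close>. Then \<open>D\<close> and its subchain have the same image under
  \<open>subchain r d\<close> but different polytopes. Example: on \<open>\<P>(K) \<times> \<P>(K\<^sup>2)\<close> with coordinates
  \<open>x; b, c\<close> on the cone, the strata \<open>p\<^sub>2\<close>: everything, \<open>p\<^sub>1\<close>: \<open>c = 0\<close>, \<open>q\<close>: \<open>x = 0\<close>,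
  \<open>p\<^sub>0\<close>: \<open>x = c = 0\<close> with extremal functions \<open>x c, x, c, b\<close> and the chain \<open>p\<^sub>2 > p\<^sub>1 > p\<^sub>0\<close>
  of degrees \<open>(1,1), (1,0), (0,1)\<close>, for \<open>d = (1,1)\<close>.\<close>

definition degrees_on_edges :: "('a \<times> 'a) set \<Rightarrow> ('m \<Rightarrow> nat) \<Rightarrow> 'a set \<Rightarrow> bool" where
  "degrees_on_edges r d C \<longleftrightarrow>
     (\<forall>D\<subseteq>C. real_degree d \<in> degree_cone r D \<longrightarrow>
        (\<forall>p\<in>D. extr_degree p \<in> minimal_face r d D \<longrightarrow> degree_ray p edge_of minimal_face r d D))"

end

definition rational_span :: "(real ^ 'a) set \<Rightarrow> (real ^ 'a) set" where
  "rational_span L = Modules.module.span (\<lambda>k::rat. (*\<^sub>R) (of_rat k)) L"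

text \<open>The empty polytope counts as \<open>0\<close>-dimensional here, whereas \<open>aff_dim {} = - 1\<close>.\<close>

definition polytope_dim :: "(real ^ 'a::finite) set \<Rightarrow> int" where
  "polytope_dim P = max 0 (aff_dim P)"

end

theory Submission
  imports Defs
begin

text \<open>The convex geometry uses only that all values have non-negative coordinates, that every exponent
  vector \<open>n\<close> supported on a chain is a value (of the monomial in the extremal functions), and that
  the degrees of the extremal functions are non-zero with entries in \<open>\<nat>\<close>. Then the polytope of \<open>C\<close> is the fibre
  over \<open>d\<close> of the degree map on the orthant of \<open>C\<close>: its extreme points are rational, being the only
  points of the fibre with their support, and rational points have multiples in \<open>\<Gamma>\<close>. A face of
  the fibre consists of the points supported on the union \<open>E\<close> of the supports of its elements. This union is
  \<open>C\<^sub>d\<close> for the fibre of \<open>C\<close> itself, because \<open>g \<in> \<tau>\<close> holds for a degree \<open>g\<close> iff a small multiple of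
  \<open>g\<close> can be split off from \<open>d\<close>.

  Non-negativity is shown along a chain with lexicographically minimal value: by induction, \<open>g\<^sub>i\<close> is
  almost integral, i.e. its powers have a common denominator, so its vanishing multiplicities
  are non-negative. For the step, let \<open>F j\<close> be the sum of suitable powers of the extremal functions of rank
  \<open>j\<close>. The cone of a stratum of rank \<open>j\<close> is finite over the polynomial ring \<open>B j\<close> in \<open>F 1, \<dots>, F j\<close>,
  all divisors given by covering relations lie over the prime divisor \<open>F j = 0\<close>, and on the stratum of \<open>p\<close> the function \<open>F j\<close>
  is a power of \<open>f p\<close>. A function whose multiplicities at all these divisors are at least those of
  \<open>F j ^ m\<close> is therefore divisible by \<open>F j ^ m\<close> up to a denominator in \<open>B j\<close> that depends on
  neither the function nor \<open>m\<close> and vanishes on none of the divisors. By minimality of the chain the divisor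
  below \<open>p\<close> has the least quotient of multiplicity and bond, so this applies to the powers of the
  next \<open>g\<close> before restriction, and the denominator survives the restriction.\<close>

section \<open>Places and prime ideals in function algebras\<close>

text \<open>The multicones need not be normal, so a rational function with non-negative
  multiplicities at all divisors need not be regular. Almost integrality is the substitute: it
  forces non-negative multiplicities, because a fixed denominator cannot absorb unbounded poles, and
  it is weak enough to pass to the next stratum. The obstacle is to find a denominator that works
  for all exponents at once. The rings \<open>B j\<close> supply it because an element of
  \<open>B (Suc j)\<close> that vanishes on one stratum of rank \<open>j\<close> is divisible by
  \<open>F (Suc j)\<close>, hence vanishes on all strata of that rank. The argument uses no
  dimension theory: the rank of a stratum is the length of a longest chain below it, and the
  discrete valuation rings show that a covering relation lowers it by exactly one. The
  Nullstellensatz behind these steps is obtained by extending homomorphisms to the ground field one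
  generator at a time. That exponent vectors are values has a different source: a chain along which
  a monomial stops restricting to a monomial gives a lexicographically larger value.\<close>

lemma infinite_alg_closed: "infinite (UNIV :: 'k::alg_closed_field set)"
proof
  assume fin: "finite (UNIV :: 'k set)"
  \<comment> \<open>The product vanishes at every element of a finite field, so adding one leaves a
    polynomial without roots.\<close>
  let ?p = "(\<Prod>a\<in>UNIV. [:- a, 1:]) + 1 :: 'k poly"
  have deg: "degree (\<Prod>a\<in>UNIV. [:- a, 1:] :: 'k poly) = card (UNIV :: 'k set)"
    by (subst degree_prod_eq_sum_degree) auto
  then have "degree ?p = card (UNIV :: 'k set)"
    using fin by (subst degree_add_eq_left) (auto simp: card_gt_0_iff)
  then have "degree ?p > 0" using fin by (simp add: card_gt_0_iff)
  then obtain x where "poly ?p x = 0" using alg_closed_imp_poly_has_root by blast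
  then have "(\<Prod>a\<in>UNIV. x - a) + 1 = 0" by (simp add: poly_prod)
  moreover have "(\<Prod>a\<in>UNIV. x - a) = 0" using fin by (intro prod_zero) auto
  ultimately show False by simp
qed

section \<open>Subalgebras, primes and places\<close>

locale constants_embedding =
  fixes \<kappa> :: "'k::alg_closed_field \<Rightarrow> 'r::comm_ring_1"
  assumes const_one: "\<kappa> 1 = 1"
    and const_add: "\<kappa> (a + b) = \<kappa> a + \<kappa> b"
    and const_mult: "\<kappa> (a * b) = \<kappa> a * \<kappa> b"
begin

text \<open>Function rings occur as subsets of one fixed ring type, so subalgebras, ideals and
  primes are predicates on sets. Closure under negation comes from the constant -1.\<close>

definition subalgebra :: "'r set \<Rightarrow> bool" where
  "subalgebra A \<longleftrightarrow> range \<kappa> \<subseteq> A \<and> (\<forall>a\<in>A. \<forall>b\<in>A. a + b \<in> A \<and> a * b \<in> A)"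

definition ideal_in :: "'r set \<Rightarrow> 'r set \<Rightarrow> bool" where
  "ideal_in C P \<longleftrightarrow> P \<subseteq> C \<and> 0 \<in> P \<and> (\<forall>a\<in>P. \<forall>b\<in>P. a + b \<in> P) \<and> (\<forall>c\<in>C. \<forall>a\<in>P. c * a \<in> P)"

definition prime_in :: "'r set \<Rightarrow> 'r set \<Rightarrow> bool" where
  "prime_in C P \<longleftrightarrow> ideal_in C P \<and> 1 \<notin> P \<and> (\<forall>a\<in>C. \<forall>b\<in>C. a * b \<in> P \<longrightarrow> a \<in> P \<or> b \<in> P)"

text \<open>A homomorphism of algebras from \<open>A\<close> to the ground field that kills the part
  of \<open>P\<close> in \<open>A\<close>. When \<open>A\<close> is generated by coordinates, this
  is a point of the zero set of \<open>P\<close>. Outside a subalgebra \<open>A\<close> the values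
  are arbitrary.\<close>

definition place :: "'r set \<Rightarrow> 'r set \<Rightarrow> ('r \<Rightarrow> 'k) \<Rightarrow> bool" where
  "place P A \<theta> \<longleftrightarrow> (\<forall>c. \<theta> (\<kappa> c) = c) \<and> (\<forall>a\<in>A. \<forall>b\<in>A. \<theta> (a + b) = \<theta> a + \<theta> b \<and> \<theta> (a * b) = \<theta> a * \<theta> b) \<and>
     (\<forall>a\<in>A \<inter> P. \<theta> a = 0)"

text \<open>The Nullstellensatz for \<open>A\<close> modulo \<open>P\<close>, in a form that is
  inherited when one more generator is adjoined.\<close>

definition separating_places :: "'r set \<Rightarrow> 'r set \<Rightarrow> bool" where
  "separating_places P A \<longleftrightarrow> (\<forall>u\<in>A - P. \<exists>\<theta>. place P A \<theta> \<and> \<theta> u \<noteq> 0)"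

definition polys :: "'r set \<Rightarrow> 'r poly set" where
  "polys A = {p. \<forall>i. coeff p i \<in> A}"

definition adjoin :: "'r set \<Rightarrow> 'r \<Rightarrow> 'r set" where
  "adjoin A x = (\<lambda>p. poly p x) ` polys A"

lemma const_0: "\<kappa> 0 = 0"
  using const_add[of 0 0] by simp

lemma const_uminus: "\<kappa> (- a) = - \<kappa> a"
  using const_add[of a "- a"] const_0 by (simp add: eq_neg_iff_add_eq_0 add.commute)

context
  fixes A assumes A: "subalgebra A"
begin

lemma sub_const: "\<kappa> c \<in> A"
  using A by (auto simp: subalgebra_def)

lemma sub_0: "0 \<in> A" and sub_1: "1 \<in> A"
  using sub_const[of 0] sub_const[of 1] by (simp_all add: const_0 const_one)

lemma sub_add: "a \<in> A \<Longrightarrow> b \<in> A \<Longrightarrow> a + b \<in> A"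
  and sub_mult: "a \<in> A \<Longrightarrow> b \<in> A \<Longrightarrow> a * b \<in> A"
  using A by (auto simp: subalgebra_def)

lemma sub_uminus: "a \<in> A \<Longrightarrow> - a \<in> A"
  using sub_mult[OF sub_const[of "- 1"], of a] by (simp add: const_uminus const_one)

lemma sub_diff: "a \<in> A \<Longrightarrow> b \<in> A \<Longrightarrow> a - b \<in> A"
  using sub_add[OF _ sub_uminus, of a b] by simp

lemma sub_power: "a \<in> A \<Longrightarrow> a ^ n \<in> A"
  by (induction n) (auto intro: sub_1 sub_mult)

lemma sub_sum: "(\<And>i. i \<in> I \<Longrightarrow> f i \<in> A) \<Longrightarrow> sum f I \<in> A"
  by (induction I rule: infinite_finite_induct) (auto intro: sub_0 sub_add)

lemma sub_prod: "(\<And>i. i \<in> I \<Longrightarrow> f i \<in> A) \<Longrightarrow> prod f I \<in> A"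
  by (induction I rule: infinite_finite_induct) (auto intro: sub_1 sub_mult)

lemmas sub_intros = sub_const sub_0 sub_1 sub_add sub_mult sub_uminus sub_diff sub_power sub_sum sub_prod

lemma polys_add: "p \<in> polys A \<Longrightarrow> q \<in> polys A \<Longrightarrow> p + q \<in> polys A"
  and polys_diff: "p \<in> polys A \<Longrightarrow> q \<in> polys A \<Longrightarrow> p - q \<in> polys A"
  and polys_mult: "p \<in> polys A \<Longrightarrow> q \<in> polys A \<Longrightarrow> p * q \<in> polys A"
  and polys_smult: "a \<in> A \<Longrightarrow> q \<in> polys A \<Longrightarrow> smult a q \<in> polys A"
  and polys_monom: "a \<in> A \<Longrightarrow> monom a n \<in> polys A"
  and polys_0: "0 \<in> polys A"
  by (auto simp: polys_def coeff_mult intro!: sub_intros)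

lemmas polys_intros = polys_add polys_diff polys_mult polys_smult polys_monom polys_0

lemma subalgebra_adjoin: "subalgebra (adjoin A x)"
  unfolding subalgebra_def
proof (intro conjI ballI)
  show "range \<kappa> \<subseteq> adjoin A x"
  proof
    fix y assume "y \<in> range \<kappa>"
    then have "y = poly (monom y 0) x" "y \<in> A" using sub_const by (auto simp: poly_monom)
    then show "y \<in> adjoin A x" unfolding adjoin_def using polys_monom by blast
  qed
next
  fix a b assume "a \<in> adjoin A x" "b \<in> adjoin A x"
  then show "a + b \<in> adjoin A x" "a * b \<in> adjoin A x"
    by (auto simp: adjoin_def simp flip: poly_add poly_mult intro!: imageI polys_intros)
qed

lemma adjoin_self: "x \<in> adjoin A x"
  unfolding adjoin_def by (rule image_eqI[of _ _ "monom 1 1"]) (auto simp: poly_monom sub_1 intro!: polys_monom)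

lemma adjoin_subset: "A \<subseteq> adjoin A x"
proof
  fix a assume "a \<in> A"
  then show "a \<in> adjoin A x"
    unfolding adjoin_def by (intro image_eqI[of _ _ "monom a 0"]) (auto simp: poly_monom intro!: polys_monom)
qed

text \<open>Polynomial division over a ring: each reduction step costs one factor
  \<open>lead_coeff p\<close> instead of a division by it.\<close>

lemma pseudo_division:
  assumes p: "p \<in> polys A" "degree p \<ge> 1" and q: "q \<in> polys A"
  shows "\<exists>n s r. s \<in> polys A \<and> r \<in> polys A \<and> smult (lead_coeff p ^ n) q = p * s + r \<and> degree r < degree p"
  using q
proof (induction "degree q" arbitrary: q rule: less_induct)
  case less
  show ?case
  proof (cases "degree q < degree p")
    case True
    then show ?thesis
      using less.prems polys_0 by (intro exI[of _ 0] exI[of _ 0] exI[of _ q]) auto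
  next
    case False
    let ?q = "smult (lead_coeff p) q - monom (lead_coeff q) (degree q - degree p) * p"
    have A': "lead_coeff p \<in> A" "lead_coeff q \<in> A" using p less.prems by (auto simp: polys_def)
    then have q': "?q \<in> polys A" using p less.prems by (intro polys_intros)
    have "degree ?q \<le> degree q"
      using False by (intro degree_diff_le degree_smult_le order.trans[OF degree_mult_le])
        (auto intro!: order.trans[OF add_right_mono[OF degree_monom_le]])
    moreover have "coeff ?q (degree q) = 0"
      using False by (simp add: coeff_monom_mult)
    ultimately have "degree ?q < degree q"
      using False p(2) by (metis (no_types, lifting) degree_0 leading_coeff_0_iff le_neq_implies_less less_le_trans not_less zero_less_one)
    from less.hyps[OF this q'] obtain n s r where
      nsr: "s \<in> polys A" "r \<in> polys A" "smult (lead_coeff p ^ n) ?q = p * s + r" "degree r < degree p"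
      by blast
    let ?m = "smult (lead_coeff p ^ n) (monom (lead_coeff q) (degree q - degree p))"
    have "smult (lead_coeff p ^ Suc n) q = smult (lead_coeff p ^ n) ?q + ?m * p"
      by (simp add: smult_diff_right mult.commute)
    also have "\<dots> = p * (s + ?m) + r" using nsr(3) by (simp add: algebra_simps)
    finally show ?thesis
      using nsr A' by (intro exI[of _ "Suc n"] exI[of _ "s + ?m"] exI[of _ r]) (auto intro!: polys_intros sub_intros)
  qed
qed

end

text \<open>Relations modulo a prime \<open>P\<close> are normalized so that their leading coefficient is not in \<open>P\<close>.\<close>

lemma strip_leading:
  assumes A: "subalgebra A" and P: "ideal_in C P" and AC: "A \<subseteq> C"
    and p: "p \<in> polys A" "\<exists>i. coeff p i \<notin> P"
  shows "\<exists>p'\<in>polys A. lead_coeff p' \<notin> P \<and> (\<forall>i. coeff (p - p') i \<in> P) \<and> degree p' \<le> degree p"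
  using p
proof (induction "degree p" arbitrary: p rule: less_induct)
  case less
  have P0: "0 \<in> P" and Padd: "\<And>a b. a \<in> P \<Longrightarrow> b \<in> P \<Longrightarrow> a + b \<in> P"
    using P by (auto simp: ideal_in_def)
  show ?case
  proof (cases "lead_coeff p \<in> P")
    case False
    then show ?thesis using less.prems P0 by (intro bexI[of _ p]) auto
  next
    case True
    let ?q = "p - monom (lead_coeff p) (degree p)"
    have q: "?q \<in> polys A" using less.prems A by (intro polys_intros) (auto simp: polys_def)
    have d0: "degree p \<noteq> 0"
    proof
      assume "degree p = 0"
      then have "coeff p i \<in> P" for i using True P0 by (cases "i = 0") (auto simp: coeff_eq_0)
      then show False using less.prems by auto
    qed
    have "degree ?q \<le> degree p" by (intro degree_diff_le degree_monom_le) auto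
    moreover have "coeff ?q (degree p) = 0" by simp
    ultimately have deg: "degree ?q < degree p"
      using d0 by (metis degree_0 leading_coeff_0_iff le_neq_implies_less not_gr0)
    have "\<exists>i. coeff ?q i \<notin> P"
    proof -
      obtain i where i: "coeff p i \<notin> P" using less.prems by auto
      then have "i \<noteq> degree p" using True by auto
      then have "coeff ?q i = coeff p i" by simp
      then show ?thesis using i by metis
    qed
    from less.hyps[OF deg q this] obtain p' where p': "p' \<in> polys A" "lead_coeff p' \<notin> P"
      "\<forall>i. coeff (?q - p') i \<in> P" "degree p' \<le> degree ?q" by blast
    have "coeff (p - p') i \<in> P" for i
    proof -
      have "coeff (p - p') i = coeff (?q - p') i + coeff (monom (lead_coeff p) (degree p)) i" by simp
      moreover have "coeff (monom (lead_coeff p) (degree p)) i \<in> P" using True P0 by (auto simp: coeff_monom)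
      ultimately show ?thesis using p'(3) Padd by metis
    qed
    then show ?thesis using p' deg by (intro bexI[of _ p']) auto
  qed
qed

lemma map_poly_place:
  assumes A: "subalgebra A" and th: "place P A \<theta>"
  shows "\<And>q i. coeff (map_poly \<theta> q) i = \<theta> (coeff q i)"
    and "\<And>p q. p \<in> polys A \<Longrightarrow> q \<in> polys A \<Longrightarrow> map_poly \<theta> (p + q) = map_poly \<theta> p + map_poly \<theta> q"
    and "\<And>p q. p \<in> polys A \<Longrightarrow> q \<in> polys A \<Longrightarrow> map_poly \<theta> (p - q) = map_poly \<theta> p - map_poly \<theta> q"
    and "\<And>p q. p \<in> polys A \<Longrightarrow> q \<in> polys A \<Longrightarrow> map_poly \<theta> (p * q) = map_poly \<theta> p * map_poly \<theta> q"
    and "\<And>p a. p \<in> polys A \<Longrightarrow> a \<in> A \<Longrightarrow> map_poly \<theta> (smult a p) = smult (\<theta> a) (map_poly \<theta> p)"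
proof -
  note Asub = sub_intros[OF A]
  have th0: "\<theta> 0 = 0" using th const_0 unfolding place_def by metis
  show c: "\<And>q i. coeff (map_poly \<theta> q) i = \<theta> (coeff q i)" using th0 by (simp add: coeff_map_poly)
  have add: "\<And>a b. a \<in> A \<Longrightarrow> b \<in> A \<Longrightarrow> \<theta> (a + b) = \<theta> a + \<theta> b"
    and mult: "\<And>a b. a \<in> A \<Longrightarrow> b \<in> A \<Longrightarrow> \<theta> (a * b) = \<theta> a * \<theta> b"
    using th by (auto simp: place_def)
  have diff: "\<theta> (a - b) = \<theta> a - \<theta> b" if "a \<in> A" "b \<in> A" for a b
    using add[OF sub_diff[OF A that] that(2)] by (simp add: algebra_simps)
  have sm: "(\<forall>i\<in>I. f i \<in> A) \<Longrightarrow> \<theta> (sum f I) = (\<Sum>i\<in>I. \<theta> (f i))" for f :: "nat \<Rightarrow> 'r" and I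
    by (induction I rule: infinite_finite_induct) (auto simp: th0 add Asub)
  fix p q assume pq: "p \<in> polys A" "q \<in> polys A"
  then have pq': "coeff p i \<in> A" "coeff q i \<in> A" for i by (auto simp: polys_def)
  show "map_poly \<theta> (p + q) = map_poly \<theta> p + map_poly \<theta> q"
    "map_poly \<theta> (p - q) = map_poly \<theta> p - map_poly \<theta> q"
    "map_poly \<theta> (p * q) = map_poly \<theta> p * map_poly \<theta> q"
    by (rule poly_eqI, simp add: c pq' add diff sm mult coeff_mult Asub)+
next
  fix p a assume "p \<in> polys A" "a \<in> A"
  moreover have "\<theta> 0 = 0" using th const_0 unfolding place_def by metis
  ultimately show "map_poly \<theta> (smult a p) = smult (\<theta> a) (map_poly \<theta> p)"
    using th by (intro poly_eqI) (auto simp: coeff_map_poly place_def polys_def)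
qed

text \<open>A place of \<open>A\<close> is extended by choosing a value \<open>l\<close> for
  \<open>x\<close>. Let \<open>N\<close> be the relations of \<open>x\<close> modulo
  \<open>P\<close> and \<open>N'\<close> the trivial ones. Without non-trivial relations almost
  every \<open>l\<close> is admissible. Otherwise \<open>l\<close> is a root of the image of a
  relation \<open>p\<close> of least degree, and the place of \<open>A\<close> has to keep the
  leading coefficient of \<open>p\<close> and an element of \<open>A\<close> that \<open>v\<close>
  divides modulo \<open>P\<close>.\<close>

lemma separating_places_adjoin:
  assumes C: "subalgebra C" and P: "prime_in C P" and A: "subalgebra A" and AC: "A \<subseteq> C" and x: "x \<in> C"
    and sep: "separating_places P A"
  shows "separating_places P (adjoin A x)"
  unfolding separating_places_def
proof
  fix v assume "v \<in> adjoin A x - P"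
  then obtain w0 where w0: "w0 \<in> polys A" "v = poly w0 x" and vP: "v \<notin> P" by (auto simp: adjoin_def)
  note Asub = sub_intros[OF A] and Csub = sub_intros[OF C] and pint = polys_intros[OF A]
  have PI: "ideal_in C P" and P1: "1 \<notin> P"
    and Pprime: "\<And>a b. a \<in> C \<Longrightarrow> b \<in> C \<Longrightarrow> a * b \<in> P \<Longrightarrow> a \<in> P \<or> b \<in> P"
    using P by (auto simp: prime_in_def)
  have PC: "P \<subseteq> C" and P0: "0 \<in> P" and Padd: "\<And>a b. a \<in> P \<Longrightarrow> b \<in> P \<Longrightarrow> a + b \<in> P"
    and Pmult: "\<And>c a. c \<in> C \<Longrightarrow> a \<in> P \<Longrightarrow> c * a \<in> P"
    using PI by (auto simp: ideal_in_def)
  have Puminus: "- a \<in> P" if "a \<in> P" for a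
    using Pmult[OF Csub(6)[OF Csub(3)] that] by simp
  have Pdiff: "a - b \<in> P" if "a \<in> P" "b \<in> P" for a b
    using Padd[OF that(1) Puminus[OF that(2)]] by simp
  have Psum: "(\<And>i. i \<in> I \<Longrightarrow> f i \<in> P) \<Longrightarrow> sum f I \<in> P" for f :: "'x \<Rightarrow> 'r" and I
    by (induction I rule: infinite_finite_induct) (auto intro: P0 Padd)
  have Ppow: "a ^ n \<notin> P" if "a \<in> C" "a \<notin> P" for a n
    by (induction n) (use that P1 Pprime Csub(8) in auto)
  define N where "N = {p \<in> polys A. poly p x \<in> P}"
  define N' where "N' = {p \<in> polys A. \<forall>i. coeff p i \<in> P}"
  have polyC: "poly p x \<in> C" if "p \<in> polys A" for p
    unfolding poly_altdef using that AC x by (intro Csub) (auto simp: polys_def)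
  have N'N: "N' \<subseteq> N"
  proof
    fix p assume p: "p \<in> N'"
    have "poly p x \<in> P" unfolding poly_altdef
    proof (rule Psum)
      fix i
      have "x ^ i * coeff p i \<in> P" by (rule Pmult) (use p x in \<open>auto simp: N'_def intro: Csub\<close>)
      then show "coeff p i * x ^ i \<in> P" by (simp add: mult.commute)
    qed
    then show "p \<in> N" using p by (auto simp: N_def N'_def)
  qed
  have N'_diff: "p - q \<in> N'" if "p \<in> N'" "q \<in> N'" for p q
    using that by (auto simp: N'_def intro: Pdiff pint)
  have N'_add: "p + q \<in> N'" if "p \<in> N'" "q \<in> N'" for p q
    using that by (auto simp: N'_def intro: Padd pint)
  have N'_mult: "q * p \<in> N'" if "p \<in> N'" "q \<in> polys A" for p q
  proof -
    have "coeff (q * p) i \<in> P" for i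
      unfolding coeff_mult by (intro Psum Pmult) (use that AC in \<open>auto simp: N'_def polys_def\<close>)
    then show ?thesis using that by (auto simp: N'_def intro: pint)
  qed
  have strip: "\<exists>p'\<in>polys A. lead_coeff p' \<notin> P \<and> p - p' \<in> N' \<and> degree p' \<le> degree p" if "p \<in> polys A" "p \<notin> N'" for p
    using strip_leading[OF A PI AC, of p] that pint(2) unfolding N'_def by blast

  have main: "\<exists>\<theta> l. place P A \<theta> \<and> (\<forall>q\<in>N. poly (map_poly \<theta> q) l = 0) \<and> poly (map_poly \<theta> w0) l \<noteq> 0"
  proof (cases "N \<subseteq> N'")
    case True
    \<comment> \<open>Here \<open>x\<close> is transcendental modulo \<open>P\<close>: keep one
      coefficient of \<open>w0\<close> non-zero and let \<open>l\<close> avoid the finitely many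
      roots of its image.\<close>
    have "w0 \<notin> N" using w0 vP by (auto simp: N_def)
    then have "\<exists>i. coeff w0 i \<notin> P" using N'N w0 by (auto simp: N'_def)
    then obtain i where i: "coeff w0 i \<notin> P" by blast
    then obtain \<theta> where th: "place P A \<theta>" "\<theta> (coeff w0 i) \<noteq> 0"
      using sep w0(1) by (auto simp: separating_places_def polys_def)
    have th0: "\<theta> 0 = 0" using th(1) const_0 unfolding place_def by metis
    have "map_poly \<theta> w0 \<noteq> 0" using th(2) th0 by (metis coeff_0 coeff_map_poly)
    then have "finite {l. poly (map_poly \<theta> w0) l = 0}" by (rule poly_roots_finite)
    then obtain l where l: "poly (map_poly \<theta> w0) l \<noteq> 0"
      using infinite_alg_closed[where 'k='k] ex_new_if_finite by blast
    have "map_poly \<theta> q = 0" if "q \<in> N" for q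
    proof (rule poly_eqI)
      fix i
      have "coeff q i \<in> A \<inter> P" using that True by (auto simp: N'_def polys_def)
      then show "coeff (map_poly \<theta> q) i = coeff 0 i" using th(1) th0 by (auto simp: coeff_map_poly place_def)
    qed
    then show ?thesis using th l by (intro exI[of _ \<theta>] exI[of _ l]) auto
  next
    case False
    \<comment> \<open>An element of least degree outside \<open>N'\<close> can be stripped to one
      with leading coefficient outside \<open>P\<close>. This is applied to the relations
      \<open>N\<close> and to the set \<open>T\<close> below.\<close>
    have min: "\<exists>p\<in>U. lead_coeff p \<notin> P \<and> (\<forall>q\<in>U. degree q < degree p \<longrightarrow> q \<in> N')"
      if U: "U \<subseteq> polys A" "\<not> U \<subseteq> N'" and Ud: "\<And>p q. p \<in> U \<Longrightarrow> q \<in> polys A \<Longrightarrow> p - q \<in> N' \<Longrightarrow> q \<in> U" for U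
    proof -
      obtain p0 where "p0 \<in> U - N'" using U by auto
      then obtain p where p: "p \<in> U - N'" "\<And>q. q \<in> U - N' \<Longrightarrow> degree p \<le> degree q"
        using ex_has_least_nat[of "\<lambda>q. q \<in> U - N'" p0 degree] by blast
      then obtain p' where p': "p' \<in> polys A" "lead_coeff p' \<notin> P" "p - p' \<in> N'" "degree p' \<le> degree p"
        using strip[of p] U by blast
      have "p' \<in> U" using Ud p p' by blast
      then show ?thesis using p p'(2,4) by (intro bexI[of _ p']) force+
    qed
    have N_diff: "p - q \<in> N" if "p \<in> N" "q \<in> N" for p q
      using that by (auto simp: N_def intro: Pdiff pint)
    have N_mult: "q * p \<in> N" if "p \<in> N" "q \<in> polys A" for p q
      using that Pmult polyC by (auto simp: N_def intro: pint)
    have "\<exists>p\<in>N. lead_coeff p \<notin> P \<and> (\<forall>q\<in>N. degree q < degree p \<longrightarrow> q \<in> N')"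
    proof (rule min)
      show "N \<subseteq> polys A" "\<not> N \<subseteq> N'" using False by (auto simp: N_def)
      fix p q assume "p \<in> N" "q \<in> polys A" "p - q \<in> N'"
      then have "p - (p - q) \<in> N" using N_diff N'N by blast
      then show "q \<in> N" by simp
    qed
    then obtain p where p: "p \<in> N" "lead_coeff p \<notin> P" "\<And>q. q \<in> N \<Longrightarrow> degree q < degree p \<Longrightarrow> q \<in> N'" by blast
    have pA: "p \<in> polys A" "poly p x \<in> P" using p by (auto simp: N_def)
    have lcA: "lead_coeff q \<in> A" if "q \<in> polys A" for q using that by (auto simp: polys_def)
    have deg0: "poly q x = lead_coeff q" if "degree q = 0" for q :: "'r poly"
      using that by (metis degree_eq_zeroE lead_coeff_pCons(2) mult_zero_right add_0_right poly_0 poly_pCons)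
    have d1: "degree p \<ge> 1" using deg0[of p] pA p(2) by (cases "degree p = 0") auto
    \<comment> \<open>Polynomials whose value at \<open>x\<close> is a multiple of \<open>v\<close>
      modulo \<open>P\<close>. The goal is to find in \<open>T\<close> a constant outside
      \<open>P\<close>.\<close>
    define T where "T = {t \<in> polys A. \<exists>w\<in>polys A. poly t x - v * poly w x \<in> P}"
    have vC: "v \<in> C" using w0 polyC by auto
    have T_I: "t \<in> T" if "t \<in> polys A" "w \<in> polys A" "poly t x - v * poly w x \<in> P" for t w
      using that unfolding T_def by blast
    have NT: "N \<subseteq> T" using polys_0[OF A] unfolding T_def N_def by (auto intro!: bexI[of _ 0])
    have T_diff: "s - t \<in> T" if st: "s \<in> T" "t \<in> T" for s t
    proof -
      obtain w w' where w: "w \<in> polys A" "poly s x - v * poly w x \<in> P" "w' \<in> polys A" "poly t x - v * poly w' x \<in> P"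
        using st by (auto simp: T_def)
      have "poly (s - t) x - v * poly (w - w') x = (poly s x - v * poly w x) - (poly t x - v * poly w' x)"
        by (simp add: algebra_simps)
      also have "\<dots> \<in> P" using Pdiff w by blast
      finally show ?thesis using w st by (intro T_I[of _ "w - w'"] pint) (auto simp: T_def)
    qed
    have T_mult: "s * t \<in> T" if st: "s \<in> polys A" "t \<in> T" for s t
    proof -
      obtain w where w: "w \<in> polys A" "poly t x - v * poly w x \<in> P"
        using st by (auto simp: T_def)
      have "poly (s * t) x - v * poly (s * w) x = poly s x * (poly t x - v * poly w x)"
        by (simp add: algebra_simps)
      also have "\<dots> \<in> P" by (rule Pmult[OF polyC[OF st(1)] w(2)])
      finally show ?thesis using w st by (intro T_I[of _ "s * w"] pint) (auto simp: T_def)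
    qed
    have "\<exists>t\<in>T. lead_coeff t \<notin> P \<and> (\<forall>q\<in>T. degree q < degree t \<longrightarrow> q \<in> N')"
    proof (rule min)
      show "T \<subseteq> polys A" "\<not> T \<subseteq> N'" using False NT by (auto simp: T_def)
      fix p q assume "p \<in> T" "q \<in> polys A" "p - q \<in> N'"
      then have "p - (p - q) \<in> T" using T_diff N'N NT by blast
      then show "q \<in> T" by simp
    qed
    then obtain t where t: "t \<in> T" "lead_coeff t \<notin> P" "\<And>q. q \<in> T \<Longrightarrow> degree q < degree t \<Longrightarrow> q \<in> N'" by blast
    have tA: "t \<in> polys A" using t by (auto simp: T_def)
    have smA: "smult a q = [:a:] * q" for a q by simp
    have cA: "[:a:] \<in> polys A" if "a \<in> A" for a using polys_monom[OF A that, of 0] by (simp add: monom_0)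
    have w0T: "w0 \<in> T" unfolding T_def using w0 P0 Asub(3)
      by (auto intro!: bexI[of _ "[:1:]"] cA)
    \<comment> \<open>If \<open>t\<close> had positive degree, it would divide \<open>p\<close>
      modulo \<open>P\<close>, up to a power of its leading coefficient, with cofactor
      \<open>s\<close>. So \<open>t\<close> or \<open>s\<close> is a relation of \<open>x\<close>.
      In the first case \<open>t\<close> also divides \<open>w0\<close>, which puts \<open>v\<close>
      into \<open>P\<close>; in the second, \<open>s\<close> has degree at least that of
      \<open>p\<close>, and the product with \<open>t\<close> is too long.\<close>
    have t0: "degree t = 0"
    proof (rule ccontr)
      assume "degree t \<noteq> 0"
      then have dt: "degree t \<ge> 1" by simp
      have reduce: "\<exists>n s. s \<in> polys A \<and> smult (lead_coeff t ^ n) q - t * s \<in> N'" if q: "q \<in> T" for q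
      proof -
        obtain n s r where *: "s \<in> polys A" "r \<in> polys A" "smult (lead_coeff t ^ n) q = t * s + r" "degree r < degree t"
          using pseudo_division[OF A tA dt, of q] q by (auto simp: T_def)
        have "r = [:lead_coeff t ^ n:] * q - s * t" using *(3) by (simp add: algebra_simps)
        moreover have "\<dots> \<in> T" by (intro T_diff T_mult cA sub_power[OF A] lcA tA q t *)
        ultimately have "r \<in> N'" using t(3) *(4) by blast
        then show ?thesis using * by (intro exI[of _ n] exI[of _ s]) auto
      qed
      have tC: "poly t x \<in> C" using polyC tA by blast
      have lC: "lead_coeff t \<in> C" using lcA[OF tA] AC by blast
      obtain m s where s: "s \<in> polys A" "smult (lead_coeff t ^ m) p - t * s \<in> N'"
        using reduce[of p] NT p by blast
      have 1: "poly (smult (lead_coeff t ^ m) p - t * s) x \<in> P" using s N'N by (auto simp: N_def)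
      have 2: "lead_coeff t ^ m * poly p x \<in> P" using pA by (intro Pmult Csub lC)
      have "poly t x * poly s x \<in> P" using Pdiff[OF 2 1] by simp
      then consider "poly t x \<in> P" | "poly s x \<in> P" using Pprime tC polyC s by blast
      then show False
      proof cases
        case 1
        obtain n s' where s': "s' \<in> polys A" "smult (lead_coeff t ^ n) w0 - t * s' \<in> N'"
          using reduce[OF w0T] by blast
        have "poly (smult (lead_coeff t ^ n) w0 - t * s') x \<in> P" using s' N'N by (auto simp: N_def)
        moreover have "poly s' x * poly t x \<in> P" using 1 s' by (intro Pmult polyC)
        ultimately have "poly (smult (lead_coeff t ^ n) w0 - t * s') x + poly s' x * poly t x \<in> P" by (rule Padd)
        then have "lead_coeff t ^ n * v \<in> P" using w0 by (simp add: algebra_simps)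
        then show False using Pprime[OF Csub(8)[OF lC] vC] Ppow[OF lC t(2)] vP by blast
      next
        case 2
        have sN: "s \<in> N" using s 2 by (auto simp: N_def)
        have "s \<notin> N'"
        proof
          assume "s \<in> N'"
          then have "(smult (lead_coeff t ^ m) p - t * s) + t * s \<in> N'" using s N'_add N'_mult tA by blast
          then have "lead_coeff t ^ m * lead_coeff p \<in> P" by (auto simp: N'_def)
          then show False using Pprime[OF Csub(8)[OF lC]] Ppow[OF lC t(2)] p(2) lcA pA AC by blast
        qed
        then obtain s' where s': "s' \<in> polys A" "lead_coeff s' \<notin> P" "s - s' \<in> N'" using strip s(1) by blast
        have "s - (s - s') \<in> N" using sN s' N'N N_diff by blast
        then have s'N: "s' \<in> N" by simp
        have "degree s' \<ge> degree p" using p(3)[OF s'N] s'(2) by (force simp: N'_def)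
        have "(smult (lead_coeff t ^ m) p - t * s) + t * (s - s') \<in> N'" using s s' N'_add N'_mult tA by blast
        moreover have "(smult (lead_coeff t ^ m) p - t * s) + t * (s - s') = smult (lead_coeff t ^ m) p - t * s'"
          by (simp add: algebra_simps)
        ultimately have "coeff (smult (lead_coeff t ^ m) p - t * s') (degree t + degree s') \<in> P" by (auto simp: N'_def)
        moreover have "coeff p (degree t + degree s') = 0"
          using dt \<open>degree s' \<ge> degree p\<close> by (intro coeff_eq_0) auto
        ultimately have "- (lead_coeff t * lead_coeff s') \<in> P" by (simp add: coeff_mult_degree_sum)
        then have "lead_coeff t * lead_coeff s' \<in> P" using Puminus by fastforce
        then show False using Pprime[OF lC, of "lead_coeff s'"] t(2) s'(1,2) lcA AC by blast
      qed
    qed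
    define c where "c = lead_coeff t"
    have c: "c \<in> A" "c \<notin> P" "poly t x = c" using t(2) lcA tA deg0[OF t0] by (auto simp: c_def)
    obtain w1 where w1: "w1 \<in> polys A" "c - v * poly w1 x \<in> P" using t(1) c by (auto simp: T_def)
    \<comment> \<open>The place must keep both factors: the leading coefficient, so that the image
      of \<open>p\<close> still has a root, and \<open>c\<close>, so that \<open>v\<close> does not
      become zero.\<close>
    have "lead_coeff p * c \<in> A - P"
    proof -
      have l: "lead_coeff p \<in> A" using lcA pA by blast
      then have "lead_coeff p * c \<notin> P" using Pprime[of "lead_coeff p" c] p(2) c AC by blast
      then show ?thesis using Asub(5)[OF l c(1)] by blast
    qed
    then obtain \<theta> where th: "place P A \<theta>" "\<theta> (lead_coeff p * c) \<noteq> 0" using sep by (auto simp: separating_places_def)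
    have th_mult: "\<And>a b. a \<in> A \<Longrightarrow> b \<in> A \<Longrightarrow> \<theta> (a * b) = \<theta> a * \<theta> b" using th by (auto simp: place_def)
    have thp: "\<theta> (lead_coeff p) \<noteq> 0" "\<theta> c \<noteq> 0" using th(2) th_mult c lcA[OF pA(1)] by auto
    note mp = map_poly_place[OF A th(1)]
    have "degree (map_poly \<theta> p) = degree p" using thp by (intro map_poly_degree_eq)
    then obtain l where l: "poly (map_poly \<theta> p) l = 0" using d1 alg_closed_imp_poly_has_root[of "map_poly \<theta> p"] by auto
    \<comment> \<open>The remainder of \<open>q\<close> on division by \<open>p\<close> is again a
      relation, of smaller degree, so its coefficients lie in \<open>P\<close> and its image is
      zero. Thus the image of \<open>q\<close> is a multiple of that of \<open>p\<close>, up to a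
      non-zero constant.\<close>
    have root: "poly (map_poly \<theta> q) l = 0" if q: "q \<in> N" for q
    proof -
      have qA: "q \<in> polys A" using q by (auto simp: N_def)
      obtain n s r where *: "s \<in> polys A" "r \<in> polys A" "smult (lead_coeff p ^ n) q = p * s + r" "degree r < degree p"
        using pseudo_division[OF A pA(1) d1 qA] by auto
      have lp: "lead_coeff p ^ n \<in> A" by (intro Asub lcA pA)
      have "r = [:lead_coeff p ^ n:] * q - s * p" using *(3) by (simp add: algebra_simps)
      moreover have "\<dots> \<in> N" by (intro N_diff N_mult cA lp q p *)
      ultimately have "r \<in> N'" using p(3) *(4) by blast
      then have r0: "map_poly \<theta> r = 0"
        using th(1) by (intro poly_eqI) (auto simp: N'_def polys_def place_def mp(1))
      have thpow: "\<theta> (lead_coeff p ^ k) \<noteq> 0" for k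
      proof (induction k)
        case 0
        have "\<theta> (\<kappa> 1) = 1" using th(1) by (auto simp: place_def)
        then show ?case by (simp add: const_one)
      qed (use thp th_mult lcA[OF pA(1)] Asub in auto)
      have "smult (\<theta> (lead_coeff p ^ n)) (map_poly \<theta> q) = map_poly \<theta> p * map_poly \<theta> s"
        using arg_cong[OF *(3), of "map_poly \<theta>"]
        unfolding mp(5)[OF qA lp] mp(2)[OF polys_mult[OF A pA(1) *(1)] *(2)] mp(4)[OF pA(1) *(1)] r0 by simp
      from arg_cong[OF this, of "\<lambda>p. poly p l"]
      have "\<theta> (lead_coeff p ^ n) * poly (map_poly \<theta> q) l = 0"
        by (simp only: poly_smult poly_mult l mult_zero_left)
      then show ?thesis using thpow by simp
    qed
    have "[:c:] - w0 * w1 \<in> N" using w0 w1 c cA pint by (auto simp: N_def)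
    then have "poly (map_poly \<theta> ([:c:] - w0 * w1)) l = 0" by (rule root)
    moreover have "map_poly \<theta> [:c:] = [:\<theta> c:]"
      by (rule poly_eqI) (use mp(1)[of 0] in \<open>auto simp: mp(1) coeff_pCons split: nat.splits\<close>)
    ultimately have "\<theta> c = poly (map_poly \<theta> w0) l * poly (map_poly \<theta> w1) l"
      using w0 w1 c by (simp add: mp(3,4) cA pint)
    then have "poly (map_poly \<theta> w0) l \<noteq> 0" using thp by auto
    then show ?thesis using th root by blast
  qed
  then obtain \<theta> l where th: "place P A \<theta>" and root: "\<And>q. q \<in> N \<Longrightarrow> poly (map_poly \<theta> q) l = 0"
    and nz: "poly (map_poly \<theta> w0) l \<noteq> 0" by blast
  note mp = map_poly_place[OF A th]
  \<comment> \<open>The extension is evaluated on a chosen polynomial in \<open>x\<close>. The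
    choice is immaterial since two choices differ by an element of \<open>N\<close>, whose image
    vanishes at \<open>l\<close>.\<close>
  define rep where "rep a = (SOME q. q \<in> polys A \<and> poly q x = a)" for a
  define \<theta>' where "\<theta>' a = poly (map_poly \<theta> (rep a)) l" for a
  have rep: "rep (poly q x) \<in> polys A \<and> poly (rep (poly q x)) x = poly q x" if "q \<in> polys A" for q
    unfolding rep_def using someI[of "\<lambda>q'. q' \<in> polys A \<and> poly q' x = poly q x" q] that by simp
  have th': "\<theta>' (poly q x) = poly (map_poly \<theta> q) l" if q: "q \<in> polys A" for q
  proof -
    have "rep (poly q x) - q \<in> N" using rep[OF q] q P0 pint by (auto simp: N_def)
    from root[OF this] show ?thesis using rep[OF q] q by (simp add: mp(3) \<theta>'_def)
  qed
  have "place P (adjoin A x) \<theta>'"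
    unfolding place_def
  proof (intro conjI allI ballI)
    fix c
    have "[:\<kappa> c:] \<in> polys A" using polys_monom[OF A Asub(1), of c 0] by (simp add: monom_0)
    moreover have "map_poly \<theta> [:\<kappa> c:] = [:\<theta> (\<kappa> c):]"
      by (rule poly_eqI) (use mp(1)[of 0] in \<open>auto simp: mp(1) coeff_pCons split: nat.splits\<close>)
    ultimately show "\<theta>' (\<kappa> c) = c" using th'[of "[:\<kappa> c:]"] th by (auto simp: place_def)
  next
    fix a b assume "a \<in> adjoin A x" "b \<in> adjoin A x"
    then obtain p q where pq: "p \<in> polys A" "q \<in> polys A" "a = poly p x" "b = poly q x" by (auto simp: adjoin_def)
    show "\<theta>' (a + b) = \<theta>' a + \<theta>' b" using th'[of "p + q"] pq by (simp add: th' pint mp(2))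
    show "\<theta>' (a * b) = \<theta>' a * \<theta>' b" using th'[of "p * q"] pq by (simp add: th' pint mp(4))
  next
    fix a assume "a \<in> adjoin A x \<inter> P"
    then obtain p where "p \<in> polys A" "a = poly p x" "p \<in> N" by (auto simp: adjoin_def N_def)
    then show "\<theta>' a = 0" using th' root by simp
  qed
  moreover have "\<theta>' v \<noteq> 0" using th' w0 nz by simp
  ultimately show "\<exists>\<theta>. place P (adjoin A x) \<theta> \<and> \<theta> v \<noteq> 0" by blast
qed

primrec generated :: "'r list \<Rightarrow> 'r set" where
  "generated [] = range \<kappa>"
| "generated (y # ys) = adjoin (generated ys) y"

lemma subalgebra_generated: "subalgebra (generated ys)"
proof (induction ys)
  case Nil
  show ?case unfolding subalgebra_def
    by (auto simp: const_add[symmetric] const_mult[symmetric])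
qed (simp add: subalgebra_adjoin)

lemma generators_in_generated: "set ys \<subseteq> generated ys"
  by (induction ys) (use adjoin_self adjoin_subset subalgebra_generated in fastforce)+

lemma generated_minimal:
  assumes "subalgebra A" "set ys \<subseteq> A" shows "generated ys \<subseteq> A"
  using assms(2)
proof (induction ys)
  case Nil
  show ?case using assms(1) by (auto simp: subalgebra_def)
next
  case (Cons y ys)
  then have "poly p y \<in> A" if "p \<in> polys (generated ys)" for p
    unfolding poly_altdef using that by (intro sub_intros[OF assms(1)]) (auto simp: polys_def)
  then show ?case by (auto simp: adjoin_def)
qed

text \<open>The induction starts with the constants, where a proper ideal contains no non-zero
  element because non-zero constants are invertible.\<close>

lemma separating_places_generated:
  assumes C: "subalgebra C" and P: "prime_in C P" and ys: "generated ys \<subseteq> C"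
  shows "separating_places P (generated ys)"
  using ys
proof (induction ys)
  case Nil
  have "(0 :: 'r) \<noteq> 1" using P by (auto simp: prime_in_def ideal_in_def)
  have inj: "inj \<kappa>"
  proof (rule injI, rule ccontr)
    fix a b assume ab: "\<kappa> a = \<kappa> b" "a \<noteq> b"
    have "\<kappa> (a - b) = 0" using ab const_add[of a "- b"] const_uminus by simp
    then have "\<kappa> ((a - b) * inverse (a - b)) = 0" unfolding const_mult by simp
    then show False using ab \<open>0 \<noteq> 1\<close> const_one by simp
  qed
  define \<theta> where "\<theta> = inv_into UNIV \<kappa>"
  have th: "\<theta> (\<kappa> c) = c" for c using inj by (simp add: \<theta>_def)
  have nP: "c = 0" if "\<kappa> c \<in> P" for c
  proof (rule ccontr)
    assume "c \<noteq> 0"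
    then have "\<kappa> (inverse c) * \<kappa> c = 1" by (simp add: const_mult[symmetric] const_one)
    then show False using that P C by (metis ideal_in_def prime_in_def sub_const)
  qed
  have "place P (range \<kappa>) \<theta>"
    unfolding place_def by (auto simp: th const_add[symmetric] const_mult[symmetric] dest: nP)
  moreover have "\<theta> u \<noteq> 0" if "u \<in> range \<kappa> - P" for u
    using that P by (auto simp: th const_0 prime_in_def ideal_in_def)
  ultimately show ?case by (auto simp: separating_places_def)
next
  case (Cons y ys)
  have "generated ys \<subseteq> C" "y \<in> C"
    using Cons.prems adjoin_subset[OF subalgebra_generated] adjoin_self[OF subalgebra_generated] by fastforce+
  then show ?case using Cons.IH separating_places_adjoin[OF C P subalgebra_generated] by simp
qed

text \<open>By Zorn there is an ideal that is maximal among those containing \<open>J\<close> and no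
  power of \<open>g\<close>. It is prime: adding an element outside it produces a power of
  \<open>g\<close>, and for two such elements with product inside, the product of these powers would
  lie inside too.\<close>

lemma prime_avoiding_powers:
  assumes C: "subalgebra C" and J: "ideal_in C J" and g: "g \<in> C" "\<And>n. g ^ n \<notin> J"
  shows "\<exists>P. prime_in C P \<and> J \<subseteq> P \<and> g \<notin> P"
proof -
  define \<A> where "\<A> = {I. ideal_in C I \<and> J \<subseteq> I \<and> (\<forall>n. g ^ n \<notin> I)}"
  have "\<exists>P\<in>\<A>. \<forall>I\<in>\<A>. P \<subseteq> I \<longrightarrow> I = P"
  proof (rule subset_Zorn)
    fix \<C> assume ch: "subset.chain \<A> \<C>"
    show "\<exists>U\<in>\<A>. \<forall>X\<in>\<C>. X \<subseteq> U"
    proof (cases "\<C> = {}")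
      case True
      then show ?thesis using J g by (auto simp: \<A>_def)
    next
      case False
      have ch': "\<And>X Y. X \<in> \<C> \<Longrightarrow> Y \<in> \<C> \<Longrightarrow> X \<subseteq> Y \<or> Y \<subseteq> X" and sub: "\<And>X. X \<in> \<C> \<Longrightarrow> X \<in> \<A>"
        using ch by (auto simp: subset.chain_def)
      have "ideal_in C (\<Union>\<C>)"
        unfolding ideal_in_def
      proof (intro conjI ballI)
        show "\<Union>\<C> \<subseteq> C" using sub by (intro Union_least) (simp add: \<A>_def ideal_in_def)
        obtain X where "X \<in> \<C>" using False by blast
        then show "0 \<in> \<Union>\<C>" using sub[of X] by (auto simp: \<A>_def ideal_in_def)
        fix a b assume "a \<in> \<Union>\<C>" "b \<in> \<Union>\<C>"
        then obtain X Y where XY: "X \<in> \<C>" "Y \<in> \<C>" "a \<in> X" "b \<in> Y" by blast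
        obtain Z where Z: "Z \<in> \<C>" "a \<in> Z" "b \<in> Z" using ch'[OF XY(1,2)] XY by blast
        then have "a + b \<in> Z" using sub[OF Z(1)] by (simp add: \<A>_def ideal_in_def)
        then show "a + b \<in> \<Union>\<C>" using Z by blast
      next
        fix c a assume "c \<in> C" "a \<in> \<Union>\<C>"
        then obtain X where X: "X \<in> \<C>" "a \<in> X" by blast
        then have "c * a \<in> X" using sub[OF X(1)] \<open>c \<in> C\<close> by (simp add: \<A>_def ideal_in_def)
        then show "c * a \<in> \<Union>\<C>" using X by blast
      qed
      moreover have "J \<subseteq> \<Union>\<C>" "\<forall>n. g ^ n \<notin> \<Union>\<C>" using sub False unfolding \<A>_def by blast+
      ultimately show ?thesis by (intro bexI[of _ "\<Union>\<C>"]) (auto simp: \<A>_def)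
    qed
  qed
  then obtain P where P: "P \<in> \<A>" and max: "\<And>I. I \<in> \<A> \<Longrightarrow> P \<subseteq> I \<Longrightarrow> I = P" by blast
  have PI: "P \<subseteq> C" "0 \<in> P" "\<And>a b. a \<in> P \<Longrightarrow> b \<in> P \<Longrightarrow> a + b \<in> P" "\<And>c a. c \<in> C \<Longrightarrow> a \<in> P \<Longrightarrow> c * a \<in> P"
    and JP: "J \<subseteq> P" and gP: "\<And>n. g ^ n \<notin> P"
    using P by (auto simp: \<A>_def ideal_in_def)
  note Csub = sub_intros[OF C]
  have power: "\<exists>n p c. p \<in> P \<and> c \<in> C \<and> g ^ n = p + c * a" if a: "a \<in> C" "a \<notin> P" for a
  proof (rule ccontr)
    assume no: "\<not> ?thesis"
    let ?I = "{p + c * a | p c. p \<in> P \<and> c \<in> C}"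
    have memI: "p + c * a \<in> ?I" if "p \<in> P" "c \<in> C" for p c using that by blast
    have "P \<subseteq> ?I" using memI[OF _ Csub(2)] by force
    have "a \<in> ?I" using memI[OF PI(2) Csub(3)] by simp
    have "ideal_in C ?I"
      unfolding ideal_in_def
    proof (intro conjI ballI)
      show "?I \<subseteq> C" using PI(1) a by (auto intro!: Csub(4,5))
      show "0 \<in> ?I" using PI(2) \<open>P \<subseteq> ?I\<close> by blast
      fix u v assume "u \<in> ?I" "v \<in> ?I"
      then obtain p c p' c' where *: "p \<in> P" "c \<in> C" "u = p + c * a" "p' \<in> P" "c' \<in> C" "v = p' + c' * a" by blast
      have "u + v = (p + p') + (c + c') * a" using * by (simp add: algebra_simps)
      then show "u + v \<in> ?I" using memI[OF PI(3)[OF *(1,4)] Csub(4)[OF *(2,5)]] by simp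
    next
      fix d u assume d: "d \<in> C" "u \<in> ?I"
      then obtain p c where *: "p \<in> P" "c \<in> C" "u = p + c * a" by blast
      have "d * u = d * p + (d * c) * a" using * by (simp add: algebra_simps)
      then show "d * u \<in> ?I" using memI[OF PI(4)[OF d(1) *(1)] Csub(5)[OF d(1) *(2)]] by simp
    qed
    moreover have "J \<subseteq> ?I" using JP \<open>P \<subseteq> ?I\<close> by blast
    moreover have "\<forall>n. g ^ n \<notin> ?I" using no by blast
    ultimately have "?I \<in> \<A>" unfolding \<A>_def by blast
    then have "?I = P" using \<open>P \<subseteq> ?I\<close> by (rule max)
    then show False using \<open>a \<in> ?I\<close> a by blast
  qed
  have "a \<in> P \<or> b \<in> P" if ab: "a \<in> C" "b \<in> C" "a * b \<in> P" for a b
  proof (rule ccontr)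
    assume "\<not> ?thesis"
    then obtain n p c n' p' c' where *: "p \<in> P" "c \<in> C" "g ^ n = p + c * a" "p' \<in> P" "c' \<in> C" "g ^ n' = p' + c' * b"
      using power[OF ab(1)] power[OF ab(2)] by blast
    have "g ^ (n + n') = (p + c * a) * p' + ((c' * b) * p + (c * c') * (a * b))"
      unfolding power_add * by (simp add: algebra_simps)
    moreover have "(p + c * a) * p' \<in> P" "(c' * b) * p \<in> P" "(c * c') * (a * b) \<in> P"
      using * ab PI(1) by (auto intro!: PI(4)[OF _ *(4)] PI(4)[OF _ *(1)] PI(4)[OF _ ab(3)] Csub(4,5))
    ultimately have "g ^ (n + n') \<in> P" using PI(3) by presburger
    then show False using gP by blast
  qed
  moreover have "1 \<notin> P" using gP[of 0] by simp
  moreover have "g \<notin> P" using gP[of 1] by simp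
  ultimately show ?thesis using PI JP by (intro exI[of _ P]) (auto simp: prime_in_def ideal_in_def)
qed

text \<open>The strong Nullstellensatz in contrapositive form. A prime ideal without powers of
  \<open>g\<close> takes the place of inverting \<open>g\<close> by an additional variable.\<close>

theorem place_avoiding_ideal:
  assumes J: "ideal_in (generated ys) J" and g: "g \<in> generated ys" "\<And>n. g ^ n \<notin> J"
  shows "\<exists>\<theta>. place J (generated ys) \<theta> \<and> \<theta> g \<noteq> 0"
proof -
  obtain P where P: "prime_in (generated ys) P" "J \<subseteq> P" "g \<notin> P"
    using prime_avoiding_powers[OF subalgebra_generated J g] by blast
  then obtain \<theta> where "place P (generated ys) \<theta>" "\<theta> g \<noteq> 0"
    using separating_places_generated[OF subalgebra_generated P(1) subset_refl] P(3) g(1)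
    unfolding separating_places_def by blast
  then show ?thesis using P(2) by (intro exI[of _ \<theta>]) (auto simp: place_def)
qed

end

section \<open>Discrete valuation rings as localizations\<close>

lemma mem_fraction:
  "(c, d) \<in> fraction R a b \<longleftrightarrow>
     c \<in> carrier R \<and> d \<in> carrier R - {\<zero>\<^bsub>R\<^esub>} \<and> c \<otimes>\<^bsub>R\<^esub> b = a \<otimes>\<^bsub>R\<^esub> d"
  by (simp add: fraction_def)

text \<open>In the presence of zero divisors \<open>g h = 0\<close> the product of \<open>g / 1\<close> and \<open>h / 1\<close> contains
  all pairs, so it is not a fraction with denominator outside \<open>P\<close>.\<close>

lemma (in cring) domain_of_localization_domain:
  assumes P: "\<zero> \<in> P" "\<one> \<notin> P" and L: "domain (localization R P)"
  shows "domain R"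
proof
  show "\<one> \<noteq> \<zero>" using P by auto
  fix g h assume gh: "g \<otimes> h = \<zero>" "g \<in> carrier R" "h \<in> carrier R"
  show "g = \<zero> \<or> h = \<zero>"
  proof (rule ccontr)
    assume nz: "\<not> ?thesis"
    let ?F = "fraction R g \<one>" and ?G = "fraction R h \<one>"
    let ?FG = "\<Union>(a, b)\<in>?F. \<Union>(c, d)\<in>?G. fraction R (a \<otimes> c) (b \<otimes> d)"
    have one: "\<one> \<in> carrier R - P" using P by auto
    have "?F \<in> carrier (localization R P)" "?G \<in> carrier (localization R P)"
      using gh one by (auto simp: localization_def)
    then have "?F \<otimes>\<^bsub>localization R P\<^esub> ?G \<in> carrier (localization R P)"
      using L by (intro monoid.m_closed) (auto simp: domain_def cring_def ring_def)
    then obtain a b where ab: "a \<in> carrier R" "b \<in> carrier R" "b \<notin> P" "?FG = fraction R a b"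
      by (auto simp: localization_def fraction_field_def)
    have F: "(g \<otimes> h, h) \<in> ?F" and G: "(h \<otimes> g, g) \<in> ?G"
      using gh nz by (auto simp: mem_fraction m_comm)
    have all: "(x, y) \<in> ?FG" if "x \<in> carrier R" "y \<in> carrier R - {\<zero>}" for x y
    proof -
      have "(x, y) \<in> fraction R ((g \<otimes> h) \<otimes> (h \<otimes> g)) (h \<otimes> g)"
        using that gh by (auto simp: mem_fraction m_comm)
      then show ?thesis using F G by blast
    qed
    have "\<one> \<in> carrier R - {\<zero>}" using P by auto
    then have "(\<zero>, \<one>) \<in> fraction R a b" "(\<one>, \<one>) \<in> fraction R a b"
      using all[of \<zero> \<one>] all[of \<one> \<one>] unfolding ab(4) by auto
    then have "a = \<zero>" "b = a" using ab by (auto simp: mem_fraction)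
    then show False using ab P by auto
  qed
qed

section \<open>Fractions over a domain and localizations\<close>

context "domain"
begin

lemma nonzero_mult: "a \<in> carrier R - {\<zero>} \<Longrightarrow> b \<in> carrier R - {\<zero>} \<Longrightarrow> a \<otimes> b \<in> carrier R - {\<zero>}"
  using integral by auto

lemma nonzero_pow: "a \<in> carrier R - {\<zero>} \<Longrightarrow> a [^] (n::nat) \<in> carrier R - {\<zero>}"
  by (induction n) (use nonzero_mult in auto)

lemma fraction_subset:
  assumes "a \<in> carrier R" "b \<in> carrier R - {\<zero>}" "c \<in> carrier R" "d \<in> carrier R - {\<zero>}" "a \<otimes> d = c \<otimes> b"
  shows "fraction R a b \<subseteq> fraction R c d"
proof (clarsimp simp: mem_fraction)
  fix x y assume xy: "x \<in> carrier R" "y \<in> carrier R" "y \<noteq> \<zero>" "x \<otimes> b = a \<otimes> y"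
  have m: "a \<in> carrier R" "b \<in> carrier R" "c \<in> carrier R" "d \<in> carrier R" "b \<noteq> \<zero>" using assms by auto
  have "(x \<otimes> d) \<otimes> b = (x \<otimes> b) \<otimes> d" using m xy(1-3) by (simp add: m_ac)
  also have "\<dots> = (a \<otimes> y) \<otimes> d" using xy(4) by simp
  also have "\<dots> = (a \<otimes> d) \<otimes> y" using m xy(1-3) by (simp add: m_ac)
  also have "\<dots> = (c \<otimes> b) \<otimes> y" using assms(5) by simp
  also have "\<dots> = (c \<otimes> y) \<otimes> b" using m xy(1-3) by (simp add: m_ac)
  finally show "x \<otimes> d = c \<otimes> y" using m xy(1-3) m_rcancel[of b "x \<otimes> d" "c \<otimes> y"] by simp
qed

lemma fraction_eq_iff:
  assumes "a \<in> carrier R" "b \<in> carrier R - {\<zero>}" "c \<in> carrier R" "d \<in> carrier R - {\<zero>}"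
  shows "fraction R a b = fraction R c d \<longleftrightarrow> a \<otimes> d = c \<otimes> b"
proof
  assume "fraction R a b = fraction R c d"
  moreover have "(a, b) \<in> fraction R a b" using assms by (simp add: mem_fraction)
  ultimately show "a \<otimes> d = c \<otimes> b" by (simp add: mem_fraction)
next
  assume "a \<otimes> d = c \<otimes> b"
  then show "fraction R a b = fraction R c d" using assms by (intro equalityI fraction_subset) auto
qed

lemma fraction_self: "a \<in> carrier R \<Longrightarrow> b \<in> carrier R - {\<zero>} \<Longrightarrow> (a, b) \<in> fraction R a b"
  by (simp add: mem_fraction)

lemma fraction_mult:
  assumes "a \<in> carrier R" "b \<in> carrier R - {\<zero>}" "c \<in> carrier R" "d \<in> carrier R - {\<zero>}"
  shows "fraction R a b \<otimes>\<^bsub>fraction_field R\<^esub> fraction R c d = fraction R (a \<otimes> c) (b \<otimes> d)"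
proof -
  have "fraction R (a' \<otimes> c') (b' \<otimes> d') = fraction R (a \<otimes> c) (b \<otimes> d)"
    if *: "(a', b') \<in> fraction R a b" "(c', d') \<in> fraction R c d" for a' b' c' d'
  proof -
    have m: "a' \<in> carrier R" "b' \<in> carrier R - {\<zero>}" "c' \<in> carrier R" "d' \<in> carrier R - {\<zero>}"
      and e: "a' \<otimes> b = a \<otimes> b'" "c' \<otimes> d = c \<otimes> d'" using * by (auto simp: mem_fraction)
    have R: "a \<in> carrier R" "b \<in> carrier R" "c \<in> carrier R" "d \<in> carrier R"
      "a' \<in> carrier R" "b' \<in> carrier R" "c' \<in> carrier R" "d' \<in> carrier R" using m assms by auto
    have "(a' \<otimes> c') \<otimes> (b \<otimes> d) = (a' \<otimes> b) \<otimes> (c' \<otimes> d)" using R by (simp add: m_ac)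
    also have "\<dots> = (a \<otimes> b') \<otimes> (c \<otimes> d')" by (simp only: e)
    also have "\<dots> = (a \<otimes> c) \<otimes> (b' \<otimes> d')" using R by (simp add: m_ac)
    finally show ?thesis
      using fraction_eq_iff[OF _ nonzero_mult[OF m(2,4)] _ nonzero_mult[OF assms(2,4)]] R by simp
  qed
  then have "(\<Union>(a', b')\<in>fraction R a b. \<Union>(c', d')\<in>fraction R c d. fraction R (a' \<otimes> c') (b' \<otimes> d')) =
      (\<Union>x\<in>fraction R a b. \<Union>y\<in>fraction R c d. fraction R (a \<otimes> c) (b \<otimes> d))"
    by (intro SUP_cong refl) auto
  also have "\<dots> = fraction R (a \<otimes> c) (b \<otimes> d)" using fraction_self assms by blast
  finally show ?thesis by (simp add: fraction_field_def)
qed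

lemma fraction_add:
  assumes "a \<in> carrier R" "b \<in> carrier R - {\<zero>}" "c \<in> carrier R" "d \<in> carrier R - {\<zero>}"
  shows "fraction R a b \<oplus>\<^bsub>fraction_field R\<^esub> fraction R c d = fraction R (a \<otimes> d \<oplus> c \<otimes> b) (b \<otimes> d)"
proof -
  have "fraction R (a' \<otimes> d' \<oplus> c' \<otimes> b') (b' \<otimes> d') = fraction R (a \<otimes> d \<oplus> c \<otimes> b) (b \<otimes> d)"
    if *: "(a', b') \<in> fraction R a b" "(c', d') \<in> fraction R c d" for a' b' c' d'
  proof -
    have m: "a' \<in> carrier R" "b' \<in> carrier R - {\<zero>}" "c' \<in> carrier R" "d' \<in> carrier R - {\<zero>}"
      and e: "a' \<otimes> b = a \<otimes> b'" "c' \<otimes> d = c \<otimes> d'" using * by (auto simp: mem_fraction)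
    have R: "a \<in> carrier R" "b \<in> carrier R" "c \<in> carrier R" "d \<in> carrier R"
      "a' \<in> carrier R" "b' \<in> carrier R" "c' \<in> carrier R" "d' \<in> carrier R" using m assms by auto
    have "(a' \<otimes> d' \<oplus> c' \<otimes> b') \<otimes> (b \<otimes> d) = (a' \<otimes> b) \<otimes> (d \<otimes> d') \<oplus> (c' \<otimes> d) \<otimes> (b \<otimes> b')"
      using R by (simp add: l_distr r_distr m_ac)
    also have "\<dots> = (a \<otimes> b') \<otimes> (d \<otimes> d') \<oplus> (c \<otimes> d') \<otimes> (b \<otimes> b')" by (simp only: e)
    also have "\<dots> = (a \<otimes> d \<oplus> c \<otimes> b) \<otimes> (b' \<otimes> d')" using R by (simp add: l_distr r_distr m_ac)
    finally show ?thesis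
      using fraction_eq_iff[OF _ nonzero_mult[OF m(2,4)] _ nonzero_mult[OF assms(2,4)]] R by simp
  qed
  then have "(\<Union>(a', b')\<in>fraction R a b. \<Union>(c', d')\<in>fraction R c d. fraction R (a' \<otimes> d' \<oplus> c' \<otimes> b') (b' \<otimes> d')) =
      (\<Union>x\<in>fraction R a b. \<Union>y\<in>fraction R c d. fraction R (a \<otimes> d \<oplus> c \<otimes> b) (b \<otimes> d))"
    by (intro SUP_cong refl) auto
  also have "\<dots> = fraction R (a \<otimes> d \<oplus> c \<otimes> b) (b \<otimes> d)" using fraction_self assms by blast
  finally show ?thesis by (simp add: fraction_field_def)
qed

lemma fraction_one: "\<one>\<^bsub>fraction_field R\<^esub> = fraction R \<one> \<one>"
  by (simp add: fraction_field_def)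

lemma fraction_nat_pow:
  assumes "a \<in> carrier R" "b \<in> carrier R - {\<zero>}"
  shows "fraction R a b [^]\<^bsub>fraction_field R\<^esub> (n::nat) = fraction R (a [^] n) (b [^] n)"
proof (induction n)
  case (Suc n)
  then show ?case using fraction_mult[OF nat_pow_closed nonzero_pow assms] assms by simp
qed (simp add: fraction_one)

lemma fraction_diag: "a \<in> carrier R - {\<zero>} \<Longrightarrow> fraction R a a = \<one>\<^bsub>fraction_field R\<^esub>"
  unfolding fraction_one by (subst fraction_eq_iff) auto

lemma carrier_fraction_field:
  "carrier (fraction_field R) = {fraction R a b | a b. a \<in> carrier R \<and> b \<in> carrier R - {\<zero>}}"
  by (simp add: fraction_field_def)

lemma fraction_inverse:
  assumes "a \<in> carrier R - {\<zero>}" "b \<in> carrier R - {\<zero>}"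
  shows "inv\<^bsub>fraction_field R\<^esub> (fraction R a b) = fraction R b a"
  unfolding m_inv_def
proof (rule the_equality)
  have R: "a \<in> carrier R" "b \<in> carrier R" using assms by auto
  have "fraction R a b \<otimes>\<^bsub>fraction_field R\<^esub> fraction R b a = \<one>\<^bsub>fraction_field R\<^esub>"
    unfolding fraction_mult[OF R(1) assms(2) R(2) assms(1)] m_comm[OF R]
    by (rule fraction_diag[OF nonzero_mult[OF assms(2,1)]])
  moreover have "fraction R b a \<otimes>\<^bsub>fraction_field R\<^esub> fraction R a b = \<one>\<^bsub>fraction_field R\<^esub>"
    unfolding fraction_mult[OF R(2) assms(1) R(1) assms(2)] m_comm[OF R]
    by (rule fraction_diag[OF nonzero_mult[OF assms(2,1)]])
  moreover have "fraction R b a \<in> carrier (fraction_field R)"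
    using R assms(1) unfolding carrier_fraction_field by blast
  ultimately show "fraction R b a \<in> carrier (fraction_field R) \<and>
    fraction R a b \<otimes>\<^bsub>fraction_field R\<^esub> fraction R b a = \<one>\<^bsub>fraction_field R\<^esub> \<and>
    fraction R b a \<otimes>\<^bsub>fraction_field R\<^esub> fraction R a b = \<one>\<^bsub>fraction_field R\<^esub>"
    by blast
next
  fix y assume y: "y \<in> carrier (fraction_field R) \<and>
    fraction R a b \<otimes>\<^bsub>fraction_field R\<^esub> y = \<one>\<^bsub>fraction_field R\<^esub> \<and>
    y \<otimes>\<^bsub>fraction_field R\<^esub> fraction R a b = \<one>\<^bsub>fraction_field R\<^esub>"
  then obtain c d where cd: "c \<in> carrier R" "d \<in> carrier R - {\<zero>}" "y = fraction R c d"
    unfolding carrier_fraction_field by blast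
  have R: "a \<in> carrier R" "b \<in> carrier R" "d \<in> carrier R" using assms cd by auto
  have "fraction R (a \<otimes> c) (b \<otimes> d) = fraction R \<one> \<one>"
    using y fraction_mult[OF R(1) assms(2) cd(1,2)] unfolding cd(3) fraction_one by simp
  then have "a \<otimes> c = b \<otimes> d"
    using fraction_eq_iff[OF _ nonzero_mult[OF assms(2) cd(2)], of "a \<otimes> c" \<one> \<one>] R cd(1) by auto
  then show "y = fraction R b a"
    unfolding cd(3) fraction_eq_iff[OF cd(1,2) R(2) assms(1)] using R cd(1) by (simp add: m_comm)
qed

lemma fraction_int_pow:
  assumes "a \<in> carrier R - {\<zero>}" "b \<in> carrier R - {\<zero>}"
  shows "fraction R a b [^]\<^bsub>fraction_field R\<^esub> (n::int) =
    (if n \<ge> 0 then fraction R (a [^] nat n) (b [^] nat n) else fraction R (b [^] nat (- n)) (a [^] nat (- n)))"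
proof -
  have R: "a \<in> carrier R" using assms by auto
  have "fraction R a b [^]\<^bsub>fraction_field R\<^esub> n =
    (if n < 0 then inv\<^bsub>fraction_field R\<^esub> (fraction R a b [^]\<^bsub>fraction_field R\<^esub> nat (- n))
     else fraction R a b [^]\<^bsub>fraction_field R\<^esub> nat n)"
    unfolding int_pow_def nat_pow_def Let_def ..
  also have "\<dots> = (if n < 0 then fraction R (b [^] nat (- n)) (a [^] nat (- n))
     else fraction R (a [^] nat n) (b [^] nat n))"
    unfolding fraction_nat_pow[OF R assms(2)] fraction_inverse[OF nonzero_pow nonzero_pow, OF assms] ..
  finally show ?thesis by (simp add: not_le)
qed

lemma localization_simps:
  "carrier (localization R P) = {fraction R a b | a b. a \<in> carrier R \<and> b \<in> carrier R - P}"
  "x \<otimes>\<^bsub>localization R P\<^esub> y = x \<otimes>\<^bsub>fraction_field R\<^esub> y"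
  "x \<oplus>\<^bsub>localization R P\<^esub> y = x \<oplus>\<^bsub>fraction_field R\<^esub> y"
  "\<one>\<^bsub>localization R P\<^esub> = fraction R \<one> \<one>"
  "\<zero>\<^bsub>localization R P\<^esub> = fraction R \<zero> \<one>"
  by (simp_all add: localization_def fraction_field_def)

lemma localization_nat_pow:
  "x [^]\<^bsub>localization R P\<^esub> (n::nat) = x [^]\<^bsub>fraction_field R\<^esub> n"
  by (simp add: localization_def nat_pow_def)

section \<open>A localization that is a discrete valuation ring\<close>

context
  fixes P
  assumes P: "primeideal P R" and dvr: "discrete_valuation_ring (localization R P)"
begin

interpretation P: primeideal P R by (rule P)

lemma L_domain: "domain (localization R P)"
  using dvr by (simp add: discrete_valuation_ring_def)

interpretation L: "domain" "localization R P" by (rule L_domain)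

lemma prime_facts:
  shows "P \<subseteq> carrier R" "\<zero> \<in> P" "\<one> \<notin> P"
    and "\<And>a b. a \<in> P \<Longrightarrow> b \<in> P \<Longrightarrow> a \<oplus> b \<in> P"
    and "\<And>a b. a \<in> carrier R \<Longrightarrow> b \<in> P \<Longrightarrow> a \<otimes> b \<in> P"
    and "\<And>a b. a \<in> carrier R \<Longrightarrow> b \<in> P \<Longrightarrow> b \<otimes> a \<in> P"
    and "\<And>a b. a \<in> carrier R \<Longrightarrow> b \<in> carrier R \<Longrightarrow> a \<otimes> b \<in> P \<Longrightarrow> a \<in> P \<or> b \<in> P"
  using P.I_prime P.I_l_closed P.I_r_closed P.I_notcarr P.one_imp_carrier by auto

lemma outside_nonzero: "s \<in> carrier R - P \<Longrightarrow> s \<in> carrier R - {\<zero>}"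
  using prime_facts(2) by auto

lemma outside_mult: "s \<in> carrier R - P \<Longrightarrow> t \<in> carrier R - P \<Longrightarrow> s \<otimes> t \<in> carrier R - P"
  using prime_facts(7) by auto

lemma outside_pow: "s \<in> carrier R - P \<Longrightarrow> s [^] (n::nat) \<in> carrier R - P"
  by (induction n) (use prime_facts(3) outside_mult in auto)

lemma in_L: "a \<in> carrier R \<Longrightarrow> s \<in> carrier R - P \<Longrightarrow> fraction R a s \<in> carrier (localization R P)"
  unfolding localization_simps by blast

lemma L_cases:
  assumes "x \<in> carrier (localization R P)"
  obtains a s where "a \<in> carrier R" "s \<in> carrier R - P" "x = fraction R a s"
  using assms unfolding localization_simps by blast

lemma L_mult:
  assumes "a \<in> carrier R" "s \<in> carrier R - P" "b \<in> carrier R" "t \<in> carrier R - P"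
  shows "fraction R a s \<otimes>\<^bsub>localization R P\<^esub> fraction R b t = fraction R (a \<otimes> b) (s \<otimes> t)"
  unfolding localization_simps using fraction_mult assms outside_nonzero by blast

lemma L_pow:
  assumes "a \<in> carrier R" "s \<in> carrier R - P"
  shows "fraction R a s [^]\<^bsub>localization R P\<^esub> (n::nat) = fraction R (a [^] n) (s [^] n)"
  unfolding localization_nat_pow using fraction_nat_pow assms outside_nonzero by blast

text \<open>Primality of \<open>P\<close> makes this independent of the chosen numerator and
  denominator.\<close>

lemma L_max_iff:
  assumes "a \<in> carrier R" "s \<in> carrier R - P"
  shows "fraction R a s \<in> localization_max R P \<longleftrightarrow> a \<in> P"
proof
  assume "fraction R a s \<in> localization_max R P"
  then obtain b t where bt: "b \<in> P" "t \<in> carrier R - P" "fraction R a s = fraction R b t"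
    unfolding localization_max_def by blast
  have bR: "b \<in> carrier R" using bt prime_facts(1) by auto
  have "a \<otimes> t = b \<otimes> s"
    using bt(3) fraction_eq_iff[OF assms(1) outside_nonzero[OF assms(2)] bR outside_nonzero[OF bt(2)]] by simp
  moreover have "b \<otimes> s \<in> P" using bt assms prime_facts(6) by auto
  ultimately show "a \<in> P" using prime_facts(7)[OF assms(1), of t] bt by auto
next
  assume "a \<in> P"
  then show "fraction R a s \<in> localization_max R P"
    using assms unfolding localization_max_def by blast
qed

lemma L_ideal:
  assumes I: "I \<subseteq> carrier (localization R P)" "\<zero>\<^bsub>localization R P\<^esub> \<in> I"
    and add: "\<And>x y. x \<in> I \<Longrightarrow> y \<in> I \<Longrightarrow> x \<oplus>\<^bsub>localization R P\<^esub> y \<in> I"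
    and mult: "\<And>x y. x \<in> carrier (localization R P) \<Longrightarrow> y \<in> I \<Longrightarrow> x \<otimes>\<^bsub>localization R P\<^esub> y \<in> I"
  shows "ideal I (localization R P)"
proof (rule idealI)
  show "ring (localization R P)" ..
  show "subgroup I (add_monoid (localization R P))"
  proof (rule L.add.subgroupI)
    show "I \<subseteq> carrier (localization R P)" "I \<noteq> {}" using I by auto
    fix a assume a: "a \<in> I"
    have aL: "a \<in> carrier (localization R P)" using a I by blast
    have "(\<ominus>\<^bsub>localization R P\<^esub> \<one>\<^bsub>localization R P\<^esub>) \<otimes>\<^bsub>localization R P\<^esub> a \<in> I"
      by (rule mult[OF L.a_inv_closed[OF L.one_closed] a])
    then show "\<ominus>\<^bsub>localization R P\<^esub> a \<in> I" using L.l_minus[OF L.one_closed aL] L.l_one[OF aL] by simp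
    fix b assume b: "b \<in> I"
    show "a \<oplus>\<^bsub>localization R P\<^esub> b \<in> I" by (rule add[OF a b])
  qed
  fix a x assume ax: "a \<in> I" "x \<in> carrier (localization R P)"
  show xa: "x \<otimes>\<^bsub>localization R P\<^esub> a \<in> I" by (rule mult[OF ax(2,1)])
  have "a \<in> carrier (localization R P)" using ax I by blast
  from L.m_comm[OF this ax(2)] show "a \<otimes>\<^bsub>localization R P\<^esub> x \<in> I" using xa by simp
qed

lemma L_principal:
  assumes "ideal I (localization R P)"
  shows "\<exists>t\<in>carrier (localization R P). I = {y \<otimes>\<^bsub>localization R P\<^esub> t | y. y \<in> carrier (localization R P)}"
proof -
  have "principalideal I (localization R P)" using dvr assms by (simp add: discrete_valuation_ring_def)
  then obtain t where t: "t \<in> carrier (localization R P)" "I = Idl\<^bsub>localization R P\<^esub> {t}"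
    using principalideal.generate by blast
  then have "I = PIdl\<^bsub>localization R P\<^esub> t" using L.cgenideal_eq_genideal by simp
  then show ?thesis using t by (auto simp: cgenideal_def)
qed

lemma L_max_ideal: "ideal (localization_max R P) (localization R P)"
proof (rule L_ideal)
  show "localization_max R P \<subseteq> carrier (localization R P)"
    using prime_facts(1) in_L unfolding localization_max_def by blast
  show "\<zero>\<^bsub>localization R P\<^esub> \<in> localization_max R P"
    unfolding localization_simps localization_max_def using prime_facts(2,3) by blast
next
  fix x y assume "x \<in> localization_max R P" "y \<in> localization_max R P"
  then obtain a s b t where *: "a \<in> P" "s \<in> carrier R - P" "x = fraction R a s"
    "b \<in> P" "t \<in> carrier R - P" "y = fraction R b t"
    unfolding localization_max_def by blast
  have ab: "a \<in> carrier R" "b \<in> carrier R" using * prime_facts(1) by auto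
  have "x \<oplus>\<^bsub>localization R P\<^esub> y = fraction R (a \<otimes> t \<oplus> b \<otimes> s) (s \<otimes> t)"
    unfolding localization_simps *(3,6) by (rule fraction_add[OF ab(1) outside_nonzero[OF *(2)] ab(2) outside_nonzero[OF *(5)]])
  moreover have "a \<otimes> t \<oplus> b \<otimes> s \<in> P" using * prime_facts(4,6) by auto
  moreover have "s \<otimes> t \<in> carrier R - P" using * outside_mult by blast
  ultimately show "x \<oplus>\<^bsub>localization R P\<^esub> y \<in> localization_max R P" unfolding localization_max_def by blast
next
  fix x y assume "x \<in> carrier (localization R P)" "y \<in> localization_max R P"
  then obtain a s b t where *: "a \<in> carrier R" "s \<in> carrier R - P" "x = fraction R a s"
    "b \<in> P" "t \<in> carrier R - P" "y = fraction R b t"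
    unfolding localization_max_def by (elim L_cases) blast
  have b: "b \<in> carrier R" using * prime_facts(1) by auto
  have "x \<otimes>\<^bsub>localization R P\<^esub> y = fraction R (a \<otimes> b) (s \<otimes> t)"
    unfolding *(3,6) by (rule L_mult[OF *(1,2) b *(5)])
  moreover have "a \<otimes> b \<in> P" using * prime_facts(5) by auto
  moreover have "s \<otimes> t \<in> carrier R - P" using * outside_mult by blast
  ultimately show "x \<otimes>\<^bsub>localization R P\<^esub> y \<in> localization_max R P" unfolding localization_max_def by blast
qed

lemma L_unit:
  assumes "a \<in> carrier R - P" "s \<in> carrier R - P"
  shows "fraction R a s \<in> Units (localization R P)"
proof -
  have R: "a \<in> carrier R" "s \<in> carrier R" using assms by auto
  have "fraction R s a \<otimes>\<^bsub>localization R P\<^esub> fraction R a s = \<one>\<^bsub>localization R P\<^esub>"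
    unfolding L_mult[OF R(2) assms(1) R(1) assms(2)] m_comm[OF R(2,1)]
    using fraction_diag[OF outside_nonzero[OF outside_mult[OF assms]]] by (simp add: localization_simps fraction_one)
  then show ?thesis using in_L[OF R(1) assms(2)] in_L[OF R(2) assms(1)] L.m_comm
    unfolding Units_def by (auto intro!: bexI[of _ "fraction R s a"])
qed

text \<open>The statement lives in \<open>R\<close>, with denominators outside \<open>P\<close>
  cleared. Its last part is the Krull intersection property: no non-zero element is divisible by all
  powers of the uniformizer in the local ring.\<close>

lemma uniformizer:
  obtains \<tau> where "\<tau> \<in> P" "\<tau> \<noteq> \<zero>"
    and "\<And>a. a \<in> P \<Longrightarrow> \<exists>s\<in>carrier R - P. \<exists>r\<in>carrier R. s \<otimes> a = r \<otimes> \<tau>"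
    and "\<And>a. a \<in> carrier R \<Longrightarrow> a \<noteq> \<zero> \<Longrightarrow> \<exists>n::nat. \<forall>s\<in>carrier R - P. \<forall>r\<in>carrier R. s \<otimes> a \<noteq> r \<otimes> \<tau> [^] n"
proof -
  let ?L = "localization R P"
  obtain t where t: "t \<in> carrier ?L" "localization_max R P = {y \<otimes>\<^bsub>?L\<^esub> t | y. y \<in> carrier ?L}"
    using L_principal[OF L_max_ideal] by blast
  obtain \<tau> \<sigma> where ts: "\<tau> \<in> carrier R" "\<sigma> \<in> carrier R - P" "t = fraction R \<tau> \<sigma>" using t(1) by (rule L_cases)
  have "t \<in> localization_max R P" unfolding t(2) by (rule CollectI, rule exI[of _ "\<one>\<^bsub>?L\<^esub>"]) (simp add: L.l_one[OF t(1)])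
  then have tP: "\<tau> \<in> P" using L_max_iff[OF ts(1,2)] unfolding ts(3) by simp
  have sR: "\<sigma> \<in> carrier R" using ts by auto
  have 1: "\<exists>s\<in>carrier R - P. \<exists>r\<in>carrier R. s \<otimes> a = r \<otimes> \<tau>" if a: "a \<in> P" for a
  proof -
    have aR: "a \<in> carrier R" using a prime_facts(1) by auto
    have one: "\<one> \<in> carrier R - P" using prime_facts(3) by auto
    have "fraction R a \<one> \<in> localization_max R P" using L_max_iff[OF aR one] a by simp
    then obtain y where y: "y \<in> carrier ?L" "fraction R a \<one> = y \<otimes>\<^bsub>?L\<^esub> t" unfolding t(2) by blast
    obtain r s where rs: "r \<in> carrier R" "s \<in> carrier R - P" "y = fraction R r s" using y(1) by (rule L_cases)
    have "fraction R a \<one> = fraction R (r \<otimes> \<tau>) (s \<otimes> \<sigma>)"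
      unfolding y(2) rs(3) ts(3) by (rule L_mult[OF rs(1,2) ts(1,2)])
    then have "a \<otimes> (s \<otimes> \<sigma>) = r \<otimes> \<tau> \<otimes> \<one>"
      using fraction_eq_iff[OF aR outside_nonzero[OF one] _ outside_nonzero[OF outside_mult[OF rs(2) ts(2)]], of "r \<otimes> \<tau>"]
        rs(1) ts(1) by auto
    then have "(s \<otimes> \<sigma>) \<otimes> a = r \<otimes> \<tau>" using rs ts aR by (auto simp: m_comm)
    then show ?thesis using outside_mult[OF rs(2) ts(2)] rs(1) by blast
  qed
  \<comment> \<open>A zero generator would make \<open>P\<close> zero and the localization a
    field.\<close>
  have nz: "\<tau> \<noteq> \<zero>"
  proof
    assume t0: "\<tau> = \<zero>"
    have z: "a = \<zero>" if a: "a \<in> P" for a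
    proof -
      obtain s r where sr: "s \<in> carrier R - P" "r \<in> carrier R" "s \<otimes> a = r \<otimes> \<tau>" using 1[OF a] by blast
      then have "s \<otimes> a = \<zero>" using t0 by simp
      then show ?thesis using integral sr(1) a prime_facts(1,2) by (metis DiffD1 DiffD2 subsetD)
    qed
    have "field ?L"
    proof (rule L.cring_fieldI2)
      show "\<zero>\<^bsub>?L\<^esub> \<noteq> \<one>\<^bsub>?L\<^esub>" using L.one_not_zero by auto
      fix x assume x: "x \<in> carrier ?L" "x \<noteq> \<zero>\<^bsub>?L\<^esub>"
      obtain a s where as: "a \<in> carrier R" "s \<in> carrier R - P" "x = fraction R a s" using x(1) by (rule L_cases)
      have "a \<noteq> \<zero>"
      proof
        assume "a = \<zero>"
        then have "x = fraction R \<zero> \<one>"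
          unfolding as(3) using fraction_eq_iff[OF zero_closed outside_nonzero[OF as(2)] zero_closed, of \<one>] as(2) by auto
        then show False using x(2) by (simp add: localization_simps)
      qed
      then have "x \<in> Units ?L" using L_unit[of a s] as z by blast
      then show "\<exists>b\<in>carrier ?L. x \<otimes>\<^bsub>?L\<^esub> b = \<one>\<^bsub>?L\<^esub>" using L.Units_r_inv L.Units_inv_closed by blast
    qed
    then show False using dvr by (simp add: discrete_valuation_ring_def)
  qed
  have 2: "\<exists>n::nat. \<forall>s\<in>carrier R - P. \<forall>r\<in>carrier R. s \<otimes> a \<noteq> r \<otimes> \<tau> [^] n" if a: "a \<in> carrier R" "a \<noteq> \<zero>" for a
  proof (rule ccontr)
    assume "\<not> ?thesis"
    then have all: "\<exists>s\<in>carrier R - P. \<exists>r\<in>carrier R. s \<otimes> a = r \<otimes> \<tau> [^] n" for n :: nat by blast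
    \<comment> \<open>The intersection of all powers of the maximal ideal. It is principal,
      generated by some \<open>z\<close>, and \<open>z\<close> divided by \<open>t\<close> again
      lies in it.\<close>
    define J where "J = {x \<in> carrier ?L. \<forall>n::nat. \<exists>y\<in>carrier ?L. x = y \<otimes>\<^bsub>?L\<^esub> t [^]\<^bsub>?L\<^esub> n}"
    have tn: "t [^]\<^bsub>?L\<^esub> n \<in> carrier ?L" for n :: nat using t(1) by simp
    have "ideal J ?L"
    proof (rule L_ideal)
      show "J \<subseteq> carrier ?L" by (auto simp: J_def)
      show "\<zero>\<^bsub>?L\<^esub> \<in> J" unfolding J_def using tn by (auto intro!: bexI[of _ "\<zero>\<^bsub>?L\<^esub>"])
    next
      fix x y assume xy: "x \<in> J" "y \<in> J"
      have "\<exists>z\<in>carrier ?L. x \<oplus>\<^bsub>?L\<^esub> y = z \<otimes>\<^bsub>?L\<^esub> t [^]\<^bsub>?L\<^esub> n" for n :: nat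
      proof -
        obtain u v where "u \<in> carrier ?L" "v \<in> carrier ?L" "x = u \<otimes>\<^bsub>?L\<^esub> t [^]\<^bsub>?L\<^esub> n" "y = v \<otimes>\<^bsub>?L\<^esub> t [^]\<^bsub>?L\<^esub> n"
          using xy unfolding J_def by blast
        then show ?thesis using tn[of n] by (intro bexI[of _ "u \<oplus>\<^bsub>?L\<^esub> v"]) (auto simp: L.l_distr)
      qed
      then show "x \<oplus>\<^bsub>?L\<^esub> y \<in> J" using xy unfolding J_def by blast
    next
      fix x y assume x: "x \<in> carrier ?L" and y: "y \<in> J"
      have "\<exists>z\<in>carrier ?L. x \<otimes>\<^bsub>?L\<^esub> y = z \<otimes>\<^bsub>?L\<^esub> t [^]\<^bsub>?L\<^esub> n" for n :: nat
      proof -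
        obtain v where "v \<in> carrier ?L" "y = v \<otimes>\<^bsub>?L\<^esub> t [^]\<^bsub>?L\<^esub> n"
          using y unfolding J_def by blast
        then show ?thesis using tn[of n] x by (intro bexI[of _ "x \<otimes>\<^bsub>?L\<^esub> v"]) (auto simp: L.m_assoc)
      qed
      then show "x \<otimes>\<^bsub>?L\<^esub> y \<in> J" using x y unfolding J_def by blast
    qed
    then obtain z where z: "z \<in> carrier ?L" "J = {y \<otimes>\<^bsub>?L\<^esub> z | y. y \<in> carrier ?L}" using L_principal by blast
    have t0: "t \<noteq> \<zero>\<^bsub>?L\<^esub>"
    proof
      assume "t = \<zero>\<^bsub>?L\<^esub>"
      then have "fraction R \<tau> \<sigma> = fraction R \<zero> \<one>" by (simp add: ts(3) localization_simps)
      then show False using fraction_eq_iff[OF ts(1) outside_nonzero[OF ts(2)] zero_closed, of \<one>] nz sR ts(1) by auto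
    qed
    have zJ: "z \<in> J" unfolding z(2) by (rule CollectI, rule exI[of _ "\<one>\<^bsub>?L\<^esub>"]) (simp add: L.l_one[OF z(1)])
    have "\<exists>y\<in>carrier ?L. z = y \<otimes>\<^bsub>?L\<^esub> t [^]\<^bsub>?L\<^esub> (1::nat)" using zJ unfolding J_def by blast
    then obtain y where y: "y \<in> carrier ?L" "z = y \<otimes>\<^bsub>?L\<^esub> t" using t(1) by auto
    have "\<exists>w\<in>carrier ?L. y = w \<otimes>\<^bsub>?L\<^esub> t [^]\<^bsub>?L\<^esub> n" for n :: nat
    proof -
      obtain w where w: "w \<in> carrier ?L" "z = w \<otimes>\<^bsub>?L\<^esub> t [^]\<^bsub>?L\<^esub> (Suc n)" using zJ unfolding J_def by blast
      have "y \<otimes>\<^bsub>?L\<^esub> t = (w \<otimes>\<^bsub>?L\<^esub> t [^]\<^bsub>?L\<^esub> n) \<otimes>\<^bsub>?L\<^esub> t"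
        using w y t(1) tn[of n] by (simp add: L.m_assoc)
      then have "y = w \<otimes>\<^bsub>?L\<^esub> t [^]\<^bsub>?L\<^esub> n" using L.m_rcancel[OF t0 t(1) y(1)] w tn[of n] by auto
      then show ?thesis using w by blast
    qed
    then have "y \<in> J" using y(1) unfolding J_def by blast
    then obtain w where w: "w \<in> carrier ?L" "y = w \<otimes>\<^bsub>?L\<^esub> z" unfolding z(2) by blast
    \<comment> \<open>From \<open>z\<close> being a multiple of \<open>z\<close> times
      \<open>t\<close> one cancels \<open>z\<close>, which would make \<open>t\<close> a
      unit.\<close>
    have z0: "z = \<zero>\<^bsub>?L\<^esub>"
    proof (rule ccontr)
      assume "z \<noteq> \<zero>\<^bsub>?L\<^esub>"
      have "z = (w \<otimes>\<^bsub>?L\<^esub> z) \<otimes>\<^bsub>?L\<^esub> t" using y(2) unfolding w(2) .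
      moreover have "(w \<otimes>\<^bsub>?L\<^esub> z) \<otimes>\<^bsub>?L\<^esub> t = (w \<otimes>\<^bsub>?L\<^esub> t) \<otimes>\<^bsub>?L\<^esub> z" using w(1) z(1) t(1) by (simp add: L.m_ac)
      ultimately have "\<one>\<^bsub>?L\<^esub> \<otimes>\<^bsub>?L\<^esub> z = (w \<otimes>\<^bsub>?L\<^esub> t) \<otimes>\<^bsub>?L\<^esub> z" using L.l_one[OF z(1)] by metis
      then have "\<one>\<^bsub>?L\<^esub> = w \<otimes>\<^bsub>?L\<^esub> t" using L.m_rcancel[OF \<open>z \<noteq> _\<close> z(1), of "\<one>\<^bsub>?L\<^esub>" "w \<otimes>\<^bsub>?L\<^esub> t"] w t(1) by auto
      then have "\<one>\<^bsub>?L\<^esub> \<in> localization_max R P" unfolding t(2) using w(1) by blast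
      then show False using L_max_iff[of \<one> \<one>] prime_facts(3) by (simp add: localization_simps)
    qed
    have one: "\<one> \<in> carrier R - P" using prime_facts(3) by auto
    have "\<exists>y\<in>carrier ?L. fraction R a \<one> = y \<otimes>\<^bsub>?L\<^esub> t [^]\<^bsub>?L\<^esub> n" for n :: nat
    proof -
      obtain s r where sr: "s \<in> carrier R - P" "r \<in> carrier R" "s \<otimes> a = r \<otimes> \<tau> [^] n" using all[of n] by blast
      have sR': "s \<in> carrier R" using sr by auto
      have m: "r \<otimes> \<sigma> [^] n \<in> carrier R" "\<tau> [^] n \<in> carrier R" "\<sigma> [^] n \<in> carrier R - P"
        using sr(2) sR ts outside_pow by auto
      have "fraction R (r \<otimes> \<sigma> [^] n) s \<otimes>\<^bsub>?L\<^esub> t [^]\<^bsub>?L\<^esub> n = fraction R ((r \<otimes> \<sigma> [^] n) \<otimes> \<tau> [^] n) (s \<otimes> \<sigma> [^] n)"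
        unfolding ts(3) L_pow[OF ts(1,2)] by (rule L_mult[OF m(1) sr(1) m(2,3)])
      moreover have "a \<otimes> (s \<otimes> \<sigma> [^] n) = ((r \<otimes> \<sigma> [^] n) \<otimes> \<tau> [^] n) \<otimes> \<one>"
      proof -
        have "a \<otimes> (s \<otimes> \<sigma> [^] n) = (s \<otimes> a) \<otimes> \<sigma> [^] n" using a(1) sR sR' by (simp add: m_ac)
        also have "\<dots> = (r \<otimes> \<tau> [^] n) \<otimes> \<sigma> [^] n" by (simp only: sr(3))
        also have "\<dots> = ((r \<otimes> \<sigma> [^] n) \<otimes> \<tau> [^] n) \<otimes> \<one>" using sr(2) ts(1) sR by (simp add: m_ac)
        finally show ?thesis .
      qed
      then have "fraction R a \<one> = fraction R ((r \<otimes> \<sigma> [^] n) \<otimes> \<tau> [^] n) (s \<otimes> \<sigma> [^] n)"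
        using fraction_eq_iff[OF a(1) outside_nonzero[OF one] m_closed[OF m(1,2)] outside_nonzero[OF outside_mult[OF sr(1) m(3)]]] by simp
      ultimately show ?thesis using in_L[OF m(1) sr(1)] by metis
    qed
    then have "fraction R a \<one> \<in> J" unfolding J_def using in_L[OF a(1) one] by blast
    then obtain y where "y \<in> carrier ?L" "fraction R a \<one> = y \<otimes>\<^bsub>?L\<^esub> \<zero>\<^bsub>?L\<^esub>" unfolding z(2) z0 by blast
    then have "fraction R a \<one> = fraction R \<zero> \<one>" using L.r_null localization_simps(5) by metis
    then show False using fraction_eq_iff[OF a(1) outside_nonzero[OF one] zero_closed outside_nonzero[OF one]] a by simp
  qed
  show thesis using that[OF tP nz 1 2] by blast
qed

text \<open>The definite description in \<open>multiplicity_at\<close> is resolved here once; later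
  arguments about multiplicities use only these properties. The third one is divisibility in the
  local ring with denominators cleared.\<close>

theorem order_function:
  obtains v :: "'a \<Rightarrow> nat"
  where "\<And>a b. a \<in> carrier R - {\<zero>} \<Longrightarrow> b \<in> carrier R - {\<zero>} \<Longrightarrow> v (a \<otimes> b) = v a + v b"
    and "\<And>a. a \<in> carrier R - {\<zero>} \<Longrightarrow> v a > 0 \<longleftrightarrow> a \<in> P"
    and "\<And>a b. a \<in> carrier R - {\<zero>} \<Longrightarrow> b \<in> carrier R - {\<zero>} \<Longrightarrow> v b \<le> v a \<Longrightarrow>
           \<exists>s\<in>carrier R - P. \<exists>r\<in>carrier R. s \<otimes> a = r \<otimes> b"
    and "\<And>a b. a \<in> carrier R - {\<zero>} \<Longrightarrow> b \<in> carrier R - {\<zero>} \<Longrightarrow>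
           multiplicity_at R P (fraction R a b) = int (v a) - int (v b)"
proof -
  obtain \<tau> where \<tau>: "\<tau> \<in> P" "\<tau> \<noteq> \<zero>"
    and gen: "\<And>a. a \<in> P \<Longrightarrow> \<exists>s\<in>carrier R - P. \<exists>r\<in>carrier R. s \<otimes> a = r \<otimes> \<tau>"
    and krull: "\<And>a. a \<in> carrier R \<Longrightarrow> a \<noteq> \<zero> \<Longrightarrow> \<exists>n::nat. \<forall>s\<in>carrier R - P. \<forall>r\<in>carrier R. s \<otimes> a \<noteq> r \<otimes> \<tau> [^] n"
    by (rule uniformizer) blast
  have tR: "\<tau> \<in> carrier R" using \<tau> prime_facts(1) by blast
  have tnR: "\<tau> [^] n \<in> carrier R" for n :: nat using tR by simp
  have tn: "\<tau> [^] n \<in> carrier R - {\<zero>}" for n :: nat using nonzero_pow tR \<tau> by blast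
  \<comment> \<open>In the local ring, \<open>a\<close> is a unit times the power \<open>n\<close>
    of the uniformizer: both \<open>s\<close> and \<open>r\<close> are outside
    \<open>P\<close>.\<close>
  define ord where "ord a n \<longleftrightarrow> (\<exists>s\<in>carrier R - P. \<exists>r\<in>carrier R - P. s \<otimes> a = r \<otimes> \<tau> [^] n)" for a and n :: nat
  have ex: "\<exists>n. ord a n" if a: "a \<in> carrier R - {\<zero>}" for a
  proof -
    let ?Q = "\<lambda>n::nat. \<forall>s\<in>carrier R - P. \<forall>r\<in>carrier R. s \<otimes> a \<noteq> r \<otimes> \<tau> [^] n"
    have "\<exists>n. ?Q n" using krull[of a] a by blast
    \<comment> \<open>\<open>n\<close> is the first power that does not divide \<open>a\<close>, so
      the order is \<open>n - 1\<close>. The quotient \<open>r\<close> at that power is a unit,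
      since otherwise one more factor could be split off.\<close>
    then obtain n where Qn: "?Q n" and least: "\<And>m. m < n \<Longrightarrow> \<not> ?Q m" unfolding exists_least_iff[of ?Q] by blast
    have "n \<noteq> 0"
    proof
      assume "n = 0"
      have "\<one> \<in> carrier R - P" "a \<in> carrier R" using a prime_facts(3) by auto
      then have "\<one> \<otimes> a \<noteq> a \<otimes> \<tau> [^] n" using Qn by blast
      then show False using a \<open>n = 0\<close> by simp
    qed
    then obtain m where m: "n = Suc m" using not0_implies_Suc by blast
    then have "\<not> ?Q m" using least[of m] by blast
    then obtain s r where sr: "s \<in> carrier R - P" "r \<in> carrier R" "s \<otimes> a = r \<otimes> \<tau> [^] m" by blast
    have "r \<notin> P"
    proof
      assume "r \<in> P"
      then obtain s' r' where sr': "s' \<in> carrier R - P" "r' \<in> carrier R" "s' \<otimes> r = r' \<otimes> \<tau>" using gen by blast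
      have sR: "s \<in> carrier R" "s' \<in> carrier R" using sr sr' by auto
      have aR: "a \<in> carrier R" using a by auto
      have "(s' \<otimes> s) \<otimes> a = s' \<otimes> (s \<otimes> a)" using sR aR by (simp add: m_assoc)
      also have "\<dots> = s' \<otimes> (r \<otimes> \<tau> [^] m)" by (simp only: sr(3))
      also have "\<dots> = (s' \<otimes> r) \<otimes> \<tau> [^] m" using sR sr(2) tR by (simp add: m_assoc)
      also have "\<dots> = (r' \<otimes> \<tau>) \<otimes> \<tau> [^] m" by (simp only: sr'(3))
      also have "\<dots> = r' \<otimes> \<tau> [^] n" using sr'(2) tR unfolding m by (simp add: m_ac)
      finally show False using Qn outside_mult[OF sr'(1) sr(1)] sr'(2) by blast
    qed
    then show ?thesis using sr unfolding ord_def by blast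
  qed
  have mult: "ord (a \<otimes> b) (n + m)" if a: "a \<in> carrier R" "b \<in> carrier R" "ord a n" "ord b m" for a b n m
  proof -
    obtain s r s' r' where *: "s \<in> carrier R - P" "r \<in> carrier R - P" "s \<otimes> a = r \<otimes> \<tau> [^] n"
      "s' \<in> carrier R - P" "r' \<in> carrier R - P" "s' \<otimes> b = r' \<otimes> \<tau> [^] m" using a unfolding ord_def by blast
    have R: "s \<in> carrier R" "r \<in> carrier R" "s' \<in> carrier R" "r' \<in> carrier R" using * by auto
    have "(s \<otimes> s') \<otimes> (a \<otimes> b) = (s \<otimes> a) \<otimes> (s' \<otimes> b)" using R a by (simp add: m_ac)
    also have "\<dots> = (r \<otimes> \<tau> [^] n) \<otimes> (r' \<otimes> \<tau> [^] m)" by (simp only: *)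
    also have "\<dots> = (r \<otimes> r') \<otimes> \<tau> [^] (n + m)" using R tR by (simp add: m_ac flip: nat_pow_mult)
    finally show ?thesis using outside_mult * unfolding ord_def by blast
  qed
  have compare: "\<exists>s\<in>carrier R - P. \<exists>r\<in>carrier R. s \<otimes> a = (r \<otimes> \<tau> [^] (n - m)) \<otimes> b \<and> r \<notin> P"
    if a: "a \<in> carrier R" "b \<in> carrier R" "ord a n" "ord b m" "m \<le> n" for a b n m
  proof -
    obtain s r s' r' where *: "s \<in> carrier R - P" "r \<in> carrier R - P" "s \<otimes> a = r \<otimes> \<tau> [^] n"
      "s' \<in> carrier R - P" "r' \<in> carrier R - P" "s' \<otimes> b = r' \<otimes> \<tau> [^] m" using a unfolding ord_def by blast
    have R: "s \<in> carrier R" "r \<in> carrier R" "s' \<in> carrier R" "r' \<in> carrier R" using * by auto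
    have "(s \<otimes> r') \<otimes> a = r' \<otimes> (s \<otimes> a)" using R a by (simp add: m_ac)
    also have "\<dots> = r' \<otimes> (r \<otimes> \<tau> [^] n)" by (simp only: *)
    also have "\<tau> [^] n = \<tau> [^] (n - m) \<otimes> \<tau> [^] m" using a(5) tR by (simp add: nat_pow_mult)
    also have "r' \<otimes> (r \<otimes> (\<tau> [^] (n - m) \<otimes> \<tau> [^] m)) = (r \<otimes> \<tau> [^] (n - m)) \<otimes> (r' \<otimes> \<tau> [^] m)"
      using R tR by (simp add: m_ac)
    also have "\<dots> = (r \<otimes> \<tau> [^] (n - m)) \<otimes> (s' \<otimes> b)" by (simp only: *)
    also have "\<dots> = ((r \<otimes> s') \<otimes> \<tau> [^] (n - m)) \<otimes> b" using R tR a by (simp add: m_ac)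
    finally show ?thesis using outside_mult[OF *(1,5)] outside_mult[OF *(2,4)] by blast
  qed
  have uniq: "n = m" if a: "a \<in> carrier R - {\<zero>}" "ord a n" "ord a m" for a n m
  proof -
    have le: "\<not> m < n" if o: "ord a n" "ord a m" for n m
    proof
      assume "m < n"
      have aR: "a \<in> carrier R" using a(1) by auto
      obtain s r where *: "s \<in> carrier R - P" "r \<in> carrier R" "s \<otimes> a = (r \<otimes> \<tau> [^] (n - m)) \<otimes> a"
        using compare[OF aR aR o less_imp_le[OF \<open>m < n\<close>]] by blast
      then have "s = r \<otimes> \<tau> [^] (n - m)" using a(1) m_rcancel[of a s "r \<otimes> \<tau> [^] (n - m)"] tR by auto
      moreover obtain k where "n - m = Suc k" using \<open>m < n\<close> by (metis Suc_diff_Suc)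
      ultimately have "s = (r \<otimes> \<tau> [^] k) \<otimes> \<tau>" using *(2) tR by (simp add: m_assoc)
      then show False using *(1) prime_facts(5)[OF m_closed[OF *(2) tnR] \<tau>(1)] by simp
    qed
    show ?thesis using le[OF a(2,3)] le[OF a(3,2)] by simp
  qed
  define v where "v a = (THE n. ord a n)" for a
  have v: "ord a n \<longleftrightarrow> v a = n" if a: "a \<in> carrier R - {\<zero>}" for a n
  proof -
    obtain k where k: "ord a k" using ex[OF a] by blast
    then have "v a = k" unfolding v_def using uniq[OF a] by blast
    then show ?thesis using k uniq[OF a] by blast
  qed
  have v_mult: "v (a \<otimes> b) = v a + v b" if "a \<in> carrier R - {\<zero>}" "b \<in> carrier R - {\<zero>}" for a b
    using mult[of a b "v a" "v b"] that v[of a] v[of b] v[OF nonzero_mult[OF that]] by auto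
  have v_pos: "v a > 0 \<longleftrightarrow> a \<in> P" if a: "a \<in> carrier R - {\<zero>}" for a
  proof -
    have aR: "a \<in> carrier R" using a by auto
    obtain s r where *: "s \<in> carrier R - P" "r \<in> carrier R - P" "s \<otimes> a = r \<otimes> \<tau> [^] v a" using v[OF a] unfolding ord_def by blast
    have R: "s \<in> carrier R" "r \<in> carrier R" using * by auto
    show ?thesis
    proof (cases "v a")
      case 0
      then have "s \<otimes> a = r" using *(3) R by simp
      then show ?thesis using 0 *(1,2) prime_facts(5)[OF R(1), of a] by auto
    next
      case (Suc k)
      then have "s \<otimes> a = (r \<otimes> \<tau> [^] k) \<otimes> \<tau>" using *(3) R tR by (simp add: m_assoc)
      then have "s \<otimes> a \<in> P" using prime_facts(5)[OF m_closed[OF R(2) tnR] \<tau>(1)] by simp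
      then show ?thesis using Suc prime_facts(7)[OF R(1) aR] *(1) by auto
    qed
  qed
  have v_pow: "v (a [^] n) = n * v a" if a: "a \<in> carrier R - {\<zero>}" for a and n :: nat
  proof (induction n)
    case 0
    have "\<one> \<in> carrier R - {\<zero>}" by auto
    then show ?case using v_pos[of \<one>] prime_facts(3) by auto
  next
    case (Suc n)
    then show ?case using v_mult[OF nonzero_pow[OF a] a] by simp
  qed
  have "\<tau> \<in> carrier R - {\<zero>}" using \<tau> tR by auto
  have v_\<tau>: "v \<tau> = 1"
  proof -
    have "ord \<tau> 1" unfolding ord_def using tR prime_facts(3) by (intro bexI[of _ \<one>]) auto
    then show ?thesis using v[OF \<open>\<tau> \<in> carrier R - {\<zero>}\<close>] by simp
  qed
  have v_eq: "int (v a) - int (v b) = int (v c) - int (v d)"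
    if "a \<in> carrier R - {\<zero>}" "b \<in> carrier R - {\<zero>}" "c \<in> carrier R - {\<zero>}" "d \<in> carrier R - {\<zero>}"
      "fraction R a b = fraction R c d" for a b c d
  proof -
    have "a \<otimes> d = c \<otimes> b" using that fraction_eq_iff[of a b c d] by auto
    then have "v a + v d = v c + v b" using v_mult that by metis
    then show ?thesis by simp
  qed
  have max: "localization_max R P = PIdl\<^bsub>localization R P\<^esub> (fraction R \<tau> \<one>)"
  proof
    have one: "\<one> \<in> carrier R - P" using prime_facts(3) by auto
    have tm: "fraction R \<tau> \<one> \<in> localization_max R P" using L_max_iff[OF tR one] \<tau> by simp
    show "PIdl\<^bsub>localization R P\<^esub> (fraction R \<tau> \<one>) \<subseteq> localization_max R P"
      using ideal.I_l_closed[OF L_max_ideal tm] by (auto simp: cgenideal_def)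
    show "localization_max R P \<subseteq> PIdl\<^bsub>localization R P\<^esub> (fraction R \<tau> \<one>)"
    proof
      fix x assume "x \<in> localization_max R P"
      then obtain a b where ab: "a \<in> P" "b \<in> carrier R - P" "x = fraction R a b" unfolding localization_max_def by blast
      obtain s r where sr: "s \<in> carrier R - P" "r \<in> carrier R" "s \<otimes> a = r \<otimes> \<tau>" using gen[OF ab(1)] by blast
      have R: "a \<in> carrier R" "b \<in> carrier R" "s \<in> carrier R" using ab sr prime_facts(1) by auto
      have sb: "s \<otimes> b \<in> carrier R - P" by (rule outside_mult[OF sr(1) ab(2)])
      have "fraction R r (s \<otimes> b) \<otimes>\<^bsub>localization R P\<^esub> fraction R \<tau> \<one> = fraction R (r \<otimes> \<tau>) ((s \<otimes> b) \<otimes> \<one>)"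
        by (rule L_mult[OF sr(2) sb tR one])
      also have "\<dots> = x"
        unfolding ab(3)
      proof (subst fraction_eq_iff)
        show "r \<otimes> \<tau> \<in> carrier R" "a \<in> carrier R" using sr(2) tR R by auto
        show "s \<otimes> b \<otimes> \<one> \<in> carrier R - {\<zero>}" by (rule outside_nonzero[OF outside_mult[OF sb one]])
        show "b \<in> carrier R - {\<zero>}" by (rule outside_nonzero[OF ab(2)])
        have "r \<otimes> \<tau> \<otimes> b = (s \<otimes> a) \<otimes> b" by (simp only: sr(3))
        also have "\<dots> = a \<otimes> (s \<otimes> b \<otimes> \<one>)" using R by (simp add: m_ac)
        finally show "r \<otimes> \<tau> \<otimes> b = a \<otimes> (s \<otimes> b \<otimes> \<one>)" .
      qed
      finally show "x \<in> PIdl\<^bsub>localization R P\<^esub> (fraction R \<tau> \<one>)"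
        using in_L[OF sr(2) sb] unfolding cgenideal_def by blast
    qed
  qed
  have v_val: "multiplicity_at R P (fraction R a b) = int (v a) - int (v b)"
    if ab: "a \<in> carrier R - {\<zero>}" "b \<in> carrier R - {\<zero>}" for a b
    unfolding multiplicity_at_def
  proof (rule the_equality)
    have one: "\<one> \<in> carrier R - P" using prime_facts(3) by auto
    note one' = outside_nonzero[OF one]
    have R: "a \<in> carrier R" "b \<in> carrier R" using ab by auto
    let ?n = "int (v a) - int (v b)"
    obtain s r where *: "s \<in> carrier R - P" "r \<in> carrier R - P" "s \<otimes> a = r \<otimes> \<tau> [^] v a" using v[OF ab(1)] unfolding ord_def by blast
    obtain s' r' where sr': "s' \<in> carrier R - P" "r' \<in> carrier R - P" "s' \<otimes> b = r' \<otimes> \<tau> [^] v b" using v[OF ab(2)] unfolding ord_def by blast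
    have R': "s \<in> carrier R" "r \<in> carrier R" "s' \<in> carrier R" "r' \<in> carrier R" using * sr' by auto
    \<comment> \<open>The integer exponent is distributed over numerator and denominator; one of
      \<open>i\<close> and \<open>j\<close> is zero.\<close>
    define i j where "i = nat ?n" and "j = nat (- ?n)"
    have ij: "v a + j = v b + i" "i = 0 \<or> j = 0" unfolding i_def j_def by auto
    have "fraction R \<tau> \<one> [^]\<^bsub>fraction_field R\<^esub> ?n = fraction R (\<tau> [^] i) (\<tau> [^] j)"
      unfolding fraction_int_pow[OF \<open>\<tau> \<in> carrier R - {\<zero>}\<close> one'] i_def j_def by (auto simp: nat_pow_one)
    moreover have "fraction R (\<tau> [^] i) (\<tau> [^] j) \<otimes>\<^bsub>fraction_field R\<^esub> fraction R (r \<otimes> s') (s \<otimes> r') =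
        fraction R (\<tau> [^] i \<otimes> (r \<otimes> s')) (\<tau> [^] j \<otimes> (s \<otimes> r'))"
      using R' by (intro fraction_mult tnR tn outside_nonzero outside_mult * sr') auto
    moreover have "fraction R a b = fraction R (\<tau> [^] i \<otimes> (r \<otimes> s')) (\<tau> [^] j \<otimes> (s \<otimes> r'))"
    proof (subst fraction_eq_iff)
      show "\<tau> [^] i \<otimes> (r \<otimes> s') \<in> carrier R" using R' tR by auto
      show "\<tau> [^] j \<otimes> (s \<otimes> r') \<in> carrier R - {\<zero>}"
        by (intro nonzero_mult tn outside_nonzero outside_mult * sr')
      have "a \<otimes> (\<tau> [^] j \<otimes> (s \<otimes> r')) = (s \<otimes> a) \<otimes> (\<tau> [^] j \<otimes> r')" using R R' tR by (simp add: m_ac)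
      also have "\<dots> = (r \<otimes> \<tau> [^] v a) \<otimes> (\<tau> [^] j \<otimes> r')" by (simp only: *)
      also have "\<dots> = (r \<otimes> r') \<otimes> (\<tau> [^] v a \<otimes> \<tau> [^] j)" using R' tR by (simp add: m_ac)
      also have "\<tau> [^] v a \<otimes> \<tau> [^] j = \<tau> [^] v b \<otimes> \<tau> [^] i" using ij(1) tR by (simp add: nat_pow_mult)
      also have "(r \<otimes> r') \<otimes> (\<tau> [^] v b \<otimes> \<tau> [^] i) = (r' \<otimes> \<tau> [^] v b) \<otimes> (\<tau> [^] i \<otimes> r)" using R' tR by (simp add: m_ac)
      also have "\<dots> = (s' \<otimes> b) \<otimes> (\<tau> [^] i \<otimes> r)" by (simp only: sr')
      also have "\<dots> = \<tau> [^] i \<otimes> (r \<otimes> s') \<otimes> b" using R R' tR by (simp add: m_ac)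
      finally show "a \<otimes> (\<tau> [^] j \<otimes> (s \<otimes> r')) = \<tau> [^] i \<otimes> (r \<otimes> s') \<otimes> b" .
    qed (use R ab in auto)
    ultimately have "fraction R a b = fraction R \<tau> \<one> [^]\<^bsub>fraction_field R\<^esub> ?n \<otimes>\<^bsub>fraction_field R\<^esub> fraction R (r \<otimes> s') (s \<otimes> r')"
      by simp
    moreover have "fraction R (r \<otimes> s') (s \<otimes> r') \<in> Units (localization R P)"
      by (intro L_unit outside_mult * sr')
    ultimately show "\<exists>t\<in>carrier (localization R P). \<exists>u\<in>Units (localization R P).
       localization_max R P = PIdl\<^bsub>localization R P\<^esub> t \<and>
       fraction R a b = t [^]\<^bsub>fraction_field R\<^esub> ?n \<otimes>\<^bsub>fraction_field R\<^esub> u"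
      using max in_L[OF tR one] by blast
  next
    fix n :: int
    assume "\<exists>t\<in>carrier (localization R P). \<exists>u\<in>Units (localization R P).
       localization_max R P = PIdl\<^bsub>localization R P\<^esub> t \<and>
       fraction R a b = t [^]\<^bsub>fraction_field R\<^esub> n \<otimes>\<^bsub>fraction_field R\<^esub> u"
    then obtain t u where t: "t \<in> carrier (localization R P)" and u: "u \<in> Units (localization R P)"
      and tmax: "localization_max R P = PIdl\<^bsub>localization R P\<^esub> t"
      and eq: "fraction R a b = t [^]\<^bsub>fraction_field R\<^esub> n \<otimes>\<^bsub>fraction_field R\<^esub> u" by blast
    have one: "\<one> \<in> carrier R - P" using prime_facts(3) by auto
    obtain c s where c: "c \<in> carrier R" "s \<in> carrier R - P" "t = fraction R c s" using t by (rule L_cases)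
    obtain u' where u': "u' \<in> carrier (localization R P)" "u' \<otimes>\<^bsub>localization R P\<^esub> u = \<one>\<^bsub>localization R P\<^esub>" "u \<in> carrier (localization R P)"
      using u unfolding Units_def by blast
    obtain e f where e: "e \<in> carrier R" "f \<in> carrier R - P" "u = fraction R e f" using u'(3) by (rule L_cases)
    obtain e' f' where e': "e' \<in> carrier R" "f' \<in> carrier R - P" "u' = fraction R e' f'" using u'(1) by (rule L_cases)
    have "fraction R (e' \<otimes> e) (f' \<otimes> f) = fraction R \<one> \<one>"
      using u'(2) L_mult[OF e'(1,2) e(1,2)] unfolding e(3) e'(3) localization_simps(4) by simp
    then have "e' \<otimes> e \<otimes> \<one> = \<one> \<otimes> (f' \<otimes> f)"
      using fraction_eq_iff[OF m_closed[OF e'(1) e(1)] outside_nonzero[OF outside_mult[OF e'(2) e(2)]] one_closed outside_nonzero[OF one]] by simp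
    then have "e' \<otimes> e = f' \<otimes> f" using e e' by auto
    then have eP: "e \<in> carrier R - P" using e e' outside_mult[OF e'(2) e(2)] prime_facts(5)[OF e'(1), of e] by auto
    have "fraction R \<tau> \<one> \<in> PIdl\<^bsub>localization R P\<^esub> t" using L_max_iff[OF tR one] \<tau> tmax by simp
    then obtain y where y: "y \<in> carrier (localization R P)" "fraction R \<tau> \<one> = y \<otimes>\<^bsub>localization R P\<^esub> t" unfolding cgenideal_def by blast
    obtain g h where g: "g \<in> carrier R" "h \<in> carrier R - P" "y = fraction R g h" using y(1) by (rule L_cases)
    have "fraction R \<tau> \<one> = fraction R (g \<otimes> c) (h \<otimes> s)" unfolding y(2) g(3) c(3) by (rule L_mult[OF g(1,2) c(1,2)])
    then have *: "\<tau> \<otimes> (h \<otimes> s) = g \<otimes> c \<otimes> \<one>"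
      using fraction_eq_iff[OF tR outside_nonzero[OF one] m_closed[OF g(1) c(1)] outside_nonzero[OF outside_mult[OF g(2) c(2)]]] by simp
    then have *: "\<tau> \<otimes> (h \<otimes> s) = g \<otimes> c" using g(1) c(1) by simp
    have nz: "\<tau> \<otimes> (h \<otimes> s) \<in> carrier R - {\<zero>}"
      by (intro nonzero_mult \<open>\<tau> \<in> carrier R - {\<zero>}\<close> outside_nonzero outside_mult g(2) c(2))
    then have gc: "g \<in> carrier R - {\<zero>}" "c \<in> carrier R - {\<zero>}" using * g(1) c(1) by auto
    have v0: "v x = 0" if "x \<in> carrier R - P" for x using v_pos[OF outside_nonzero[OF that]] that by auto
    \<comment> \<open>Any generator of the maximal ideal has order one: it divides the chosen
      uniformizer, so the order is at most one, and it lies in the ideal, so the order is positive.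
      The exponent therefore does not depend on the generator.\<close>
    have "1 = v g + v c" using v_mult[OF gc] v_mult[OF \<open>\<tau> \<in> carrier R - {\<zero>}\<close> outside_nonzero[OF outside_mult[OF g(2) c(2)]]]
        v0[OF outside_mult[OF g(2) c(2)]] v_\<tau> * by simp
    moreover have "t \<in> localization_max R P" unfolding tmax cgenideal_def
      using L.one_closed L.l_one[OF t] by force
    then have "v c > 0" using L_max_iff[OF c(1,2)] v_pos[OF gc(2)] unfolding c(3) by simp
    ultimately have vc: "v c = 1" by simp
    note s' = outside_nonzero[OF c(2)] and e'' = outside_nonzero[OF eP] and f'' = outside_nonzero[OF e(2)]
    define i j where "i = nat n" and "j = nat (- n)"
    have "t [^]\<^bsub>fraction_field R\<^esub> n = fraction R (c [^] i \<otimes> s [^] j) (s [^] i \<otimes> c [^] j)"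
    proof -
      have R: "c \<in> carrier R" "s \<in> carrier R" using c by auto
      show ?thesis unfolding c(3) fraction_int_pow[OF gc(2) s'] i_def j_def
        using R by (cases n rule: int_cases2) auto
    qed
    moreover have m1: "c [^] i \<otimes> s [^] j \<in> carrier R - {\<zero>}" "s [^] i \<otimes> c [^] j \<in> carrier R - {\<zero>}"
      by (intro nonzero_mult nonzero_pow gc s')+
    ultimately have "fraction R a b = fraction R ((c [^] i \<otimes> s [^] j) \<otimes> e) ((s [^] i \<otimes> c [^] j) \<otimes> f)"
      unfolding eq e(3) using fraction_mult[of "c [^] i \<otimes> s [^] j" "s [^] i \<otimes> c [^] j" e f] e(1) f'' by auto
    then have "int (v a) - int (v b) = int (v ((c [^] i \<otimes> s [^] j) \<otimes> e)) - int (v ((s [^] i \<otimes> c [^] j) \<otimes> f))"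
      by (intro v_eq ab nonzero_mult[OF m1(1) e''] nonzero_mult[OF m1(2) f''])
    also have "v ((c [^] i \<otimes> s [^] j) \<otimes> e) = i"
      using v_mult[OF m1(1) e''] v_mult[OF nonzero_pow[OF gc(2)] nonzero_pow[OF s'], of i j] v_pow[OF gc(2)] v_pow[OF s'] v0[OF eP] v0[OF c(2)] vc by simp
    also have "v ((s [^] i \<otimes> c [^] j) \<otimes> f) = j"
      using v_mult[OF m1(2) f''] v_mult[OF nonzero_pow[OF s'] nonzero_pow[OF gc(2)], of i j] v_pow[OF gc(2)] v_pow[OF s'] v0[OF e(2)] v0[OF c(2)] vc by simp
    finally show "n = int (v a) - int (v b)" unfolding i_def j_def by auto
  qed
  show thesis
  proof (rule that[of v])
    fix a b assume ab: "a \<in> carrier R - {\<zero>}" "b \<in> carrier R - {\<zero>}" "v b \<le> v a"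
    have R: "a \<in> carrier R" "b \<in> carrier R" using ab by auto
    have "ord a (v a)" "ord b (v b)" using v ab by auto
    from compare[OF R this ab(3)] show "\<exists>s\<in>carrier R - P. \<exists>r\<in>carrier R. s \<otimes> a = r \<otimes> b"
      using tR by blast
  qed (use v_mult v_pos v_val in blast)+
qed

end

end

section \<open>Polynomial functions and graded Noether normalization\<close>

lemma power_fun_apply [simp]: "((f :: 'a \<Rightarrow> 'b::monoid_mult) ^ n) x = f x ^ n"
  by (induction n) auto

lemma sum_fun_apply [simp]: "(sum f A) x = (\<Sum>a\<in>A. (f a :: 'a \<Rightarrow> 'b::comm_monoid_add) x)"
  by (induction A rule: infinite_finite_induct) auto

lemma prod_fun_apply [simp]: "(prod f A) x = (\<Prod>a\<in>A. (f a :: 'a \<Rightarrow> 'b::comm_monoid_mult) x)"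
  by (induction A rule: infinite_finite_induct) auto

lemma monomial_split:
  fixes Y :: "'r::comm_monoid_mult set"
  assumes "finite Y" "y \<in> Y" "M \<le> \<alpha> y"
  shows "(\<Prod>z\<in>Y. z ^ \<alpha> z) = y ^ M * (\<Prod>z\<in>Y. z ^ (\<alpha>(y := \<alpha> y - M)) z)"
    and "(\<Sum>z\<in>Y. \<alpha> z) = M + (\<Sum>z\<in>Y. (\<alpha>(y := \<alpha> y - M)) z)"
proof -
  let ?\<alpha> = "\<alpha>(y := \<alpha> y - M)"
  have "(\<Prod>z\<in>Y. z ^ \<alpha> z) = y ^ \<alpha> y * (\<Prod>z\<in>Y - {y}. z ^ ?\<alpha> z)"
    by (subst prod.remove[OF assms(1,2)]) (auto intro!: arg_cong2[where f="(*)"] prod.cong)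
  also have "y ^ \<alpha> y = y ^ M * y ^ ?\<alpha> y" using assms(3) by (simp flip: power_add)
  finally show "(\<Prod>z\<in>Y. z ^ \<alpha> z) = y ^ M * (\<Prod>z\<in>Y. z ^ ?\<alpha> z)"
    by (simp add: prod.remove[OF assms(1,2)] mult.assoc)
  have "(\<Sum>z\<in>Y. \<alpha> z) = \<alpha> y + (\<Sum>z\<in>Y - {y}. ?\<alpha> z)"
    by (subst sum.remove[OF assms(1,2)]) (auto intro!: arg_cong2[where f="(+)"] sum.cong)
  then show "(\<Sum>z\<in>Y. \<alpha> z) = M + (\<Sum>z\<in>Y. ?\<alpha> z)"
    using assms(3) sum.remove[OF assms(1,2), of ?\<alpha>] by simp
qed

section \<open>Forms in a set of generators\<close>

context constants_embedding
begin

text \<open>Elements expressible as forms of degree \<open>n\<close> in \<open>Y\<close>. Nothing is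
  claimed about uniqueness of the degree or of the expression; components are separated later by
  scaling the argument.\<close>

inductive_set hpoly :: "'r set \<Rightarrow> nat \<Rightarrow> 'r set"
  for Y n where
    zero: "0 \<in> hpoly Y n"
  | mono: "(\<Sum>y\<in>Y. \<alpha> y) = n \<Longrightarrow> \<kappa> c * (\<Prod>y\<in>Y. y ^ \<alpha> y) \<in> hpoly Y n"
  | add: "\<phi> \<in> hpoly Y n \<Longrightarrow> \<psi> \<in> hpoly Y n \<Longrightarrow> \<phi> + \<psi> \<in> hpoly Y n"

lemma hpoly_mult:
  assumes "\<phi> \<in> hpoly Y n" "\<psi> \<in> hpoly Y k" shows "\<phi> * \<psi> \<in> hpoly Y (n + k)"
  using assms
proof (induction)
  case zero
  then show ?case by (simp add: hpoly.zero)
next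
  case (mono \<alpha> c)
  from mono(2,1) show ?case
  proof (induction)
    case zero
    then show ?case by (simp add: hpoly.zero)
  next
    case (mono \<beta> d)
    have "\<kappa> c * (\<Prod>y\<in>Y. y ^ \<alpha> y) * (\<kappa> d * (\<Prod>y\<in>Y. y ^ \<beta> y)) = \<kappa> (c * d) * (\<Prod>y\<in>Y. y ^ (\<alpha> y + \<beta> y))"
      by (simp add: power_add prod.distrib const_mult mult_ac)
    moreover have "(\<Sum>y\<in>Y. \<alpha> y + \<beta> y) = n + k" using mono by (simp add: sum.distrib)
    ultimately show ?case using hpoly.mono by metis
  next
    case (add \<phi> \<psi>)
    then show ?case by (simp add: distrib_left hpoly.add)
  qed
next
  case (add \<phi> \<psi>)
  then show ?case by (simp add: distrib_right hpoly.add)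
qed

text \<open>Finite sums of forms are closed under sums and products and contain the generators, so
  they exhaust the generated algebra.\<close>

lemma hpoly_decomposition:
  assumes "\<phi> \<in> generated ys"
  shows "\<exists>N f. (\<forall>n. f n \<in> hpoly (set ys) n) \<and> (\<forall>n>N. f n = 0) \<and> \<phi> = (\<Sum>n\<le>N. f n)"
proof -
  let ?Y = "set ys"
  define D where "D N f \<longleftrightarrow> (\<forall>n. f n \<in> hpoly ?Y n) \<and> (\<forall>n>N. f n = 0)" for N f
  let ?A = "{\<phi>. \<exists>N f. D N f \<and> \<phi> = (\<Sum>n\<le>N. f n)}"
  have single: "\<phi> \<in> ?A" if "\<phi> \<in> hpoly ?Y k" for \<phi> k
  proof -
    have "D k (\<lambda>n. if n = k then \<phi> else 0)" using that by (auto simp: D_def hpoly.zero)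
    moreover have "\<phi> = (\<Sum>n\<le>k. if n = k then \<phi> else 0)" by simp
    ultimately show ?thesis by blast
  qed
  have const: "\<kappa> c \<in> ?A" for c
  proof -
    have "\<kappa> c \<in> hpoly ?Y 0" using hpoly.mono[of "\<lambda>_. 0" ?Y 0 c] by simp
    then show ?thesis by (rule single)
  qed
  have add: "a + b \<in> ?A" if ab: "a \<in> ?A" "b \<in> ?A" for a b
  proof -
    obtain N f M g where *: "D N f" "a = (\<Sum>n\<le>N. f n)" "D M g" "b = (\<Sum>n\<le>M. g n)" using ab by blast
    have ext: "(\<Sum>n\<le>N. f n) = (\<Sum>n\<le>max N M. f n)" "(\<Sum>n\<le>M. g n) = (\<Sum>n\<le>max N M. g n)"
      using * by (intro sum.mono_neutral_left; auto simp: D_def)+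
    have "D (max N M) (\<lambda>n. f n + g n)" using * by (auto simp: D_def intro: hpoly.add)
    moreover have "a + b = (\<Sum>n\<le>max N M. f n + g n)" unfolding *(2,4) ext by (simp add: sum.distrib)
    ultimately show "a + b \<in> ?A" by blast
  qed
  have sum: "(\<Sum>i\<in>I. h i) \<in> ?A" if "\<And>i. i \<in> I \<Longrightarrow> h i \<in> ?A" for h :: "nat \<Rightarrow> 'r" and I
    using that
  proof (induction I rule: infinite_finite_induct)
    case (insert i I)
    then have "h i \<in> ?A" "sum h I \<in> ?A" by blast+
    then show ?case using add insert by simp
  qed (use const[of 0] const_0 in auto)
  have mult: "a * b \<in> ?A" if ab: "a \<in> ?A" "b \<in> ?A" for a b
  proof -
    obtain N f M g where *: "D N f" "a = (\<Sum>n\<le>N. f n)" "D M g" "b = (\<Sum>n\<le>M. g n)" using ab by blast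
    have "a * b = (\<Sum>i\<le>N. \<Sum>j\<le>M. f i * g j)" unfolding *(2,4) by (rule sum_product)
    moreover have "f i * g j \<in> ?A" for i j
      using * hpoly_mult[of "f i" ?Y i "g j" j] by (intro single) (auto simp: D_def)
    ultimately show ?thesis using sum by presburger
  qed
  have "subalgebra ?A"
    unfolding subalgebra_def using const add mult by blast
  moreover have "?Y \<subseteq> ?A"
  proof
    fix y assume y: "y \<in> ?Y"
    let ?\<alpha> = "\<lambda>z. if z = y then 1 else 0"
    have "(\<Prod>z\<in>?Y. z ^ ?\<alpha> z) = (\<Prod>z\<in>?Y. if z = y then y else 1)" by (intro prod.cong) auto
    also have "\<dots> = y" using y by simp
    finally have "\<kappa> 1 * (\<Prod>z\<in>?Y. z ^ ?\<alpha> z) = y" by (simp add: const_one)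
    moreover have "(\<Sum>z\<in>?Y. ?\<alpha> z) = 1" using y by simp
    ultimately have "y \<in> hpoly ?Y 1" using hpoly.mono[of ?\<alpha> ?Y 1 1] by (simp only:)
    then show "y \<in> ?A" by (rule single)
  qed
  ultimately have "generated ys \<subseteq> ?A" by (rule generated_minimal)
  then show ?thesis using assms unfolding D_def by blast
qed

end

section \<open>Coordinates, Nullstellensatz and graded normalization\<close>

locale ambient =
  fixes S :: "('k::alg_closed_field, 'v::ab_group_add, 'm::finite, 'z) ambient_scheme"
  assumes ambient: "ambient_space S"
begin

interpretation vs: vector_space "scl S"
  using ambient by (simp add: ambient_space_def)

sublocale pf: constants_embedding "\<lambda>(c::'k) (_::'m \<Rightarrow> 'v). c"
  by unfold_locales (auto simp: fun_eq_iff)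

lemma polyfun_subalgebra: "pf.subalgebra (polyfun S)"
  unfolding pf.subalgebra_def using polyfun.intros[where M=S] by (auto simp: plus_fun_def times_fun_def)

lemmas polyfun_intros = pf.sub_intros[OF polyfun_subalgebra]

definition scale :: "'k \<Rightarrow> ('m \<Rightarrow> 'v) \<Rightarrow> 'm \<Rightarrow> 'v" where
  "scale t v = (\<lambda>i. scl S t (v i))"

text \<open>All that is used about bases of the spaces: a finite list of linear coordinates that
  separates the vertex, generates the polynomial functions, and turns places into evaluations at
  points. Polynomial functions agree with polynomials in the coordinates only on
  \<open>prod_space S UNIV\<close>, since functionals are free outside the
  \<open>VS S i\<close>.\<close>

lemma coordinate_functions:
  obtains ys :: "(('m \<Rightarrow> 'v) \<Rightarrow> 'k) list" where "set ys \<subseteq> polyfun S"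
    and "\<And>y t v. y \<in> set ys \<Longrightarrow> y (scale t v) = t * y v"
    and "\<And>\<phi>. \<phi> \<in> polyfun S \<Longrightarrow> \<exists>\<psi>\<in>pf.generated ys. \<forall>v\<in>prod_space S UNIV. \<phi> v = \<psi> v"
    and "\<And>J \<theta>. pf.place J (pf.generated ys) \<theta> \<Longrightarrow> \<exists>v\<in>prod_space S UNIV. \<forall>\<phi>\<in>pf.generated ys. \<phi> v = \<theta> \<phi>"
    and "\<And>v. v \<in> prod_space S UNIV \<Longrightarrow> (\<And>y. y \<in> set ys \<Longrightarrow> y v = 0) \<Longrightarrow> v = (\<lambda>_. 0)"
proof -
  have "\<exists>B. finite B \<and> vs.independent B \<and> VS S i = vs.span B" for i
  proof -
    obtain B where B: "finite B" "VS S i = vs.span B" using ambient by (auto simp: ambient_space_def)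
    obtain B' where "B' \<subseteq> B" "vs.independent B'" "B \<subseteq> vs.span B'" by (rule vs.maximal_independent_subset)
    then show ?thesis using B by (metis finite_subset vs.span_mono vs.span_span subset_antisym)
  qed
  then obtain B where B: "\<And>i. finite (B i)" "\<And>i. vs.independent (B i)" "\<And>i. VS S i = vs.span (B i)" by metis
  \<comment> \<open>\<open>polyfun\<close> asks for functionals on the whole vector space, hence the
    extension of the basis of \<open>VS S i\<close> to a basis of everything.\<close>
  define l where "l i b v = vs.representation (vs.extend_basis (B i)) v b" for i b v
  have l_add: "l i b (u + v) = l i b u + l i b v" and l_scale: "l i b (scl S t v) = t * l i b v" for i b u v t
    unfolding l_def using vs.independent_extend_basis[OF B(2)[of i]] vs.span_extend_basis[OF B(2)[of i]]
    by (simp_all add: vs.representation_add vs.representation_scale)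
  have l_basis: "l i b b' = (if b' = b then 1 else 0)" if "b' \<in> B i" for i b b'
    unfolding l_def using vs.representation_basis[OF vs.independent_extend_basis[OF B(2)[of i]], of b']
      vs.extend_basis_superset[OF B(2)[of i]] that by auto
  have l_linear: "Vector_Spaces.linear (scl S) (*) (l i b)" for i b
    by unfold_locales (auto simp: l_add l_scale algebra_simps)
  have expand: "(\<Sum>b\<in>B i. scl S (l i b v) b) = v" if "v \<in> VS S i" for i v
  proof -
    have "l i b v = vs.representation (B i) v b" for b
      unfolding l_def using vs.representation_extend[OF vs.independent_extend_basis[OF B(2)[of i]] _ vs.extend_basis_superset[OF B(2)[of i]]] that B(3) by simp
    then show ?thesis using vs.sum_representation_eq[OF B(2)[of i], of v "B i"] that B by simp
  qed
  define Y where "Y = (\<lambda>(i, b) v. l i b (v i)) ` (SIGMA i:UNIV. B i)"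
  have "finite Y" unfolding Y_def using B(1) by auto
  then obtain ys where ys: "set ys = Y" using finite_list by blast
  have yI: "(\<lambda>v. l i b (v i)) \<in> set ys" if "b \<in> B i" for i b using that unfolding ys Y_def by force
  have yE: "\<exists>i b. b \<in> B i \<and> y = (\<lambda>v. l i b (v i))" if "y \<in> set ys" for y using that unfolding ys Y_def by auto
  note gen = pf.sub_intros[OF pf.subalgebra_generated[of ys]]
  have ygen: "(\<lambda>v. l i b (v i)) \<in> pf.generated ys" if "b \<in> B i" for i b
    using yI[OF that] pf.generators_in_generated[of ys] by blast
  show thesis
  proof (rule that[of ys])
    show "set ys \<subseteq> polyfun S" using polyfun.coord[where M=S, OF l_linear] by (auto dest!: yE)
    show "y (scale t v) = t * y v" if "y \<in> set ys" for y t v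
      using yE[OF that] by (auto simp: scale_def l_scale)
    fix \<phi> assume "\<phi> \<in> polyfun S"
    then show "\<exists>\<psi>\<in>pf.generated ys. \<forall>v\<in>prod_space S UNIV. \<phi> v = \<psi> v"
    proof induction
      case (const c)
      show ?case by (rule bexI[of _ "\<lambda>_. c"]) (simp_all add: gen(1))
    next
      case (coord k i)
      interpret k: Vector_Spaces.linear "scl S" "(*)" k by fact
      let ?\<psi> = "\<Sum>b\<in>B i. (\<lambda>_. k b) * (\<lambda>v. l i b (v i))"
      have "?\<psi> \<in> pf.generated ys" using ygen by (intro gen) auto
      moreover have "k (v i) = ?\<psi> v" if "v \<in> prod_space S UNIV" for v
      proof -
        have "v i \<in> VS S i" using that by (simp add: prod_space_def)
        then have "k (v i) = k (\<Sum>b\<in>B i. scl S (l i b (v i)) b)" by (simp add: expand)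
        also have "\<dots> = ?\<psi> v" by (simp add: k.sum k.scale mult.commute)
        finally show ?thesis .
      qed
      ultimately show ?case by blast
    next
      case (add \<phi> \<psi>)
      then obtain \<phi>' \<psi>' where "\<phi>' \<in> pf.generated ys" "\<psi>' \<in> pf.generated ys"
        "\<forall>v\<in>prod_space S UNIV. \<phi> v = \<phi>' v" "\<forall>v\<in>prod_space S UNIV. \<psi> v = \<psi>' v" by blast
      then show ?case by (intro bexI[of _ "\<phi>' + \<psi>'"] gen(4)) auto
    next
      case (mult \<phi> \<psi>)
      then obtain \<phi>' \<psi>' where "\<phi>' \<in> pf.generated ys" "\<psi>' \<in> pf.generated ys"
        "\<forall>v\<in>prod_space S UNIV. \<phi> v = \<phi>' v" "\<forall>v\<in>prod_space S UNIV. \<psi> v = \<psi>' v" by blast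
      then show ?case by (intro bexI[of _ "\<phi>' * \<psi>'"] gen(5)) auto
    qed
  next
    fix J \<theta> assume th: "pf.place J (pf.generated ys) \<theta>"
    define v where "v i = (\<Sum>b\<in>B i. scl S (\<theta> (\<lambda>v. l i b (v i))) b)" for i
    have v: "v \<in> prod_space S UNIV"
      unfolding prod_space_def v_def B(3) by (auto intro: vs.span_sum vs.span_scale vs.span_base)
    have lv: "l i b (v i) = \<theta> (\<lambda>v. l i b (v i))" if "b \<in> B i" for i b
    proof -
      interpret l: Vector_Spaces.linear "scl S" "(*)" "l i b" by (rule l_linear)
      have "l i b (v i) = (\<Sum>b'\<in>B i. \<theta> (\<lambda>v. l i b' (v i)) * l i b b')"
        unfolding v_def by (simp add: l.sum l.scale)
      also have "\<dots> = (\<Sum>b'\<in>B i. if b' = b then \<theta> (\<lambda>v. l i b' (v i)) else 0)"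
        by (intro sum.cong) (auto simp: l_basis)
      finally show ?thesis using that B(1) by simp
    qed
    let ?A = "{\<phi> \<in> pf.generated ys. \<phi> v = \<theta> \<phi>}"
    have "pf.subalgebra ?A"
      using th gen unfolding pf.subalgebra_def pf.place_def by auto
    moreover have "set ys \<subseteq> ?A" using lv ygen by (auto dest!: yE)
    ultimately have "pf.generated ys \<subseteq> ?A" by (rule pf.generated_minimal)
    then show "\<exists>v\<in>prod_space S UNIV. \<forall>\<phi>\<in>pf.generated ys. \<phi> v = \<theta> \<phi>" using v by blast
  next
    fix v assume v: "v \<in> prod_space S UNIV" and 0: "\<And>y. y \<in> set ys \<Longrightarrow> y v = 0"
    have "v i = 0" for i
    proof -
      have "l i b (v i) = 0" if "b \<in> B i" for b using 0[OF yI[OF that]] .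
      moreover have "v i \<in> VS S i" using v by (simp add: prod_space_def)
      ultimately show ?thesis using expand[of "v i" i] by simp
    qed
    then show "v = (\<lambda>_. 0)" by auto
  qed
qed

text \<open>If no power of \<open>g\<close> lay in the ideal of the \<open>G i\<close> on
  \<open>Z\<close>, a place killing this ideal but not \<open>g\<close> would be evaluation at a
  point of \<open>Z\<close> where all \<open>G i\<close> vanish and \<open>g\<close> does
  not.\<close>

theorem nullstellensatz:
  assumes E: "E \<subseteq> polyfun S" and Z: "Z = {v \<in> prod_space S UNIV. \<forall>\<phi>\<in>E. \<phi> v = 0}"
    and G: "finite I" "\<And>i. i \<in> I \<Longrightarrow> G i \<in> polyfun S" and g: "g \<in> polyfun S"
    and van: "\<And>v. v \<in> Z \<Longrightarrow> (\<And>i. i \<in> I \<Longrightarrow> G i v = 0) \<Longrightarrow> g v = 0"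
  shows "\<exists>n r. (\<forall>i\<in>I. r i \<in> polyfun S) \<and> (\<forall>v\<in>Z. g v ^ n = (\<Sum>i\<in>I. G i v * r i v))"
proof (rule ccontr)
  assume no: "\<not> ?thesis"
  obtain ys :: "(('m \<Rightarrow> 'v) \<Rightarrow> 'k) list" where ys: "set ys \<subseteq> polyfun S"
    and rep: "\<And>\<phi>. \<phi> \<in> polyfun S \<Longrightarrow> \<exists>\<psi>\<in>pf.generated ys. \<forall>v\<in>prod_space S UNIV. \<phi> v = \<psi> v"
    and point: "\<And>J \<theta>. pf.place J (pf.generated ys) \<theta> \<Longrightarrow> \<exists>v\<in>prod_space S UNIV. \<forall>\<phi>\<in>pf.generated ys. \<phi> v = \<theta> \<phi>"
    by (rule coordinate_functions) blast
  have gen_pf: "pf.generated ys \<subseteq> polyfun S" by (rule pf.generated_minimal[OF polyfun_subalgebra ys])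
  note gen = pf.sub_intros[OF pf.subalgebra_generated[of ys]]
  \<comment> \<open>The representation is required on \<open>Z\<close> only, so the equations in
    \<open>E\<close> belong to the ideal with zero coefficients and need not be finite in
    number.\<close>
  define J where "J = {\<phi> \<in> pf.generated ys. \<exists>r. (\<forall>i\<in>I. r i \<in> polyfun S) \<and> (\<forall>v\<in>Z. \<phi> v = (\<Sum>i\<in>I. G i v * r i v))}"
  have J: "pf.ideal_in (pf.generated ys) J"
    unfolding pf.ideal_in_def
  proof (intro conjI ballI)
    show "J \<subseteq> pf.generated ys" by (auto simp: J_def)
    show "0 \<in> J" unfolding J_def using gen(2) by (auto intro!: exI[of _ "\<lambda>_. 0"] polyfun_intros)
  next
    fix a b assume "a \<in> J" "b \<in> J"
    then obtain r s where *: "a \<in> pf.generated ys" "b \<in> pf.generated ys" "\<forall>i\<in>I. r i \<in> polyfun S" "\<forall>i\<in>I. s i \<in> polyfun S"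
      "\<forall>v\<in>Z. a v = (\<Sum>i\<in>I. G i v * r i v)" "\<forall>v\<in>Z. b v = (\<Sum>i\<in>I. G i v * s i v)" by (auto simp: J_def)
    then show "a + b \<in> J" unfolding J_def
      by (auto intro!: exI[of _ "\<lambda>i. r i + s i"] gen polyfun_intros simp: algebra_simps sum.distrib)
  next
    fix c a assume "c \<in> pf.generated ys" "a \<in> J"
    then obtain r where *: "c \<in> pf.generated ys" "a \<in> pf.generated ys" "\<forall>i\<in>I. r i \<in> polyfun S"
      "\<forall>v\<in>Z. a v = (\<Sum>i\<in>I. G i v * r i v)" by (auto simp: J_def)
    then have "c \<in> polyfun S" using gen_pf by blast
    then show "c * a \<in> J" unfolding J_def using *
      by (auto intro!: exI[of _ "\<lambda>i. c * r i"] gen polyfun_intros simp: algebra_simps sum_distrib_left)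
  qed
  obtain h where h: "h \<in> pf.generated ys" "\<forall>v\<in>prod_space S UNIV. g v = h v" using rep[OF g] by blast
  have hn: "h ^ n \<notin> J" for n
  proof
    assume "h ^ n \<in> J"
    then obtain r where r: "\<forall>i\<in>I. r i \<in> polyfun S" "\<forall>v\<in>Z. h v ^ n = (\<Sum>i\<in>I. G i v * r i v)" by (auto simp: J_def)
    have "g v = h v" if "v \<in> Z" for v using that h Z by blast
    then have "\<forall>v\<in>Z. g v ^ n = (\<Sum>i\<in>I. G i v * r i v)" using r(2) by simp
    then show False using no r(1) by blast
  qed
  obtain \<theta> where th: "pf.place J (pf.generated ys) \<theta>" "\<theta> h \<noteq> 0" using pf.place_avoiding_ideal[OF J h(1) hn] by blast
  obtain v where v: "v \<in> prod_space S UNIV" "\<forall>\<phi>\<in>pf.generated ys. \<phi> v = \<theta> \<phi>" using point[OF th(1)] by blast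
  have J0: "\<phi> v = 0" if "\<phi> \<in> J" for \<phi> using th(1) v(2) that by (auto simp: pf.place_def J_def)
  have "v \<in> Z"
  proof -
    have "\<phi> v = 0" if phi: "\<phi> \<in> E" for \<phi>
    proof -
      obtain \<psi> where psi: "\<psi> \<in> pf.generated ys" "\<forall>v\<in>prod_space S UNIV. \<phi> v = \<psi> v" using rep phi E by blast
      then have "\<psi> \<in> J" unfolding J_def using phi Z by (auto intro!: exI[of _ "\<lambda>_. 0"] polyfun_intros)
      then show ?thesis using psi v J0 by auto
    qed
    then show ?thesis using Z v by blast
  qed
  moreover have "G i v = 0" if i: "i \<in> I" for i
  proof -
    obtain \<psi> where psi: "\<psi> \<in> pf.generated ys" "\<forall>v\<in>prod_space S UNIV. G i v = \<psi> v" using rep[OF G(2)[OF i]] by blast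
    have "\<forall>v\<in>Z. \<psi> v = (\<Sum>j\<in>I. G j v * (if j = i then 1 else 0) v)"
    proof
      fix v assume "v \<in> Z"
      have "(\<Sum>j\<in>I. G j v * (if j = i then 1 else 0) v) = (\<Sum>j\<in>I. if j = i then G i v else 0)"
        by (intro sum.cong) auto
      then show "\<psi> v = (\<Sum>j\<in>I. G j v * (if j = i then 1 else 0) v)" using i G(1) psi \<open>v \<in> Z\<close> Z by auto
    qed
    moreover have "\<forall>j\<in>I. (if j = i then 1 else 0) \<in> polyfun S" using polyfun_intros by auto
    ultimately have "\<psi> \<in> J" unfolding J_def using psi(1)
      by (intro CollectI conjI exI[of _ "\<lambda>j. if j = i then 1 else 0"])
    then show ?thesis using psi v J0 by auto
  qed
  ultimately have "g v = 0" by (rule van)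
  then show False using th(2) h v by auto
qed

text \<open>At \<open>scale t v\<close> the sum is a polynomial in \<open>t\<close> whose
  coefficients are the components at \<open>v\<close>; it has infinitely many zeros.\<close>

lemma graded_components_vanish:
  fixes f :: "nat \<Rightarrow> ('m \<Rightarrow> 'v) \<Rightarrow> 'k"
  assumes Z: "\<And>t v. v \<in> Z \<Longrightarrow> scale t v \<in> Z"
    and hom: "\<And>n t v. v \<in> Z \<Longrightarrow> f n (scale t v) = t ^ n * f n v"
    and 0: "\<And>v. v \<in> Z \<Longrightarrow> (\<Sum>n\<le>N. f n v) = 0"
    and v: "v \<in> Z" and n: "n \<le> N"
  shows "f n v = 0"
proof -
  let ?p = "\<Sum>n\<le>N. monom (f n v) n"
  have "poly ?p t = 0" for t
  proof -
    have "poly ?p t = (\<Sum>n\<le>N. f n (scale t v))" by (simp add: poly_sum poly_monom hom[OF v] mult.commute)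
    then show ?thesis using 0[OF Z[OF v]] by simp
  qed
  then have "{t. poly ?p t = 0} = UNIV" by auto
  then have "?p = 0" using poly_roots_finite[of ?p] infinite_alg_closed[where 'k='k] by auto
  then have "coeff ?p n = 0" by simp
  moreover have "coeff ?p n = f n v" using n by (simp add: coeff_sum)
  ultimately show ?thesis by simp
qed

lemma hpoly_scale:
  assumes Y: "\<And>y t v. y \<in> Y \<Longrightarrow> y (scale t v) = t * y v" and "\<phi> \<in> pf.hpoly Y n"
  shows "\<phi> (scale t v) = t ^ n * \<phi> v"
  using assms(2)
proof induction
  case (mono \<alpha> c)
  have "(\<Prod>y\<in>Y. y (scale t v) ^ \<alpha> y) = (\<Prod>y\<in>Y. t ^ \<alpha> y * y v ^ \<alpha> y)"
    by (intro prod.cong) (auto simp: Y power_mult_distrib)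
  then show ?case using mono by (simp add: prod.distrib flip: power_sum)
qed (auto simp: algebra_simps)

text \<open>Graded Noether normalization: the \<open>F i\<close> have no common zero on \<open>Z\<close> except the vertex, so a
  power of every coordinate lies in the ideal of the \<open>F i\<close>; comparing degrees reduces every monomial
  with a large exponent.\<close>

theorem finite_over_parameters:
  assumes E: "E \<subseteq> polyfun S" and Z: "Z = {v \<in> prod_space S UNIV. \<forall>\<phi>\<in>E. \<phi> v = 0}"
    and cone: "\<And>t v. v \<in> Z \<Longrightarrow> scale t v \<in> Z"
    and F: "finite I" "\<And>i. i \<in> I \<Longrightarrow> F i \<in> polyfun S" "\<And>i t v. i \<in> I \<Longrightarrow> v \<in> Z \<Longrightarrow> F i (scale t v) = t ^ D * F i v" "D > 0"
    and zero: "\<And>v. v \<in> Z \<Longrightarrow> (\<And>i. i \<in> I \<Longrightarrow> F i v = 0) \<Longrightarrow> v = (\<lambda>_. 0)"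
    and B: "pf.subalgebra B" "\<And>i. i \<in> I \<Longrightarrow> F i \<in> B"
  shows "\<exists>X. finite X \<and> X \<subseteq> polyfun S \<and>
    (\<forall>\<phi>\<in>polyfun S. \<exists>\<beta>. (\<forall>x\<in>X. \<beta> x \<in> B) \<and> (\<forall>v\<in>Z. \<phi> v = (\<Sum>x\<in>X. \<beta> x v * x v)))"
proof -
  obtain ys :: "(('m \<Rightarrow> 'v) \<Rightarrow> 'k) list" where ys: "set ys \<subseteq> polyfun S"
    and lin: "\<And>y t v. y \<in> set ys \<Longrightarrow> y (scale t v) = t * y v"
    and rep: "\<And>\<phi>. \<phi> \<in> polyfun S \<Longrightarrow> \<exists>\<psi>\<in>pf.generated ys. \<forall>v\<in>prod_space S UNIV. \<phi> v = \<psi> v"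
    by (rule coordinate_functions) blast
  define Y where "Y = set ys"
  note hscale = hpoly_scale[OF lin, folded Y_def]
  have ZV: "Z \<subseteq> prod_space S UNIV" using Z by blast
  have dec: "\<exists>N f. (\<forall>n. f n \<in> pf.hpoly Y n) \<and> (\<forall>n>N. f n = 0) \<and> (\<forall>v\<in>Z. \<phi> v = (\<Sum>n\<le>N. f n v))" if phi: "\<phi> \<in> polyfun S" for \<phi>
  proof -
    obtain \<psi> where psi: "\<psi> \<in> pf.generated ys" "\<forall>v\<in>prod_space S UNIV. \<phi> v = \<psi> v" using rep[OF phi] by blast
    obtain N f where f: "\<forall>n. f n \<in> pf.hpoly Y n" "\<forall>n>N. f n = 0" "\<psi> = (\<Sum>n\<le>N. f n)" using pf.hpoly_decomposition[OF psi(1)] unfolding Y_def by blast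
    have "\<forall>v\<in>Z. \<phi> v = (\<Sum>n\<le>N. f n v)" using psi(2) ZV f(3) by auto
    then show ?thesis using f by blast
  qed
  have y0: "y (\<lambda>_. 0) = 0" if "y \<in> Y" for y
  proof -
    have "scale 0 (\<lambda>_. 0) = (\<lambda>_. 0)" by (simp add: scale_def)
    then show ?thesis using lin[of y 0 "\<lambda>_. 0"] that unfolding Y_def by simp
  qed
  have pow: "\<exists>M r. (\<forall>i\<in>I. r i \<in> polyfun S) \<and> (\<forall>v\<in>Z. y v ^ M = (\<Sum>i\<in>I. F i v * r i v))" if y: "y \<in> Y" for y
  proof (rule nullstellensatz[OF E Z F(1,2)])
    show "y \<in> polyfun S" using y ys unfolding Y_def by blast
    fix v assume "v \<in> Z" "\<And>i. i \<in> I \<Longrightarrow> F i v = 0"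
    then show "y v = 0" using zero y0[OF y] by blast
  qed
  have "\<exists>M. \<forall>y\<in>Y. \<exists>r. (\<forall>i\<in>I. r i \<in> polyfun S) \<and> (\<forall>v\<in>Z. y v ^ M = (\<Sum>i\<in>I. F i v * r i v))"
  proof -
    have "\<forall>y\<in>Y. \<exists>M r. (\<forall>i\<in>I. r i \<in> polyfun S) \<and> (\<forall>v\<in>Z. y v ^ M = (\<Sum>i\<in>I. F i v * r i v))" using pow by blast
    from bchoice[OF this] obtain m where m: "\<And>y. y \<in> Y \<Longrightarrow> \<exists>r. (\<forall>i\<in>I. r i \<in> polyfun S) \<and> (\<forall>v\<in>Z. y v ^ m y = (\<Sum>i\<in>I. F i v * r i v))"
      by blast
    let ?M = "Max (insert 0 (m ` Y))"
    have "\<exists>r. (\<forall>i\<in>I. r i \<in> polyfun S) \<and> (\<forall>v\<in>Z. y v ^ ?M = (\<Sum>i\<in>I. F i v * r i v))" if y: "y \<in> Y" for y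
    proof -
      obtain r where r: "\<forall>i\<in>I. r i \<in> polyfun S" "\<forall>v\<in>Z. y v ^ m y = (\<Sum>i\<in>I. F i v * r i v)" using m[OF y] by blast
      have "m y \<le> ?M" using y by (intro Max_ge) (auto simp: Y_def)
      then have e: "z ^ ?M = z ^ m y * z ^ (?M - m y)" for z :: 'k by (simp flip: power_add)
      have "\<forall>v\<in>Z. y v ^ ?M = (\<Sum>i\<in>I. F i v * (r i * y ^ (?M - m y)) v)"
        unfolding e using r(2) by (simp add: sum_distrib_right mult.assoc)
      moreover have "\<forall>i\<in>I. r i * y ^ (?M - m y) \<in> polyfun S" using r(1) y ys unfolding Y_def by (auto intro!: polyfun_intros)
      ultimately show ?thesis by (intro exI[of _ "\<lambda>i. r i * y ^ (?M - m y)"]) blast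
    qed
    then show ?thesis by blast
  qed
  then obtain M where M: "\<And>y. y \<in> Y \<Longrightarrow> \<exists>r. (\<forall>i\<in>I. r i \<in> polyfun S) \<and> (\<forall>v\<in>Z. y v ^ M = (\<Sum>i\<in>I. F i v * r i v))" by blast
  \<comment> \<open>Only the part of degree \<open>M\<close> on the right can contribute, so each
    \<open>r i\<close> may be replaced by its component of degree \<open>M - D\<close>. If
    \<open>M < D\<close> there is none, and the power of \<open>y\<close> vanishes on
    \<open>Z\<close>.\<close>
  have hM: "\<exists>r. (\<forall>i\<in>I. if D \<le> M then r i \<in> pf.hpoly Y (M - D) else r i = 0) \<and> (\<forall>v\<in>Z. y v ^ M = (\<Sum>i\<in>I. F i v * r i v))"
    if y: "y \<in> Y" for y
  proof -
    obtain r where r: "\<forall>i\<in>I. r i \<in> polyfun S" "\<forall>v\<in>Z. y v ^ M = (\<Sum>i\<in>I. F i v * r i v)" using M[OF y] by blast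
    have "\<forall>i\<in>I. \<exists>N f. (\<forall>n. f n \<in> pf.hpoly Y n) \<and> (\<forall>n>N. f n = 0) \<and> (\<forall>v\<in>Z. r i v = (\<Sum>n\<le>N. f n v))" using dec r(1) by blast
    from bchoice[OF this] obtain N where "\<forall>i\<in>I. \<exists>f. (\<forall>n. f n \<in> pf.hpoly Y n) \<and> (\<forall>n>N i. f n = 0) \<and> (\<forall>v\<in>Z. r i v = (\<Sum>n\<le>N i. f n v))" by blast
    from bchoice[OF this] obtain f where f: "\<And>i n. i \<in> I \<Longrightarrow> f i n \<in> pf.hpoly Y n" "\<And>i n. i \<in> I \<Longrightarrow> n > N i \<Longrightarrow> f i n = 0"
      "\<And>i v. i \<in> I \<Longrightarrow> v \<in> Z \<Longrightarrow> r i v = (\<Sum>n\<le>N i. f i n v)" by blast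
    define K where "K = Max (insert M ((\<lambda>i. N i + D) ` I))"
    have K: "M \<le> K" "\<And>i. i \<in> I \<Longrightarrow> N i + D \<le> K" unfolding K_def using F(1) by auto
    \<comment> \<open>The component of degree \<open>n\<close> of the difference of both sides of
      the relation.\<close>
    define h where "h n v = (if n = M then y v ^ M else 0) - (\<Sum>i\<in>I. if D \<le> n then F i v * f i (n - D) v else 0)" for n v
    have h_hom: "h n (scale t v) = t ^ n * h n v" if v: "v \<in> Z" for n t v
    proof -
      have "(if D \<le> n then F i (scale t v) * f i (n - D) (scale t v) else 0) = t ^ n * (if D \<le> n then F i v * f i (n - D) v else 0)" if i: "i \<in> I" for i
        using F(3)[OF i v] hscale[OF _ f(1)[OF i]] by (auto simp: mult_ac simp flip: power_add)
      moreover have "y (scale t v) = t * y v" using lin y unfolding Y_def by blast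
      ultimately show ?thesis unfolding h_def by (simp add: Y_def power_mult_distrib algebra_simps sum_distrib_left)
    qed
    have h_sum: "(\<Sum>n\<le>K. h n v) = 0" if v: "v \<in> Z" for v
    proof -
      have "(\<Sum>n\<le>K. if D \<le> n then F i v * f i (n - D) v else 0) = F i v * r i v" if i: "i \<in> I" for i
      proof -
        have "(\<Sum>n\<le>K. if D \<le> n then F i v * f i (n - D) v else 0) = (\<Sum>n\<in>{D..N i + D}. F i v * f i (n - D) v)"
          using K(2)[OF i] f(2)[OF i] by (intro sum.mono_neutral_cong_right) auto
        also have "\<dots> = (\<Sum>n\<le>N i. F i v * f i n v)"
          by (rule sum.reindex_bij_witness[of _ "\<lambda>n. n + D" "\<lambda>n. n - D"]) auto
        finally show ?thesis using f(3)[OF i v] by (simp add: sum_distrib_left)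
      qed
      then have "(\<Sum>i\<in>I. \<Sum>n\<le>K. if D \<le> n then F i v * f i (n - D) v else 0) = y v ^ M" using r(2) v by simp
      moreover have "(\<Sum>n\<le>K. \<Sum>i\<in>I. if D \<le> n then F i v * f i (n - D) v else 0) = (\<Sum>i\<in>I. \<Sum>n\<le>K. if D \<le> n then F i v * f i (n - D) v else 0)"
        by (rule sum.swap)
      ultimately show ?thesis using K(1) by (simp add: h_def sum_subtractf)
    qed
    have "h M v = 0" if "v \<in> Z" for v
      by (rule graded_components_vanish[of Z h K, OF cone h_hom h_sum that K(1)])
    then have "\<forall>v\<in>Z. y v ^ M = (\<Sum>i\<in>I. F i v * (if D \<le> M then f i (M - D) else 0) v)"
      unfolding h_def by (auto intro!: sum.cong)
    then show ?thesis using f(1) by (intro exI[of _ "\<lambda>i. if D \<le> M then f i (M - D) else 0"]) auto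
  qed
  note Bsub = pf.sub_intros[OF B(1)]
  \<comment> \<open>The generators are the monomials with all exponents below \<open>M\<close>.
    Every other monomial is rewritten by \<open>hM\<close> as a combination of the
    \<open>F i\<close> with forms of smaller degree.\<close>
  define X where "X = (\<lambda>\<alpha>. \<Prod>y\<in>Y. y ^ \<alpha> y) ` (Y \<rightarrow>\<^sub>E {..<M})"
  have finX: "finite X" unfolding X_def Y_def by (intro finite_imageI finite_PiE) auto
  have XP: "X \<subseteq> polyfun S" unfolding X_def using ys by (auto simp: Y_def intro!: polyfun_intros)
  define Span where "Span = {\<phi>. \<exists>\<beta>. (\<forall>x\<in>X. \<beta> x \<in> B) \<and> (\<forall>v\<in>Z. \<phi> v = (\<Sum>x\<in>X. \<beta> x v * x v))}"
  have Span_0: "0 \<in> Span" unfolding Span_def using Bsub(2) by (auto intro!: exI[of _ "\<lambda>_. 0"])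
  have Span_add: "\<phi> + \<psi> \<in> Span" if "\<phi> \<in> Span" "\<psi> \<in> Span" for \<phi> \<psi>
  proof -
    obtain \<beta> \<gamma> where "\<forall>x\<in>X. \<beta> x \<in> B" "\<forall>v\<in>Z. \<phi> v = (\<Sum>x\<in>X. \<beta> x v * x v)"
      "\<forall>x\<in>X. \<gamma> x \<in> B" "\<forall>v\<in>Z. \<psi> v = (\<Sum>x\<in>X. \<gamma> x v * x v)" using \<open>\<phi> \<in> Span\<close> \<open>\<psi> \<in> Span\<close> unfolding Span_def by blast
    then show ?thesis unfolding Span_def by (auto intro!: exI[of _ "\<lambda>x. \<beta> x + \<gamma> x"] Bsub(4) simp: sum.distrib algebra_simps)
  qed
  have Span_mult: "b * \<phi> \<in> Span" if "b \<in> B" "\<phi> \<in> Span" for b \<phi>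
  proof -
    obtain \<beta> where "\<forall>x\<in>X. \<beta> x \<in> B" "\<forall>v\<in>Z. \<phi> v = (\<Sum>x\<in>X. \<beta> x v * x v)" using \<open>\<phi> \<in> Span\<close> unfolding Span_def by blast
    then show ?thesis unfolding Span_def using \<open>b \<in> B\<close>
      by (auto intro!: exI[of _ "\<lambda>x. b * \<beta> x"] Bsub(5) simp: sum_distrib_left mult.assoc)
  qed
  have Span_cong: "\<phi> \<in> Span" if "\<psi> \<in> Span" "\<And>v. v \<in> Z \<Longrightarrow> \<phi> v = \<psi> v" for \<phi> \<psi>
    using that unfolding Span_def by auto
  have Span_sum: "sum f J \<in> Span" if "\<And>i. i \<in> J \<Longrightarrow> f i \<in> Span" for f :: "'j \<Rightarrow> _" and J
    using that by (induction J rule: infinite_finite_induct) (auto intro: Span_0 Span_add)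
  have Span_X: "x \<in> Span" if x: "x \<in> X" for x
  proof -
    have "\<forall>v\<in>Z. x v = (\<Sum>z\<in>X. (if z = x then 1 else 0) v * z v)"
    proof
      fix v
      have "(\<Sum>z\<in>X. (if z = x then 1 else 0) v * z v) = (\<Sum>z\<in>X. if z = x then x v else 0)" by (intro sum.cong) auto
      then show "x v = (\<Sum>z\<in>X. (if z = x then 1 else 0) v * z v)" using x finX by simp
    qed
    moreover have "\<forall>z\<in>X. (if z = x then 1 else 0) \<in> B" using Bsub by auto
    ultimately show ?thesis unfolding Span_def by (intro CollectI exI[of _ "\<lambda>z. if z = x then 1 else 0"]) blast
  qed
  have hpoly_Span: "\<phi> \<in> Span" if "\<phi> \<in> pf.hpoly Y n" for n \<phi>
    using that
  proof (induction n arbitrary: \<phi> rule: less_induct)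
    case (less n)
    from less.prems show ?case
    proof induction
      case zero
      show ?case by (rule Span_0)
    next
      case (add \<phi> \<psi>)
      then show ?case by (intro Span_add)
    next
      case (mono \<alpha> c)
      have "(\<Prod>y\<in>Y. y ^ \<alpha> y) \<in> Span"
      proof (cases "\<forall>y\<in>Y. \<alpha> y < M")
        case True
        have "(\<Prod>y\<in>Y. y ^ \<alpha> y) = (\<Prod>y\<in>Y. y ^ restrict \<alpha> Y y)" by (intro prod.cong) auto
        moreover have "restrict \<alpha> Y \<in> Y \<rightarrow>\<^sub>E {..<M}" using True by auto
        ultimately have "(\<Prod>y\<in>Y. y ^ \<alpha> y) \<in> X" unfolding X_def by (rule image_eqI)
        then show ?thesis by (rule Span_X)
      next
        case False
        then obtain y where y: "y \<in> Y" "M \<le> \<alpha> y" by force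
        obtain r where r: "\<forall>i\<in>I. if D \<le> M then r i \<in> pf.hpoly Y (M - D) else r i = 0"
          "\<forall>v\<in>Z. y v ^ M = (\<Sum>i\<in>I. F i v * r i v)" using hM[OF y(1)] by blast
        define \<alpha>' where "\<alpha>' = \<alpha>(y := \<alpha> y - M)"
        have finY: "finite Y" by (simp add: Y_def)
        note split = monomial_split(1)[where \<alpha>=\<alpha>, OF finY y, folded \<alpha>'_def] and deg = monomial_split(2)[where \<alpha>=\<alpha>, OF finY y, folded \<alpha>'_def]
        have h1: "(\<Prod>z\<in>Y. z ^ \<alpha>' z) \<in> pf.hpoly Y (n - M)"
        proof -
          have "(\<lambda>_. 1) * (\<Prod>z\<in>Y. z ^ \<alpha>' z) \<in> pf.hpoly Y (n - M)"
            by (rule pf.hpoly.mono) (use deg mono in linarith)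
          moreover have "(\<lambda>_. 1) * (\<Prod>z\<in>Y. z ^ \<alpha>' z) = (\<Prod>z\<in>Y. z ^ \<alpha>' z)" by (simp add: fun_eq_iff)
          ultimately show ?thesis by simp
        qed
        have "F i * (r i * (\<Prod>z\<in>Y. z ^ \<alpha>' z)) \<in> Span" if i: "i \<in> I" for i
        proof (cases "D \<le> M")
          case True
          then have mem: "r i * (\<Prod>z\<in>Y. z ^ \<alpha>' z) \<in> pf.hpoly Y ((M - D) + (n - M))" using r(1) i by (intro pf.hpoly_mult h1) auto
          \<comment> \<open>The degree drops by \<open>D\<close>, which is positive, so the
            induction on the degree applies.\<close>
          have lt: "(M - D) + (n - M) < n" using True F(4) deg mono by linarith
          show ?thesis by (rule Span_mult[OF B(2)[OF i] less.IH[OF lt mem]])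
        next
          case False
          then show ?thesis using r(1) i Span_0 by simp
        qed
        then have "(\<Sum>i\<in>I. F i * (r i * (\<Prod>z\<in>Y. z ^ \<alpha>' z))) \<in> Span" by (rule Span_sum)
        then show ?thesis
        proof (rule Span_cong)
          fix v assume "v \<in> Z"
          then show "(\<Prod>z\<in>Y. z ^ \<alpha> z) v = (\<Sum>i\<in>I. F i * (r i * (\<Prod>z\<in>Y. z ^ \<alpha>' z))) v"
            unfolding split using r(2) by (simp add: sum_distrib_right mult.assoc)
        qed
      qed
      then show ?case by (intro Span_mult Bsub(1))
    qed
  qed
  have "\<phi> \<in> Span" if phi: "\<phi> \<in> polyfun S" for \<phi>
  proof -
    obtain N f where f: "\<forall>n. f n \<in> pf.hpoly Y n" "\<forall>v\<in>Z. \<phi> v = (\<Sum>n\<le>N. f n v)" using dec[OF phi] by blast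
    have "(\<Sum>n\<le>N. f n) \<in> Span" using f(1) hpoly_Span by (intro Span_sum) blast
    then show ?thesis by (rule Span_cong) (use f(2) in auto)
  qed
  then show ?thesis using finX XP unfolding Span_def by blast
qed

end

section \<open>Strata, extremal functions and vanishing orders\<close>

context ambient
begin

interpretation vs: vector_space "scl S"
  using ambient by (simp add: ambient_space_def)

lemma zero_in_VS: "0 \<in> VS S i"
  using ambient unfolding ambient_space_def by (metis vs.span_zero)

lemma scl_in_VS: "x \<in> VS S i \<Longrightarrow> scl S c x \<in> VS S i"
  using ambient unfolding ambient_space_def by (metis vs.span_scale)

lemma prod_space_subset: "prod_space S I \<subseteq> prod_space S UNIV"
  using zero_in_VS unfolding prod_space_def by (smt (verit) Collect_mono_iff UNIV_I)

lemma multicone_scale: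
  assumes "v \<in> multicone S I Y" shows "(\<lambda>i. scl S (t i) (v i)) \<in> multicone S I Y"
proof -
  obtain w where w: "v \<in> prod_space S I" "w \<in> nonzero_tuples S I" "\<forall>i\<in>I. \<exists>c. v i = scl S c (w i)" "lines S I w \<in> Y"
    using assms by (auto simp: multicone_def)
  have "\<forall>i\<in>I. \<exists>c. scl S (t i) (v i) = scl S c (w i)" using w(3) vs.scale_scale by metis
  moreover have "(\<lambda>i. scl S (t i) (v i)) \<in> prod_space S I" using w(1) scl_in_VS by (auto simp: prod_space_def)
  ultimately show ?thesis using w by (auto simp: multicone_def)
qed

lemma zero_in_multicone:
  assumes "w \<in> nonzero_tuples S I" "lines S I w \<in> Y" shows "(\<lambda>_. 0) \<in> multicone S I Y"
proof -
  have "\<forall>i\<in>I. \<exists>c. 0 = scl S c (w i)" using vs.scale_zero_left by metis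
  moreover have "(\<lambda>_. 0) \<in> prod_space S I" using zero_in_VS by (simp add: prod_space_def)
  ultimately show ?thesis using assms unfolding multicone_def by blast
qed

lemma representative_in_multicone:
  assumes "w \<in> nonzero_tuples S I" "lines S I w \<in> Y" shows "w \<in> multicone S I Y"
proof -
  have "\<forall>i\<in>I. \<exists>c. w i = scl S c (w i)" using vs.scale_one by metis
  then show ?thesis using assms unfolding multicone_def nonzero_tuples_def by blast
qed

lemma multihom_scale:
  assumes "\<phi> \<in> multihom S d" "v \<in> prod_space S UNIV"
  shows "\<phi> (\<lambda>i. scl S (t i) (v i)) = (\<Prod>i\<in>UNIV. t i ^ d i) * \<phi> v"
  using assms by (auto simp: multihom_def)

text \<open>A point of \<open>Y'\<close> lifts to a point of \<open>Y\<close>. The coordinates of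
  \<open>v\<close> outside \<open>I\<close> are zero, hence multiples of whatever lines the lift
  adds there.\<close>

lemma multicone_projection:
  assumes Y: "Y' \<subseteq> (\<lambda>y. restrict y I) ` Y" and Ycl: "proj_closed S UNIV Y"
  shows "multicone S I Y' \<subseteq> multicone S UNIV Y"
proof
  fix v assume "v \<in> multicone S I Y'"
  then obtain w where w: "v \<in> prod_space S I" "w \<in> nonzero_tuples S I" "\<forall>i\<in>I. \<exists>c. v i = scl S c (w i)" "lines S I w \<in> Y'"
    by (auto simp: multicone_def)
  then obtain y where y: "y \<in> Y" "lines S I w = restrict y I" using Y by blast
  then obtain u where u: "u \<in> nonzero_tuples S UNIV" "y = lines S UNIV u" using Ycl unfolding proj_closed_def by blast
  have "\<exists>c. v i = scl S c (u i)" for i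
  proof (cases "i \<in> I")
    case True
    then have "vs.span {w i} = vs.span {u i}"
      using fun_cong[OF y(2), of i] by (simp add: lines_def u(2))
    moreover obtain c where "v i = scl S c (w i)" using w(3) True by blast
    ultimately have "v i \<in> vs.span {u i}" using vs.span_scale vs.span_base by (metis insertI1)
    then show ?thesis by (auto simp: vs.span_singleton)
  next
    case False
    then have "v i = scl S 0 (u i)" using w(1) by (simp add: prod_space_def)
    then show ?thesis by blast
  qed
  moreover have "v \<in> prod_space S UNIV" using w(1) prod_space_subset by blast
  ultimately show "v \<in> multicone S UNIV Y"
    using u y(1) unfolding multicone_def by blast
qed

text \<open>The class of \<open>\<phi>\<close> in the coordinate ring of \<open>Z\<close> is
  non-zero. With this, arguments about coordinate rings of different strata can use the same
  functions on the whole space.\<close>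

definition nz :: "('m \<Rightarrow> 'v) set \<Rightarrow> (('m \<Rightarrow> 'v) \<Rightarrow> 'k) \<Rightarrow> bool" where
  "nz Z \<phi> \<longleftrightarrow> (\<exists>v\<in>Z. \<phi> v \<noteq> 0)"

definition no_zero_divisors :: "('m \<Rightarrow> 'v) set \<Rightarrow> bool" where
  "no_zero_divisors Z \<longleftrightarrow> Z \<noteq> {} \<and> (\<forall>\<phi>\<in>polyfun S. \<forall>\<psi>\<in>polyfun S. nz Z \<phi> \<longrightarrow> nz Z \<psi> \<longrightarrow> nz Z (\<phi> * \<psi>))"

lemma coordinate_ring_simps:
  "carrier (coordinate_ring S Z) = (\<lambda>\<phi>. restrict \<phi> Z) ` polyfun S"
  "restrict \<phi> Z \<otimes>\<^bsub>coordinate_ring S Z\<^esub> restrict \<psi> Z = restrict (\<phi> * \<psi>) Z"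
  "restrict \<phi> Z \<oplus>\<^bsub>coordinate_ring S Z\<^esub> restrict \<psi> Z = restrict (\<phi> + \<psi>) Z"
  "\<one>\<^bsub>coordinate_ring S Z\<^esub> = restrict 1 Z"
  "\<zero>\<^bsub>coordinate_ring S Z\<^esub> = restrict 0 Z"
  by (auto simp: coordinate_ring_def fun_eq_iff)

lemma coordinate_ring_cring: "cring (coordinate_ring S Z)"
proof (rule cringI)
  show "abelian_group (coordinate_ring S Z)"
  proof (rule abelian_groupI)
    fix x assume "x \<in> carrier (coordinate_ring S Z)"
    then obtain \<phi> where "\<phi> \<in> polyfun S" "x = restrict \<phi> Z" by (auto simp: coordinate_ring_simps(1))
    then have "restrict (- \<phi>) Z \<in> carrier (coordinate_ring S Z)" "restrict (- \<phi>) Z \<oplus>\<^bsub>coordinate_ring S Z\<^esub> x = \<zero>\<^bsub>coordinate_ring S Z\<^esub>"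
      by (auto simp: coordinate_ring_simps intro: polyfun_intros)
    then show "\<exists>y\<in>carrier (coordinate_ring S Z). y \<oplus>\<^bsub>coordinate_ring S Z\<^esub> x = \<zero>\<^bsub>coordinate_ring S Z\<^esub>" by blast
  qed (auto simp: coordinate_ring_simps add.assoc add.commute intro!: imageI polyfun_intros)
  show "Group.comm_monoid (coordinate_ring S Z)"
    by (rule comm_monoidI) (auto simp: coordinate_ring_simps mult.assoc mult.commute intro!: imageI polyfun_intros)
qed (auto simp: coordinate_ring_simps distrib_right)

lemma restrict_eq_iff: "restrict \<phi> Z = restrict \<psi> Z \<longleftrightarrow> (\<forall>v\<in>Z. \<phi> v = \<psi> v)"
  by (metis restrict_apply' restrict_ext)

lemma nz_restrict: "restrict \<phi> Z \<noteq> \<zero>\<^bsub>coordinate_ring S Z\<^esub> \<longleftrightarrow> nz Z \<phi>"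
  by (auto simp: coordinate_ring_simps restrict_eq_iff nz_def)

lemma coordinate_ring_domain_iff: "domain (coordinate_ring S Z) \<longleftrightarrow> no_zero_divisors Z"
proof
  assume "domain (coordinate_ring S Z)"
  then interpret "domain" "coordinate_ring S Z" .
  have "nz Z 1" using one_not_zero by (simp add: coordinate_ring_simps(4) nz_restrict)
  then have "Z \<noteq> {}" by (auto simp: nz_def)
  moreover have "nz Z (\<phi> * \<psi>)" if "\<phi> \<in> polyfun S" "\<psi> \<in> polyfun S" "nz Z \<phi>" "nz Z \<psi>" for \<phi> \<psi>
    using integral[of "restrict \<phi> Z" "restrict \<psi> Z"] that
    by (auto simp: coordinate_ring_simps(1,2) simp flip: nz_restrict)
  ultimately show "no_zero_divisors Z" by (auto simp: no_zero_divisors_def)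
next
  assume nzd: "no_zero_divisors Z"
  interpret cring "coordinate_ring S Z" by (rule coordinate_ring_cring)
  show "domain (coordinate_ring S Z)"
  proof
    have "nz Z 1" using nzd by (auto simp: no_zero_divisors_def nz_def)
    then show "\<one>\<^bsub>coordinate_ring S Z\<^esub> \<noteq> \<zero>\<^bsub>coordinate_ring S Z\<^esub>" by (simp add: coordinate_ring_simps(4) nz_restrict)
    fix a b assume *: "a \<otimes>\<^bsub>coordinate_ring S Z\<^esub> b = \<zero>\<^bsub>coordinate_ring S Z\<^esub>" "a \<in> carrier (coordinate_ring S Z)" "b \<in> carrier (coordinate_ring S Z)"
    then obtain \<phi> \<psi> where "\<phi> \<in> polyfun S" "\<psi> \<in> polyfun S" "a = restrict \<phi> Z" "b = restrict \<psi> Z" by (auto simp: coordinate_ring_simps(1))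
    then show "a = \<zero>\<^bsub>coordinate_ring S Z\<^esub> \<or> b = \<zero>\<^bsub>coordinate_ring S Z\<^esub>"
      using *(1) nzd by (metis coordinate_ring_simps(2) no_zero_divisors_def nz_restrict)
  qed
qed

lemma vanishing_ideal_iff:
  assumes "W \<subseteq> Z" "\<phi> \<in> polyfun S"
  shows "restrict \<phi> Z \<in> vanishing_ideal S Z W \<longleftrightarrow> \<not> nz W \<phi>"
  using assms by (auto simp: vanishing_ideal_def coordinate_ring_simps(1) nz_def)

lemma vanishing_ideal_prime:
  assumes W: "W \<subseteq> Z" and nzd: "no_zero_divisors W"
  shows "primeideal (vanishing_ideal S Z W) (coordinate_ring S Z)"
proof -
  let ?R = "coordinate_ring S Z" and ?P = "vanishing_ideal S Z W"
  interpret cring ?R by (rule coordinate_ring_cring)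
  have mem: "\<exists>\<phi>\<in>polyfun S. x = restrict \<phi> Z \<and> \<not> nz W \<phi>" if "x \<in> ?P" for x
    using that vanishing_ideal_iff[OF W] by (auto simp: vanishing_ideal_def coordinate_ring_simps(1))
  have 0: "ideal ?P ?R"
  proof (rule idealI)
    show "ring ?R" ..
    show "subgroup ?P (add_monoid ?R)"
    proof (rule add.subgroupI)
      show "?P \<subseteq> carrier ?R" by (auto simp: vanishing_ideal_def)
      have "restrict 0 Z \<in> ?P" using vanishing_ideal_iff[OF W, of 0] polyfun_intros(2) by (simp add: nz_def)
      then show "?P \<noteq> {}" by blast
      fix a assume "a \<in> ?P"
      then obtain \<phi> where phi: "\<phi> \<in> polyfun S" "a = restrict \<phi> Z" "\<not> nz W \<phi>" using mem by blast
      have "\<ominus>\<^bsub>?R\<^esub> a = restrict (- \<phi>) Z"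
        by (rule minus_equality) (auto simp: phi coordinate_ring_simps intro!: imageI polyfun_intros)
      then show "\<ominus>\<^bsub>?R\<^esub> a \<in> ?P" using vanishing_ideal_iff[OF W polyfun_intros(6)[OF phi(1)]] phi(3) by (simp add: nz_def)
      fix b assume "b \<in> ?P"
      then obtain \<psi> where psi: "\<psi> \<in> polyfun S" "b = restrict \<psi> Z" "\<not> nz W \<psi>" using mem by blast
      show "a \<oplus>\<^bsub>?R\<^esub> b \<in> ?P"
        using vanishing_ideal_iff[OF W polyfun_intros(4)[OF phi(1) psi(1)]] phi psi by (simp add: nz_def coordinate_ring_simps(3))
    qed
    fix a x assume "a \<in> ?P" "x \<in> carrier ?R"
    then obtain \<phi> \<psi> where *: "\<phi> \<in> polyfun S" "a = restrict \<phi> Z" "\<not> nz W \<phi>" "\<psi> \<in> polyfun S" "x = restrict \<psi> Z"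
      using mem[OF \<open>a \<in> ?P\<close>] unfolding coordinate_ring_simps(1) by blast
    show "x \<otimes>\<^bsub>?R\<^esub> a \<in> ?P"
      using vanishing_ideal_iff[OF W polyfun_intros(5)[OF *(4,1)]] * by (simp add: nz_def coordinate_ring_simps(2))
    show "a \<otimes>\<^bsub>?R\<^esub> x \<in> ?P"
      using vanishing_ideal_iff[OF W polyfun_intros(5)[OF *(1,4)]] * by (simp add: nz_def coordinate_ring_simps(2))
  qed
  show ?thesis
  proof (rule primeidealI[OF 0])
    show "cring ?R" ..
    have "nz W 1" using nzd by (auto simp: no_zero_divisors_def nz_def)
    then have "\<one>\<^bsub>?R\<^esub> \<notin> ?P" using vanishing_ideal_iff[OF W polyfun_intros(3)] by (simp add: coordinate_ring_simps(4))
    then show "carrier ?R \<noteq> ?P" by auto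
    fix a b assume *: "a \<in> carrier ?R" "b \<in> carrier ?R" "a \<otimes>\<^bsub>?R\<^esub> b \<in> ?P"
    then obtain \<phi> \<psi> where **: "\<phi> \<in> polyfun S" "a = restrict \<phi> Z" "\<psi> \<in> polyfun S" "b = restrict \<psi> Z"
      by (auto simp: coordinate_ring_simps(1))
    then have "\<not> nz W (\<phi> * \<psi>)" using *(3) vanishing_ideal_iff[OF W polyfun_intros(5)] by (simp add: coordinate_ring_simps(2))
    then have "\<not> nz W \<phi> \<or> \<not> nz W \<psi>" using nzd ** by (auto simp: no_zero_divisors_def)
    then show "a \<in> ?P \<or> b \<in> ?P" using vanishing_ideal_iff[OF W] ** by auto
  qed
qed

definition frac :: "('m \<Rightarrow> 'v) set \<Rightarrow> (('m \<Rightarrow> 'v) \<Rightarrow> 'k) \<Rightarrow> (('m \<Rightarrow> 'v) \<Rightarrow> 'k) \<Rightarrow> _" where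
  "frac Z \<phi> \<psi> = fraction (coordinate_ring S Z) (restrict \<phi> Z) (restrict \<psi> Z)"

lemma carrier_nz: "\<phi> \<in> polyfun S \<Longrightarrow> nz Z \<phi> \<Longrightarrow> restrict \<phi> Z \<in> carrier (coordinate_ring S Z) - {\<zero>\<^bsub>coordinate_ring S Z\<^esub>}"
  using nz_restrict by (auto simp: coordinate_ring_simps(1))

lemma carrier_restrict: "\<phi> \<in> polyfun S \<Longrightarrow> restrict \<phi> Z \<in> carrier (coordinate_ring S Z)"
  by (simp add: coordinate_ring_simps(1))

lemma frac_eq_iff:
  assumes "no_zero_divisors Z" "\<phi> \<in> polyfun S" "\<psi> \<in> polyfun S" "nz Z \<psi>" "\<phi>' \<in> polyfun S" "\<psi>' \<in> polyfun S" "nz Z \<psi>'"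
  shows "frac Z \<phi> \<psi> = frac Z \<phi>' \<psi>' \<longleftrightarrow> (\<forall>v\<in>Z. \<phi> v * \<psi>' v = \<phi>' v * \<psi> v)"
proof -
  interpret "domain" "coordinate_ring S Z" using assms(1) coordinate_ring_domain_iff by blast
  show ?thesis unfolding frac_def
    by (subst fraction_eq_iff) (use assms in \<open>auto simp: carrier_restrict nz_restrict coordinate_ring_simps(2) restrict_eq_iff\<close>)
qed

lemma restrict_nat_pow:
  "restrict \<phi> Z [^]\<^bsub>coordinate_ring S Z\<^esub> (n::nat) = restrict (\<phi> ^ n) Z"
proof -
  interpret cring "coordinate_ring S Z" by (rule coordinate_ring_cring)
  show ?thesis
    by (induction n) (simp_all only: nat_pow_0 nat_pow_Suc power_0 power_Suc2 coordinate_ring_simps(2,4))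
qed

lemma frac_power_quotient:
  assumes Z: "no_zero_divisors Z" and a: "\<phi> \<in> polyfun S" "\<psi> \<in> polyfun S" "nz Z \<phi>" "nz Z \<psi>"
    and f: "f \<in> polyfun S" "nz Z f"
  shows "frac Z \<phi> \<psi> [^]\<^bsub>fraction_field (coordinate_ring S Z)\<^esub> int n \<otimes>\<^bsub>fraction_field (coordinate_ring S Z)\<^esub>
     inv\<^bsub>fraction_field (coordinate_ring S Z)\<^esub> (frac Z f 1 [^]\<^bsub>fraction_field (coordinate_ring S Z)\<^esub> int k) =
     frac Z (\<phi> ^ n) (\<psi> ^ n * f ^ k)"
proof -
  interpret "domain" "coordinate_ring S Z" using Z coordinate_ring_domain_iff by blast
  have 1: "nz Z 1" using Z by (auto simp: no_zero_divisors_def nz_def)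
  have P: "\<phi> ^ n \<in> polyfun S" "\<psi> ^ n \<in> polyfun S" "f ^ k \<in> polyfun S" for n k using a f polyfun_intros(8) by auto
  note c = carrier_nz[OF a(1,3)] carrier_nz[OF a(2,4)] carrier_nz[OF f] carrier_nz[OF polyfun_intros(3) 1]
  note c' = c[THEN nonzero_pow, unfolded restrict_nat_pow]
  have "frac Z \<phi> \<psi> [^]\<^bsub>fraction_field (coordinate_ring S Z)\<^esub> int n = frac Z (\<phi> ^ n) (\<psi> ^ n)"
    unfolding frac_def fraction_int_pow[OF c(1,2)] by (simp add: restrict_nat_pow)
  moreover have "frac Z f 1 [^]\<^bsub>fraction_field (coordinate_ring S Z)\<^esub> int k = frac Z (f ^ k) (1 ^ k)"
    unfolding frac_def fraction_int_pow[OF c(3,4)] by (simp add: restrict_nat_pow del: power_one)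
  moreover have "inv\<^bsub>fraction_field (coordinate_ring S Z)\<^esub> (frac Z (f ^ k) (1 ^ k)) = frac Z (1 ^ k) (f ^ k)"
    unfolding frac_def by (rule fraction_inverse[OF c'(3,4)])
  moreover have "frac Z (\<phi> ^ n) (\<psi> ^ n) \<otimes>\<^bsub>fraction_field (coordinate_ring S Z)\<^esub> frac Z (1 ^ k) (f ^ k) = frac Z (\<phi> ^ n * 1 ^ k) (\<psi> ^ n * f ^ k)"
    unfolding frac_def coordinate_ring_simps(2)[symmetric]
    by (rule fraction_mult[OF carrier_restrict[OF P(1)] c'(2) _ c'(3)]) (use c'(4) in auto)
  ultimately show ?thesis by simp
qed

text \<open>Any two representatives with denominators not vanishing on \<open>W\<close>
  cross-multiply on \<open>Z\<close>, hence on \<open>W\<close>, so the union consists of copies of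
  one fraction; the given representative shows that it is not empty.\<close>

lemma restrict_rational_frac:
  assumes Z: "no_zero_divisors Z" and W: "no_zero_divisors W" "W \<subseteq> Z"
    and a: "\<phi> \<in> polyfun S" "\<psi> \<in> polyfun S" "nz W \<psi>"
  shows "restrict_rational S Z W (frac Z \<phi> \<psi>) = frac W \<phi> \<psi>"
proof -
  interpret W: "domain" "coordinate_ring S W" using W coordinate_ring_domain_iff by blast
  have nzZ: "nz Z \<psi>" using a W by (auto simp: nz_def)
  let ?F = "{(a, b) \<in> frac Z \<phi> \<psi>. b \<notin> vanishing_ideal S Z W}"
  have "fraction (coordinate_ring S W) (restrict x W) (restrict y W) = frac W \<phi> \<psi>" if "(x, y) \<in> ?F" for x y
  proof -
    have xy: "x \<in> carrier (coordinate_ring S Z)" "y \<in> carrier (coordinate_ring S Z)" "y \<notin> vanishing_ideal S Z W"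
      "x \<otimes>\<^bsub>coordinate_ring S Z\<^esub> restrict \<psi> Z = restrict \<phi> Z \<otimes>\<^bsub>coordinate_ring S Z\<^esub> y"
      using that by (auto simp: frac_def mem_fraction)
    then obtain \<xi> \<eta> where *: "\<xi> \<in> polyfun S" "x = restrict \<xi> Z" "\<eta> \<in> polyfun S" "y = restrict \<eta> Z"
      by (auto simp: coordinate_ring_simps(1))
    have "nz W \<eta>" using xy(3) vanishing_ideal_iff[OF W(2) *(3)] * by auto
    moreover have "\<forall>v\<in>Z. \<xi> v * \<psi> v = \<phi> v * \<eta> v" using xy(4) unfolding * coordinate_ring_simps(2) restrict_eq_iff by simp
    ultimately have "frac W \<xi> \<eta> = frac W \<phi> \<psi>" using frac_eq_iff[OF W(1) *(1,3) _ a] W(2) by blast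
    moreover have "restrict (restrict \<xi> Z) W = restrict \<xi> W" "restrict (restrict \<eta> Z) W = restrict \<eta> W"
      using W(2) by (auto simp: Int_absorb1)
    ultimately show ?thesis by (simp add: * frac_def)
  qed
  then have "restrict_rational S Z W (frac Z \<phi> \<psi>) = (\<Union>(a, b)\<in>?F. frac W \<phi> \<psi>)"
    unfolding restrict_rational_def by (intro SUP_cong refl) auto
  moreover have "(restrict \<phi> Z, restrict \<psi> Z) \<in> ?F"
    using a vanishing_ideal_iff[OF W(2) a(2)] nzZ nz_restrict by (auto simp: frac_def mem_fraction carrier_restrict)
  ultimately show ?thesis by auto
qed

end

section \<open>Geometry of the strata\<close>

locale seshadri =
  fixes S :: "('k::alg_closed_field, 'v::ab_group_add, 'm::finite, 'a::finite) stratification"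
  assumes strat: "seshadri_stratification S" and div: "has_divisorial_valuations S"

sublocale seshadri \<subseteq> ambient S
  using strat by unfold_locales (simp add: seshadri_stratification_def)

context seshadri
begin

interpretation vs: vector_space "scl S"
  using ambient by (simp add: ambient_space_def)

abbreviation Z :: "'a option \<Rightarrow> ('m \<Rightarrow> 'v) set" where "Z \<equiv> cone_of S"

lemma strat_facts:
  shows var_closed: "proj_closed S UNIV (var S)"
    and idx_nonempty: "idx S p \<noteq> {}"
    and stratum_irreducible: "irreducible_closed (proj_closed S (idx S p)) (stratum S p)"
    and stratum_projection: "stratum S p \<subseteq> (\<lambda>y. restrict y (idx S p)) ` var S"
    and extr_hom: "\<exists>d. extr S p \<in> hom_component S d \<and> (\<forall>j. j \<notin> idx S p \<longrightarrow> d j = 0)"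
    and extr_nonconstant: "\<not> (\<exists>c. \<forall>v\<in>var_cone S. extr S p v = c)"
    and cone_inj_Some: "inj (\<lambda>p. Z (Some p))"
    and maximum_exists: "\<exists>p. idx S p = UNIV \<and> stratum S p = var S"
    and cover_codimension: "covers S (Some p) (Some q) \<Longrightarrow> codimension (affine_closed S) (Z (Some q)) (Z (Some p)) = 1"
    and extr_vanishes: "\<not> Z (Some q) \<subseteq> Z (Some p) \<Longrightarrow> v \<in> Z (Some p) \<Longrightarrow> extr S q v = 0"
    and extr_zero_set: "{v \<in> var_cone S. extr S p v = 0} \<inter> Z (Some p) =
          {\<lambda>_. 0} \<union> (\<Union>q\<in>{q. covers S (Some p) (Some q)}. Z (Some q))"
proof -
  note s = strat[unfolded seshadri_stratification_def, THEN conjunct2]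
  show "proj_closed S UNIV (var S)" by (rule s[THEN conjunct1])
  note s = s[THEN conjunct2]
  note p = s[THEN conjunct1, rule_format, of p]
  show "idx S p \<noteq> {}" by (rule p[THEN conjunct1])
  note p = p[THEN conjunct2]
  show "irreducible_closed (proj_closed S (idx S p)) (stratum S p)" by (rule p[THEN conjunct1])
  show "stratum S p \<subseteq> (\<lambda>y. restrict y (idx S p)) ` var S" by (rule p[THEN conjunct2, THEN conjunct1])
  note s = s[THEN conjunct2]
  note p = s[THEN conjunct1, rule_format, of p]
  show "\<exists>d. extr S p \<in> hom_component S d \<and> (\<forall>j. j \<notin> idx S p \<longrightarrow> d j = 0)" by (rule p[THEN conjunct1])
  show "\<not> (\<exists>c. \<forall>v\<in>var_cone S. extr S p v = c)" by (rule p[THEN conjunct2])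
  note s = s[THEN conjunct2]
  show "inj (\<lambda>p. Z (Some p))" by (rule s[THEN conjunct1])
  note s = s[THEN conjunct2]
  show "\<exists>p. idx S p = UNIV \<and> stratum S p = var S" by (rule s[THEN conjunct1])
  note s = s[THEN conjunct2]
  show "covers S (Some p) (Some q) \<Longrightarrow> codimension (affine_closed S) (Z (Some q)) (Z (Some p)) = 1"
    by (rule s[THEN conjunct1, rule_format])
  note s = s[THEN conjunct2]
  show "\<not> Z (Some q) \<subseteq> Z (Some p) \<Longrightarrow> v \<in> Z (Some p) \<Longrightarrow> extr S q v = 0"
    by (rule s[THEN conjunct1, rule_format])
  show "{v \<in> var_cone S. extr S p v = 0} \<inter> Z (Some p) =
          {\<lambda>_. 0} \<union> (\<Union>q\<in>{q. covers S (Some p) (Some q)}. Z (Some q))"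
    by (rule s[THEN conjunct2, rule_format])
qed

lemma cone_Some: "Z (Some p) = multicone S (idx S p) (stratum S p)"
  and cone_None: "Z None = {\<lambda>_. 0}"
  by (simp_all add: cone_of_def)

lemma stratum_representative: "\<exists>w\<in>nonzero_tuples S (idx S p). lines S (idx S p) w \<in> stratum S p"
proof -
  have pc: "proj_closed S (idx S p) (stratum S p)" and ne: "stratum S p \<noteq> {}"
    using stratum_irreducible[of p] unfolding irreducible_closed_def by simp_all
  from pc obtain E where "E \<subseteq> (\<Union>d. multihom S d) \<and> stratum S p = lines S (idx S p) ` {w \<in> nonzero_tuples S (idx S p). \<forall>\<phi>\<in>E. \<phi> w = 0}"
    unfolding proj_closed_def ..
  then show ?thesis using ne by auto
qed

lemma zero_in_cone: "(\<lambda>_. 0) \<in> Z x"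
proof (cases x)
  case (Some p)
  obtain w where "w \<in> nonzero_tuples S (idx S p)" "lines S (idx S p) w \<in> stratum S p" using stratum_representative by blast
  then show ?thesis unfolding Some cone_Some by (rule zero_in_multicone)
qed (simp add: cone_None)

lemma cone_nonzero: "\<exists>v\<in>Z (Some p). v \<noteq> (\<lambda>_. 0)"
proof -
  obtain w where w: "w \<in> nonzero_tuples S (idx S p)" "lines S (idx S p) w \<in> stratum S p"
    using stratum_representative by blast
  then have "w \<noteq> (\<lambda>_. 0)" using idx_nonempty[of p] by (auto simp: nonzero_tuples_def)
  then show ?thesis using representative_in_multicone[OF w] cone_Some by blast
qed

lemma cone_scale: "v \<in> Z x \<Longrightarrow> (\<lambda>i. scl S (t i) (v i)) \<in> Z x"
  using multicone_scale by (cases x) (auto simp: cone_None cone_Some)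

lemma cone_scale': "v \<in> Z x \<Longrightarrow> scale t v \<in> Z x"
  unfolding scale_def by (rule cone_scale)

lemma var_cone_subset: "var_cone S \<subseteq> prod_space S UNIV"
  by (auto simp: var_cone_def multicone_def)

lemma cone_subset_var_cone: "Z x \<subseteq> var_cone S"
proof (cases x)
  case (Some p)
  then show ?thesis using multicone_projection[OF stratum_projection[of p] var_closed] by (simp add: cone_Some var_cone_def)
next
  case None
  obtain p where "idx S p = UNIV" "stratum S p = var S" using maximum_exists by blast
  then have "Z (Some p) = var_cone S" by (simp add: cone_Some var_cone_def)
  then show ?thesis using zero_in_cone[of "Some p"] None cone_None by auto
qed

lemma cone_subset: "Z x \<subseteq> prod_space S UNIV"
  by (rule order_trans[OF cone_subset_var_cone var_cone_subset])

definition top_elem :: 'a where "top_elem = (SOME p. Z (Some p) = var_cone S)"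

lemma cone_top: "Z (Some top_elem) = var_cone S"
proof -
  obtain p where "idx S p = UNIV" "stratum S p = var S" using maximum_exists by blast
  then have "Z (Some p) = var_cone S" by (simp add: cone_Some var_cone_def)
  then show ?thesis unfolding top_elem_def by (rule someI[where P="\<lambda>p. Z (Some p) = var_cone S"])
qed

lemma None_less: "Z None \<subset> Z (Some p)"
  using zero_in_cone cone_nonzero[of p] by (auto simp: cone_None)

lemma cone_inj: "Z x = Z y \<Longrightarrow> x = y"
proof -
  assume eq: "Z x = Z y"
  have "Z (Some p) \<noteq> Z None" for p using None_less[of p] by simp
  then show "x = y" using eq cone_inj_Some by (cases x; cases y) (auto simp: inj_def)
qed

lemma cover_below:
  assumes "Z y \<subset> Z x" shows "\<exists>q. covers S x q \<and> Z y \<subseteq> Z q"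
proof -
  let ?A = "Z ` {q. Z y \<subseteq> Z q \<and> Z q \<subset> Z x}"
  have fin: "finite ?A" and ne: "?A \<noteq> {}" using assms by auto
  from finite_has_maximal[OF fin ne] obtain M where M: "M \<in> ?A" "\<forall>b\<in>?A. M \<subseteq> b \<longrightarrow> M = b" by (rule bexE)
  from M(1) obtain q where q: "M = Z q" "Z y \<subseteq> Z q" "Z q \<subset> Z x" by auto
  have "covers S x q"
    unfolding covers_def
  proof (intro conjI notI)
    assume "\<exists>r. Z q \<subset> Z r \<and> Z r \<subset> Z x"
    then obtain r where r: "Z q \<subset> Z r" "Z r \<subset> Z x" by blast
    then have "Z r \<in> ?A" using q by blast
    then show False using M(2) r q by blast
  qed (use q in blast)
  then show ?thesis using q by blast
qed

lemma cover_above: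
  assumes "Z y \<subset> Z x" shows "\<exists>q. covers S q y"
proof -
  let ?A = "Z ` {q. Z y \<subset> Z q}"
  have fin: "finite ?A" and ne: "?A \<noteq> {}" using assms by auto
  from finite_has_minimal[OF fin ne] obtain M where M: "M \<in> ?A" "\<forall>b\<in>?A. b \<subseteq> M \<longrightarrow> M = b" by (rule bexE)
  from M(1) obtain q where q: "M = Z q" "Z y \<subset> Z q" by auto
  have "covers S q y"
    unfolding covers_def
  proof (intro conjI notI)
    assume "\<exists>r. Z y \<subset> Z r \<and> Z r \<subset> Z q"
    then obtain r where r: "Z y \<subset> Z r" "Z r \<subset> Z q" by blast
    then have "Z r \<in> ?A" by blast
    then show False using M(2) r q by blast
  qed (use q in blast)
  then show ?thesis by blast
qed

lemma covers_less: "covers S x y \<Longrightarrow> Z y \<subset> Z x"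
  by (simp add: covers_def)

lemma cover_exists: "\<exists>q. covers S (Some p) q"
  using cover_below[OF None_less] by blast

text \<open>Irreducibility of a cone is read off at any divisor below it: a ring whose localization
  is a domain has no zero divisors itself, by \<open>domain_of_localization_domain\<close>.\<close>

lemma nzd: "no_zero_divisors (Z x)"
proof (cases x)
  case None
  then show ?thesis by (auto simp: no_zero_divisors_def nz_def cone_None)
next
  case (Some p)
  obtain q where q: "covers S (Some p) q" using cover_exists by blast
  let ?R = "coordinate_ring S (Z (Some p))" and ?P = "vanishing_ideal S (Z (Some p)) (Z q)"
  have sub: "Z q \<subseteq> Z (Some p)" using covers_less[OF q] by blast
  interpret cring ?R by (rule coordinate_ring_cring)
  have "discrete_valuation_ring (localization ?R ?P)" using div q by (simp add: has_divisorial_valuations_def)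
  then have L: "domain (localization ?R ?P)" by (simp add: discrete_valuation_ring_def)
  have "\<zero>\<^bsub>?R\<^esub> \<in> ?P"
    unfolding coordinate_ring_simps(5) using vanishing_ideal_iff[OF sub polyfun_intros(2)] by (simp add: nz_def)
  moreover have "nz (Z q) 1" using zero_in_cone by (auto simp: nz_def)
  then have "\<one>\<^bsub>?R\<^esub> \<notin> ?P"
    unfolding coordinate_ring_simps(4) using vanishing_ideal_iff[OF sub polyfun_intros(3)] by simp
  ultimately have "domain ?R" by (rule domain_of_localization_domain[OF _ _ L])
  then show ?thesis using Some coordinate_ring_domain_iff by blast
qed

lemma nz_mult: "\<phi> \<in> polyfun S \<Longrightarrow> \<psi> \<in> polyfun S \<Longrightarrow> nz (Z x) \<phi> \<Longrightarrow> nz (Z x) \<psi> \<Longrightarrow> nz (Z x) (\<phi> * \<psi>)"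
  using nzd by (auto simp: no_zero_divisors_def)

lemma nz_one: "nz (Z x) 1"
  using zero_in_cone by (auto simp: nz_def)

lemma nz_power: "\<phi> \<in> polyfun S \<Longrightarrow> nz (Z x) \<phi> \<Longrightarrow> nz (Z x) (\<phi> ^ n)"
  by (induction n) (auto intro: nz_mult nz_one polyfun_intros)

lemma nz_prod: "(\<And>i. i \<in> I \<Longrightarrow> f i \<in> polyfun S \<and> nz (Z x) (f i)) \<Longrightarrow> nz (Z x) (prod f I)"
  by (induction I rule: infinite_finite_induct) (auto intro: nz_mult nz_one polyfun_intros)

lemma nz_mono: "Z x \<subseteq> Z y \<Longrightarrow> nz (Z x) \<phi> \<Longrightarrow> nz (Z y) \<phi>"
  by (auto simp: nz_def)

lemma cancel:
  assumes "\<phi> \<in> polyfun S" "\<psi> \<in> polyfun S" "\<omega> \<in> polyfun S" "nz (Z x) \<omega>" "\<forall>v\<in>Z x. \<omega> v * \<phi> v = \<omega> v * \<psi> v"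
  shows "\<forall>v\<in>Z x. \<phi> v = \<psi> v"
proof (rule ccontr)
  assume "\<not> ?thesis"
  then have "nz (Z x) (\<phi> - \<psi>)" by (auto simp: nz_def)
  then have "nz (Z x) (\<omega> * (\<phi> - \<psi>))" using assms by (intro nz_mult polyfun_intros)
  then show False using assms(5) by (auto simp: nz_def algebra_simps)
qed

definition deg :: "'a \<Rightarrow> 'm \<Rightarrow> nat" where
  "deg p = (SOME d. extr S p \<in> hom_component S d \<and> (\<forall>j. j \<notin> idx S p \<longrightarrow> d j = 0))"

text \<open>\<open>extr S p\<close> is extensional on the cone of \<open>X\<close>. A
  multihomogeneous function on the whole space that extends it can be multiplied and restricted
  freely.\<close>

definition f :: "'a \<Rightarrow> ('m \<Rightarrow> 'v) \<Rightarrow> 'k" where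
  "f p = (SOME \<phi>. \<phi> \<in> multihom S (deg p) \<and> extr S p = restrict \<phi> (var_cone S))"

lemma f_hom: "f p \<in> multihom S (deg p)" and extr_eq: "extr S p = restrict (f p) (var_cone S)"
proof -
  have "extr S p \<in> hom_component S (deg p)" unfolding deg_def using someI_ex[OF extr_hom] by blast
  then have "\<exists>\<phi>. \<phi> \<in> multihom S (deg p) \<and> extr S p = restrict \<phi> (var_cone S)" by (auto simp: hom_component_def)
  from someI_ex[OF this] show "f p \<in> multihom S (deg p)" "extr S p = restrict (f p) (var_cone S)"
    unfolding f_def by auto
qed

lemma f_poly: "f p \<in> polyfun S"
  using f_hom by (auto simp: multihom_def)

lemma f_extr: "v \<in> var_cone S \<Longrightarrow> extr S p v = f p v"
  by (simp add: extr_eq)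

lemma f_scale: "v \<in> Z x \<Longrightarrow> f p (\<lambda>i. scl S (t i) (v i)) = (\<Prod>i\<in>UNIV. t i ^ deg p i) * f p v"
  using multihom_scale[OF f_hom] cone_subset by blast

text \<open>In degree zero, scaling all coordinates by 0 would not change the value, so the function
  would be constant.\<close>

lemma deg_nonzero: "deg p \<noteq> (\<lambda>_. 0)"
proof
  assume 0: "deg p = (\<lambda>_. 0)"
  have "f p v = f p (\<lambda>_. 0)" if "v \<in> var_cone S" for v
    using f_scale[of v "Some top_elem" p "\<lambda>_. 0"] that by (simp add: 0 cone_top)
  then have "\<forall>v\<in>var_cone S. extr S p v = f p (\<lambda>_. 0)" by (simp add: f_extr)
  then show False using extr_nonconstant[of p] by blast
qed

lemma f_zero: "f p (\<lambda>_. 0) = 0"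
proof -
  obtain i where "deg p i \<noteq> 0" using deg_nonzero[of p] by (auto simp: fun_eq_iff)
  then have 0: "(\<Prod>i\<in>UNIV. (0::'k) ^ deg p i) = 0" by (intro prod_zero) auto
  have "f p (\<lambda>i. scl S 0 0) = (\<Prod>i\<in>UNIV. 0 ^ deg p i) * f p (\<lambda>_. 0)"
    by (rule f_scale[of _ None]) (simp add: cone_None)
  then show ?thesis unfolding 0 by simp
qed

lemma f_vanishes: "\<not> Z (Some q) \<subseteq> Z x \<Longrightarrow> v \<in> Z x \<Longrightarrow> f q v = 0"
proof (cases x)
  case (Some p)
  assume "\<not> Z (Some q) \<subseteq> Z x" "v \<in> Z x"
  then show ?thesis using extr_vanishes[of q p v] f_extr[of v q] cone_subset_var_cone[of x] Some by auto
next
  case None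
  assume "v \<in> Z x"
  then show ?thesis using None f_zero by (simp add: cone_None)
qed

text \<open>Condition (S3) with the vertex regarded as the cone of \<open>None\<close>: every
  stratum covers something, and every cone contains the vertex, so the separate vertex is absorbed
  by the union.\<close>

lemma f_zero_set: "{v \<in> Z (Some p). f p v = 0} = (\<Union>q\<in>{q. covers S (Some p) q}. Z q)"
proof -
  have "{v \<in> Z (Some p). f p v = 0} = {v \<in> var_cone S. extr S p v = 0} \<inter> Z (Some p)"
    using cone_subset_var_cone[of "Some p"] by (auto simp: f_extr)
  also note extr_zero_set
  also have "{\<lambda>_. 0} \<union> (\<Union>q\<in>{q. covers S (Some p) (Some q)}. Z (Some q)) = (\<Union>q\<in>{q. covers S (Some p) q}. Z q)"
  proof
    show "{\<lambda>_. 0} \<union> (\<Union>q\<in>{q. covers S (Some p) (Some q)}. Z (Some q)) \<subseteq> (\<Union>q\<in>{q. covers S (Some p) q}. Z q)"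
      using cover_exists[of p] zero_in_cone by auto
    show "(\<Union>q\<in>{q. covers S (Some p) q}. Z q) \<subseteq> {\<lambda>_. 0} \<union> (\<Union>q\<in>{q. covers S (Some p) (Some q)}. Z (Some q))"
    proof
      fix v assume "v \<in> (\<Union>q\<in>{q. covers S (Some p) q}. Z q)"
      then obtain q where "covers S (Some p) q" "v \<in> Z q" by blast
      then show "v \<in> {\<lambda>_. 0} \<union> (\<Union>q\<in>{q. covers S (Some p) (Some q)}. Z (Some q))"
        by (cases q) (auto simp: cone_None)
    qed
  qed
  finally show ?thesis .
qed

lemma closed_of_codimension:
  assumes "codimension (affine_closed S) W Y = 1"
  shows "affine_closed S W \<and> affine_closed S Y"
proof -
  have "{enat n | n U. irreducible_chain (affine_closed S) n U \<and> U 0 = W \<and> U n = Y} \<noteq> {}"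
  proof
    assume "{enat n | n U. irreducible_chain (affine_closed S) n U \<and> U 0 = W \<and> U n = Y} = {}"
    then have "codimension (affine_closed S) W Y = Sup {}" unfolding codimension_def by (rule arg_cong)
    then show False using assms by (simp add: bot_enat_def)
  qed
  then show ?thesis by (auto simp: irreducible_chain_def irreducible_closed_def)
qed

text \<open>The strata occurring in a covering relation are closed by (S1). If the poset is a single
  point, the extremal function has no zero on the cone except the vertex, which forces \<open>m = 1\<close>,
  and there the multicone is cut out by the equations of \<open>X\<close>.\<close>

lemma cone_closed_single:
  assumes single: "\<And>p. p = top_elem"
  shows "affine_closed S (var_cone S)"
proof -
  obtain p where p: "idx S p = UNIV" "stratum S p = var S" using maximum_exists by blast
  moreover have "p = top_elem" by (rule single)
  ultimately have top: "idx S top_elem = UNIV" "stratum S top_elem = var S" by simp_all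
  have no_cover: "\<not> covers S (Some top_elem) (Some q)" for q
    using single[of q] covers_less[of "Some top_elem" "Some q"] by auto
  have fz: "v = (\<lambda>_. 0)" if v: "v \<in> var_cone S" "f top_elem v = 0" for v
  proof -
    have "v \<in> (\<Union>q\<in>{q. covers S (Some top_elem) q}. Z q)" using v by (simp add: cone_top flip: f_zero_set)
    then obtain q where q: "covers S (Some top_elem) q" "v \<in> Z q" by blast
    then show ?thesis using no_cover by (cases q) (auto simp: cone_None)
  qed
  obtain w where w: "w \<in> nonzero_tuples S UNIV" "lines S UNIV w \<in> var S" using stratum_representative[of top_elem] top by auto
  have wc: "w \<in> var_cone S" unfolding var_cone_def by (rule representative_in_multicone[OF w])
  \<comment> \<open>If there were two factors, choose one in which the degree of the extremal
    function is positive and set that coordinate of \<open>w\<close> to zero. The function vanishes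
    there, although another coordinate is non-zero, so the point is not the vertex.\<close>
  have one: "i = j" for i j :: 'm
  proof (rule ccontr)
    assume "i \<noteq> j"
    have "deg top_elem l = 0" for l
    proof (rule ccontr)
      assume l: "deg top_elem l \<noteq> 0"
      obtain j where j: "j \<noteq> l" using \<open>i \<noteq> _\<close> by metis
      let ?t = "\<lambda>i. if i = l then 0 else (1::'k)"
      let ?v = "\<lambda>i. scl S (?t i) (w i)"
      have "(\<Prod>i\<in>UNIV. ?t i ^ deg top_elem i) = 0" using l by (intro prod_zero) auto
      then have "f top_elem ?v = 0" using f_scale[of w "Some top_elem" top_elem ?t] wc cone_top by simp
      moreover have "?v \<in> var_cone S" using cone_scale[of w "Some top_elem" ?t] wc cone_top by simp
      ultimately have "?v = (\<lambda>_. 0)" using fz by blast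
      then have "?v j = 0" by (rule fun_cong)
      then show False using j w(1) by (simp add: nonzero_tuples_def)
    qed
    then show False using deg_nonzero[of top_elem] by (simp add: fun_eq_iff)
  qed
  obtain E where E: "E \<subseteq> (\<Union>d. multihom S d)" "var S = lines S UNIV ` {w \<in> nonzero_tuples S UNIV. \<forall>\<phi>\<in>E. \<phi> w = 0}"
    using var_closed unfolding proj_closed_def by blast
  have "var_cone S = {v \<in> prod_space S UNIV. \<forall>\<phi>\<in>E. \<phi> v = 0}"
  proof (intro equalityI subsetI CollectI conjI ballI)
    fix v assume v: "v \<in> var_cone S"
    then show "v \<in> prod_space S UNIV" using var_cone_subset by blast
    fix \<phi> assume phi: "\<phi> \<in> E"
    then obtain d where d: "\<phi> \<in> multihom S d" using E(1) by blast
    obtain u where u: "\<forall>i. \<exists>c. v i = scl S c (u i)" "lines S UNIV u \<in> var S"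
      using v unfolding var_cone_def multicone_def by blast
    then obtain u' where u': "u' \<in> nonzero_tuples S UNIV" "\<phi> u' = 0" "lines S UNIV u = lines S UNIV u'"
      using phi unfolding E(2) by blast
    have "\<exists>c. v i = scl S c (u' i)" for i
    proof -
      have "vs.span {u i} = vs.span {u' i}" using fun_cong[OF u'(3), of i] by (simp add: lines_def)
      moreover obtain c where "v i = scl S c (u i)" using u(1) by blast
      ultimately have "v i \<in> vs.span {u' i}" using vs.span_scale vs.span_base by (metis insertI1)
      then show ?thesis by (auto simp: vs.span_singleton)
    qed
    then obtain t where "\<And>i. v i = scl S (t i) (u' i)" by metis
    then have "v = (\<lambda>i. scl S (t i) (u' i))" by blast
    then show "\<phi> v = 0" using multihom_scale[OF d, of u' t] u'(1,2) by (simp add: nonzero_tuples_def)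
  next
    fix v assume v: "v \<in> {v \<in> prod_space S UNIV. \<forall>\<phi>\<in>E. \<phi> v = 0}"
    show "v \<in> var_cone S"
    proof (cases "\<exists>i. v i = 0")
      case True
      then have "v = (\<lambda>_. 0)" using one by (metis ext)
      then show ?thesis using zero_in_cone[of "Some top_elem"] cone_top by simp
    next
      case False
      then have "v \<in> nonzero_tuples S UNIV" using v by (simp add: nonzero_tuples_def)
      moreover have "lines S UNIV v \<in> var S" unfolding E(2) using v \<open>v \<in> nonzero_tuples S UNIV\<close> by blast
      ultimately show ?thesis unfolding var_cone_def by (rule representative_in_multicone)
    qed
  qed
  moreover have "E \<subseteq> polyfun S" using E(1) by (auto simp: multihom_def)
  ultimately show ?thesis unfolding affine_closed_def by blast
qed

lemma below_top: "p \<noteq> top_elem \<Longrightarrow> Z (Some p) \<subset> Z (Some top_elem)"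
  using cone_subset_var_cone[of "Some p"] cone_top cone_inj[of "Some p" "Some top_elem"] by auto

lemma cone_closed: "affine_closed S (Z (Some p))"
proof -
  have cl: "affine_closed S (Z (Some p)) \<and> affine_closed S (Z (Some q))" if "covers S (Some p) (Some q)" for p q
    using closed_of_codimension[OF cover_codimension[OF that]] by blast
  show ?thesis
  proof (cases "p = top_elem")
    case False
    from cover_above[OF below_top[OF this]] obtain q where q: "covers S q (Some p)" by blast
    then obtain q' where "q = Some q'" using covers_less[OF q] None_less by (cases q) auto
    then show ?thesis using cl q by blast
  next
    case True
    show ?thesis
    proof (cases "\<forall>q. q = top_elem")
      case True
      then have "affine_closed S (var_cone S)" by (intro cone_closed_single) blast
      then show ?thesis unfolding \<open>p = top_elem\<close> cone_top .
    next
      case False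
      then obtain q where "q \<noteq> top_elem" by blast
      from cover_below[OF below_top[OF this]] obtain r where r: "covers S (Some p) r" "Z (Some q) \<subseteq> Z r" using True by blast
      then obtain r' where "r = Some r'" using None_less[of q] by (cases r) auto
      then show ?thesis using cl r by blast
    qed
  qed
qed

lemma separating_function:
  assumes "Z x \<subset> Z y" shows "\<exists>\<phi>\<in>polyfun S. \<not> nz (Z x) \<phi> \<and> nz (Z y) \<phi>"
proof -
  obtain v where v: "v \<in> Z y" "v \<notin> Z x" using assms by blast
  have vV: "v \<in> prod_space S UNIV" using v(1) cone_subset[of y] by (rule rev_subsetD)
  show ?thesis
  proof (cases x)
    case (Some p)
    obtain E where E: "E \<subseteq> polyfun S" "Z (Some p) = {v \<in> prod_space S UNIV. \<forall>\<phi>\<in>E. \<phi> v = 0}"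
      using cone_closed[of p] unfolding affine_closed_def by (elim exE conjE) (rule that)
    obtain \<phi> where "\<phi> \<in> E" "\<phi> v \<noteq> 0" using v(2) vV unfolding Some E(2) by blast
    moreover have "\<forall>v\<in>Z x. \<phi> v = 0" unfolding Some E(2) using \<open>\<phi> \<in> E\<close> by blast
    ultimately show ?thesis using E(1) v(1) by (auto simp: nz_def)
  next
    case None
    obtain ys :: "(('m \<Rightarrow> 'v) \<Rightarrow> 'k) list" where ys: "set ys \<subseteq> polyfun S"
      and lin: "\<And>y t v. y \<in> set ys \<Longrightarrow> y (scale t v) = t * y v"
      and sep: "\<And>v. v \<in> prod_space S UNIV \<Longrightarrow> (\<And>y. y \<in> set ys \<Longrightarrow> y v = 0) \<Longrightarrow> v = (\<lambda>_. 0)"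
      by (rule coordinate_functions) blast
    have "v \<noteq> (\<lambda>_. 0)" using v(2) None by (simp add: cone_None)
    then obtain y where y: "y \<in> set ys" "y v \<noteq> 0" using sep[OF vV] by blast
    have "y (\<lambda>_. 0) = 0" using lin[OF y(1), of 0 "\<lambda>_. 0"] by (simp add: scale_def)
    then show ?thesis using y v(1) ys None by (intro bexI[of _ y]) (auto simp: nz_def cone_None)
  qed
qed

text \<open>Otherwise the cone would be the union of its divisors. For each divisor take a function
  that vanishes on it but not on the cone: the product of these vanishes everywhere, contrary to the
  absence of zero divisors.\<close>

lemma f_nz: "nz (Z (Some p)) (f p)"
proof (rule ccontr)
  assume "\<not> nz (Z (Some p)) (f p)"
  then have all: "Z (Some p) = (\<Union>q\<in>{q. covers S (Some p) q}. Z q)" using f_zero_set[of p] by (auto simp: nz_def)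
  have "\<forall>q\<in>{q. covers S (Some p) q}. \<exists>\<phi>. \<phi> \<in> polyfun S \<and> \<not> nz (Z q) \<phi> \<and> nz (Z (Some p)) \<phi>"
    using separating_function covers_less by blast
  from bchoice[OF this] obtain \<phi> where phi: "\<And>q. covers S (Some p) q \<Longrightarrow> \<phi> q \<in> polyfun S \<and> \<not> nz (Z q) (\<phi> q) \<and> nz (Z (Some p)) (\<phi> q)" by blast
  have "nz (Z (Some p)) (\<Prod>q\<in>{q. covers S (Some p) q}. \<phi> q)" using phi by (intro nz_prod) auto
  then obtain v where v: "v \<in> Z (Some p)" "(\<Prod>q\<in>{q. covers S (Some p) q}. \<phi> q v) \<noteq> 0" by (auto simp: nz_def)
  then obtain q where q: "covers S (Some p) q" "v \<in> Z q" using all by blast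
  then have "\<phi> q v = 0" using phi[OF q(1)] by (auto simp: nz_def)
  then have "(\<Prod>q\<in>{q. covers S (Some p) q}. \<phi> q v) = 0" using q(1) by (intro prod_zero) auto
  then show False using v by simp
qed

lemma f_nz_iff: "nz (Z x) (f q) \<longleftrightarrow> Z (Some q) \<subseteq> Z x"
  using f_nz nz_mono f_vanishes by (auto simp: nz_def) blast

text \<open>Scaling a single coordinate of a point where \<open>f p\<close> is non-zero compares two
  possible degrees: the powers of \<open>t\<close> agree for all \<open>t\<close> in an infinite
  field.\<close>

lemma multidegree_extr: "multidegree S (extr S p) = deg p"
  unfolding multidegree_def
proof (rule the_equality)
  show "extr S p \<in> hom_component S (deg p)" unfolding hom_component_def using f_hom extr_eq by blast
  fix d assume "extr S p \<in> hom_component S d"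
  then obtain \<phi> where phi: "\<phi> \<in> multihom S d" "extr S p = restrict \<phi> (var_cone S)" by (auto simp: hom_component_def)
  have eq: "\<phi> v = f p v" if "v \<in> var_cone S" for v using phi(2) extr_eq that by (metis restrict_apply')
  obtain v where v: "v \<in> var_cone S" "f p v \<noteq> 0" using f_nz[of p] cone_subset_var_cone by (auto simp: nz_def)
  show "d = deg p"
  proof (rule ccontr)
    assume "d \<noteq> deg p"
    then obtain j where j: "d j \<noteq> deg p j" by blast
    have "t ^ d j = t ^ deg p j" for t :: 'k
    proof -
      let ?t = "\<lambda>i. if i = j then t else 1"
      let ?v = "\<lambda>i. scl S (?t i) (v i)"
      have pr: "(\<Prod>i\<in>UNIV. ?t i ^ e i) = t ^ e j" for e :: "'m \<Rightarrow> nat"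
      proof -
        have "(\<Prod>i\<in>UNIV. ?t i ^ e i) = (\<Prod>i\<in>UNIV. if i = j then t ^ e j else 1)" by (intro prod.cong) auto
        then show ?thesis by simp
      qed
      have vV: "v \<in> prod_space S UNIV" using v var_cone_subset by blast
      have "?v \<in> var_cone S" using cone_scale[of v "Some top_elem" ?t] v cone_top by simp
      then have "\<phi> ?v = f p ?v" by (rule eq)
      moreover have "\<phi> ?v = t ^ d j * \<phi> v" using multihom_scale[OF phi(1) vV, of ?t] pr[of d] by simp
      moreover have "f p ?v = t ^ deg p j * f p v" using multihom_scale[OF f_hom vV, of _ ?t] pr[of "deg p"] by simp
      ultimately show ?thesis using eq[OF v(1)] v(2) by simp
    qed
    then have "poly (monom 1 (d j) - monom 1 (deg p j)) t = 0" for t :: 'k by (simp add: poly_monom)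
    then have "{t. poly (monom 1 (d j) - monom 1 (deg p j)) t = (0::'k)} = UNIV" by auto
    then have "monom 1 (d j) - monom 1 (deg p j) = (0 :: 'k poly)"
      using poly_roots_finite infinite_alg_closed[where 'k='k] by metis
    then have "coeff (monom 1 (d j) - monom 1 (deg p j) :: 'k poly) (d j) = 0" by simp
    then show False using j by simp
  qed
qed

text \<open>Multiplicities of regular functions are non-negative, so \<open>nat\<close> loses
  nothing for functions that are non-zero on the cone of \<open>p\<close>.\<close>

definition ord :: "'a \<Rightarrow> 'a option \<Rightarrow> (('m \<Rightarrow> 'v) \<Rightarrow> 'k) \<Rightarrow> nat" where
  "ord p q \<phi> = nat (val S p q (frac (Z (Some p)) \<phi> 1))"

section \<open>Vanishing orders along a covering relation\<close>

context
  fixes p q assumes cov: "covers S (Some p) q"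
begin

text \<open>The properties of \<open>order_function\<close>, carried over from restricted functions
  to polynomial functions on the whole space.\<close>

lemma ord_facts:
  shows ord_mult: "\<And>\<phi> \<psi>. \<phi> \<in> polyfun S \<Longrightarrow> \<psi> \<in> polyfun S \<Longrightarrow> nz (Z (Some p)) \<phi> \<Longrightarrow> nz (Z (Some p)) \<psi> \<Longrightarrow>
          ord p q (\<phi> * \<psi>) = ord p q \<phi> + ord p q \<psi>"
    and ord_pos: "\<And>\<phi>. \<phi> \<in> polyfun S \<Longrightarrow> nz (Z (Some p)) \<phi> \<Longrightarrow> ord p q \<phi> > 0 \<longleftrightarrow> \<not> nz (Z q) \<phi>"
    and ord_le: "\<And>\<phi> \<psi>. \<phi> \<in> polyfun S \<Longrightarrow> \<psi> \<in> polyfun S \<Longrightarrow> nz (Z (Some p)) \<phi> \<Longrightarrow> nz (Z (Some p)) \<psi> \<Longrightarrow>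
          ord p q \<psi> \<le> ord p q \<phi> \<Longrightarrow>
          \<exists>s\<in>polyfun S. \<exists>r\<in>polyfun S. nz (Z q) s \<and> (\<forall>v\<in>Z (Some p). s v * \<phi> v = r v * \<psi> v)"
    and val_frac: "\<And>\<phi> \<psi>. \<phi> \<in> polyfun S \<Longrightarrow> \<psi> \<in> polyfun S \<Longrightarrow> nz (Z (Some p)) \<phi> \<Longrightarrow> nz (Z (Some p)) \<psi> \<Longrightarrow>
          val S p q (frac (Z (Some p)) \<phi> \<psi>) = int (ord p q \<phi>) - int (ord p q \<psi>)"
proof -
  let ?R = "coordinate_ring S (Z (Some p))" and ?P = "vanishing_ideal S (Z (Some p)) (Z q)"
  have sub: "Z q \<subseteq> Z (Some p)" using covers_less[OF cov] by blast
  interpret "domain" ?R using nzd coordinate_ring_domain_iff by blast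
  have P: "primeideal ?P ?R" by (rule vanishing_ideal_prime[OF sub nzd])
  have dvr: "discrete_valuation_ring (localization ?R ?P)" using div cov by (simp add: has_divisorial_valuations_def)
  obtain v where v1: "\<And>a b. a \<in> carrier ?R - {\<zero>\<^bsub>?R\<^esub>} \<Longrightarrow> b \<in> carrier ?R - {\<zero>\<^bsub>?R\<^esub>} \<Longrightarrow> v (a \<otimes>\<^bsub>?R\<^esub> b) = v a + v b"
    and v2: "\<And>a. a \<in> carrier ?R - {\<zero>\<^bsub>?R\<^esub>} \<Longrightarrow> v a > 0 \<longleftrightarrow> a \<in> ?P"
    and v3: "\<And>a b. a \<in> carrier ?R - {\<zero>\<^bsub>?R\<^esub>} \<Longrightarrow> b \<in> carrier ?R - {\<zero>\<^bsub>?R\<^esub>} \<Longrightarrow> v b \<le> v a \<Longrightarrow>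
           \<exists>s\<in>carrier ?R - ?P. \<exists>r\<in>carrier ?R. s \<otimes>\<^bsub>?R\<^esub> a = r \<otimes>\<^bsub>?R\<^esub> b"
    and v4: "\<And>a b. a \<in> carrier ?R - {\<zero>\<^bsub>?R\<^esub>} \<Longrightarrow> b \<in> carrier ?R - {\<zero>\<^bsub>?R\<^esub>} \<Longrightarrow>
           multiplicity_at ?R ?P (fraction ?R a b) = int (v a) - int (v b)"
    by (rule order_function[OF P dvr]) blast
  note c = carrier_nz[where Z="Z (Some p)"]
  note c1 = c[OF polyfun_intros(3) nz_one]
  have v_one: "v (restrict 1 (Z (Some p))) = 0"
    using v1[OF c1 c1] by (simp add: coordinate_ring_simps(2))
  have ord_v: "ord p q \<phi> = v (restrict \<phi> (Z (Some p)))" if "\<phi> \<in> polyfun S" "nz (Z (Some p)) \<phi>" for \<phi>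
    using v4[OF c[OF that] c1] v_one by (simp add: ord_def val_def frac_def)
  {
    fix \<phi> \<psi> assume *: "\<phi> \<in> polyfun S" "\<psi> \<in> polyfun S" "nz (Z (Some p)) \<phi>" "nz (Z (Some p)) \<psi>"
    note cc = c[OF *(1,3)] c[OF *(2,4)]
    show "ord p q (\<phi> * \<psi>) = ord p q \<phi> + ord p q \<psi>"
      using v1[OF cc] * by (simp add: ord_v coordinate_ring_simps(2) nz_mult polyfun_intros)
    show "val S p q (frac (Z (Some p)) \<phi> \<psi>) = int (ord p q \<phi>) - int (ord p q \<psi>)"
      using v4[OF cc] * by (simp add: ord_v val_def frac_def)
    assume "ord p q \<psi> \<le> ord p q \<phi>"
    then obtain s r where sr: "s \<in> carrier ?R - ?P" "r \<in> carrier ?R"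
      "s \<otimes>\<^bsub>?R\<^esub> restrict \<phi> (Z (Some p)) = r \<otimes>\<^bsub>?R\<^esub> restrict \<psi> (Z (Some p))"
      using v3[OF cc] * ord_v by metis
    then obtain \<sigma> \<rho> where **: "\<sigma> \<in> polyfun S" "s = restrict \<sigma> (Z (Some p))" "\<rho> \<in> polyfun S" "r = restrict \<rho> (Z (Some p))"
      by (auto simp: coordinate_ring_simps(1))
    have "nz (Z q) \<sigma>" using sr(1) ** vanishing_ideal_iff[OF sub **(1)] by auto
    moreover have "\<forall>v\<in>Z (Some p). \<sigma> v * \<phi> v = \<rho> v * \<psi> v"
      using sr(3) unfolding ** coordinate_ring_simps(2) restrict_eq_iff by simp
    ultimately show "\<exists>s\<in>polyfun S. \<exists>r\<in>polyfun S. nz (Z q) s \<and> (\<forall>v\<in>Z (Some p). s v * \<phi> v = r v * \<psi> v)"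
      using ** by blast
  }
  fix \<phi> assume *: "\<phi> \<in> polyfun S" "nz (Z (Some p)) \<phi>"
  show "ord p q \<phi> > 0 \<longleftrightarrow> \<not> nz (Z q) \<phi>"
    using v2[OF c[OF *]] vanishing_ideal_iff[OF sub *(1)] ord_v[OF *] by simp
qed

lemma ord_cong:
  assumes "\<phi> \<in> polyfun S" "\<psi> \<in> polyfun S" "\<forall>v\<in>Z (Some p). \<phi> v = \<psi> v"
  shows "ord p q \<phi> = ord p q \<psi>"
proof -
  have "restrict \<phi> (Z (Some p)) = restrict \<psi> (Z (Some p))" using assms by (simp add: restrict_eq_iff)
  then show ?thesis by (simp add: ord_def frac_def)
qed

lemma ord_one: "ord p q 1 = 0"
  using ord_mult[OF polyfun_intros(3) polyfun_intros(3) nz_one nz_one] by simp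

lemma ord_power: "\<phi> \<in> polyfun S \<Longrightarrow> nz (Z (Some p)) \<phi> \<Longrightarrow> ord p q (\<phi> ^ n) = n * ord p q \<phi>"
  by (induction n) (simp_all add: ord_one ord_mult nz_power polyfun_intros)

end

end

section \<open>Parameters on a stratum\<close>

context constants_embedding
begin

text \<open>Gaussian elimination without division: more rows than columns over a domain are linearly
  dependent.\<close>

lemma dependent_rows:
  assumes A: "subalgebra A" and dom: "\<And>a b. a \<in> A \<Longrightarrow> b \<in> A \<Longrightarrow> a * b = 0 \<Longrightarrow> a = 0 \<or> b = 0" and one: "(1::'r) \<noteq> 0"
    and L: "finite L" and J: "finite J" "card L < card J" and a: "\<And>j l. j \<in> J \<Longrightarrow> l \<in> L \<Longrightarrow> a j l \<in> A"
  shows "\<exists>\<gamma>. (\<forall>j\<in>J. \<gamma> j \<in> A) \<and> (\<exists>j\<in>J. \<gamma> j \<noteq> 0) \<and> (\<forall>l\<in>L. (\<Sum>j\<in>J. \<gamma> j * a j l) = 0)"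
  using L J a
proof (induction L arbitrary: J a rule: finite_induct)
  case empty
  then obtain j where "j \<in> J" by fastforce
  then show ?case using one sub_intros(3)[OF A] by (intro exI[of _ "\<lambda>_. 1"]) auto
next
  case (insert l0 L)
  note As = sub_intros[OF A]
  show ?case
  proof (cases "\<forall>j\<in>J. a j l0 = 0")
    case True
    have "card L < card J" using insert.prems(2) insert.hyps by simp
    from insert.IH[OF insert.prems(1) this, of a] insert.prems(3)
    obtain \<gamma> where "(\<forall>j\<in>J. \<gamma> j \<in> A) \<and> (\<exists>j\<in>J. \<gamma> j \<noteq> 0) \<and> (\<forall>l\<in>L. (\<Sum>j\<in>J. \<gamma> j * a j l) = 0)" by auto
    then show ?thesis using True by (intro exI[of _ \<gamma>]) auto
  next
    case False
    then obtain k where k: "k \<in> J" "a k l0 \<noteq> 0" by blast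
    let ?J = "J - {k}"
    let ?a = "\<lambda>j l. a k l0 * a j l - a j l0 * a k l"
    have "card L < card ?J" using insert.prems insert.hyps k by simp
    moreover have "?a j l \<in> A" if "j \<in> ?J" "l \<in> L" for j l
      using that insert.prems(3) k by (intro As(5,7)) auto
    ultimately obtain \<gamma> where g: "\<forall>j\<in>?J. \<gamma> j \<in> A" "\<exists>j\<in>?J. \<gamma> j \<noteq> 0" "\<forall>l\<in>L. (\<Sum>j\<in>?J. \<gamma> j * ?a j l) = 0"
      using insert.IH[of ?J ?a] insert.prems(1) by auto
    \<comment> \<open>The rows other than the pivot are multiplied by the pivot entry
      \<open>a k l0\<close>, and the coefficient of the pivot row is chosen to cancel column
      \<open>l0\<close>.\<close>
    define \<delta> where "\<delta> j = (if j = k then - (\<Sum>i\<in>?J. \<gamma> i * a i l0) else \<gamma> j * a k l0)" for j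
    have "\<delta> j \<in> A" if "j \<in> J" for j
      using that g(1) insert.prems(3) k unfolding \<delta>_def by (auto intro!: As(5,6) sub_sum[OF A])
    moreover obtain j where j: "j \<in> ?J" "\<gamma> j \<noteq> 0" using g(2) by blast
    then have "\<delta> j \<noteq> 0" using dom[of "\<gamma> j" "a k l0"] g(1) insert.prems(3) k unfolding \<delta>_def by auto
    moreover have sum_eq: "(\<Sum>j\<in>J. \<delta> j * a j l) = (\<Sum>j\<in>?J. \<gamma> j * ?a j l)" for l
    proof -
      have "(\<Sum>j\<in>J. \<delta> j * a j l) = \<delta> k * a k l + (\<Sum>j\<in>?J. \<delta> j * a j l)" by (rule sum.remove[OF insert.prems(1) k(1)])
      also have "(\<Sum>j\<in>?J. \<delta> j * a j l) = (\<Sum>j\<in>?J. \<gamma> j * a k l0 * a j l)" by (intro sum.cong) (auto simp: \<delta>_def)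
      finally show ?thesis by (simp add: \<delta>_def sum_distrib_left sum_distrib_right sum_subtractf algebra_simps)
    qed
    moreover have "(\<Sum>j\<in>?J. \<gamma> j * ?a j l0) = 0" by (simp add: mult.commute)
    ultimately show ?thesis using g(3) j(1) by (intro exI[of _ \<delta>]) auto
  qed
qed

end

context seshadri
begin

section \<open>Rank of a stratum and the parameters\<close>

definition below_chains :: "'a option \<Rightarrow> 'a option set set" where
  "below_chains x = {C. (\<forall>y\<in>C. Z y \<subset> Z x) \<and> (\<forall>y\<in>C. \<forall>z\<in>C. Z y \<subseteq> Z z \<or> Z z \<subseteq> Z y)}"

text \<open>This plays the role of the dimension of the cone. The extra least element counts as a
  member of the chains, so it has rank 0 and proper strata have positive rank. The maximum is over a
  finite set that contains the size of the empty chain.\<close>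

definition rk :: "'a option \<Rightarrow> nat" where "rk x = Max (card ` below_chains x)"

lemma rk_ge: "C \<in> below_chains x \<Longrightarrow> card C \<le> rk x"
  unfolding rk_def by (rule Max_ge) auto

lemma rk_attained: "\<exists>C\<in>below_chains x. card C = rk x"
proof -
  have "card ` below_chains x \<noteq> {}" using image_is_empty[of card] by (auto simp: below_chains_def)
  then have "rk x \<in> card ` below_chains x" unfolding rk_def by (intro Max_in) auto
  then show ?thesis by auto
qed

lemma rk_less:
  assumes "Z y \<subset> Z x" shows "rk y < rk x"
proof -
  obtain C where C: "C \<in> below_chains y" "card C = rk y" using rk_attained by blast
  have "insert y C \<in> below_chains x" using C(1) assms unfolding below_chains_def by auto
  then have "card (insert y C) \<le> rk x" by (rule rk_ge)
  moreover have "y \<notin> C" using C(1) by (auto simp: below_chains_def)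
  ultimately show ?thesis using C(2) by simp
qed

lemma rk_le:
  assumes "Z y \<subseteq> Z x" shows "rk y \<le> rk x"
proof (cases "Z y = Z x")
  case True
  then show ?thesis using cone_inj[of y x] by simp
next
  case False
  then have "Z y \<subset> Z x" using assms by simp
  then show ?thesis by (rule less_imp_le[OF rk_less])
qed

text \<open>The largest member of a longest chain below \<open>x\<close> has the rest of this chain
  below it.\<close>

lemma rk_pred:
  assumes "rk x = Suc j" shows "\<exists>y. Z y \<subset> Z x \<and> rk y = j"
proof -
  obtain C where C: "C \<in> below_chains x" "card C = Suc j" using rk_attained[of x] assms by auto
  have fin: "finite (Z ` C)" and ne: "Z ` C \<noteq> {}" using C(2) by auto
  from finite_has_maximal[OF fin ne] obtain M where M: "M \<in> Z ` C" "\<forall>b\<in>Z ` C. M \<subseteq> b \<longrightarrow> M = b" by (rule bexE)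
  from M(1) obtain y where y: "y \<in> C" "M = Z y" by auto
  have "Z z \<subset> Z y" if z: "z \<in> C - {y}" for z
  proof -
    have "Z y \<subseteq> Z z \<or> Z z \<subseteq> Z y" using C(1) y z by (auto simp: below_chains_def)
    moreover have "Z z \<noteq> Z y" using cone_inj[of z y] z by auto
    moreover have "Z y \<subseteq> Z z \<longrightarrow> Z y = Z z" using M(2) y(2) z by auto
    ultimately show ?thesis by auto
  qed
  then have "C - {y} \<in> below_chains y" using C(1) unfolding below_chains_def by auto
  then have "card (C - {y}) \<le> rk y" by (rule rk_ge)
  then have "j \<le> rk y" using C(2) y(1) by simp
  moreover have "Z y \<subset> Z x" using C(1) y(1) by (auto simp: below_chains_def)
  ultimately show ?thesis using rk_less[of y x] assms by (intro exI[of _ y]) auto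
qed

lemma rk_None: "rk None = 0"
proof -
  obtain C where C: "C \<in> below_chains None" "card C = rk None" using rk_attained by blast
  have "\<not> Z y \<subset> Z None" for y using zero_in_cone[of y] by (auto simp: cone_None)
  then have "C = {}" using C(1) by (auto simp: below_chains_def)
  then show ?thesis using C(2) by simp
qed

lemma rk_Some: "\<exists>j. rk (Some p) = Suc j"
  using rk_less[OF None_less[of p]] by (cases "rk (Some p)") auto

definition tdeg :: "'a \<Rightarrow> nat" where "tdeg p = (\<Sum>i\<in>UNIV. deg p i)"

text \<open>A common multiple of the total degrees: suitable powers of all extremal functions then
  have the same degree, as the graded normalization requires.\<close>

definition D :: nat where "D = (\<Prod>p\<in>UNIV. tdeg p)"

definition F :: "nat \<Rightarrow> ('m \<Rightarrow> 'v) \<Rightarrow> 'k" where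
  "F j = (\<Sum>p\<in>{p. rk (Some p) = j}. f p ^ (D div tdeg p))"

lemma tdeg_pos: "tdeg p > 0"
proof (rule gr0I)
  assume "tdeg p = 0"
  then have "deg p = (\<lambda>_. 0)" by (simp add: tdeg_def fun_eq_iff)
  then show False using deg_nonzero by blast
qed

lemma D_pos: "D > 0"
  using tdeg_pos by (simp add: D_def)

lemma tdeg_D: "tdeg p * (D div tdeg p) = D"
  unfolding D_def by (intro dvd_mult_div_cancel dvd_prodI) auto

lemma exponent_pos: "D div tdeg p > 0"
  using tdeg_D[of p] D_pos by (metis gr0I mult_0_right)

lemma F_poly: "F j \<in> polyfun S"
  unfolding F_def by (intro polyfun_intros f_poly)

lemma F_scale:
  assumes "v \<in> Z x" shows "F j (scale t v) = t ^ D * F j v"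
proof -
  have "f p (scale t v) ^ (D div tdeg p) = t ^ D * f p v ^ (D div tdeg p)" for p
  proof -
    have "f p (scale t v) = t ^ tdeg p * f p v"
      unfolding scale_def f_scale[OF assms] by (simp add: tdeg_def power_sum)
    then show ?thesis by (simp add: power_mult_distrib tdeg_D flip: power_mult)
  qed
  then show ?thesis by (simp add: F_def sum_distrib_left)
qed

text \<open>A summand that is non-zero somewhere on the cone of \<open>x\<close> belongs to a
  stratum below \<open>x\<close>, whose rank is at most that of \<open>x\<close>.\<close>

lemma F_vanishes:
  assumes "rk x < j" "v \<in> Z x" shows "F j v = 0"
proof -
  have "f p v ^ (D div tdeg p) = 0" if "rk (Some p) = j" for p
  proof -
    have "\<not> Z (Some p) \<subseteq> Z x" using rk_le[of "Some p" x] that assms by auto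
    then show ?thesis using f_vanishes[OF _ assms(2)] exponent_pos[of p] by simp
  qed
  then have "\<forall>p\<in>{p. rk (Some p) = j}. (f p ^ (D div tdeg p)) v = 0" by simp
  then show ?thesis unfolding F_def sum_fun_apply by (rule sum.neutral)
qed

text \<open>Different strata of the same rank are incomparable, so by (S2) all other summands vanish
  on the cone of \<open>p\<close>.\<close>

lemma F_on:
  assumes v: "v \<in> Z (Some p)" shows "F (rk (Some p)) v = f p v ^ (D div tdeg p)"
proof -
  have "f q v ^ (D div tdeg q) = 0" if q: "rk (Some q) = rk (Some p)" "q \<noteq> p" for q
  proof -
    have "\<not> Z (Some q) \<subseteq> Z (Some p)" using rk_less[of "Some q" "Some p"] cone_inj[of "Some q" "Some p"] q by auto
    then show ?thesis using f_vanishes[OF _ v] exponent_pos[of q] by simp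
  qed
  then have "(\<Sum>q\<in>{q. rk (Some q) = rk (Some p)}. f q v ^ (D div tdeg q)) = (\<Sum>q\<in>{p}. f q v ^ (D div tdeg q))"
    by (intro sum.mono_neutral_right) auto
  then show ?thesis by (simp add: F_def)
qed

lemma F_zero_iff: "v \<in> Z (Some p) \<Longrightarrow> F (rk (Some p)) v = 0 \<longleftrightarrow> f p v = 0"
  using F_on exponent_pos by simp

lemma F_nz: "nz (Z (Some p)) (F (rk (Some p)))"
  using f_nz[of p] by (auto simp: nz_def F_zero_iff)

text \<open>Vanishing of the last parameter is vanishing of \<open>f p\<close>, which by (S3) moves
  the point to a divisor, that is, to smaller rank.\<close>

lemma common_zero:
  assumes v: "v \<in> Z x" and 0: "\<And>i. i \<in> {1..rk x} \<Longrightarrow> F i v = 0"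
  shows "v = (\<lambda>_. 0)"
  using assms
proof (induction "rk x" arbitrary: x rule: less_induct)
  case less
  show ?case
  proof (cases x)
    case None
    then show ?thesis using less.prems by (simp add: cone_None)
  next
    case (Some p)
    have "rk x \<in> {1..rk x}" using rk_Some[of p] Some by auto
    then have "F (rk x) v = 0" by (rule less.prems(2))
    then have "f p v = 0" using F_zero_iff less.prems(1) Some by simp
    then have "v \<in> (\<Union>q\<in>{q. covers S (Some p) q}. Z q)" using less.prems(1) Some by (simp flip: f_zero_set)
    then obtain q where q: "covers S (Some p) q" "v \<in> Z q" by blast
    have "rk q < rk x" using rk_less[OF covers_less[OF q(1)]] Some by simp
    then show ?thesis using less.prems(2) by (intro less.hyps[of q] q(2)) auto
  qed
qed

section \<open>The polynomial rings in the parameters\<close>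

primrec B :: "nat \<Rightarrow> (('m \<Rightarrow> 'v) \<Rightarrow> 'k) set" where
  "B 0 = range (\<lambda>c _. c)"
| "B (Suc j) = pf.adjoin (B j) (F (Suc j))"

lemma B_subalgebra: "pf.subalgebra (B j)"
proof (induction j)
  case 0
  show ?case unfolding pf.subalgebra_def by (auto simp: fun_eq_iff)
next
  case (Suc j)
  then show ?case using pf.subalgebra_adjoin by simp
qed

lemmas B_intros = pf.sub_intros[OF B_subalgebra]

lemma B_Suc: "B j \<subseteq> B (Suc j)" and F_in_B_Suc: "F (Suc j) \<in> B (Suc j)"
  using pf.adjoin_subset[OF B_subalgebra] pf.adjoin_self[OF B_subalgebra] by auto

lemma B_mono: "i \<le> j \<Longrightarrow> B i \<subseteq> B j"
  by (rule lift_Suc_mono_le[of B]) (use B_Suc in auto)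

lemma F_in_B: "1 \<le> i \<Longrightarrow> i \<le> j \<Longrightarrow> F i \<in> B j"
  using F_in_B_Suc[of "i - 1"] B_mono[of i j] by auto

lemma B_poly: "B j \<subseteq> polyfun S"
proof (induction j)
  case 0
  show ?case using polyfun_intros(1) by auto
next
  case (Suc j)
  show ?case
  proof
    fix b assume "b \<in> B (Suc j)"
    then obtain q where q: "\<forall>i. coeff q i \<in> B j" "b = poly q (F (Suc j))" by (auto simp: pf.adjoin_def pf.polys_def)
    then show "b \<in> polyfun S" unfolding q(2) poly_altdef using Suc F_poly by (auto intro!: polyfun_intros)
  qed
qed

text \<open>\<open>b0\<close> is the constant term of a polynomial expression in the last parameter.
  On strata of rank \<open>j\<close>, where that parameter vanishes, \<open>b0\<close> is all that
  is left of \<open>b\<close>.\<close>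

lemma B_decompose:
  assumes "b \<in> B (Suc j)"
  shows "\<exists>b0\<in>B j. \<exists>b1\<in>B (Suc j). b = b0 + F (Suc j) * b1"
proof -
  obtain q where q: "\<forall>i. coeff q i \<in> B j" "b = poly q (F (Suc j))" using assms by (auto simp: pf.adjoin_def pf.polys_def)
  obtain c q' where cq: "q = pCons c q'" by (rule pCons_cases)
  have "c \<in> B j" using q(1)[rule_format, of 0] cq by simp
  moreover have "coeff q' i \<in> B j" for i using q(1)[rule_format, of "Suc i"] cq by simp
  then have "poly q' (F (Suc j)) \<in> B (Suc j)" by (auto simp: pf.adjoin_def pf.polys_def)
  ultimately show ?thesis using q(2) cq by auto
qed

text \<open>Algebraic independence of \<open>F 1, \<dots>, F j\<close> on a stratum of rank \<open>j\<close>: restrict to a stratum of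
  rank \<open>j - 1\<close>, where \<open>F j\<close> vanishes.\<close>

lemma B_zero:
  assumes "rk x = j" "b \<in> B j" "\<not> nz (Z x) b" shows "b = 0"
  using assms
proof (induction j arbitrary: x b)
  case 0
  then show ?case using zero_in_cone[of x] by (auto simp: nz_def fun_eq_iff)
next
  case (Suc j)
  obtain p where p: "x = Some p" using Suc.prems(1) rk_None by (cases x) auto
  obtain y where y: "Z y \<subset> Z x" "rk y = j" using rk_pred[OF Suc.prems(1)] by blast
  obtain q where q: "\<forall>i. coeff q i \<in> B j" "b = poly q (F (Suc j))" using Suc.prems(2) by (auto simp: pf.adjoin_def pf.polys_def)
  have "(\<forall>i. coeff q i \<in> B j) \<longrightarrow> \<not> nz (Z x) (poly q (F (Suc j))) \<longrightarrow> poly q (F (Suc j)) = 0"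
  proof (induction q rule: pCons_induct)
    case (pCons c q)
    show ?case
    proof (intro impI)
      assume c: "\<forall>i. coeff (pCons c q) i \<in> B j" and nz: "\<not> nz (Z x) (poly (pCons c q) (F (Suc j)))"
      have cB: "c \<in> B j" using c[rule_format, of 0] by simp
      have qB: "\<forall>i. coeff q i \<in> B j" using c[rule_format, of "Suc _"] by simp
      then have qp: "poly q (F (Suc j)) \<in> polyfun S" using B_poly[of "Suc j"] by (auto simp: pf.adjoin_def pf.polys_def)
      \<comment> \<open>On the smaller stratum only the constant coefficient survives; it is zero by
        induction on the rank, and then the last parameter can be cancelled.\<close>
      have "c v = 0" if "v \<in> Z y" for v
      proof -
        have "v \<in> Z x" using that y(1) by blast
        moreover have "F (Suc j) v = 0" using F_vanishes[of y "Suc j" v] y(2) that by simp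
        ultimately show ?thesis using nz by (auto simp: nz_def)
      qed
      then have "c = 0" using Suc.IH[OF y(2) cB] by (auto simp: nz_def)
      then have "\<not> nz (Z x) (F (Suc j) * poly q (F (Suc j)))" using nz by simp
      then have "\<not> nz (Z x) (poly q (F (Suc j)))"
        using nz_mult[OF F_poly qp] F_nz[of p] p Suc.prems(1) by auto
      then have 0: "poly q (F (Suc j)) = 0" using pCons.IH qB by blast
      show "poly (pCons c q) (F (Suc j)) = 0"
        by (simp only: poly_pCons 0 \<open>c = 0\<close> mult_zero_right add_0_left)
    qed
  qed simp
  then show ?case using q Suc.prems(3) by blast
qed

lemma B_domain:
  assumes "rk x = j" "a \<in> B j" "b \<in> B j" "a * b = 0" shows "a = 0 \<or> b = 0"
proof (rule ccontr)
  assume "\<not> ?thesis"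
  then have "nz (Z x) a" "nz (Z x) b" using B_zero[OF assms(1,2)] B_zero[OF assms(1,3)] by blast+
  then have "nz (Z x) (a * b)" using B_poly assms by (intro nz_mult) auto
  then show False using assms by (simp add: nz_def)
qed

text \<open>On a stratum of rank \<open>j\<close> only the part \<open>b0\<close> in
  \<open>B j\<close> is visible, and by algebraic independence it vanishes on such a stratum only if
  it is zero.\<close>

lemma nz_B_independent:
  assumes "rk y = j" "rk z = j" "b \<in> B (Suc j)" "nz (Z y) b" shows "nz (Z z) b"
proof (rule ccontr)
  assume nz: "\<not> nz (Z z) b"
  obtain b0 b1 where b: "b0 \<in> B j" "b1 \<in> B (Suc j)" "b = b0 + F (Suc j) * b1" using B_decompose[OF assms(3)] by blast
  have "F (Suc j) v = 0" if "v \<in> Z y \<or> v \<in> Z z" for v using F_vanishes[of y "Suc j" v] F_vanishes[of z "Suc j" v] assms(1,2) that by auto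
  then have *: "b v = b0 v" if "v \<in> Z y \<or> v \<in> Z z" for v using that b(3) by simp
  then have "\<not> nz (Z z) b0" using nz by (simp add: nz_def)
  then have "b0 = 0" using B_zero[OF assms(2) b(1)] by blast
  then show False using assms(4) * by (simp add: nz_def)
qed

text \<open>In \<open>B (Suc j)\<close> the functions vanishing on a stratum of rank
  \<open>j\<close> form the principal prime generated by the last parameter: the part free of it is
  zero by \<open>B_zero\<close>.\<close>

lemma B_divisible:
  assumes "rk y = j" "b \<in> B (Suc j)" "\<not> nz (Z y) b" shows "\<exists>b1\<in>B (Suc j). b = F (Suc j) * b1"
proof -
  obtain b0 b1 where b: "b0 \<in> B j" "b1 \<in> B (Suc j)" "b = b0 + F (Suc j) * b1" using B_decompose[OF assms(2)] by blast
  have "b0 v = 0" if "v \<in> Z y" for v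
  proof -
    have "F (Suc j) v = 0" using F_vanishes[of y "Suc j" v] assms(1) that by simp
    then show ?thesis using b(3) assms(3) that by (auto simp: nz_def)
  qed
  then have "b0 = 0" using B_zero[OF assms(1) b(1)] by (auto simp: nz_def)
  then show ?thesis using b by auto
qed

lemma finite_over_B:
  "\<exists>X. finite X \<and> X \<subseteq> polyfun S \<and>
    (\<forall>\<phi>\<in>polyfun S. \<exists>\<beta>. (\<forall>g\<in>X. \<beta> g \<in> B (rk x)) \<and> (\<forall>v\<in>Z x. \<phi> v = (\<Sum>g\<in>X. \<beta> g v * g v)))"
proof (cases x)
  case None
  have "\<exists>\<beta>. (\<forall>g\<in>{1}. \<beta> g \<in> B (rk x)) \<and> (\<forall>v\<in>Z x. \<phi> v = (\<Sum>g\<in>{1}. \<beta> g v * g v))" for \<phi>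
    using None by (intro exI[of _ "\<lambda>_ _. \<phi> (\<lambda>_. 0)"]) (auto simp: rk_None cone_None)
  then show ?thesis using polyfun_intros(3) by (intro exI[of _ "{1}"]) blast
next
  case (Some p)
  obtain E where E: "E \<subseteq> polyfun S" "Z x = {v \<in> prod_space S UNIV. \<forall>\<phi>\<in>E. \<phi> v = 0}"
    using cone_closed[of p] Some unfolding affine_closed_def by (elim exE conjE) (rule that, simp_all)
  show ?thesis
  proof (rule finite_over_parameters[OF E, of "{1..rk x}" F D])
    show "\<And>t v. v \<in> Z x \<Longrightarrow> scale t v \<in> Z x" by (rule cone_scale')
    show "\<And>i t v. v \<in> Z x \<Longrightarrow> F i (scale t v) = t ^ D * F i v" by (rule F_scale)
    show "\<And>v. v \<in> Z x \<Longrightarrow> (\<And>i. i \<in> {1..rk x} \<Longrightarrow> F i v = 0) \<Longrightarrow> v = (\<lambda>_. 0)" by (rule common_zero)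
  qed (use F_poly D_pos B_subalgebra F_in_B in auto)
qed

text \<open>More powers of \<open>s\<close> than there are module generators are dependent over
  \<open>B\<close>. After the lowest power of \<open>s\<close> in the relation is cancelled, the
  lowest coefficient is a multiple of \<open>s\<close>.\<close>

lemma algebraic_over_B:
  assumes s: "s \<in> polyfun S" "nz (Z x) s"
  shows "\<exists>r\<in>polyfun S. \<exists>b\<in>B (rk x). nz (Z x) b \<and> (\<forall>v\<in>Z x. b v = s v * r v)"
proof -
  let ?B = "B (rk x)"
  obtain X where X: "finite X" "X \<subseteq> polyfun S"
    and span: "\<And>\<phi>. \<phi> \<in> polyfun S \<Longrightarrow> \<exists>\<beta>. (\<forall>g\<in>X. \<beta> g \<in> ?B) \<and> (\<forall>v\<in>Z x. \<phi> v = (\<Sum>g\<in>X. \<beta> g v * g v))"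
    using finite_over_B[of x] by blast
  have "\<forall>j. \<exists>\<beta>. (\<forall>g\<in>X. \<beta> g \<in> ?B) \<and> (\<forall>v\<in>Z x. s v ^ j = (\<Sum>g\<in>X. \<beta> g v * g v))"
    using span[OF polyfun_intros(8)[OF s(1)]] by simp
  from choice[OF this] obtain \<beta> where beta: "\<And>j g. g \<in> X \<Longrightarrow> \<beta> j g \<in> ?B" "\<And>j v. v \<in> Z x \<Longrightarrow> s v ^ j = (\<Sum>g\<in>X. \<beta> j g v * g v)"
    by blast
  have one: "(1 :: ('m \<Rightarrow> 'v) \<Rightarrow> 'k) \<noteq> 0" by (auto simp: fun_eq_iff)
  have "\<exists>\<gamma>. (\<forall>j\<in>{..card X}. \<gamma> j \<in> ?B) \<and> (\<exists>j\<in>{..card X}. \<gamma> j \<noteq> 0) \<and>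
      (\<forall>g\<in>X. (\<Sum>j\<in>{..card X}. \<gamma> j * \<beta> j g) = 0)"
    by (rule pf.dependent_rows[OF B_subalgebra B_domain[of x, OF refl] one X(1)]) (use beta(1) in auto)
  then obtain \<gamma> where g: "\<And>j. j \<in> {..card X} \<Longrightarrow> \<gamma> j \<in> ?B" "\<exists>j\<in>{..card X}. \<gamma> j \<noteq> 0" "\<And>g. g \<in> X \<Longrightarrow> (\<Sum>j\<in>{..card X}. \<gamma> j * \<beta> j g) = 0"
    by (elim exE conjE) (rule that, auto)
  have zero: "(\<Sum>j\<le>card X. \<gamma> j v * s v ^ j) = 0" if v: "v \<in> Z x" for v
  proof -
    have "(\<Sum>j\<le>card X. \<gamma> j v * s v ^ j) = (\<Sum>j\<le>card X. \<Sum>g\<in>X. \<gamma> j v * \<beta> j g v * g v)"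
      using beta(2)[OF v] by (simp add: sum_distrib_left mult_ac)
    also have "\<dots> = (\<Sum>g\<in>X. (\<Sum>j\<le>card X. \<gamma> j * \<beta> j g) v * g v)"
      by (subst sum.swap) (simp add: sum_distrib_right)
    finally show ?thesis using g(3) by simp
  qed
  have "\<exists>j. j \<le> card X \<and> \<gamma> j \<noteq> 0" using g(2) by auto
  then obtain k where k: "k \<le> card X \<and> \<gamma> k \<noteq> 0" and least: "\<forall>j<k. \<not> (j \<le> card X \<and> \<gamma> j \<noteq> 0)"
    unfolding exists_least_iff[of "\<lambda>j. j \<le> card X \<and> \<gamma> j \<noteq> 0"] by blast
  have small: "\<gamma> j = 0" if "j < k" for j using least that k by auto
  \<comment> \<open>The relation, divided by the power \<open>k\<close> of \<open>s\<close>,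
    expresses \<open>\<gamma> k\<close> as minus the higher terms; one further factor
    \<open>s\<close> can be taken out of them.\<close>
  define r where "r = - (\<Sum>j\<in>{Suc k..card X}. \<gamma> j * s ^ (j - Suc k))"
  have rP: "r \<in> polyfun S" unfolding r_def using g(1) B_poly[of "rk x"] s(1) by (auto intro!: polyfun_intros)
  have "s v ^ k * \<gamma> k v = s v ^ k * (s v * r v)" if v: "v \<in> Z x" for v
  proof -
    have "(\<Sum>j\<le>card X. \<gamma> j v * s v ^ j) = (\<Sum>j\<in>{k..card X}. \<gamma> j v * s v ^ j)"
      using small by (intro sum.mono_neutral_right) auto
    also have "\<dots> = \<gamma> k v * s v ^ k + (\<Sum>j\<in>{Suc k..card X}. \<gamma> j v * s v ^ j)" using k by (simp add: sum.atLeast_Suc_atMost)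
    also have "(\<Sum>j\<in>{Suc k..card X}. \<gamma> j v * s v ^ j) = s v ^ k * (s v * (\<Sum>j\<in>{Suc k..card X}. \<gamma> j v * s v ^ (j - Suc k)))"
      unfolding sum_distrib_left
    proof (rule sum.cong)
      fix j assume "j \<in> {Suc k..card X}"
      then have "j = Suc k + (j - Suc k)" by simp
      then have "s v ^ j = s v ^ k * s v * s v ^ (j - Suc k)" by (metis power_Suc2 power_add)
      then show "\<gamma> j v * s v ^ j = s v ^ k * (s v * (\<gamma> j v * s v ^ (j - Suc k)))" by simp
    qed simp
    finally show ?thesis using zero[OF v] by (simp add: r_def algebra_simps add_eq_0_iff)
  qed
  then have "\<forall>v\<in>Z x. (s ^ k) v * \<gamma> k v = (s ^ k) v * (s * r) v" by simp
  then have "\<forall>v\<in>Z x. \<gamma> k v = (s * r) v"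
    using g(1)[of k] k B_poly[of "rk x"] rP s by (intro cancel[of "\<gamma> k" "s * r" "s ^ k"] polyfun_intros nz_power) auto
  moreover have "\<gamma> k \<in> ?B" using g(1) k by simp
  moreover have "nz (Z x) (\<gamma> k)" using B_zero[OF refl \<open>\<gamma> k \<in> ?B\<close>] k by blast
  ultimately show ?thesis using rP by (intro bexI[of _ r] bexI[of _ "\<gamma> k"]) auto
qed

end

section \<open>Divisibility by the last parameter\<close>

context seshadri
begin

declare B.simps(2) [simp del]

lemma F_Suc_vanishes: "rk y = j \<Longrightarrow> v \<in> Z y \<Longrightarrow> F (Suc j) v = 0"
  using F_vanishes[of y "Suc j" v] by simp

text \<open>Nakayama's lemma with an explicit denominator. Up to factors that do not vanish on
  \<open>y\<close>, each generator lies in \<open>L\<close> modulo multiples of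
  \<open>F (Suc j)\<close>. The generators are eliminated one at a time, and the factors collected
  on the way still do not vanish on \<open>y\<close>.\<close>

lemma eliminate:
  assumes y: "rk y = j"
    and L_add: "\<And>\<phi> \<psi>. \<phi> \<in> L \<Longrightarrow> \<psi> \<in> L \<Longrightarrow> \<phi> + \<psi> \<in> L" and L_0: "0 \<in> L"
    and L_mult: "\<And>b \<phi>. b \<in> B (Suc j) \<Longrightarrow> \<phi> \<in> L \<Longrightarrow> b * \<phi> \<in> L"
    and X: "finite X"
    and red: "\<And>x. x \<in> X \<Longrightarrow> \<exists>\<delta>\<in>B (Suc j). nz (Z y) \<delta> \<and>
      (\<exists>b. (\<forall>g\<in>X. b g \<in> B (Suc j)) \<and> \<delta> * x - F (Suc j) * (\<Sum>g\<in>X. b g * g) \<in> L)"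
  shows "\<exists>c\<in>B (Suc j). nz (Z y) c \<and> (\<forall>x\<in>X. c * x \<in> L)"
  using X red
proof (induction X rule: finite_induct)
  case empty
  show ?case using B_intros(3) nz_one by blast
next
  case (insert x0 X)
  let ?F = "F (Suc j)"
  note Bs = B_intros[where j="Suc j"]
  have FB: "?F \<in> B (Suc j)" by (rule F_in_B_Suc)
  have sum_closed: "sum h J \<in> L" if "\<And>i. i \<in> J \<Longrightarrow> h i \<in> L" for h :: "_ \<Rightarrow> _" and J
    using that by (induction J rule: infinite_finite_induct) (auto intro: L_0 L_add)
  obtain \<delta>0 b0 where d0: "\<delta>0 \<in> B (Suc j)" "nz (Z y) \<delta>0" "\<forall>g\<in>insert x0 X. b0 g \<in> B (Suc j)"
    "\<delta>0 * x0 - ?F * (\<Sum>g\<in>insert x0 X. b0 g * g) \<in> L" using insert.prems[of x0] by blast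
  \<comment> \<open>Moving the \<open>x0\<close> term to the other side changes the coefficient only
    by a multiple of the parameter, which is invisible on \<open>y\<close>.\<close>
  define e where "e = \<delta>0 - ?F * b0 x0"
  have eB: "e \<in> B (Suc j)" unfolding e_def using d0 FB by (intro Bs(5,7)) auto
  have "e v = \<delta>0 v" if "v \<in> Z y" for v using F_Suc_vanishes[OF y that] by (simp add: e_def)
  then have e_nz: "nz (Z y) e" using d0(2) by (auto simp: nz_def)
  have e_red: "e * x0 - ?F * (\<Sum>g\<in>X. b0 g * g) \<in> L"
  proof -
    have "e * x0 - ?F * (\<Sum>g\<in>X. b0 g * g) = \<delta>0 * x0 - ?F * (\<Sum>g\<in>insert x0 X. b0 g * g)"
      using insert.hyps by (simp add: e_def algebra_simps)
    then show ?thesis using d0(4) by simp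
  qed
  have "\<exists>\<delta>\<in>B (Suc j). nz (Z y) \<delta> \<and> (\<exists>b. (\<forall>g\<in>X. b g \<in> B (Suc j)) \<and> \<delta> * x - ?F * (\<Sum>g\<in>X. b g * g) \<in> L)"
    if x: "x \<in> X" for x
  proof -
    obtain \<delta> b where d: "\<delta> \<in> B (Suc j)" "nz (Z y) \<delta>" "\<forall>g\<in>insert x0 X. b g \<in> B (Suc j)"
      "\<delta> * x - ?F * (\<Sum>g\<in>insert x0 X. b g * g) \<in> L" using insert.prems[of x] x by blast
    let ?b = "\<lambda>g. e * b g + ?F * b x0 * b0 g"
    have "(e * \<delta>) * x - ?F * (\<Sum>g\<in>X. ?b g * g) =
      e * (\<delta> * x - ?F * (\<Sum>g\<in>insert x0 X. b g * g)) + (?F * b x0) * (e * x0 - ?F * (\<Sum>g\<in>X. b0 g * g))"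
      using insert.hyps by (simp add: algebra_simps sum.distrib sum_distrib_left)
    moreover have "\<dots> \<in> L" using d e_red eB FB by (intro L_add L_mult Bs(5)) auto
    moreover have "e * \<delta> \<in> B (Suc j)" using eB d by (intro Bs(5))
    moreover have "nz (Z y) (e * \<delta>)" using eB d e_nz B_poly[of "Suc j"] by (intro nz_mult) auto
    moreover have "\<forall>g\<in>X. ?b g \<in> B (Suc j)" using d(3) d0(3) eB FB by (auto intro!: Bs(4,5))
    ultimately show ?thesis by (intro bexI[of _ "e * \<delta>"] conjI exI[of _ ?b]) simp_all
  qed
  then obtain c where c: "c \<in> B (Suc j)" "nz (Z y) c" "\<forall>x\<in>X. c * x \<in> L" using insert.IH by blast
  have "(c * e) * x0 = c * (e * x0 - ?F * (\<Sum>g\<in>X. b0 g * g)) + (\<Sum>g\<in>X. (?F * b0 g) * (c * g))"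
    by (simp add: algebra_simps sum_distrib_left)
  moreover have "(?F * b0 g) * (c * g) \<in> L" if "g \<in> X" for g
    by (rule L_mult) (use c(3) d0(3) FB that in \<open>auto intro: Bs(5)\<close>)
  then have "(\<Sum>g\<in>X. (?F * b0 g) * (c * g)) \<in> L"
    by (intro sum_closed) auto
  ultimately have "(c * e) * x0 \<in> L" using L_add L_mult[OF c(1) e_red] by simp
  moreover have "(c * e) * x \<in> L" if "x \<in> X" for x
    using L_mult[OF eB, of "c * x"] c(3) that by (simp add: mult_ac)
  moreover have "c * e \<in> B (Suc j)" using c eB by (intro Bs(5))
  moreover have "nz (Z y) (c * e)" using c eB e_nz B_poly[of "Suc j"] by (intro nz_mult) auto
  ultimately show ?case by (intro bexI[of _ "c * e"] conjI ballI) blast+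
qed

text \<open>Up to a denominator \<open>c\<close> prime to \<open>F\<close>, the ring is free over \<open>B\<close> on elements \<open>E\<close> that are
  independent modulo \<open>F\<close>; in a free module, divisibility of \<open>s u\<close> by a power of the prime \<open>F\<close>
  passes to \<open>u\<close>.\<close>

lemma saturation:
  assumes rk: "rk (Some p) = Suc j" and y: "rk y = j"
  shows "\<exists>c\<in>B (Suc j). nz (Z y) c \<and> (\<forall>u\<in>polyfun S. \<forall>s\<in>B (Suc j). \<forall>m. \<forall>w\<in>polyfun S. nz (Z y) s \<longrightarrow>
     (\<forall>v\<in>Z (Some p). s v * u v = F (Suc j) v ^ m * w v) \<longrightarrow>
     (\<exists>z\<in>polyfun S. \<forall>v\<in>Z (Some p). c v * u v = F (Suc j) v ^ m * z v))"
proof -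
  let ?F = "F (Suc j)" and ?B = "B (Suc j)" and ?Z = "Z (Some p)"
  note Bs = B_intros[where j="Suc j"]
  have FB: "?F \<in> ?B" by (rule F_in_B_Suc)
  have BP: "b \<in> polyfun S" if "b \<in> ?B" for b using that B_poly by blast
  have Fnz: "nz ?Z ?F" using F_nz[of p] rk by simp
  obtain X where X: "finite X" "X \<subseteq> polyfun S"
    and span: "\<And>\<phi>. \<phi> \<in> polyfun S \<Longrightarrow> \<exists>\<beta>. (\<forall>g\<in>X. \<beta> g \<in> ?B) \<and> (\<forall>v\<in>?Z. \<phi> v = (\<Sum>g\<in>X. \<beta> g v * g v))"
    using finite_over_B[of "Some p"] unfolding rk by blast
  \<comment> \<open>Linear independence modulo the last parameter: in a combination divisible by it,
    each coefficient vanishes on \<open>y\<close> and is therefore divisible by it.\<close>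
  define indep where "indep E \<longleftrightarrow> (\<forall>\<beta> w. (\<forall>e\<in>E. \<beta> e \<in> ?B) \<longrightarrow> w \<in> polyfun S \<longrightarrow>
     (\<forall>v\<in>?Z. (\<Sum>e\<in>E. \<beta> e v * e v) = ?F v * w v) \<longrightarrow> (\<forall>e\<in>E. \<not> nz (Z y) (\<beta> e)))" for E
  have fin: "finite {E. E \<subseteq> X \<and> indep E}" using X(1) by simp
  have "indep {}" by (simp add: indep_def)
  then have ne: "{E. E \<subseteq> X \<and> indep E} \<noteq> {}" by blast
  from finite_has_maximal[OF fin ne] obtain E where E0: "E \<in> {E. E \<subseteq> X \<and> indep E}"
    and E1: "\<forall>E'\<in>{E. E \<subseteq> X \<and> indep E}. E \<subseteq> E' \<longrightarrow> E = E'" by (rule bexE)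
  have E: "E \<subseteq> X" "indep E" using E0 by auto
  have finE: "finite E" using E X finite_subset by blast
  have EP: "e \<in> polyfun S" if "e \<in> E" for e using that E X by blast
  define L where "L = {\<phi>. \<exists>\<beta>. (\<forall>e\<in>E. \<beta> e \<in> ?B) \<and> (\<forall>v\<in>?Z. \<phi> v = (\<Sum>e\<in>E. \<beta> e v * e v))}"
  have LI: "\<phi> \<in> L" if "\<And>e. e \<in> E \<Longrightarrow> \<beta> e \<in> ?B" "\<And>v. v \<in> ?Z \<Longrightarrow> \<phi> v = (\<Sum>e\<in>E. \<beta> e v * e v)" for \<phi> \<beta>
    using that unfolding L_def by blast
  have L_0: "0 \<in> L" by (rule LI[of "\<lambda>_. 0"]) (auto intro: Bs(2))
  have L_add: "\<phi> + \<psi> \<in> L" if phi: "\<phi> \<in> L" and psi: "\<psi> \<in> L" for \<phi> \<psi>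
  proof -
    obtain \<beta> \<gamma> where "\<forall>e\<in>E. \<beta> e \<in> ?B" "\<forall>v\<in>?Z. \<phi> v = (\<Sum>e\<in>E. \<beta> e v * e v)"
      "\<forall>e\<in>E. \<gamma> e \<in> ?B" "\<forall>v\<in>?Z. \<psi> v = (\<Sum>e\<in>E. \<gamma> e v * e v)" using phi psi unfolding L_def by blast
    then show ?thesis by (intro LI[of "\<lambda>e. \<beta> e + \<gamma> e"]) (auto intro: Bs(4) simp: sum.distrib algebra_simps)
  qed
  have L_mult: "b * \<phi> \<in> L" if b: "b \<in> ?B" and phi: "\<phi> \<in> L" for b \<phi>
  proof -
    obtain \<beta> where "\<forall>e\<in>E. \<beta> e \<in> ?B" "\<forall>v\<in>?Z. \<phi> v = (\<Sum>e\<in>E. \<beta> e v * e v)" using phi unfolding L_def by blast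
    then show ?thesis using b by (intro LI[of "\<lambda>e. b * \<beta> e"]) (auto intro: Bs(5) simp: sum_distrib_left mult.assoc)
  qed
  have L_cong: "\<phi> \<in> L" if "\<psi> \<in> L" "\<And>v. v \<in> ?Z \<Longrightarrow> \<phi> v = \<psi> v" for \<phi> \<psi>
    using that unfolding L_def by auto
  have L_sum: "sum h J \<in> L" if "\<And>i. i \<in> J \<Longrightarrow> h i \<in> L" for h :: "'j \<Rightarrow> _" and J
    using that by (induction J rule: infinite_finite_induct) (auto intro: L_0 L_add)
  have "\<exists>c\<in>?B. nz (Z y) c \<and> (\<forall>x\<in>X. c * x \<in> L)"
  proof (rule eliminate[OF y L_add L_0 L_mult X(1)])
    fix x assume x: "x \<in> X"
    show "\<exists>\<delta>\<in>?B. nz (Z y) \<delta> \<and> (\<exists>b. (\<forall>g\<in>X. b g \<in> ?B) \<and> \<delta> * x - ?F * (\<Sum>g\<in>X. b g * g) \<in> L)"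
    proof (cases "x \<in> E")
      case True
      have "x \<in> L"
      proof (rule LI[of "\<lambda>e. if e = x then 1 else 0"])
        fix v
        have "(\<Sum>e\<in>E. (if e = x then 1 else 0) v * e v) = (\<Sum>e\<in>E. if e = x then x v else 0)" by (intro sum.cong) auto
        then show "x v = (\<Sum>e\<in>E. (if e = x then 1 else 0) v * e v)" using True finE by simp
      qed (use Bs in auto)
      moreover have "1 * x - ?F * (\<Sum>g\<in>X. 0 * g) = x" by simp
      ultimately have "1 * x - ?F * (\<Sum>g\<in>X. 0 * g) \<in> L" by (simp only:)
      then show ?thesis using Bs(2,3) nz_one by (intro bexI[of _ 1] conjI exI[of _ "\<lambda>_. 0"]) blast+
    next
      case False
      \<comment> \<open>\<open>E\<close> is maximal, so \<open>x\<close> satisfies a relation modulo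
        the parameter. Its coefficient at \<open>x\<close> does not vanish on \<open>y\<close>:
        otherwise this term could be moved to the right, leaving a forbidden relation among
        \<open>E\<close>.\<close>
      have "\<not> indep (insert x E)" using E1 x E False by blast
      then obtain \<beta> w e0 where bw: "\<forall>e\<in>insert x E. \<beta> e \<in> ?B" "w \<in> polyfun S"
        "\<forall>v\<in>?Z. (\<Sum>e\<in>insert x E. \<beta> e v * e v) = ?F v * w v" "e0 \<in> insert x E" "nz (Z y) (\<beta> e0)"
        unfolding indep_def not_all not_imp Set.ball_simps(10) not_not by (elim exE conjE bexE) (rule that)
      have eq: "\<beta> x v * x v + (\<Sum>e\<in>E. \<beta> e v * e v) = ?F v * w v" if "v \<in> ?Z" for v
        using bw(3) that False finE by simp
      have "nz (Z y) (\<beta> x)"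
      proof (rule ccontr)
        assume n: "\<not> nz (Z y) (\<beta> x)"
        then obtain b' where b': "b' \<in> ?B" "\<beta> x = ?F * b'" using B_divisible[OF y, of "\<beta> x"] bw(1) by blast
        have "\<forall>v\<in>?Z. (\<Sum>e\<in>E. \<beta> e v * e v) = ?F v * (w - b' * x) v"
          using eq unfolding b'(2) by (auto simp: algebra_simps)
        moreover have "w - b' * x \<in> polyfun S" using bw(2) b' BP x X(2) by (intro polyfun_intros(5,7)) auto
        ultimately have "\<forall>e\<in>E. \<not> nz (Z y) (\<beta> e)" using E(2) bw(1) unfolding indep_def by blast
        then show False using n bw(4,5) by blast
      qed
      moreover obtain b where b: "\<forall>g\<in>X. b g \<in> ?B" "\<forall>v\<in>?Z. w v = (\<Sum>g\<in>X. b g v * g v)" using span[OF bw(2)] by blast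
      moreover have "\<beta> x * x - ?F * (\<Sum>g\<in>X. b g * g) \<in> L"
      proof (rule LI[of "\<lambda>e. - \<beta> e"])
        fix v assume v: "v \<in> ?Z"
        have "\<beta> x v * x v - ?F v * w v = - (\<Sum>e\<in>E. \<beta> e v * e v)" using eq[OF v] by (simp add: algebra_simps eq_neg_iff_add_eq_0)
        then show "(\<beta> x * x - ?F * (\<Sum>g\<in>X. b g * g)) v = (\<Sum>e\<in>E. (- \<beta> e) v * e v)"
          using b(2) v by (simp add: sum_negf)
      qed (use bw(1) Bs(6) in auto)
      moreover have "\<beta> x \<in> ?B" using bw(1) by simp
      ultimately show ?thesis by blast
    qed
  qed
  then obtain c where c: "c \<in> ?B" "nz (Z y) c" "\<forall>x\<in>X. c * x \<in> L" by blast
  \<comment> \<open>One power at a time: by independence \<open>s * \<beta> e\<close> vanishes on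
    \<open>y\<close>, hence so does \<open>\<beta> e\<close>, as \<open>s\<close> does not. So all
    \<open>\<beta> e\<close> are divisible by the parameter, which is then cancelled.\<close>
  have divide: "\<exists>z\<in>polyfun S. \<forall>v\<in>?Z. (\<Sum>e\<in>E. \<beta> e v * e v) = ?F v ^ m * z v"
    if "s \<in> ?B" "nz (Z y) s" "\<forall>e\<in>E. \<beta> e \<in> ?B" "w \<in> polyfun S" "\<forall>v\<in>?Z. s v * (\<Sum>e\<in>E. \<beta> e v * e v) = ?F v ^ m * w v"
    for s \<beta> w m
    using that(3-5)
  proof (induction m arbitrary: \<beta> w)
    case 0
    have "(\<Sum>e\<in>E. \<beta> e * e) \<in> polyfun S" using 0 BP EP by (intro polyfun_intros(5,9)) auto
    then show ?case by (intro bexI[of _ "\<Sum>e\<in>E. \<beta> e * e"]) auto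
  next
    case (Suc m)
    have "\<forall>v\<in>?Z. (\<Sum>e\<in>E. (s * \<beta> e) v * e v) = ?F v * (?F ^ m * w) v"
      using Suc.prems(3) by (simp add: sum_distrib_left mult_ac)
    moreover have "?F ^ m * w \<in> polyfun S" using Suc.prems F_poly by (intro polyfun_intros(5,8))
    moreover have "\<forall>e\<in>E. s * \<beta> e \<in> ?B" using Suc.prems that(1) by (auto intro: Bs(5))
    ultimately have "\<forall>e\<in>E. \<not> nz (Z y) (s * \<beta> e)" using E(2)[unfolded indep_def, rule_format, of "\<lambda>e. s * \<beta> e"] by blast
    then have "\<forall>e\<in>E. \<not> nz (Z y) (\<beta> e)" using nz_mult[of s] that(1,2) Suc.prems(1) BP by blast
    then have "\<forall>e\<in>E. \<exists>b. b \<in> ?B \<and> \<beta> e = ?F * b" using B_divisible[OF y] Suc.prems(1) by blast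
    from bchoice[OF this] obtain \<gamma> where g: "\<forall>e\<in>E. \<gamma> e \<in> ?B \<and> \<beta> e = ?F * \<gamma> e" by blast
    have sum_eq: "(\<Sum>e\<in>E. \<beta> e v * e v) = ?F v * (\<Sum>e\<in>E. \<gamma> e v * e v)" for v
      using g by (simp add: sum_distrib_left mult_ac)
    have gP: "(\<Sum>e\<in>E. \<gamma> e * e) \<in> polyfun S" using g BP EP by (intro polyfun_intros(5,9)) auto
    have "\<forall>v\<in>?Z. (s * (\<Sum>e\<in>E. \<gamma> e * e)) v = (?F ^ m * w) v"
    proof (rule cancel[OF _ _ F_poly Fnz])
      show "s * (\<Sum>e\<in>E. \<gamma> e * e) \<in> polyfun S" using gP that(1) BP by (intro polyfun_intros(5)) auto
      show "?F ^ m * w \<in> polyfun S" by fact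
      show "\<forall>v\<in>?Z. ?F v * (s * (\<Sum>e\<in>E. \<gamma> e * e)) v = ?F v * (?F ^ m * w) v"
        using Suc.prems(3) unfolding sum_eq by (simp add: mult_ac)
    qed
    then have "\<forall>v\<in>?Z. s v * (\<Sum>e\<in>E. \<gamma> e v * e v) = ?F v ^ m * w v" by simp
    with g Suc.prems(2) obtain z where "z \<in> polyfun S" "\<forall>v\<in>?Z. (\<Sum>e\<in>E. \<gamma> e v * e v) = ?F v ^ m * z v"
      using Suc.IH[of \<gamma> w] by blast
    then show ?case unfolding sum_eq by (intro bexI[of _ z]) (auto simp: mult.assoc)
  qed
  have sat: "\<exists>z\<in>polyfun S. \<forall>v\<in>?Z. c v * u v = ?F v ^ m * z v"
    if u: "u \<in> polyfun S" and s: "s \<in> ?B" "nz (Z y) s" and w: "w \<in> polyfun S" "\<forall>v\<in>?Z. s v * u v = ?F v ^ m * w v" for u s m w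
  proof -
    obtain b where b: "\<forall>g\<in>X. b g \<in> ?B" "\<forall>v\<in>?Z. u v = (\<Sum>g\<in>X. b g v * g v)" using span[OF u] by blast
    have "b g * (c * g) \<in> L" if "g \<in> X" for g using L_mult[of "b g" "c * g"] b(1) c(3) that by blast
    then have "(\<Sum>g\<in>X. b g * (c * g)) \<in> L" by (rule L_sum)
    then have "c * u \<in> L"
      by (rule L_cong) (use b(2) in \<open>auto simp: sum_distrib_left mult_ac\<close>)
    then obtain \<beta> where beta: "\<forall>e\<in>E. \<beta> e \<in> ?B" "\<forall>v\<in>?Z. (c * u) v = (\<Sum>e\<in>E. \<beta> e v * e v)" unfolding L_def by blast
    have "\<forall>v\<in>?Z. s v * (\<Sum>e\<in>E. \<beta> e v * e v) = ?F v ^ m * (c * w) v"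
    proof
      fix v assume v: "v \<in> ?Z"
      have "(\<Sum>e\<in>E. \<beta> e v * e v) = c v * u v" using beta(2)[rule_format, OF v] by simp
      then have "s v * (\<Sum>e\<in>E. \<beta> e v * e v) = c v * (s v * u v)" by (simp add: mult_ac)
      also have "\<dots> = c v * (?F v ^ m * w v)" using w(2) v by simp
      finally show "s v * (\<Sum>e\<in>E. \<beta> e v * e v) = ?F v ^ m * (c * w) v" by (simp add: mult_ac)
    qed
    moreover have "c * w \<in> polyfun S" using c(1) BP w(1) by (intro polyfun_intros(5)) auto
    ultimately obtain z where "z \<in> polyfun S" "\<forall>v\<in>?Z. (\<Sum>e\<in>E. \<beta> e v * e v) = ?F v ^ m * z v"
      using divide[OF s beta(1)] by blast
    then show ?thesis using beta(2) by (intro bexI[of _ z]) auto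
  qed
  show ?thesis by (intro bexI[OF _ c(1)] conjI c(2) ballI allI impI) (rule sat)
qed

text \<open>If a divisor had smaller rank, then \<open>F (Suc j)\<close> and \<open>F j\<close> would both vanish on it, and since the
  local ring is a discrete valuation ring, \<open>F j\<close> would be divisible by \<open>F (Suc j)\<close> up to a power and
  a local unit \<open>s\<close>.\<close>

lemma cover_rank:
  assumes cov: "covers S (Some p) q" shows "rk (Some p) = Suc (rk q)"
proof (rule ccontr)
  assume ne: "rk (Some p) \<noteq> Suc (rk q)"
  obtain j where j: "rk (Some p) = Suc j" using rk_Some by blast
  have lt: "rk q < j" using rk_less[OF covers_less[OF cov]] ne j by simp
  obtain y where y: "Z y \<subset> Z (Some p)" "rk y = j" using rk_pred[OF j] by blast
  obtain p' where p': "y = Some p'" using y(2) lt rk_None by (cases y) auto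
  let ?F = "F (Suc j)" and ?G = "F j"
  have Gy: "nz (Z y) ?G" using F_nz[of p'] y(2) p' by simp
  have Gp: "nz (Z (Some p)) ?G" using nz_mono[OF _ Gy] y(1) by blast
  have Fp: "nz (Z (Some p)) ?F" using F_nz[of p] j by simp
  have GB: "?G \<in> B (Suc j)" using lt by (intro F_in_B) auto
  have vanish: "\<not> nz (Z q) ?F" "\<not> nz (Z q) ?G" using F_vanishes[of q] lt by (auto simp: nz_def)
  define a where "a = ord p q ?F"
  have "ord p q ?G > 0" using ord_pos[OF cov F_poly Gp] vanish by simp
  then have "a \<le> ord p q (?G ^ a)" using ord_power[OF cov F_poly Gp] by simp
  then obtain s r where sr: "s \<in> polyfun S" "r \<in> polyfun S" "nz (Z q) s" "\<forall>v\<in>Z (Some p). s v * (?G ^ a) v = r v * ?F v"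
    using ord_le[OF cov polyfun_intros(8)[OF F_poly] F_poly nz_power[OF F_poly Gp] Fp] unfolding a_def by blast
  have sp: "nz (Z (Some p)) s" using nz_mono[OF _ sr(3)] covers_less[OF cov] by blast
  obtain c where c: "c \<in> B (Suc j)" "nz (Z y) c"
    and sat: "\<And>u s m w. u \<in> polyfun S \<Longrightarrow> s \<in> B (Suc j) \<Longrightarrow> w \<in> polyfun S \<Longrightarrow> nz (Z y) s \<Longrightarrow>
     \<forall>v\<in>Z (Some p). s v * u v = ?F v ^ m * w v \<Longrightarrow> \<exists>z\<in>polyfun S. \<forall>v\<in>Z (Some p). c v * u v = ?F v ^ m * z v"
    using saturation[OF j y(2)] by blast
  have cP: "c \<in> polyfun S" using c B_poly by blast
  have cp: "nz (Z (Some p)) c" using nz_mono[OF _ c(2)] y(1) by blast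
  \<comment> \<open>\<open>s\<close> does not vanish on the divisor, so \<open>c * s ^ k\<close> has
    the order of \<open>c\<close>. But it is divisible by \<open>?F ^ k\<close>, which has order at
    least \<open>k\<close>; one more than the order of \<open>c\<close> is a contradiction.\<close>
  define k where "k = Suc (ord p q c)"
  have "\<exists>z\<in>polyfun S. \<forall>v\<in>Z (Some p). c v * (s ^ k) v = ?F v ^ k * z v"
  proof (rule sat)
    show "s ^ k \<in> polyfun S" "r ^ k \<in> polyfun S" using sr by (auto intro: polyfun_intros)
    show "?G ^ (a * k) \<in> B (Suc j)" using GB by (rule B_intros(8))
    show "nz (Z y) (?G ^ (a * k))" by (rule nz_power[OF F_poly Gy])
    show "\<forall>v\<in>Z (Some p). (?G ^ (a * k)) v * (s ^ k) v = ?F v ^ k * (r ^ k) v"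
    proof
      fix v assume "v \<in> Z (Some p)"
      then have "s v * ?G v ^ a = r v * ?F v" using sr(4) by simp
      then have "(s v * ?G v ^ a) ^ k = (r v * ?F v) ^ k" by simp
      then show "(?G ^ (a * k)) v * (s ^ k) v = ?F v ^ k * (r ^ k) v"
        by (simp add: power_mult_distrib power_mult mult.commute)
    qed
  qed
  then obtain z where z: "z \<in> polyfun S" "\<forall>v\<in>Z (Some p). c v * (s ^ k) v = ?F v ^ k * z v" by blast
  have "nz (Z (Some p)) (c * s ^ k)" by (intro nz_mult nz_power cP sr cp sp polyfun_intros(8))
  then obtain v where v: "v \<in> Z (Some p)" "(c * s ^ k) v \<noteq> 0" unfolding nz_def by (rule bexE)
  then have "z v \<noteq> 0" using z(2)[rule_format, OF v(1)] by auto
  then have zp: "nz (Z (Some p)) z" using v(1) unfolding nz_def by (rule bexI)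
  have "ord p q (c * s ^ k) = ord p q (?F ^ k * z)"
    using z by (intro ord_cong[OF cov] polyfun_intros cP sr F_poly) auto
  moreover have "ord p q (c * s ^ k) = ord p q c + k * ord p q s"
    using ord_mult[OF cov cP polyfun_intros(8)[OF sr(1)] cp nz_power[OF sr(1) sp]] ord_power[OF cov sr(1) sp] by simp
  moreover have "ord p q s = 0" using ord_pos[OF cov sr(1) sp] sr(3) by simp
  moreover have "ord p q (?F ^ k * z) = k * a + ord p q z"
    using ord_mult[OF cov polyfun_intros(8)[OF F_poly] z(1) nz_power[OF F_poly Fp] zp] ord_power[OF cov F_poly Fp] by (simp add: a_def)
  moreover have "a > 0" using ord_pos[OF cov F_poly Fp] vanish by (simp add: a_def)
  then have "k \<le> k * a" by simp
  ultimately show False by (simp add: k_def)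
qed

text \<open>\<open>T\<close> is the ideal of denominators that make \<open>u\<close> divisible by
  the power of the parameter. Each divisor \<open>q\<close> contributes some \<open>t q\<close> in
  \<open>T\<close> that agrees on \<open>q\<close> with a non-zero \<open>b q\<close> in
  \<open>B j\<close>. The product of the differences vanishes wherever the parameter does, so by the
  Nullstellensatz a power of it lies in \<open>T\<close>. Modulo \<open>T\<close> this is a power of
  the product of the \<open>b q\<close>, an element of \<open>B j\<close> that vanishes on no
  stratum of rank \<open>j\<close>.\<close>

lemma locally_divisible:
  assumes rk: "rk (Some p) = Suc j" and y: "rk y = j" and u: "u \<in> polyfun S" "nz (Z (Some p)) u"
    and ord: "\<And>q. covers S (Some p) q \<Longrightarrow> m * ord p q (F (Suc j)) \<le> ord p q u"
  shows "\<exists>s\<in>B (Suc j). \<exists>w\<in>polyfun S. nz (Z y) s \<and> (\<forall>v\<in>Z (Some p). s v * u v = F (Suc j) v ^ m * w v)"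
proof -
  let ?F = "F (Suc j)" and ?Z = "Z (Some p)" and ?Q = "{q. covers S (Some p) q}"
  have Fnz: "nz ?Z ?F" using F_nz[of p] rk by simp
  define T where "T = {x \<in> polyfun S. \<exists>w\<in>polyfun S. \<forall>v\<in>?Z. x v * u v = ?F v ^ m * w v}"
  have T_add: "a + b \<in> T" if ab: "a \<in> T" "b \<in> T" for a b
  proof -
    obtain w w' where "w \<in> polyfun S" "w' \<in> polyfun S" "\<forall>v\<in>?Z. a v * u v = ?F v ^ m * w v" "\<forall>v\<in>?Z. b v * u v = ?F v ^ m * w' v"
      using ab unfolding T_def by blast
    then show ?thesis using ab unfolding T_def by (auto intro!: bexI[of _ "w + w'"] polyfun_intros simp: algebra_simps)
  qed
  have T_mult: "c * a \<in> T" if c: "c \<in> polyfun S" and a: "a \<in> T" for a c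
  proof -
    obtain w where "w \<in> polyfun S" "\<forall>v\<in>?Z. a v * u v = ?F v ^ m * w v" using a unfolding T_def by blast
    then show ?thesis using a c unfolding T_def by (auto intro!: bexI[of _ "c * w"] polyfun_intros simp: mult_ac)
  qed
  have T_0: "0 \<in> T" unfolding T_def by (auto intro!: bexI[of _ 0] polyfun_intros)
  have "\<forall>q\<in>?Q. \<exists>bt. fst bt \<in> B j \<and> snd bt \<in> T \<and> nz (Z q) (fst bt) \<and> (\<forall>v\<in>Z q. fst bt v = snd bt v)"
  proof
    fix q assume "q \<in> ?Q"
    then have cov: "covers S (Some p) q" by simp
    have rq: "rk q = j" using cover_rank[OF cov] rk by simp
    have "ord p q (?F ^ m) \<le> ord p q u" using ord[OF cov] ord_power[OF cov F_poly Fnz] by simp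
    then obtain s r where sr: "s \<in> polyfun S" "r \<in> polyfun S" "nz (Z q) s" "\<forall>v\<in>?Z. s v * u v = r v * (?F ^ m) v"
      using ord_le[OF cov u(1) polyfun_intros(8)[OF F_poly] u(2) nz_power[OF F_poly Fnz]] by blast
    then have sT: "s \<in> T" unfolding T_def by (auto intro!: bexI[of _ r] simp: mult.commute)
    obtain t b where tb: "t \<in> polyfun S" "b \<in> B j" "nz (Z q) b" "\<forall>v\<in>Z q. b v = s v * t v"
      using algebraic_over_B[OF sr(1,3)] unfolding rq by blast
    have "t * s \<in> T" by (rule T_mult[OF tb(1) sT])
    then show "\<exists>bt. fst bt \<in> B j \<and> snd bt \<in> T \<and> nz (Z q) (fst bt) \<and> (\<forall>v\<in>Z q. fst bt v = snd bt v)"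
      using tb by (intro exI[of _ "(b, t * s)"]) (auto simp: mult.commute)
  qed
  from bchoice[OF this] obtain bt where bt: "\<forall>q\<in>?Q. fst (bt q) \<in> B j \<and> snd (bt q) \<in> T \<and> nz (Z q) (fst (bt q)) \<and> (\<forall>v\<in>Z q. fst (bt q) v = snd (bt q) v)"
    by blast
  define b t where "b q = fst (bt q)" and "t q = snd (bt q)" for q
  have bt: "b q \<in> B j" "t q \<in> T" "nz (Z q) (b q)" "\<And>v. v \<in> Z q \<Longrightarrow> b q v = t q v" if "q \<in> ?Q" for q
    using bt that unfolding b_def t_def by auto
  have bP: "b q \<in> polyfun S" and tP: "t q \<in> polyfun S" if "q \<in> ?Q" for q using bt[OF that] B_poly by (auto simp: T_def)
  \<comment> \<open>Modulo \<open>T\<close> the factors \<open>b q - t q\<close> and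
    \<open>b q\<close> are the same.\<close>
  have prod_T: "finite Q \<Longrightarrow> Q \<subseteq> ?Q \<Longrightarrow> (\<Prod>q\<in>Q. b q) - (\<Prod>q\<in>Q. b q - t q) \<in> T" for Q
  proof (induction Q rule: finite_induct)
    case (insert q Q)
    have q: "q \<in> ?Q" and Q: "Q \<subseteq> ?Q" using insert.prems by simp_all
    have PP: "(\<Prod>q\<in>Q. b q - t q) \<in> polyfun S" using Q bP tP by (intro polyfun_intros) blast+
    have "(\<Prod>q\<in>insert q Q. b q) - (\<Prod>q\<in>insert q Q. b q - t q) =
        b q * ((\<Prod>q\<in>Q. b q) - (\<Prod>q\<in>Q. b q - t q)) + (\<Prod>q\<in>Q. b q - t q) * t q"
      using insert.hyps by (simp add: algebra_simps)
    moreover have "\<dots> \<in> T" by (rule T_add[OF T_mult[OF bP[OF q] insert.IH[OF Q]] T_mult[OF PP bt(2)[OF q]]])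
    ultimately show ?case by (simp only:)
  qed (simp add: T_0)
  let ?b = "\<Prod>q\<in>?Q. b q" and ?g = "\<Prod>q\<in>?Q. b q - t q"
  have P: "?b \<in> polyfun S" "?g \<in> polyfun S" using bP tP by (intro polyfun_intros; blast)+
  have pow_T: "?b ^ M - ?g ^ M \<in> T" for M
  proof (induction M)
    case (Suc M)
    have "?b ^ Suc M - ?g ^ Suc M = ?b * (?b ^ M - ?g ^ M) + ?g ^ M * (?b - ?g)" by (simp add: algebra_simps)
    moreover have "\<dots> \<in> T"
      by (rule T_add[OF T_mult[OF P(1) Suc.IH] T_mult[OF polyfun_intros(8)[OF P(2)] prod_T[OF _ subset_refl]]]) simp
    ultimately show ?case by (simp only:)
  qed (simp only: power_0 diff_self T_0)
  obtain E where E: "E \<subseteq> polyfun S" "?Z = {v \<in> prod_space S UNIV. \<forall>\<phi>\<in>E. \<phi> v = 0}"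
    using cone_closed[of p] unfolding affine_closed_def by (elim exE conjE) (rule that)
  \<comment> \<open>The Nullstellensatz for an ideal with the single generator
    \<open>?F ^ m\<close>, hence the one-element index set.\<close>
  have "\<exists>M r. (\<forall>i\<in>{()}. r i \<in> polyfun S) \<and> (\<forall>v\<in>?Z. ?g v ^ M = (\<Sum>i\<in>{()}. (?F ^ m) v * r i v))"
  proof (rule nullstellensatz[OF E])
    fix v assume v: "v \<in> ?Z" and "\<And>i. i \<in> {()} \<Longrightarrow> (?F ^ m) v = 0"
    then have "?F v = 0" by simp
    then have "f p v = 0" using F_zero_iff[OF v] rk by simp
    then have "v \<in> (\<Union>q\<in>?Q. Z q)" using v by (simp flip: f_zero_set)
    then obtain q where q: "q \<in> ?Q" "v \<in> Z q" by auto
    then have "(b q - t q) v = 0" using bt(4)[OF q] by simp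
    then show "?g v = 0" using q(1) unfolding prod_fun_apply by (intro prod_zero) auto
  qed (simp, intro polyfun_intros(8) F_poly, rule P(2))
  then have "\<exists>M r. r () \<in> polyfun S \<and> (\<forall>v\<in>?Z. ?g v ^ M = (?F ^ m) v * r () v)" by (simp del: prod_fun_apply)
  then obtain M r where r: "r () \<in> polyfun S" "\<forall>v\<in>?Z. ?g v ^ M = (?F ^ m) v * r () v"
    by (elim exE conjE) (rule that)
  have "\<forall>v\<in>?Z. (?g ^ M) v * u v = ?F v ^ m * (r () * u) v"
  proof
    fix v assume "v \<in> ?Z"
    show "(?g ^ M) v * u v = ?F v ^ m * (r () * u) v"
      unfolding power_fun_apply[of ?g] r(2)[rule_format, OF \<open>v \<in> ?Z\<close>] by (simp add: mult.assoc)
  qed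
  moreover have "?g ^ M \<in> polyfun S" "r () * u \<in> polyfun S" by (rule polyfun_intros P r u)+
  ultimately have "?g ^ M \<in> T" unfolding T_def by blast
  then have "(?b ^ M - ?g ^ M) + ?g ^ M \<in> T" by (rule T_add[OF pow_T])
  then have "?b ^ M \<in> T" by (simp only: diff_add_cancel)
  moreover have "?b \<in> B j" using bt(1) by (intro B_intros(10)) auto
  then have "?b ^ M \<in> B (Suc j)" using B_Suc[of j] by (intro B_intros(8)) auto
  moreover have "nz (Z y) (b q)" if q: "q \<in> ?Q" for q
  proof (rule ccontr)
    assume "\<not> nz (Z y) (b q)"
    then have "b q = 0" by (rule B_zero[OF y bt(1)[OF q]])
    then show False using bt(3)[OF q] by (simp add: nz_def)
  qed
  then have "nz (Z y) (?b ^ M)" using bP P by (intro nz_power nz_prod) auto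
  ultimately show ?thesis unfolding T_def by blast
qed

text \<open>The denominator in \<open>locally_divisible\<close> depends on \<open>u\<close> and
  \<open>m\<close>; \<open>saturation\<close> exchanges it for a fixed one.\<close>

lemma uniformly_divisible:
  "\<exists>c\<in>B (rk (Some p)). (\<forall>q. covers S (Some p) q \<longrightarrow> nz (Z q) c) \<and>
    (\<forall>u\<in>polyfun S. \<forall>m. nz (Z (Some p)) u \<longrightarrow>
       (\<forall>q. covers S (Some p) q \<longrightarrow> m * ord p q (F (rk (Some p))) \<le> ord p q u) \<longrightarrow>
       (\<exists>z\<in>polyfun S. \<forall>v\<in>Z (Some p). c v * u v = F (rk (Some p)) v ^ m * z v))"
proof -
  obtain j where j: "rk (Some p) = Suc j" using rk_Some by blast
  obtain y where y: "rk y = j" using rk_pred[OF j] by blast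
  obtain c where c: "c \<in> B (Suc j)" "nz (Z y) c"
    and sat: "\<And>u s m w. u \<in> polyfun S \<Longrightarrow> s \<in> B (Suc j) \<Longrightarrow> w \<in> polyfun S \<Longrightarrow> nz (Z y) s \<Longrightarrow>
     \<forall>v\<in>Z (Some p). s v * u v = F (Suc j) v ^ m * w v \<Longrightarrow> \<exists>z\<in>polyfun S. \<forall>v\<in>Z (Some p). c v * u v = F (Suc j) v ^ m * z v"
    using saturation[OF j y] by blast
  have "nz (Z q) c" if "covers S (Some p) q" for q
    using nz_B_independent[OF y _ c] cover_rank[OF that] j by simp
  moreover have "\<exists>z\<in>polyfun S. \<forall>v\<in>Z (Some p). c v * u v = F (Suc j) v ^ m * z v"
    if u: "u \<in> polyfun S" "nz (Z (Some p)) u" "\<And>q. covers S (Some p) q \<Longrightarrow> m * ord p q (F (Suc j)) \<le> ord p q u" for u m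
  proof -
    obtain s w where "s \<in> B (Suc j)" "w \<in> polyfun S" "nz (Z y) s" "\<forall>v\<in>Z (Some p). s v * u v = F (Suc j) v ^ m * w v"
      using locally_divisible[OF j y u] by blast
    then show ?thesis using sat[OF u(1)] by blast
  qed
  ultimately show ?thesis unfolding j using c(1) by blast
qed

end

section \<open>Almost integral quotients\<close>

context seshadri
begin

lemma nz_cong: "\<forall>v\<in>W. \<phi> v = \<psi> v \<Longrightarrow> nz W \<phi> \<longleftrightarrow> nz W \<psi>"
  unfolding nz_def by simp

lemma nz_factor: "nz W (\<phi> * \<psi>) \<Longrightarrow> nz W \<phi>"
  by (auto simp: nz_def)

lemma nz_quotient:
  assumes "a \<in> polyfun S" "nz (Z x) a" "c \<in> polyfun S" "nz (Z x) c"
    and eq: "\<forall>v\<in>Z x. c v * a v ^ k = e v * b v ^ k"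
  shows "nz (Z x) e"
proof -
  have "nz (Z x) (c * a ^ k)" using assms by (intro nz_mult nz_power polyfun_intros)
  moreover have "\<forall>v\<in>Z x. (c * a ^ k) v = (e * b ^ k) v" using eq by simp
  ultimately have "nz (Z x) (e * b ^ k)" using nz_cong by blast
  then show ?thesis by (rule nz_factor)
qed

lemma ord_quotient:
  assumes cov: "covers S (Some p) q"
    and a: "a \<in> polyfun S" "nz (Z (Some p)) a" and b: "b \<in> polyfun S" "nz (Z (Some p)) b"
    and c: "c \<in> polyfun S" "nz (Z (Some p)) c" and e: "e \<in> polyfun S"
    and eq: "\<forall>v\<in>Z (Some p). c v * a v ^ k = e v * b v ^ k"
  shows "ord p q c + k * ord p q a = ord p q e + k * ord p q b"
proof -
  have e': "nz (Z (Some p)) e" by (rule nz_quotient[OF a c eq])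
  have P: "a ^ k \<in> polyfun S" "b ^ k \<in> polyfun S" using a b by (intro polyfun_intros; simp)+
  have "ord p q (c * a ^ k) = ord p q (e * b ^ k)"
    by (rule ord_cong[OF cov]) (use P c e eq in \<open>auto intro: polyfun_intros\<close>)
  then show ?thesis
    unfolding ord_mult[OF cov c(1) P(1) c(2) nz_power[OF a]] ord_mult[OF cov e P(2) e' nz_power[OF b]]
      ord_power[OF cov a] ord_power[OF cov b] .
qed

text \<open>The common denominator of the powers of \<open>a / b\<close> is taken from \<open>B\<close>, where the vanishing on one
  divisor implies the vanishing on all of them.\<close>

definition almost_integral :: "'a \<Rightarrow> (('m \<Rightarrow> 'v) \<Rightarrow> 'k) \<Rightarrow> (('m \<Rightarrow> 'v) \<Rightarrow> 'k) \<Rightarrow> bool" where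
  "almost_integral p a b \<longleftrightarrow>
     (\<exists>c\<in>B (rk (Some p)). nz (Z (Some p)) c \<and> (\<forall>k. \<exists>e\<in>polyfun S. \<forall>v\<in>Z (Some p). c v * a v ^ k = e v * b v ^ k))"

text \<open>Factors of the last parameter are split off as long as \<open>c\<close> vanishes on the
  given divisor; each of them lowers the order there. What remains is non-zero on one divisor, hence
  on all.\<close>

lemma B_factor:
  assumes cov: "covers S (Some p) q" and c: "c \<in> B (rk (Some p))" "nz (Z (Some p)) c"
  shows "\<exists>n. \<exists>c'\<in>B (rk (Some p)). c = F (rk (Some p)) ^ n * c' \<and> (\<forall>q. covers S (Some p) q \<longrightarrow> nz (Z q) c')"
  using c
proof (induction "ord p q c" arbitrary: c rule: less_induct)
  case less
  define j where "j = rk q"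
  have j: "rk (Some p) = Suc j" using cover_rank[OF cov] j_def by simp
  have cB: "c \<in> B (Suc j)" using less.prems j by simp
  show ?case
  proof (cases "nz (Z q) c")
    case True
    have "nz (Z q') c" if "covers S (Some p) q'" for q'
      using nz_B_independent[OF _ _ cB True] cover_rank[OF that] j j_def by simp
    then show ?thesis using less.prems(1) by (intro exI[of _ 0] bexI[of _ c]) auto
  next
    case False
    obtain c1 where c1: "c1 \<in> B (Suc j)" "c = F (Suc j) * c1" using B_divisible[OF _ cB False] j_def by blast
    have c1P: "c1 \<in> polyfun S" using c1(1) B_poly by blast
    have c1nz: "nz (Z (Some p)) c1" using less.prems(2) c1(2) by (auto simp: nz_def)
    have Fnz: "nz (Z (Some p)) (F (Suc j))" using F_nz[of p] j by simp
    have "\<not> nz (Z q) (F (Suc j))" using F_Suc_vanishes[of q j] j_def by (auto simp: nz_def)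
    then have "ord p q (F (Suc j)) > 0" using ord_pos[OF cov F_poly Fnz] by simp
    then have "ord p q c1 < ord p q c" unfolding c1(2) ord_mult[OF cov F_poly c1P Fnz c1nz] by simp
    moreover have "c1 \<in> B (rk (Some p))" using c1(1) j by simp
    ultimately obtain n c' where "c' \<in> B (rk (Some p))" "c1 = F (rk (Some p)) ^ n * c'"
      "\<forall>q. covers S (Some p) q \<longrightarrow> nz (Z q) c'" using less.hyps[of c1] c1nz by blast
    then show ?thesis using c1(2) j by (intro exI[of _ "Suc n"] bexI[of _ c'] conjI) (simp_all only: power_Suc mult.assoc)
  qed
qed

context
  fixes p a b assumes a: "a \<in> polyfun S" "nz (Z (Some p)) a" and b: "b \<in> polyfun S" "nz (Z (Some p)) b"
    and integral: "almost_integral p a b"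
begin

text \<open>A pole of \<open>a / b\<close> would grow linearly with the exponent \<open>k\<close>,
  which the fixed order of the denominator cannot compensate.\<close>

lemma almost_integral_ord:
  assumes cov: "covers S (Some p) q" shows "ord p q b \<le> ord p q a"
proof (rule ccontr)
  assume "\<not> ?thesis"
  then have lt: "Suc (ord p q a) \<le> ord p q b" by simp
  obtain c where c: "c \<in> B (rk (Some p))" "nz (Z (Some p)) c"
    and e: "\<And>k. \<exists>e\<in>polyfun S. \<forall>v\<in>Z (Some p). c v * a v ^ k = e v * b v ^ k"
    using integral unfolding almost_integral_def by blast
  have cP: "c \<in> polyfun S" using c B_poly by blast
  define k where "k = Suc (ord p q c)"
  obtain e where e: "e \<in> polyfun S" "\<forall>v\<in>Z (Some p). c v * a v ^ k = e v * b v ^ k" using e by blast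
  have "ord p q c + k * ord p q a = ord p q e + k * ord p q b" by (rule ord_quotient[OF cov a b cP c(2) e])
  moreover have "k * Suc (ord p q a) \<le> k * ord p q b" using lt by (rule mult_le_mono2)
  ultimately show False by (simp add: k_def)
qed

text \<open>A denominator may contain a power of the parameter and then vanish on the divisors.
  Since \<open>a / b\<close> has no poles, the numerators \<open>e\<close> contain this power at
  every divisor as well, so it can be exchanged for the denominator of
  \<open>uniformly_divisible\<close>, which vanishes on none of them.\<close>

lemma almost_integral_good_denominator:
  "\<exists>c\<in>B (rk (Some p)). (\<forall>q. covers S (Some p) q \<longrightarrow> nz (Z q) c) \<and>
    (\<forall>k. \<exists>e\<in>polyfun S. \<forall>v\<in>Z (Some p). c v * a v ^ k = e v * b v ^ k)"
proof -
  let ?F = "F (rk (Some p))"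
  obtain q0 where q0: "covers S (Some p) q0" using cover_exists by blast
  obtain c where c: "c \<in> B (rk (Some p))" "nz (Z (Some p)) c"
    and e: "\<And>k. \<exists>e\<in>polyfun S. \<forall>v\<in>Z (Some p). c v * a v ^ k = e v * b v ^ k"
    using integral unfolding almost_integral_def by blast
  have cP: "c \<in> polyfun S" using c B_poly by blast
  obtain n c' where c': "c' \<in> B (rk (Some p))" "c = ?F ^ n * c'" "\<And>q. covers S (Some p) q \<Longrightarrow> nz (Z q) c'"
    using B_factor[OF q0 c] by blast
  have c'P: "c' \<in> polyfun S" using c' B_poly by blast
  have c'nz: "nz (Z (Some p)) c'" using c(2) c'(2) by (auto simp: nz_def)
  obtain d where d: "d \<in> B (rk (Some p))" "\<And>q. covers S (Some p) q \<Longrightarrow> nz (Z q) d"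
    and divides: "\<And>u m. u \<in> polyfun S \<Longrightarrow> nz (Z (Some p)) u \<Longrightarrow>
       (\<And>q. covers S (Some p) q \<Longrightarrow> m * ord p q ?F \<le> ord p q u) \<Longrightarrow>
       \<exists>z\<in>polyfun S. \<forall>v\<in>Z (Some p). d v * u v = ?F v ^ m * z v"
    using uniformly_divisible[of p] by (elim bexE conjE) (rule that, blast+)
  have dP: "d \<in> polyfun S" using d B_poly by blast
  have "\<exists>z\<in>polyfun S. \<forall>v\<in>Z (Some p). (d * c') v * a v ^ k = z v * b v ^ k" for k
  proof -
    obtain e where e: "e \<in> polyfun S" "\<forall>v\<in>Z (Some p). c v * a v ^ k = e v * b v ^ k" using e by blast
    have P: "a ^ k \<in> polyfun S" "b ^ k \<in> polyfun S" using a b by (intro polyfun_intros; simp)+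
    have enz: "nz (Z (Some p)) e" by (rule nz_quotient[OF a cP c(2) e(2)])
    have "n * ord p q ?F \<le> ord p q e" if cov: "covers S (Some p) q" for q
    proof -
      have "ord p q c + k * ord p q a = ord p q e + k * ord p q b" by (rule ord_quotient[OF cov a b cP c(2) e])
      moreover have "k * ord p q b \<le> k * ord p q a" using almost_integral_ord[OF cov] by simp
      moreover have "ord p q c = n * ord p q ?F + ord p q c'" unfolding c'(2)
        using ord_mult[OF cov polyfun_intros(8)[OF F_poly] c'P nz_power[OF F_poly F_nz] c'nz] by (simp add: ord_power[OF cov F_poly F_nz])
      ultimately show ?thesis by linarith
    qed
    then obtain z where z: "z \<in> polyfun S" "\<forall>v\<in>Z (Some p). d v * e v = ?F v ^ n * z v" using divides[OF e(1) enz] by blast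
    have "\<forall>v\<in>Z (Some p). (d * c' * a ^ k) v = (z * b ^ k) v"
    proof (rule cancel[of _ _ "?F ^ n"])
      show "d * c' * a ^ k \<in> polyfun S" "z * b ^ k \<in> polyfun S" "?F ^ n \<in> polyfun S"
        by (rule P dP c'P z(1) F_poly polyfun_intros(5,8))+
      show "nz (Z (Some p)) (?F ^ n)" by (rule nz_power[OF F_poly F_nz])
      show "\<forall>v\<in>Z (Some p). (?F ^ n) v * (d * c' * a ^ k) v = (?F ^ n) v * (z * b ^ k) v"
      proof
        fix v assume v: "v \<in> Z (Some p)"
        have "(?F ^ n) v * (d * c' * a ^ k) v = d v * (c v * a v ^ k)" unfolding c'(2) by (simp add: mult_ac)
        also have "\<dots> = (d v * e v) * b v ^ k" using e(2) v by (simp add: mult.assoc)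
        also have "\<dots> = (?F ^ n) v * (z * b ^ k) v" using z(2) v by (simp add: mult.assoc)
        finally show "(?F ^ n) v * (d * c' * a ^ k) v = (?F ^ n) v * (z * b ^ k) v" .
      qed
    qed
    then show ?thesis using z(1) by (intro bexI[of _ z]) simp_all
  qed
  moreover have "d * c' \<in> B (rk (Some p))" using d(1) c'(1) by (rule B_intros(5))
  moreover have "nz (Z q) (d * c')" if "covers S (Some p) q" for q
    using dP c'P d(2)[OF that] c'(3)[OF that] by (rule nz_mult)
  ultimately show ?thesis by blast
qed

text \<open>\<open>r / s\<close> is the quotient of the power \<open>\<beta>\<close> of
  \<open>a / b\<close> by the power \<open>n\<close> of \<open>f p\<close>, which
  \<open>descend\<close> restricts to \<open>q\<close>. By minimality no divisor below
  \<open>p\<close> is a pole of it, so its powers have a common denominator on the cone of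
  \<open>p\<close> that is not zero on \<open>q\<close>.\<close>

lemma almost_integral_step:
  assumes cov: "covers S (Some p) (Some q)"
    and minimal: "\<And>q'. covers S (Some p) q' \<Longrightarrow>
      (ord p (Some q) a - ord p (Some q) b) * ord p q' (f p) \<le> (ord p q' a - ord p q' b) * ord p (Some q) (f p)"
    and r: "r \<in> polyfun S" and s: "s \<in> polyfun S" "nz (Z (Some q)) s"
    and eq: "\<forall>v\<in>Z (Some p). s v * a v ^ ord p (Some q) (f p) =
      r v * (b v ^ ord p (Some q) (f p) * f p v ^ (ord p (Some q) a - ord p (Some q) b))"
  shows "almost_integral q r s"
proof -
  let ?Z = "Z (Some p)" and ?F = "F (rk (Some p))" and ?D = "D div tdeg p"
  let ?\<beta> = "ord p (Some q) (f p)" and ?n = "ord p (Some q) a - ord p (Some q) b"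
  obtain c where c: "c \<in> B (rk (Some p))" "\<And>q. covers S (Some p) q \<Longrightarrow> nz (Z q) c"
    and ints: "\<And>k. \<exists>e\<in>polyfun S. \<forall>v\<in>?Z. c v * a v ^ k = e v * b v ^ k"
    using almost_integral_good_denominator by (elim bexE conjE) (rule that, blast+)
  obtain d where d: "d \<in> B (rk (Some p))" "\<And>q. covers S (Some p) q \<Longrightarrow> nz (Z q) d"
    and divides: "\<And>u m. u \<in> polyfun S \<Longrightarrow> nz ?Z u \<Longrightarrow>
       (\<And>q. covers S (Some p) q \<Longrightarrow> m * ord p q ?F \<le> ord p q u) \<Longrightarrow>
       \<exists>z\<in>polyfun S. \<forall>v\<in>?Z. d v * u v = ?F v ^ m * z v"
    using uniformly_divisible[of p] by (elim bexE conjE) (rule that, blast+)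
  have cP: "c \<in> polyfun S" and dP: "d \<in> polyfun S" using c d B_poly by blast+
  have cnz: "nz ?Z c" using nz_mono[OF _ c(2)[OF cov]] covers_less[OF cov] by blast
  have "\<exists>z\<in>polyfun S. \<forall>v\<in>?Z. (d * c) v * r v ^ k = z v * s v ^ k" for k
  proof -
    let ?k = "?\<beta> * k" and ?m = "?n * k"
    obtain e where e: "e \<in> polyfun S" "\<forall>v\<in>?Z. c v * a v ^ ?k = e v * b v ^ ?k" using ints by blast
    have P: "a ^ ?k \<in> polyfun S" "b ^ ?k \<in> polyfun S" "f p ^ n \<in> polyfun S" for n
      using a b f_poly by (intro polyfun_intros; simp)+
    have enz: "nz ?Z e" by (rule nz_quotient[OF a cP cnz e(2)])
    have fnz: "nz ?Z (f p ^ n)" for n by (rule nz_power[OF f_poly f_nz])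
    \<comment> \<open>On this cone the parameter is the power \<open>?D\<close> of
      \<open>f p\<close>, while only \<open>f p ^ ?m\<close> is to be divided out. The missing
      powers of \<open>f p\<close> are supplied here and cancelled afterwards.\<close>
    let ?u = "f p ^ ((?D - 1) * ?m) * e"
    have "\<exists>z\<in>polyfun S. \<forall>v\<in>?Z. d v * ?u v = ?F v ^ ?m * z v"
    proof (rule divides)
      show "?u \<in> polyfun S" by (rule polyfun_intros(5)[OF P(3) e(1)])
      show "nz ?Z ?u" by (rule nz_mult[OF P(3) e(1) fnz enz])
      fix q' assume cov': "covers S (Some p) q'"
      let ?b = "ord p q' (f p)"
      have "ord p q' c = 0" using ord_pos[OF cov' cP cnz] c(2)[OF cov'] by simp
      then have "ord p q' e + ?k * ord p q' b = ?k * ord p q' a"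
        using ord_quotient[OF cov' a b cP cnz e] by simp
      then have "ord p q' e = ?k * (ord p q' a - ord p q' b)" by (simp add: diff_mult_distrib2)
      moreover have "(?n * ?b) * k \<le> ((ord p q' a - ord p q' b) * ?\<beta>) * k" using minimal[OF cov'] by (rule mult_le_mono1)
      ultimately have e_ge: "?m * ?b \<le> ord p q' e" by (simp add: mult_ac)
      have "\<forall>v\<in>?Z. ?F v = (f p ^ ?D) v" using F_on by simp
      then have "ord p q' ?F = ?D * ?b" using ord_cong[OF cov' F_poly P(3)] ord_power[OF cov' f_poly f_nz] by simp
      then have "?m * ord p q' ?F = (?D - 1) * ?m * ?b + ?m * ?b"
        using exponent_pos[of p] by (cases ?D) (simp_all add: algebra_simps)
      also have "\<dots> \<le> (?D - 1) * ?m * ?b + ord p q' e" using e_ge by simp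
      also have "\<dots> = ord p q' ?u" using ord_mult[OF cov' P(3) e(1) fnz enz] ord_power[OF cov' f_poly f_nz] by simp
      finally show "?m * ord p q' ?F \<le> ord p q' ?u" .
    qed
    then obtain z where z: "z \<in> polyfun S" "\<forall>v\<in>?Z. d v * ?u v = ?F v ^ ?m * z v" by blast
    have "\<forall>v\<in>?Z. (d * e) v = (f p ^ ?m * z) v"
    proof (rule cancel[OF _ _ P(3) fnz])
      show "d * e \<in> polyfun S" "f p ^ ?m * z \<in> polyfun S" by (rule P dP e(1) z(1) polyfun_intros(5))+
      show "\<forall>v\<in>?Z. (f p ^ ((?D - 1) * ?m)) v * (d * e) v = (f p ^ ((?D - 1) * ?m)) v * (f p ^ ?m * z) v"
      proof
        fix v assume v: "v \<in> ?Z"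
        have "(f p ^ ((?D - 1) * ?m)) v * (d * e) v = d v * ?u v" by (simp add: mult_ac)
        also have "\<dots> = f p v ^ (?D * ?m) * z v" using z(2) v F_on[OF v] by (simp add: power_mult)
        also have "?D * ?m = (?D - 1) * ?m + ?m" using exponent_pos[of p] by (cases ?D) auto
        finally show "(f p ^ ((?D - 1) * ?m)) v * (d * e) v = (f p ^ ((?D - 1) * ?m)) v * (f p ^ ?m * z) v"
          by (simp add: power_add mult_ac)
      qed
    qed
    then have de: "d v * e v = f p v ^ ?m * z v" if "v \<in> ?Z" for v using that by simp
    let ?w = "b ^ ?k * f p ^ ?m"
    have "\<forall>v\<in>?Z. (d * c * r ^ k) v = (z * s ^ k) v"
    proof (rule cancel[of _ _ ?w])
      show "d * c * r ^ k \<in> polyfun S" "z * s ^ k \<in> polyfun S" "?w \<in> polyfun S"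
        by (rule P dP cP z(1) r s(1) polyfun_intros(5,8))+
      show "nz ?Z ?w" by (rule nz_mult[OF P(2,3) nz_power[OF b] fnz])
      show "\<forall>v\<in>?Z. ?w v * (d * c * r ^ k) v = ?w v * (z * s ^ k) v"
      proof
        fix v assume v: "v \<in> ?Z"
        have "s v * a v ^ ?\<beta> = r v * (b v ^ ?\<beta> * f p v ^ ?n)" using eq v by blast
        then have "(s v * a v ^ ?\<beta>) ^ k = (r v * (b v ^ ?\<beta> * f p v ^ ?n)) ^ k" by simp
        then have pow: "s v ^ k * a v ^ ?k = r v ^ k * ?w v" by (simp add: power_mult_distrib power_mult)
        have "?w v * (d * c * r ^ k) v = d v * c v * (r v ^ k * ?w v)" by (simp add: mult_ac)
        also have "\<dots> = d v * s v ^ k * (c v * a v ^ ?k)" unfolding pow[symmetric] by (simp add: mult_ac)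
        also have "\<dots> = (d v * e v) * (s v ^ k * b v ^ ?k)" using e(2) v by (simp add: mult_ac)
        also have "\<dots> = ?w v * (z * s ^ k) v" unfolding de[OF v] by (simp add: mult_ac)
        finally show "?w v * (d * c * r ^ k) v = ?w v * (z * s ^ k) v" .
      qed
    qed
    then show ?thesis using z(1) by (intro bexI[of _ z]) simp_all
  qed
  note ints' = this
  have rk: "rk (Some p) = Suc (rk (Some q))" by (rule cover_rank[OF cov])
  \<comment> \<open>The denominator has to be moved to the smaller ring
    \<open>B (rk (Some q))\<close>. On \<open>q\<close> the last parameter vanishes, so the part of
    \<open>d * c\<close> free of it has the same values there.\<close>
  have "d * c \<in> B (Suc (rk (Some q)))" using d(1) c(1) unfolding rk by (rule B_intros(5))
  then obtain c0 c1 where c0: "c0 \<in> B (rk (Some q))" "d * c = c0 + F (Suc (rk (Some q))) * c1" using B_decompose by blast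
  have c0_eq: "c0 v = (d * c) v" if "v \<in> Z (Some q)" for v
    unfolding c0(2) using F_Suc_vanishes[OF refl that] by simp
  have "nz (Z (Some q)) (d * c)" using dP cP d(2)[OF cov] c(2)[OF cov] by (rule nz_mult)
  then have "nz (Z (Some q)) c0" using c0_eq by (simp add: nz_def)
  moreover have "\<exists>z\<in>polyfun S. \<forall>v\<in>Z (Some q). c0 v * r v ^ k = z v * s v ^ k" for k
  proof -
    obtain z where z: "z \<in> polyfun S" "\<forall>v\<in>?Z. (d * c) v * r v ^ k = z v * s v ^ k" using ints' by blast
    have "v \<in> ?Z" if "v \<in> Z (Some q)" for v using covers_less[OF cov] that by blast
    then have "\<forall>v\<in>Z (Some q). c0 v * r v ^ k = z v * s v ^ k" using c0_eq z(2) by metis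
    then show ?thesis using z(1) by blast
  qed
  ultimately show ?thesis unfolding almost_integral_def using c0(1) by blast
qed

end

end

section \<open>Maximal chains\<close>

context seshadri
begin

definition N :: nat where "N = rk (Some top_elem)"

lemma N_pos: "N > 0"
  using rk_Some[of top_elem] by (auto simp: N_def)

lemma rk_le_N: "rk x \<le> N"
  unfolding N_def by (rule rk_le) (simp add: cone_top cone_subset_var_cone)

lemma rk_pos: "rk (Some p) > 0"
  using rk_Some[of p] by auto

lemma comparable_rank:
  assumes "Z x \<subseteq> Z y \<or> Z y \<subseteq> Z x" "rk x \<le> rk y" shows "Z x \<subseteq> Z y"
  using assms rk_less[of y x] by auto

lemma chain_extends:
  assumes "poset_chain S C" shows "\<exists>D. maximal_chain S D \<and> C \<subseteq> D"
proof -
  let ?A = "{D. poset_chain S D \<and> C \<subseteq> D}"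
  have fin: "finite ?A" and ne: "?A \<noteq> {}" using assms by auto
  from finite_has_maximal[OF fin ne] obtain D where "D \<in> ?A" "\<forall>E\<in>?A. D \<subseteq> E \<longrightarrow> D = E" by (rule bexE)
  then show ?thesis unfolding maximal_chain_def by (intro exI[of _ D]) blast
qed

lemma maximal_chainD:
  assumes "maximal_chain S C"
  shows "p \<in> C \<Longrightarrow> q \<in> C \<Longrightarrow> Z (Some p) \<subseteq> Z (Some q) \<or> Z (Some q) \<subseteq> Z (Some p)"
    and "(\<And>q. q \<in> C \<Longrightarrow> Z (Some p) \<subseteq> Z (Some q) \<or> Z (Some q) \<subseteq> Z (Some p)) \<Longrightarrow> p \<in> C"
proof -
  have C: "poset_chain S C" "\<And>D. poset_chain S D \<Longrightarrow> C \<subseteq> D \<Longrightarrow> D = C" using assms by (auto simp: maximal_chain_def)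
  then show "p \<in> C \<Longrightarrow> q \<in> C \<Longrightarrow> Z (Some p) \<subseteq> Z (Some q) \<or> Z (Some q) \<subseteq> Z (Some p)" by (auto simp: poset_chain_def)
  assume "\<And>q. q \<in> C \<Longrightarrow> Z (Some p) \<subseteq> Z (Some q) \<or> Z (Some q) \<subseteq> Z (Some p)"
  then have "poset_chain S (insert p C)" using C(1) unfolding poset_chain_def by auto
  then have "insert p C = C" by (rule C(2)) auto
  then show "p \<in> C" by auto
qed

context
  fixes C assumes C: "maximal_chain S C"
begin

lemma top_in_chain: "top_elem \<in> C"
  by (rule maximal_chainD(2)[OF C]) (simp add: cone_top cone_subset_var_cone)

lemma chain_inj: "inj_on (\<lambda>p. rk (Some p)) C"
proof (rule inj_onI)
  fix p q assume "p \<in> C" "q \<in> C" "rk (Some p) = rk (Some q)"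
  then have "Z (Some p) = Z (Some q)"
    using comparable_rank[of "Some p" "Some q"] comparable_rank[of "Some q" "Some p"] maximal_chainD(1)[OF C, of p q] by auto
  then show "p = q" using cone_inj[of "Some p" "Some q"] by simp
qed

text \<open>The largest member of the chain below \<open>p\<close>, or \<open>None\<close>, is
  covered by \<open>p\<close>: anything strictly in between would be comparable with the whole chain
  and thus belong to it.\<close>

lemma chain_cover:
  assumes p: "p \<in> C" shows "\<exists>y. covers S (Some p) y \<and> (\<forall>q. y = Some q \<longrightarrow> q \<in> C)"
proof -
  let ?Y = "{y. Z y \<subset> Z (Some p) \<and> (\<forall>q. y = Some q \<longrightarrow> q \<in> C)}"
  have "None \<in> ?Y" using None_less by simp
  then have fin: "finite (Z ` ?Y)" and ne: "Z ` ?Y \<noteq> {}" by (simp, blast)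
  from finite_has_maximal[OF fin ne] obtain W where W: "W \<in> Z ` ?Y" "\<forall>b\<in>Z ` ?Y. W \<subseteq> b \<longrightarrow> W = b" by (rule bexE)
  then obtain y where y: "y \<in> ?Y" "\<And>x. x \<in> ?Y \<Longrightarrow> Z y \<subseteq> Z x \<Longrightarrow> Z y = Z x" by auto
  have "covers S (Some p) y" unfolding covers_def
  proof (intro conjI notI)
    show "Z y \<subset> Z (Some p)" using y(1) by simp
    assume "\<exists>r. Z y \<subset> Z r \<and> Z r \<subset> Z (Some p)"
    then obtain r where r: "Z y \<subset> Z r" "Z r \<subset> Z (Some p)" by blast
    have "r \<in> ?Y"
    proof (cases r)
      case (Some r')
      have "r' \<in> C"
      proof (rule maximal_chainD(2)[OF C])
        fix c assume c: "c \<in> C"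
        show "Z (Some r') \<subseteq> Z (Some c) \<or> Z (Some c) \<subseteq> Z (Some r')"
        proof (cases "Z (Some c) \<subset> Z (Some p)")
          case True
          then have cY: "Some c \<in> ?Y" using c by simp
          have "Z (Some c) \<subseteq> Z y \<or> Z y \<subseteq> Z (Some c)"
            using y(1) maximal_chainD(1)[OF C c] zero_in_cone[of "Some c"] by (cases y) (auto simp: cone_None)
          then have "Z (Some c) \<subseteq> Z y" using y(2)[OF cY] by blast
          then show ?thesis using r(1) Some by blast
        next
          case False
          then have "Z (Some p) \<subseteq> Z (Some c)" using maximal_chainD(1)[OF C p c] by auto
          then show ?thesis using r(2) Some by blast
        qed
      qed
      then show ?thesis using r(2) Some by simp
    qed (use r(2) in simp)
    then show False using y(2)[of r] r(1) by blast
  qed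
  then show ?thesis using y(1) by blast
qed

text \<open>Going down from the top, \<open>cover_rank\<close> lowers the rank by exactly one at
  each step, so a maximal chain meets every rank. This gives all maximal chains the same
  length.\<close>

lemma rank_exists:
  assumes "j < N" shows "\<exists>p\<in>C. rk (Some p) = Suc j"
proof -
  have "k < N \<Longrightarrow> \<exists>p\<in>C. rk (Some p) = N - k" for k
  proof (induction k)
    case 0
    then show ?case using top_in_chain by (auto simp: N_def)
  next
    case (Suc k)
    then obtain p where p: "p \<in> C" "rk (Some p) = N - k" by auto
    obtain y where y: "covers S (Some p) y" "\<forall>q. y = Some q \<longrightarrow> q \<in> C" using chain_cover[OF p(1)] by blast
    have "rk y = N - Suc k" using cover_rank[OF y(1)] p(2) Suc.prems by simp
    then show ?case using y(2) Suc.prems rk_None by (cases y) auto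
  qed
  from this[of "N - Suc j"] show ?thesis using assms by simp
qed

lemma chain_ranks: "(\<lambda>p. rk (Some p)) ` {q \<in> C. rk (Some q) < j} = {q. 1 \<le> q \<and> q < j \<and> q \<le> N}"
proof (intro equalityI subsetI)
  fix i assume "i \<in> {q. 1 \<le> q \<and> q < j \<and> q \<le> N}"
  then show "i \<in> (\<lambda>p. rk (Some p)) ` {q \<in> C. rk (Some q) < j}" using rank_exists[of "i - 1"] by force
qed (auto simp: Suc_le_eq rk_pos rk_le_N)

lemma card_chain: "card C = N"
proof -
  have "{q \<in> C. rk (Some q) < Suc N} = C" using rk_le_N by (auto simp: less_Suc_eq_le)
  then have "(\<lambda>p. rk (Some p)) ` C = {1..N}" using chain_ranks[of "Suc N"] by auto
  then show ?thesis using card_image[OF chain_inj] by simp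
qed

lemma card_below:
  assumes p: "p \<in> C" shows "card {q \<in> C. Z (Some q) \<subset> Z (Some p)} = rk (Some p) - 1"
proof -
  have "Z (Some q) \<subset> Z (Some p) \<longleftrightarrow> rk (Some q) < rk (Some p)" if "q \<in> C" for q
    using rk_less[of "Some q" "Some p"] rk_le[of "Some p" "Some q"] maximal_chainD(1)[OF C p that] by fastforce
  then have "{q \<in> C. Z (Some q) \<subset> Z (Some p)} = {q \<in> C. rk (Some q) < rk (Some p)}" by blast
  moreover have "card \<dots> = card {q. 1 \<le> q \<and> q < rk (Some p) \<and> q \<le> N}"
    unfolding chain_ranks[symmetric] by (rule card_image[symmetric]) (rule inj_on_subset[OF chain_inj], auto)
  moreover have "{q. 1 \<le> q \<and> q < rk (Some p) \<and> q \<le> N} = {1..<rk (Some p)}" using rk_le_N[of "Some p"] by auto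
  ultimately show ?thesis by simp
qed

text \<open>Members of a maximal chain are found by rank. The shift by one is due to
  \<open>None\<close>, which the rank counts and \<open>nth_elem\<close> does not.\<close>

lemma nth_elem_eqI:
  assumes "p \<in> C" "rk (Some p) = Suc i" shows "nth_elem S C i = p"
  unfolding nth_elem_def
proof (rule the_equality)
  show "p \<in> C \<and> card {q \<in> C. Z (Some q) \<subset> Z (Some p)} = i" using card_below[OF assms(1)] assms by simp
  fix q assume "q \<in> C \<and> card {x \<in> C. Z (Some x) \<subset> Z (Some q)} = i"
  then have "q \<in> C" "rk (Some q) = rk (Some p)" using card_below[of q] rk_pos[of q] assms(2) by auto
  then show "q = p" using chain_inj assms(1) by (auto simp: inj_on_def)
qed

lemma nth_elem:
  assumes "i < N" shows "nth_elem S C i \<in> C" "rk (Some (nth_elem S C i)) = Suc i"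
proof -
  obtain p where p: "p \<in> C" "rk (Some p) = Suc i" using rank_exists[OF assms] by blast
  then have "nth_elem S C i = p" by (rule nth_elem_eqI)
  then show "nth_elem S C i \<in> C" "rk (Some (nth_elem S C i)) = Suc i" using p by (simp_all only:)
qed

lemma members: assumes "p \<in> C" shows "\<exists>i<N. p = nth_elem S C i"
  using nth_elem_eqI[OF assms, of "rk (Some p) - 1"] rk_pos[of p] rk_le_N[of "Some p"]
  by (intro exI[of _ "rk (Some p) - 1"]) auto

lemma nth_elem_top: "nth_elem S C (N - 1) = top_elem"
  by (rule nth_elem_eqI[OF top_in_chain]) (use N_pos in \<open>simp add: N_def\<close>)

lemma nth_elem_inj: "i < N \<Longrightarrow> j < N \<Longrightarrow> nth_elem S C i = nth_elem S C j \<Longrightarrow> i = j"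
  by (metis nth_elem(2) nat.inject)

lemma nth_elem_mono: "i \<le> j \<Longrightarrow> j < N \<Longrightarrow> Z (Some (nth_elem S C i)) \<subseteq> Z (Some (nth_elem S C j))"
  by (rule comparable_rank[OF maximal_chainD(1)[OF C]]) (simp_all add: nth_elem)

lemma pred_elem_cover: assumes "i < N" shows "covers S (Some (nth_elem S C i)) (pred_elem S C i)"
proof -
  obtain y where y: "covers S (Some (nth_elem S C i)) y" "\<forall>q. y = Some q \<longrightarrow> q \<in> C"
    using chain_cover[OF nth_elem(1)[OF assms]] by blast
  have rk: "rk y = i" using cover_rank[OF y(1)] nth_elem(2)[OF assms] by simp
  have "y = pred_elem S C i"
  proof (cases y)
    case None
    then show ?thesis using rk rk_None by (simp add: pred_elem_def)
  next
    case (Some q)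
    then have "i > 0" using rk rk_pos[of q] by simp
    then have "nth_elem S C (i - 1) = q" using y(2) Some rk by (intro nth_elem_eqI) auto
    then show ?thesis using \<open>i > 0\<close> Some by (simp add: pred_elem_def)
  qed
  then show ?thesis using y(1) by simp
qed

end

text \<open>Supplies the competitors of a minimal chain: keep the part from index \<open>i\<close>
  upwards and continue with any other divisor below that element.\<close>

lemma exchange:
  assumes C: "maximal_chain S C" and i: "i < N" and cov: "covers S (Some (nth_elem S C i)) y"
  shows "\<exists>D. maximal_chain S D \<and> (\<forall>j. i \<le> j \<longrightarrow> j < N \<longrightarrow> nth_elem S D j = nth_elem S C j) \<and> pred_elem S D i = y"
proof -
  let ?U = "nth_elem S C ` {i..<N}"
  let ?E = "?U \<union> {q. y = Some q}"
  have low: "Z y \<subseteq> Z (Some (nth_elem S C j))" if "i \<le> j" "j < N" for j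
    using covers_less[OF cov] nth_elem_mono[OF C that] by blast
  have "poset_chain S ?E" unfolding poset_chain_def
  proof (intro ballI)
    fix p q assume p: "p \<in> ?E" and q: "q \<in> ?E"
    have U: "x \<in> C" if "x \<in> ?U" for x using that nth_elem(1)[OF C] by auto
    show "Z (Some p) \<subseteq> Z (Some q) \<or> Z (Some q) \<subseteq> Z (Some p)"
    proof (cases "p \<in> ?U \<and> q \<in> ?U")
      case True
      then show ?thesis using U maximal_chainD(1)[OF C] by blast
    next
      case False
      then show ?thesis using p q low by fastforce
    qed
  qed
  then obtain D where D: "maximal_chain S D" "?E \<subseteq> D" using chain_extends by blast
  have same: "nth_elem S D j = nth_elem S C j" if "i \<le> j" "j < N" for j
    using D(2) that nth_elem(2)[OF C that(2)] by (intro nth_elem_eqI[OF D(1)]) auto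
  have rk: "rk y = i" using cover_rank[OF cov] nth_elem(2)[OF C i] by simp
  have "pred_elem S D i = y"
  proof (cases y)
    case None
    then show ?thesis using rk rk_None by (simp add: pred_elem_def)
  next
    case (Some q)
    then have "i > 0" using rk rk_pos[of q] by simp
    then have "nth_elem S D (i - 1) = q" using D(2) Some rk by (intro nth_elem_eqI[OF D(1)]) auto
    then show ?thesis using \<open>i > 0\<close> Some by (simp add: pred_elem_def)
  qed
  then show ?thesis using D(1) same by blast
qed

section \<open>Bonds and the descent along a chain\<close>

lemma bond_eq: "covers S (Some p) q \<Longrightarrow> bond S p q = int (ord p q (f p))"
proof -
  assume cov: "covers S (Some p) q"
  have "restrict (extr S p) (Z (Some p)) = restrict (f p) (Z (Some p))"
    using cone_subset_var_cone[of "Some p"] by (auto simp: restrict_eq_iff f_extr)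
  then have "bond S p q = val S p q (frac (Z (Some p)) (f p) 1)"
    by (simp add: bond_def extr_on_def frac_def coordinate_ring_simps(4))
  then show ?thesis using val_frac[OF cov f_poly polyfun_intros(3) f_nz nz_one] ord_one[OF cov] by simp
qed

lemma extr_on_eq: "extr_on S p = frac (Z (Some p)) (f p) 1"
proof -
  have "restrict (extr S p) (Z (Some p)) = restrict (f p) (Z (Some p))"
    using cone_subset_var_cone[of "Some p"] by (auto simp: restrict_eq_iff f_extr)
  then show ?thesis by (simp add: extr_on_def frac_def coordinate_ring_simps(4))
qed

lemma bond_pos: "covers S (Some p) q \<Longrightarrow> ord p q (f p) > 0"
  using ord_pos[OF _ f_poly f_nz] f_nz_iff[of q p] covers_less[of "Some p" q] by auto

lemma chain_bond_pos: "maximal_chain S C \<Longrightarrow> i < N \<Longrightarrow> chain_bond S C i > 0"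
  using bond_eq[OF pred_elem_cover] bond_pos[OF pred_elem_cover] by (simp add: chain_bond_def)

lemma descend_0: "descend S C (restrict \<gamma> (var_cone S)) 0 = frac (Z (Some top_elem)) \<gamma> 1"
  by (simp add: cone_top frac_def coordinate_ring_simps(4))

text \<open>To compute the restriction, the quotient must be represented by \<open>r / s\<close>
  with \<open>s\<close> not vanishing on \<open>q\<close>; the equation \<open>eq\<close> is the
  cross-multiplied form of this representation.\<close>

lemma descend_Suc:
  assumes C: "maximal_chain S C" and i: "i < N" and G: "descend S C g (N - 1 - i) = frac (Z (Some p)) a b"
    and p: "p = nth_elem S C i" and q: "q = pred_elem S C i"
    and a: "a \<in> polyfun S" "nz (Z (Some p)) a" and b: "b \<in> polyfun S" "nz (Z (Some p)) b"
    and le: "ord p q b \<le> ord p q a"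
    and r: "r \<in> polyfun S" and s: "s \<in> polyfun S" "nz (Z q) s"
    and eq: "\<forall>v\<in>Z (Some p). s v * a v ^ ord p q (f p) = r v * (b v ^ ord p q (f p) * f p v ^ (ord p q a - ord p q b))"
  shows "descend S C g (Suc (N - 1 - i)) = frac (Z q) r s"
proof -
  let ?\<beta> = "ord p q (f p)" and ?n = "ord p q a - ord p q b" and ?Z = "Z (Some p)"
  have cov: "covers S (Some p) q" using pred_elem_cover[OF C i] p q by simp
  have sub: "Z q \<subseteq> ?Z" using covers_less[OF cov] by blast
  have val: "val S p q (frac ?Z a b) = int ?n" using val_frac[OF cov a(1) b(1) a(2) b(2)] le by simp
  have idx: "card C - 1 - (N - 1 - i) = i" using card_chain[OF C] i by simp
  have P: "a ^ ?\<beta> \<in> polyfun S" "b ^ ?\<beta> * f p ^ ?n \<in> polyfun S"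
    using a b f_poly by (intro polyfun_intros; simp)+
  have "nz ?Z (b ^ ?\<beta> * f p ^ ?n)" by (intro nz_mult nz_power polyfun_intros f_poly f_nz b)
  then have "frac ?Z (a ^ ?\<beta>) (b ^ ?\<beta> * f p ^ ?n) = frac ?Z r s"
    using frac_eq_iff[OF nzd P(1,2) _ r s(1) nz_mono[OF sub s(2)]] eq by (simp add: mult_ac)
  moreover have "descend S C g (Suc (N - 1 - i)) = restrict_rational S ?Z (Z q) (frac ?Z (a ^ ?\<beta>) (b ^ ?\<beta> * f p ^ ?n))"
    unfolding descend.simps(2) Let_def G idx p[symmetric] q[symmetric] extr_on_eq bond_eq[OF cov] val
      frac_power_quotient[OF nzd a(1) b(1) a(2) b(2) f_poly f_nz] ..
  ultimately show ?thesis using restrict_rational_frac[OF nzd nzd sub r s] by simp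
qed

lemma pred_elem_agree:
  "\<forall>j. i \<le> j \<longrightarrow> j < N \<longrightarrow> nth_elem S E j = nth_elem S C j \<Longrightarrow> i < j \<Longrightarrow> j < N \<Longrightarrow> pred_elem S E j = pred_elem S C j"
  by (auto simp: pred_elem_def)

text \<open>After \<open>k\<close> steps the function lives on the element of index
  \<open>N - 1 - k\<close>, which is at least \<open>i\<close>; the steps so far have used only
  elements from that index upwards.\<close>

lemma descend_agree:
  assumes C: "maximal_chain S C" and E: "maximal_chain S E"
    and agree: "\<forall>j. i \<le> j \<longrightarrow> j < N \<longrightarrow> nth_elem S E j = nth_elem S C j" and k: "k + i < N"
  shows "descend S E g k = descend S C g k"
  using k
proof (induction k)
  case (Suc k)
  have "nth_elem S E (N - 1 - k) = nth_elem S C (N - 1 - k)" using agree Suc.prems by auto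
  moreover have "pred_elem S E (N - 1 - k) = pred_elem S C (N - 1 - k)" by (rule pred_elem_agree[OF agree]) (use Suc.prems in auto)
  ultimately show ?case using Suc by (simp add: card_chain[OF C] card_chain[OF E] Let_def)
qed simp

lemma chain_valuation_nth:
  assumes C: "maximal_chain S C" and j: "j < N"
  shows "chain_valuation S C g $ nth_elem S C j = of_int (chain_val S C g j) / of_int (\<Prod>k=j..N - 1. chain_bond S C k)"
proof -
  let ?c = "\<lambda>j. of_int (chain_val S C g j) / of_int (\<Prod>k=j..N - 1. chain_bond S C k) :: real"
  have "chain_valuation S C g $ nth_elem S C j = (\<Sum>i<N. if i = j then ?c j else 0)"
    unfolding chain_valuation_def sum_component card_chain[OF C]
    by (intro sum.cong) (use nth_elem_inj[OF C _ j] in \<open>auto simp: axis_def\<close>)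
  then show ?thesis using j by simp
qed

lemma chain_valuation_outside:
  assumes C: "maximal_chain S C" and p: "p \<notin> C"
  shows "chain_valuation S C g $ p = 0"
  unfolding chain_valuation_def sum_component card_chain[OF C]
  by (intro sum.neutral) (use nth_elem(1)[OF C] p in \<open>auto simp: axis_def\<close>)

lemma chain_valuation_agree:
  assumes C: "maximal_chain S C" and E: "maximal_chain S E"
    and agree: "\<forall>j. i \<le> j \<longrightarrow> j < N \<longrightarrow> nth_elem S E j = nth_elem S C j" and j: "i < j" "j < N"
  shows "chain_valuation S E g $ nth_elem S C j = chain_valuation S C g $ nth_elem S C j"
proof -
  have nth: "nth_elem S E j = nth_elem S C j" using agree j by simp
  have "chain_val S E g j = chain_val S C g j"
    using descend_agree[OF C E agree, of "N - 1 - j"] j pred_elem_agree[OF agree j] nth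
    by (simp add: chain_val_def card_chain[OF C] card_chain[OF E])
  moreover have "chain_bond S E k = chain_bond S C k" if "k \<in> {j..N - 1}" for k
  proof -
    have "i < k" "k < N" using that j by auto
    then show ?thesis using agree pred_elem_agree[OF agree, of k] by (simp add: chain_bond_def)
  qed
  then have "(\<Prod>k=j..N - 1. chain_bond S E k) = (\<Prod>k=j..N - 1. chain_bond S C k)" by (rule prod.cong[OF refl])
  ultimately show ?thesis using chain_valuation_nth[OF C j(2)] chain_valuation_nth[OF E j(2)] nth by simp
qed

section \<open>The lexicographic order\<close>

context
  fixes r :: "('a \<times> 'a) set" assumes r: "linear_order r"
begin

lemma linear_order_facts: "(p, p) \<in> r" "(p, q) \<in> r \<Longrightarrow> (q, p) \<in> r \<Longrightarrow> p = q"
  "(p, q) \<in> r \<Longrightarrow> (q, s) \<in> r \<Longrightarrow> (p, s) \<in> r" "(p, q) \<in> r \<or> (q, p) \<in> r"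
proof -
  show "(p, p) \<in> r" using r by (simp add: linear_order_on_def partial_order_on_def preorder_on_def refl_on_def)
  then show "(p, q) \<in> r \<or> (q, p) \<in> r" using r by (cases "p = q") (auto simp: linear_order_on_def total_on_def)
  show "(p, q) \<in> r \<Longrightarrow> (q, p) \<in> r \<Longrightarrow> p = q" using r by (auto simp: linear_order_on_def partial_order_on_def antisym_def)
  show "(p, q) \<in> r \<Longrightarrow> (q, s) \<in> r \<Longrightarrow> (p, s) \<in> r"
    using r by (auto simp: linear_order_on_def partial_order_on_def preorder_on_def trans_def)
qed

lemma finite_has_greatest: "finite P \<Longrightarrow> P \<noteq> {} \<Longrightarrow> \<exists>p\<in>P. \<forall>q\<in>P. (q, p) \<in> r"
proof (induction P rule: finite_ne_induct)
  case (insert x P)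
  then obtain p where "p \<in> P" "\<forall>q\<in>P. (q, p) \<in> r" by blast
  then show ?case using linear_order_facts(1)[of x] linear_order_facts(3)[of _ p x] linear_order_facts(4)[of p x] by auto
qed (simp add: linear_order_facts(1))

lemma lex_le_total: "lex_le r a b \<or> lex_le r b a"
proof (cases "a = b")
  case False
  then have "{p. a $ p \<noteq> b $ p} \<noteq> {}" by (auto simp: vec_eq_iff)
  then obtain p where p: "a $ p \<noteq> b $ p" "\<And>q. a $ q \<noteq> b $ q \<Longrightarrow> (q, p) \<in> r" using finite_has_greatest[of "{p. a $ p \<noteq> b $ p}"] by auto
  have "a $ q = b $ q" if "(p, q) \<in> r" "q \<noteq> p" for q using p(2)[of q] linear_order_facts(2) that by blast
  then show ?thesis using p(1) unfolding lex_le_def by (metis linorder_neqE_linordered_idom)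
qed (simp add: lex_le_def)

lemma lex_le_trans: assumes "lex_le r a b" "lex_le r b c" shows "lex_le r a c"
proof (cases "a = b \<or> b = c")
  case False
  then obtain p q where p: "a $ p < b $ p" "\<And>x. (p, x) \<in> r \<Longrightarrow> x \<noteq> p \<Longrightarrow> a $ x = b $ x"
    and q: "b $ q < c $ q" "\<And>x. (q, x) \<in> r \<Longrightarrow> x \<noteq> q \<Longrightarrow> b $ x = c $ x" using assms unfolding lex_le_def by blast
  define s where "s = (if (p, q) \<in> r then q else p)"
  have s: "(p, s) \<in> r" "(q, s) \<in> r" using linear_order_facts(1,4) by (auto simp: s_def)
  have "a $ s < c $ s"
  proof (cases "p = q")
    case True
    then show ?thesis using p(1) q(1) linear_order_facts(1) by (auto simp: s_def)
  next
    case False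
    then have "s = q \<and> s \<noteq> p \<or> s = p \<and> s \<noteq> q" by (simp add: s_def)
    then show ?thesis using p q s by (elim disjE) auto
  qed
  moreover have "a $ x = c $ x" if "(s, x) \<in> r" "x \<noteq> s" for x
  proof -
    have "(p, x) \<in> r" "(q, x) \<in> r"
      by (rule linear_order_facts(3)[OF s(1) that(1)], rule linear_order_facts(3)[OF s(2) that(1)])
    moreover have "x \<noteq> p" "x \<noteq> q" using linear_order_facts(2)[OF s(1)] linear_order_facts(2)[OF s(2)] that by auto
    ultimately show ?thesis using p q by simp
  qed
  ultimately show ?thesis unfolding lex_le_def by blast
qed (use assms in auto)

lemma lex_le_antisym: assumes "lex_le r a b" "lex_le r b a" shows "a = b"
proof (rule ccontr)
  assume "a \<noteq> b"
  then obtain p q where p: "a $ p < b $ p" "\<And>x. (p, x) \<in> r \<Longrightarrow> x \<noteq> p \<Longrightarrow> a $ x = b $ x"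
    and q: "b $ q < a $ q" "\<And>x. (q, x) \<in> r \<Longrightarrow> x \<noteq> q \<Longrightarrow> b $ x = a $ x" using assms unfolding lex_le_def by metis
  have "p \<noteq> q" using p(1) q(1) by auto
  then show False using p(2)[of q] q(2)[of p] p(1) q(1) linear_order_facts(4)[of p q] by auto
qed

lemma lex_le_nth:
  assumes "lex_le r a b" "\<And>x. (p, x) \<in> r \<Longrightarrow> x \<noteq> p \<Longrightarrow> a $ x = b $ x" shows "a $ p \<le> b $ p"
proof (cases "a = b")
  case False
  then obtain q where q: "a $ q < b $ q" "\<And>x. (q, x) \<in> r \<Longrightarrow> x \<noteq> q \<Longrightarrow> a $ x = b $ x" using assms(1) unfolding lex_le_def by blast
  show ?thesis
  proof (cases "q = p")
    case False
    then have "(p, q) \<notin> r" using assms(2) q(1) by force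
    then have "(q, p) \<in> r" using linear_order_facts(4) by blast
    then show ?thesis using q(2) False by auto
  qed (use q in simp)
qed simp

lemma lex_le_minimum: "finite X \<Longrightarrow> X \<noteq> {} \<Longrightarrow> \<exists>a\<in>X. \<forall>b\<in>X. lex_le r a b"
proof (induction X rule: finite_ne_induct)
  case (insert x X)
  then obtain a where a: "a \<in> X" "\<forall>b\<in>X. lex_le r a b" by blast
  show ?case
  proof (cases "lex_le r a x")
    case False
    then have "lex_le r x a" using lex_le_total by blast
    then have "\<forall>b\<in>X. lex_le r x b" using a(2) lex_le_trans by blast
    then show ?thesis by (auto simp: lex_le_def)
  qed (use a in auto)
qed (simp add: lex_le_def)

end

end

section \<open>Values\<close>

lemma cross_multiply:
  fixes b c d x y :: real
  assumes "x / (b * c) \<le> y / (d * c)" "b > 0" "c > 0" "d > 0" shows "x * d \<le> y * b"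
  using assms by (simp add: field_simps)

context seshadri
begin

section \<open>Lexicographically minimal chains and non-negative values\<close>

context
  fixes r :: "('a \<times> 'a) set" assumes refines: "refines_order S r"
begin

lemma linear: "linear_order r" and refines_le: "Z (Some q) \<subseteq> Z (Some p) \<Longrightarrow> (q, p) \<in> r"
  using refines by (auto simp: refines_order_def)

lemma quasi_valuation_eqI:
  assumes "maximal_chain S C" "\<And>E. maximal_chain S E \<Longrightarrow> lex_le r (chain_valuation S C g) (chain_valuation S E g)"
  shows "quasi_valuation S r g = chain_valuation S C g"
  unfolding quasi_valuation_def
proof (rule the_equality)
  show "chain_valuation S C g \<in> {chain_valuation S C g |C. maximal_chain S C} \<and>
    (\<forall>b\<in>{chain_valuation S C g |C. maximal_chain S C}. lex_le r (chain_valuation S C g) b)" using assms by blast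
  fix a assume "a \<in> {chain_valuation S C g |C. maximal_chain S C} \<and> (\<forall>b\<in>{chain_valuation S C g |C. maximal_chain S C}. lex_le r a b)"
  then have "lex_le r a (chain_valuation S C g)" "lex_le r (chain_valuation S C g) a" using assms by blast+
  then show "a = chain_valuation S C g" by (rule lex_le_antisym[OF linear])
qed

lemma quasi_valuation_attained:
  "\<exists>C. maximal_chain S C \<and> quasi_valuation S r g = chain_valuation S C g \<and>
    (\<forall>E. maximal_chain S E \<longrightarrow> lex_le r (chain_valuation S C g) (chain_valuation S E g))"
proof -
  let ?X = "(\<lambda>C. chain_valuation S C g) ` {C. maximal_chain S C}"
  have "poset_chain S {}" by (simp add: poset_chain_def)
  then have "?X \<noteq> {}" using chain_extends by blast
  then obtain a where "a \<in> ?X" "\<forall>b\<in>?X. lex_le r a b" using lex_le_minimum[OF linear, of ?X] by auto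
  then obtain C where "maximal_chain S C" "\<And>E. maximal_chain S E \<Longrightarrow> lex_le r (chain_valuation S C g) (chain_valuation S E g)" by auto
  then show ?thesis using quasi_valuation_eqI by blast
qed

text \<open>Elements that are larger than \<open>nth_elem S C i\<close> for \<open>r\<close> and lie
  in one of the chains have a larger index, as \<open>r\<close> refines the partial order. There
  both values agree, and outside both chains they are zero, so this coefficient is decisive or
  equal.\<close>

lemma lex_minimal_coeff:
  assumes C: "maximal_chain S C" and E: "maximal_chain S E" and i: "i < N"
    and agree: "\<forall>j. i \<le> j \<longrightarrow> j < N \<longrightarrow> nth_elem S E j = nth_elem S C j"
    and le: "lex_le r (chain_valuation S C g) (chain_valuation S E g)"
  shows "chain_valuation S C g $ nth_elem S C i \<le> chain_valuation S E g $ nth_elem S C i"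
proof (rule lex_le_nth[OF linear le])
  fix x assume x: "(nth_elem S C i, x) \<in> r" "x \<noteq> nth_elem S C i"
  show "chain_valuation S C g $ x = chain_valuation S E g $ x"
  proof (cases "x \<in> C")
    case True
    then obtain j where j: "j < N" "x = nth_elem S C j" using members[OF C] by blast
    have "i < j"
    proof (rule ccontr)
      assume "\<not> i < j"
      then have "(x, nth_elem S C i) \<in> r" using nth_elem_mono[OF C, of j i] i j(2) by (intro refines_le) auto
      then show False using x linear_order_facts(2)[OF linear] by blast
    qed
    then show ?thesis using chain_valuation_agree[OF C E agree _ j(1)] j(2) by simp
  next
    case False
    have "x \<notin> E"
    proof
      assume "x \<in> E"
      then obtain j where j: "j < N" "x = nth_elem S E j" using members[OF E] by blast
      show False
      proof (cases "i \<le> j")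
        case True
        then show False using agree j nth_elem(1)[OF C j(1)] False by simp
      next
        case False
        then have "(x, nth_elem S E i) \<in> r" using nth_elem_mono[OF E, of j i] i j(2) by (intro refines_le) auto
        then show False using x linear_order_facts(2)[OF linear] agree i by auto
      qed
    qed
    then show ?thesis using False chain_valuation_outside[OF C] chain_valuation_outside[OF E] by simp
  qed
qed

lemma descend_almost_integral:
  assumes C: "maximal_chain S C"
    and minimal: "\<And>E. maximal_chain S E \<Longrightarrow> lex_le r (chain_valuation S C (restrict \<gamma> (var_cone S))) (chain_valuation S E (restrict \<gamma> (var_cone S)))"
    and \<gamma>: "\<gamma> \<in> polyfun S" "nz (var_cone S) \<gamma>"
    and i: "i < N"
  shows "\<exists>a b. a \<in> polyfun S \<and> b \<in> polyfun S \<and> nz (Z (Some (nth_elem S C i))) a \<and> nz (Z (Some (nth_elem S C i))) b \<and>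
    descend S C (restrict \<gamma> (var_cone S)) (N - 1 - i) = frac (Z (Some (nth_elem S C i))) a b \<and> almost_integral (nth_elem S C i) a b"
proof -
  let ?g = "restrict \<gamma> (var_cone S)"
  have "i \<le> N - 1" using i by simp
  then show ?thesis
  proof (induction i rule: inc_induct)
    case base
    have "almost_integral top_elem \<gamma> 1" unfolding almost_integral_def
      using B_intros(3) nz_one \<gamma> by (intro bexI[of _ 1]) (auto intro!: bexI[of _ "\<gamma> ^ _"] polyfun_intros)
    moreover have "nz (Z (Some top_elem)) \<gamma>" using \<gamma>(2) by (simp add: cone_top)
    ultimately show ?case unfolding nth_elem_top[OF C] diff_self_eq_0 descend_0
      using \<gamma>(1) nz_one polyfun_intros(3) by blast
  next
    case (step i)
    let ?i = "Suc i"
    define p where "p = nth_elem S C ?i"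
    define q where "q = nth_elem S C i"
    have i: "?i < N" using step.hyps by simp
    have pred: "pred_elem S C ?i = Some q" by (simp add: pred_elem_def q_def)
    have cov: "covers S (Some p) (Some q)" using pred_elem_cover[OF C i] pred p_def by simp
    obtain a b where ab: "a \<in> polyfun S" "b \<in> polyfun S" "nz (Z (Some p)) a" "nz (Z (Some p)) b"
      "descend S C ?g (N - 1 - ?i) = frac (Z (Some p)) a b" "almost_integral p a b" using step.IH unfolding p_def by blast
    note ord_ge = almost_integral_ord[OF ab(1,3,2,4,6)]
    let ?\<beta> = "ord p (Some q) (f p)" and ?n = "ord p (Some q) a - ord p (Some q) b"
    have min: "?n * ord p y (f p) \<le> (ord p y a - ord p y b) * ?\<beta>" if y: "covers S (Some p) y" for y
    proof -
      \<comment> \<open>The competitor descends through \<open>y\<close> instead of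
        \<open>q\<close>. At \<open>p\<close> both values have the same factor \<open>?P\<close> of
        bonds above in the denominator, so comparing them compares the quotients of multiplicity and
        bond.\<close>
      obtain E where E: "maximal_chain S E" "\<forall>j. ?i \<le> j \<longrightarrow> j < N \<longrightarrow> nth_elem S E j = nth_elem S C j" "pred_elem S E ?i = y"
        using exchange[OF C i] y p_def by blast
      let ?P = "\<Prod>k=Suc ?i..N - 1. chain_bond S C k"
      have P: "(\<Prod>k=Suc ?i..N - 1. chain_bond S E k) = ?P"
      proof (rule prod.cong[OF refl])
        fix k assume "k \<in> {Suc ?i..N - 1}"
        then have "?i < k" "k < N" using i by auto
        then show "chain_bond S E k = chain_bond S C k" using E(2) pred_elem_agree[OF E(2), of k] by (simp add: chain_bond_def)
      qed
      have Ppos: "?P > 0" using chain_bond_pos[OF C] i by (intro prod_pos) auto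
      have split: "(\<Prod>k=?i..N - 1. h k) = h ?i * (\<Prod>k=Suc ?i..N - 1. h k)" for h :: "nat \<Rightarrow> int"
        using i by (intro prod.atLeast_Suc_atMost) auto
      have nthE: "nth_elem S E ?i = p" using E(2) i p_def by simp
      have "chain_valuation S C ?g $ p \<le> chain_valuation S E ?g $ p"
        using lex_minimal_coeff[OF C E(1) i E(2) minimal[OF E(1)]] p_def by simp
      moreover have "chain_valuation S C ?g $ p = of_int (int ?n) / of_int (int ?\<beta> * ?P)"
      proof -
        have "chain_val S C ?g ?i = int ?n"
          using val_frac[OF cov ab(1,2,3,4)] ord_ge[OF cov] unfolding chain_val_def card_chain[OF C] ab(5) pred p_def by simp
        moreover have "chain_bond S C ?i = int ?\<beta>" using bond_eq[OF cov] unfolding chain_bond_def pred p_def by simp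
        ultimately show ?thesis using chain_valuation_nth[OF C i, of ?g] unfolding split p_def by simp
      qed
      moreover have "chain_valuation S E ?g $ p = of_int (int (ord p y a - ord p y b)) / of_int (int (ord p y (f p)) * ?P)"
      proof -
        have "descend S E ?g (N - 1 - ?i) = frac (Z (Some p)) a b" using descend_agree[OF C E(1,2)] ab(5) i by simp
        then have "chain_val S E ?g ?i = int (ord p y a - ord p y b)"
          using val_frac[OF y ab(1,2,3,4)] ord_ge[OF y] unfolding chain_val_def card_chain[OF E(1)] E(3) nthE by simp
        moreover have "chain_bond S E ?i = int (ord p y (f p))" using bond_eq[OF y] unfolding chain_bond_def E(3) nthE by simp
        ultimately show ?thesis using chain_valuation_nth[OF E(1) i, of ?g] unfolding split P nthE by simp
      qed
      ultimately have "real ?n / (real ?\<beta> * of_int ?P) \<le> real (ord p y a - ord p y b) / (real (ord p y (f p)) * of_int ?P)" by simp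
      then have "real ?n * real (ord p y (f p)) \<le> real (ord p y a - ord p y b) * real ?\<beta>"
        by (rule cross_multiply) (use Ppos bond_pos[OF y] bond_pos[OF cov] in \<open>simp_all del: of_int_prod\<close>)
      then show ?thesis by (simp flip: of_nat_mult)
    qed
    have P: "a ^ ?\<beta> \<in> polyfun S" "b ^ ?\<beta> \<in> polyfun S" "f p ^ ?n \<in> polyfun S" "b ^ ?\<beta> * f p ^ ?n \<in> polyfun S"
      using ab f_poly by (intro polyfun_intros; simp)+
    have nzs: "nz (Z (Some p)) (a ^ ?\<beta>)" "nz (Z (Some p)) (b ^ ?\<beta>)" "nz (Z (Some p)) (f p ^ ?n)" "nz (Z (Some p)) (b ^ ?\<beta> * f p ^ ?n)"
      by (intro nz_mult nz_power polyfun_intros ab f_poly f_nz)+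
    \<comment> \<open>Numerator and denominator of the next quotient have equal order at
      \<open>q\<close>. Hence it can be written as \<open>t / s\<close> with both \<open>s\<close>
      and \<open>t\<close> not vanishing on \<open>q\<close>.\<close>
    have "ord p (Some q) (b ^ ?\<beta> * f p ^ ?n) = ?\<beta> * ord p (Some q) b + ?n * ?\<beta>"
      using ord_mult[OF cov P(2,3) nzs(2,3)] ord_power[OF cov] ab f_poly f_nz by simp
    also have "\<dots> = ?\<beta> * ord p (Some q) a" using ord_ge[OF cov] by (simp add: algebra_simps flip: distrib_left)
    finally have ords: "ord p (Some q) (b ^ ?\<beta> * f p ^ ?n) = ord p (Some q) (a ^ ?\<beta>)" using ord_power[OF cov ab(1,3)] by simp
    then obtain s t where st: "s \<in> polyfun S" "t \<in> polyfun S" "nz (Z (Some q)) s"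
      "\<forall>v\<in>Z (Some p). s v * (a ^ ?\<beta>) v = t v * (b ^ ?\<beta> * f p ^ ?n) v"
      using ord_le[OF cov P(1,4) nzs(1,4)] by auto
    have sp: "nz (Z (Some p)) s" using nz_mono[OF _ st(3)] covers_less[OF cov] by blast
    have eq1: "\<forall>v\<in>Z (Some p). s v * (a ^ ?\<beta>) v ^ 1 = t v * (b ^ ?\<beta> * f p ^ ?n) v ^ 1" using st(4) by simp
    have tp: "nz (Z (Some p)) t" by (rule nz_quotient[OF P(1) nzs(1) st(1) sp eq1])
    have "ord p (Some q) s = ord p (Some q) t" using ord_quotient[where a="a ^ ?\<beta>" and b="b ^ ?\<beta> * f p ^ ?n", OF cov P(1) nzs(1) P(4) nzs(4) st(1) sp st(2) eq1] ords by simp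
    then have tq: "nz (Z (Some q)) t" using ord_pos[OF cov st(1) sp] ord_pos[OF cov st(2) tp] st(3) by simp
    have eq: "\<forall>v\<in>Z (Some p). s v * a v ^ ?\<beta> = t v * (b v ^ ?\<beta> * f p v ^ ?n)" using st(4) by simp
    have "almost_integral q t s"
      by (rule almost_integral_step[OF ab(1,3,2,4,6) cov min st(2,1,3) eq])
    moreover have "descend S C ?g (N - 1 - i) = frac (Z (Some q)) t s"
      using descend_Suc[OF C i ab(5) p_def pred[symmetric] ab(1,3,2,4) ord_ge[OF cov] st(2,1,3) eq] i by (simp add: Suc_diff_Suc)
    ultimately show ?case using st tq unfolding q_def by blast
  qed
qed

lemma Gamma_nonneg:
  assumes "x \<in> Gamma S r" shows "x $ p \<ge> 0"
proof -
  obtain \<gamma> where g: "\<gamma> \<in> polyfun S" "nz (var_cone S) \<gamma>" "x = quasi_valuation S r (restrict \<gamma> (var_cone S))"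
    using assms by (auto simp: Gamma_def coordinate_ring_simps(1) simp flip: nz_restrict)
  let ?g = "restrict \<gamma> (var_cone S)"
  obtain C where C: "maximal_chain S C" "quasi_valuation S r ?g = chain_valuation S C ?g"
    "\<And>E. maximal_chain S E \<Longrightarrow> lex_le r (chain_valuation S C ?g) (chain_valuation S E ?g)"  using quasi_valuation_attained[of ?g] by blast
  show ?thesis
  proof (cases "p \<in> C")
    case True
    then obtain i where i: "i < N" "p = nth_elem S C i" using members[OF C(1)] by blast
    obtain a b where ab: "a \<in> polyfun S" "b \<in> polyfun S" "nz (Z (Some p)) a" "nz (Z (Some p)) b"
      "descend S C ?g (N - 1 - i) = frac (Z (Some p)) a b" "almost_integral p a b"
      using descend_almost_integral[OF C(1,3) g(1,2) i(1)] unfolding i(2) by blast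
    have cov: "covers S (Some p) (pred_elem S C i)" using pred_elem_cover[OF C(1) i(1)] i(2) by simp
    have "chain_val S C ?g i \<ge> 0"
      using val_frac[OF cov ab(1-4)] almost_integral_ord[OF ab(1,3,2,4,6) cov]
      unfolding chain_val_def card_chain[OF C(1)] ab(5) i(2)[symmetric] by simp
    moreover have "(\<Prod>k=i..N - 1. chain_bond S C k) > 0" using chain_bond_pos[OF C(1)] i(1) by (intro prod_pos) auto
    ultimately show ?thesis unfolding g(3) C(2) i(2) chain_valuation_nth[OF C(1) i(1)] by (intro divide_nonneg_pos) (simp_all del: of_int_prod)
  next
    case False
    then show ?thesis unfolding g(3) C(2) using chain_valuation_outside[OF C(1)] by simp
  qed
qed

end

section \<open>Values of monomials in the extremal functions\<close>

definition monomial :: "('a \<Rightarrow> nat) \<Rightarrow> 'a option \<Rightarrow> ('m \<Rightarrow> 'v) \<Rightarrow> 'k" where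
  "monomial n x = (\<Prod>p\<in>{p. Z (Some p) \<subseteq> Z x}. f p ^ n p)"

lemma monomial_poly: "monomial n x \<in> polyfun S"
  unfolding monomial_def by (intro polyfun_intros f_poly)

text \<open>The product in \<open>monomial\<close> runs only over the extremal functions that do not
  vanish on the cone of \<open>x\<close>; for \<open>None\<close> it is empty.\<close>

lemma monomial_nz: "nz (Z x) (monomial n x)"
  unfolding monomial_def using f_nz_iff[of x] by (intro nz_prod conjI polyfun_intros f_poly nz_power) auto

context
  fixes p y assumes cov: "covers S (Some p) y"
begin

lemma ord_monomial:
  "ord p y (monomial n (Some p)) = n p * ord p y (f p) + ord p y (\<Prod>q\<in>{q. Z (Some q) \<subseteq> Z (Some p) \<and> q \<noteq> p}. f q ^ n q)"
proof -
  have "monomial n (Some p) = f p ^ n p * (\<Prod>q\<in>{q. Z (Some q) \<subseteq> Z (Some p)} - {p}. f q ^ n q)"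
    unfolding monomial_def by (rule prod.remove) auto
  moreover have "{q. Z (Some q) \<subseteq> Z (Some p)} - {p} = {q. Z (Some q) \<subseteq> Z (Some p) \<and> q \<noteq> p}" by auto
  moreover have "nz (Z (Some p)) (\<Prod>q\<in>{q. Z (Some q) \<subseteq> Z (Some p) \<and> q \<noteq> p}. f q ^ n q)"
    using f_nz_iff[of "Some p"] by (intro nz_prod conjI polyfun_intros f_poly nz_power) auto
  ultimately show ?thesis
    using ord_mult[OF cov polyfun_intros(8)[OF f_poly] _ nz_power[OF f_poly f_nz]] ord_power[OF cov f_poly f_nz]
    by (simp add: polyfun_intros f_poly)
qed

text \<open>If every other factor survives on \<open>y\<close>, dividing by the power of
  \<open>f p\<close> leaves exactly the monomial of \<open>y\<close>, and the order comes from
  \<open>f p\<close> alone.\<close>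

lemma monomial_below:
  assumes "\<And>q. n q \<noteq> 0 \<Longrightarrow> Z (Some q) \<subseteq> Z (Some p) \<Longrightarrow> q \<noteq> p \<Longrightarrow> Z (Some q) \<subseteq> Z y"
  shows "monomial n (Some p) = f p ^ n p * monomial n y" "ord p y (monomial n (Some p)) = n p * ord p y (f p)"
proof -
  have less: "Z y \<subset> Z (Some p)" by (rule covers_less[OF cov])
  have eq: "(\<Prod>q\<in>{q. Z (Some q) \<subseteq> Z (Some p) \<and> q \<noteq> p}. f q ^ n q) = monomial n y"
    unfolding monomial_def
  proof (rule prod.mono_neutral_right)
    show "{q. Z (Some q) \<subseteq> Z y} \<subseteq> {q. Z (Some q) \<subseteq> Z (Some p) \<and> q \<noteq> p}" using less by auto
    show "\<forall>q\<in>{q. Z (Some q) \<subseteq> Z (Some p) \<and> q \<noteq> p} - {q. Z (Some q) \<subseteq> Z y}. f q ^ n q = 1"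
    proof
      fix q assume "q \<in> {q. Z (Some q) \<subseteq> Z (Some p) \<and> q \<noteq> p} - {q. Z (Some q) \<subseteq> Z y}"
      then have "n q = 0" using assms[of q] by blast
      then show "f q ^ n q = 1" by simp
    qed
  qed simp
  have "monomial n (Some p) = f p ^ n p * (\<Prod>q\<in>{q. Z (Some q) \<subseteq> Z (Some p)} - {p}. f q ^ n q)"
    unfolding monomial_def by (rule prod.remove) auto
  also have "{q. Z (Some q) \<subseteq> Z (Some p)} - {p} = {q. Z (Some q) \<subseteq> Z (Some p) \<and> q \<noteq> p}" by auto
  finally show "monomial n (Some p) = f p ^ n p * monomial n y" unfolding eq .
  have "ord p y (monomial n y) = 0" using ord_pos[OF cov monomial_poly nz_mono[OF psubset_imp_subset[OF less] monomial_nz]] monomial_nz by simp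
  then show "ord p y (monomial n (Some p)) = n p * ord p y (f p)" unfolding ord_monomial eq by simp
qed

text \<open>A factor \<open>f q\<close> that vanishes on the divisor adds a positive amount to the
  order.\<close>

lemma ord_monomial_greater:
  assumes "n q \<noteq> 0" "Z (Some q) \<subseteq> Z (Some p)" "q \<noteq> p" "\<not> Z (Some q) \<subseteq> Z y"
  shows "ord p y (monomial n (Some p)) > n p * ord p y (f p)"
proof -
  let ?h = "\<Prod>q\<in>{q. Z (Some q) \<subseteq> Z (Some p) \<and> q \<noteq> p}. f q ^ n q"
  have "?h v = 0" if "v \<in> Z y" for v
    unfolding prod_fun_apply using f_vanishes[OF assms(4) that] assms(1-3) by (intro prod_zero) auto
  then have "\<not> nz (Z y) ?h" by (auto simp: nz_def simp del: prod_fun_apply)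
  moreover have "nz (Z (Some p)) ?h"
    using f_nz_iff[of "Some p"] by (intro nz_prod conjI polyfun_intros f_poly nz_power) auto
  moreover have "?h \<in> polyfun S" by (intro polyfun_intros f_poly)
  ultimately have "ord p y ?h > 0" using ord_pos[OF cov] by blast
  then show ?thesis unfolding ord_monomial by simp
qed

end

text \<open>The condition on a maximal chain \<open>E\<close> under which a monomial in the extremal functions
  restricts down to \<open>p\<^sub>i\<close> in the form of a monomial, only losing the factors \<open>f p\<^sub>j\<close>, \<open>j > i\<close>.\<close>

definition monomial_along :: "('a \<Rightarrow> nat) \<Rightarrow> 'a set \<Rightarrow> nat \<Rightarrow> bool" where
  "monomial_along n E i \<longleftrightarrow>
     (\<forall>q. n q \<noteq> 0 \<longrightarrow> (\<exists>j. i < j \<and> j < N \<and> q = nth_elem S E j) \<or> Z (Some q) \<subseteq> Z (Some (nth_elem S E i)))"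

context
  fixes n :: "'a \<Rightarrow> nat" and E assumes E: "maximal_chain S E"
begin

text \<open>At index 0 there is no such \<open>q\<close>, since no stratum lies properly below one
  of rank one. At larger indices the condition one step lower applies, because \<open>q\<close> is
  too low to be one of the upper chain members.\<close>

lemma monomial_along_pred:
  assumes i: "i < N" and H: "i > 0 \<Longrightarrow> monomial_along n E (i - 1)"
    and q: "n q \<noteq> 0" "Z (Some q) \<subseteq> Z (Some (nth_elem S E i))" "q \<noteq> nth_elem S E i"
  shows "Z (Some q) \<subseteq> Z (pred_elem S E i)"
proof -
  have "Z (Some q) \<subset> Z (Some (nth_elem S E i))" using q(2,3) cone_inj[of "Some q" "Some (nth_elem S E i)"] by auto
  then have rk: "rk (Some q) < Suc i" using rk_less nth_elem(2)[OF E i] by metis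
  then have i0: "i > 0" using rk_pos[of q] by simp
  have "\<not> (\<exists>j. i - 1 < j \<and> j < N \<and> q = nth_elem S E j)" using rk nth_elem(2)[OF E] by auto
  then show ?thesis using H[OF i0] q(1) i0 by (auto simp: monomial_along_def pred_elem_def)
qed

lemma monomial_along_Suc:
  assumes i: "Suc i < N" and H: "monomial_along n E i" shows "monomial_along n E (Suc i)"
  unfolding monomial_along_def
proof (intro allI impI)
  fix q assume "n q \<noteq> 0"
  then consider j where "i < j" "j < N" "q = nth_elem S E j" | "Z (Some q) \<subseteq> Z (Some (nth_elem S E i))"
    using H unfolding monomial_along_def by blast
  then show "(\<exists>j. Suc i < j \<and> j < N \<and> q = nth_elem S E j) \<or> Z (Some q) \<subseteq> Z (Some (nth_elem S E (Suc i)))"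
  proof cases
    case (1 j)
    show ?thesis
    proof (cases "j = Suc i")
      case False
      then have "Suc i < j" using 1 by simp
      then show ?thesis using 1 by blast
    qed (use 1 in simp)
  next
    case 2
    then have "Z (Some q) \<subseteq> Z (Some (nth_elem S E (Suc i)))" by (rule order_trans) (use nth_elem_mono[OF E, of i "Suc i"] i in simp)
    then show ?thesis by blast
  qed
qed

lemma monomial_along_step:
  assumes i: "Suc i < N" and H: "monomial_along n E (Suc i)" and H': "\<not> monomial_along n E i"
  shows "\<exists>q. n q \<noteq> 0 \<and> Z (Some q) \<subseteq> Z (Some (nth_elem S E (Suc i))) \<and> q \<noteq> nth_elem S E (Suc i) \<and>
    \<not> Z (Some q) \<subseteq> Z (pred_elem S E (Suc i))"
proof -
  obtain q where q: "n q \<noteq> 0" "\<not> (\<exists>j. i < j \<and> j < N \<and> q = nth_elem S E j)" "\<not> Z (Some q) \<subseteq> Z (Some (nth_elem S E i))"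
    using H' unfolding monomial_along_def by blast
  have "q \<noteq> nth_elem S E (Suc i)" using q(2) i by blast
  moreover have "\<not> (\<exists>j. Suc i < j \<and> j < N \<and> q = nth_elem S E j)" using q(2) Suc_lessD by blast
  then have "Z (Some q) \<subseteq> Z (Some (nth_elem S E (Suc i)))" using H q(1) unfolding monomial_along_def by blast
  ultimately show ?thesis using q(1,3) by (intro exI[of _ q]) (simp add: pred_elem_def)
qed

lemma monomial_along_top: "monomial_along n E (N - 1)"
  unfolding monomial_along_def nth_elem_top[OF E] by (simp add: cone_top cone_subset_var_cone)

definition bond_nat :: "nat \<Rightarrow> nat" where
  "bond_nat k = ord (nth_elem S E k) (pred_elem S E k) (f (nth_elem S E k))"

text \<open>Each step takes a power with the bond as exponent and removes the factor
  \<open>f p\<close>. The accumulated product of bonds cancels against the denominators in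
  \<open>chain_valuation\<close>.\<close>

lemma descend_monomial:
  assumes "i < N" "monomial_along n E i"
  shows "descend S E (restrict (monomial n (Some top_elem)) (var_cone S)) (N - 1 - i) =
    frac (Z (Some (nth_elem S E i))) (monomial n (Some (nth_elem S E i)) ^ (\<Prod>k=Suc i..N - 1. bond_nat k)) 1"
proof -
  have "i \<le> N - 1" using assms(1) by simp
  then show ?thesis using assms(2)
  proof (induction i rule: inc_induct)
    case base
    have "(\<Prod>k=Suc (N - 1)..N - 1. bond_nat k) = 1" by simp
    then show ?case unfolding nth_elem_top[OF E] diff_self_eq_0 descend_0 by (simp only: power_one_right)
  next
    case (step i)
    define p where "p = nth_elem S E (Suc i)"
    define q where "q = nth_elem S E i"
    let ?M = "\<Prod>k=Suc (Suc i)..N - 1. bond_nat k" and ?\<beta> = "ord p (Some q) (f p)"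
    have i: "Suc i < N" using step.hyps by simp
    have pred: "pred_elem S E (Suc i) = Some q" by (simp add: pred_elem_def q_def)
    have cov: "covers S (Some p) (Some q)" using pred_elem_cover[OF E i] pred p_def by simp
    have M: "(\<Prod>k=Suc i..N - 1. bond_nat k) = ?\<beta> * ?M"
      using i pred p_def by (subst prod.atLeast_Suc_atMost) (auto simp: bond_nat_def)
    have G: "descend S E (restrict (monomial n (Some top_elem)) (var_cone S)) (N - 1 - Suc i) = frac (Z (Some p)) (monomial n (Some p) ^ ?M) 1"
      by (rule step.IH[OF monomial_along_Suc[OF i step.prems], folded p_def])
    have le: "Z (Some x) \<subseteq> Z (Some q)" if "n x \<noteq> 0" "Z (Some x) \<subseteq> Z (Some p)" "x \<noteq> p" for x
      using monomial_along_pred[OF i _ that(1)] step.prems that(2,3) unfolding pred p_def by simp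
    have below: "monomial n (Some p) = f p ^ n p * monomial n (Some q)" "ord p (Some q) (monomial n (Some p)) = n p * ?\<beta>"
      by (rule monomial_below[OF cov], erule (2) le)+
    have ord: "ord p (Some q) (monomial n (Some p) ^ ?M) - ord p (Some q) 1 = ?M * (n p * ?\<beta>)"
      using ord_power[OF cov monomial_poly monomial_nz] ord_one[OF cov] below(2) by simp
    have "descend S E (restrict (monomial n (Some top_elem)) (var_cone S)) (Suc (N - 1 - Suc i)) =
      frac (Z (Some q)) (monomial n (Some q) ^ (?\<beta> * ?M)) 1"
    proof (rule descend_Suc[OF E i G p_def pred[symmetric]])
      show "\<forall>v\<in>Z (Some p). 1 v * (monomial n (Some p) ^ ?M) v ^ ?\<beta> = (monomial n (Some q) ^ (?\<beta> * ?M)) v *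
          (1 v ^ ?\<beta> * f p v ^ (ord p (Some q) (monomial n (Some p) ^ ?M) - ord p (Some q) 1))"
        unfolding ord unfolding below(1) by (simp add: power_mult_distrib mult_ac flip: power_mult)
      show "ord p (Some q) 1 \<le> ord p (Some q) (monomial n (Some p) ^ ?M)" by (simp add: ord_one[OF cov])
    qed (intro nz_one nz_power monomial_nz polyfun_intros monomial_poly)+
    moreover have idx: "Suc (N - 1 - Suc i) = N - 1 - i" using i by simp
    ultimately show ?case unfolding idx q_def[symmetric] M by (simp only:)
  qed
qed

lemma bond_nat_pos: "k < N \<Longrightarrow> bond_nat k > 0"
  unfolding bond_nat_def by (rule bond_pos[OF pred_elem_cover[OF E]])

lemma monomial_coefficient:
  assumes i: "i < N" and H: "monomial_along n E i"
  shows "chain_valuation S E (restrict (monomial n (Some top_elem)) (var_cone S)) $ nth_elem S E i =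
    real (ord (nth_elem S E i) (pred_elem S E i) (monomial n (Some (nth_elem S E i)))) / real (bond_nat i)"
proof -
  let ?G = "restrict (monomial n (Some top_elem)) (var_cone S)" and ?M = "\<Prod>k=Suc i..N - 1. bond_nat k"
  define p where "p = nth_elem S E i"
  have cov: "covers S (Some p) (pred_elem S E i)" using pred_elem_cover[OF E i] p_def by simp
  have "val S p (pred_elem S E i) (frac (Z (Some p)) (monomial n (Some p) ^ ?M) 1) =
      int (?M * ord p (pred_elem S E i) (monomial n (Some p)))"
    unfolding val_frac[OF cov polyfun_intros(8)[OF monomial_poly] polyfun_intros(3) nz_power[OF monomial_poly monomial_nz] nz_one]
      ord_power[OF cov monomial_poly monomial_nz] ord_one[OF cov] by simp
  then have "chain_val S E ?G i = int (?M * ord p (pred_elem S E i) (monomial n (Some p)))"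
    unfolding chain_val_def card_chain[OF E] descend_monomial[OF assms] p_def by (simp only:)
  moreover have "(\<Prod>k=i..N - 1. chain_bond S E k) = (\<Prod>k=i..N - 1. int (bond_nat k))"
    using bond_eq[OF pred_elem_cover[OF E]] i by (intro prod.cong) (auto simp: chain_bond_def bond_nat_def)
  moreover have "\<dots> = int (bond_nat i * ?M)" using i by (subst prod.atLeast_Suc_atMost) auto
  moreover have "?M > 0" using bond_nat_pos by (intro prod_pos) auto
  ultimately show ?thesis using chain_valuation_nth[OF E i, of ?G] bond_nat_pos[OF i] unfolding p_def by simp
qed

lemma monomial_coefficient_eq:
  assumes i: "i < N" and H: "monomial_along n E i" and H': "i > 0 \<Longrightarrow> monomial_along n E (i - 1)"
  shows "chain_valuation S E (restrict (monomial n (Some top_elem)) (var_cone S)) $ nth_elem S E i = real (n (nth_elem S E i))"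
  using monomial_coefficient[OF i H] bond_nat_pos[OF i]
    monomial_below(2)[OF pred_elem_cover[OF E i], of n, OF monomial_along_pred[OF i H']]
  by (simp add: bond_nat_def)

text \<open>At the first failure some factor vanishes on the next divisor, which enlarges the
  coefficient strictly.\<close>

lemma monomial_coefficient_greater:
  assumes i: "Suc i < N" and H: "monomial_along n E (Suc i)" and H': "\<not> monomial_along n E i"
  shows "chain_valuation S E (restrict (monomial n (Some top_elem)) (var_cone S)) $ nth_elem S E (Suc i) > real (n (nth_elem S E (Suc i)))"
proof -
  obtain q where q: "n q \<noteq> 0" "Z (Some q) \<subseteq> Z (Some (nth_elem S E (Suc i)))" "q \<noteq> nth_elem S E (Suc i)"
    "\<not> Z (Some q) \<subseteq> Z (pred_elem S E (Suc i))" using monomial_along_step[OF assms] by blast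
  have "n (nth_elem S E (Suc i)) * bond_nat (Suc i) <
      ord (nth_elem S E (Suc i)) (pred_elem S E (Suc i)) (monomial n (Some (nth_elem S E (Suc i))))"
    using ord_monomial_greater[where n=n, OF pred_elem_cover[OF E i] q] by (simp add: bond_nat_def)
  then have "real (n (nth_elem S E (Suc i))) * real (bond_nat (Suc i)) <
      real (ord (nth_elem S E (Suc i)) (pred_elem S E (Suc i)) (monomial n (Some (nth_elem S E (Suc i)))))"
    by (simp flip: of_nat_mult)
  then show ?thesis unfolding monomial_coefficient[OF i H] using bond_nat_pos[OF i] by (simp add: pos_less_divide_eq)
qed

lemma support_in_chain:
  assumes "monomial_along n E 0" "n p \<noteq> 0" shows "p \<in> E"
proof -
  consider j where "j < N" "p = nth_elem S E j" | "Z (Some p) \<subseteq> Z (Some (nth_elem S E 0))"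
    using assms unfolding monomial_along_def by blast
  then show ?thesis
  proof cases
    case 2
    have "\<not> Z (Some p) \<subset> Z (Some (nth_elem S E 0))"
      using rk_less[of "Some p" "Some (nth_elem S E 0)"] rk_pos[of p] nth_elem(2)[OF E N_pos] by auto
    then have "p = nth_elem S E 0" using 2 cone_inj[of "Some p" "Some (nth_elem S E 0)"] by auto
    then show ?thesis using nth_elem(1)[OF E N_pos] by simp
  qed (use nth_elem(1)[OF E] in simp)
qed

lemma monomial_value:
  assumes "\<And>i. i < N \<Longrightarrow> monomial_along n E i"
  shows "chain_valuation S E (restrict (monomial n (Some top_elem)) (var_cone S)) = (\<chi> p. real (n p))"
proof -
  have "chain_valuation S E (restrict (monomial n (Some top_elem)) (var_cone S)) $ p = real (n p)" for p
  proof (cases "p \<in> E")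
    case True
    then obtain i where "i < N" "p = nth_elem S E i" using members[OF E] by blast
    then show ?thesis using monomial_coefficient_eq assms by simp
  next
    case False
    then show ?thesis using chain_valuation_outside[OF E] support_in_chain[OF assms[OF N_pos]] by fastforce
  qed
  then show ?thesis by (simp add: vec_eq_iff)
qed

end

text \<open>Along a maximal chain containing \<open>C\<close> the monomial has value
  \<open>n\<close>. Along another chain the coefficients agree with \<open>n\<close> from the top
  down to the first failure, where the coefficient is larger; so no chain gives a smaller
  value.\<close>

lemma monomial_in_Gamma:
  assumes r: "refines_order S r" and C: "poset_chain S C" and supp: "\<And>p. n p \<noteq> 0 \<Longrightarrow> p \<in> C"
  shows "(\<chi> p. real (n p)) \<in> Gamma S r"
proof -
  let ?G = "restrict (monomial n (Some top_elem)) (var_cone S)" and ?w = "\<chi> p. real (n p)"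
  obtain E where E: "maximal_chain S E" "C \<subseteq> E" using chain_extends[OF C] by blast
  have "monomial_along n E i" if i: "i < N" for i unfolding monomial_along_def
  proof (intro allI impI)
    fix q assume "n q \<noteq> 0"
    then obtain j where "j < N" "q = nth_elem S E j" using supp E(2) members[OF E(1)] by blast
    then show "(\<exists>j. i < j \<and> j < N \<and> q = nth_elem S E j) \<or> Z (Some q) \<subseteq> Z (Some (nth_elem S E i))"
      using nth_elem_mono[OF E(1), of j i] i by (cases "i < j") auto
  qed
  then have val_eq: "chain_valuation S E ?G = ?w" by (rule monomial_value[OF E(1)])
  have "lex_le r ?w (chain_valuation S E' ?G)" if E': "maximal_chain S E'" for E'
  proof (cases "\<forall>i<N. monomial_along n E' i")
    case True
    then show ?thesis using monomial_value[OF E'] by (simp add: lex_le_def)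
  next
    case False
    then obtain i where "i < N" "\<not> monomial_along n E' i" by blast
    then have "\<not> monomial_along n E' (N - 1 - (N - 1 - i))" by simp
    then have "\<exists>i. \<not> monomial_along n E' (N - 1 - i)" by blast
    then obtain k where k: "\<not> monomial_along n E' (N - 1 - k)" "\<forall>j<k. \<not> \<not> monomial_along n E' (N - 1 - j)"
      unfolding exists_least_iff[of "\<lambda>i. \<not> monomial_along n E' (N - 1 - i)"] by (elim exE conjE) (rule that)
    have k0: "k > 0"
    proof (rule gr0I)
      assume "k = 0"
      then show False using k(1) monomial_along_top[OF E', of n] by simp
    qed
    have kN: "k < N"
    proof (rule ccontr)
      assume "\<not> k < N"
      \<comment> \<open>Truncated subtraction: both sides are 0.\<close>
      then have "N - 1 - k = N - 1 - (k - 1)" by simp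
      then show False using k(1) k(2)[rule_format, of "k - 1"] k0 by simp
    qed
    \<comment> \<open>The largest index at which the condition fails, found by counting down from
      the top. It holds at the top itself, so the element of index \<open>Suc i\<close>
      exists.\<close>
    define i where "i = N - 1 - k"
    have iN: "Suc i < N" using k0 kN by (simp add: i_def)
    have low: "\<not> monomial_along n E' i" using k(1) i_def by simp
    have high: "monomial_along n E' j" if "i < j" "j < N" for j
      using k(2)[rule_format, of "N - 1 - j"] that by (simp add: i_def)
    let ?p = "nth_elem S E' (Suc i)"
    have "?w $ ?p < chain_valuation S E' ?G $ ?p"
      using monomial_coefficient_greater[OF E' iN high[OF lessI iN] low] by simp
    moreover have "?w $ x = chain_valuation S E' ?G $ x" if x: "(?p, x) \<in> r" "x \<noteq> ?p" for x
    proof (cases "x \<in> E'")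
      case True
      then obtain j where j: "j < N" "x = nth_elem S E' j" using members[OF E'] by blast
      have "Suc i < j"
      proof (rule ccontr)
        assume "\<not> Suc i < j"
        then have "(x, ?p) \<in> r" using nth_elem_mono[OF E', of j "Suc i"] iN j(2) by (intro refines_le[OF r]) auto
        then show False using x linear_order_facts(2)[OF linear[OF r]] by blast
      qed
      then show ?thesis using monomial_coefficient_eq[OF E' j(1), of n] high[of j] high[of "j - 1"] j by simp
    next
      case False
      \<comment> \<open>A factor outside the chain would have to lie below \<open>?p\<close>,
        contrary to \<open>x\<close> being larger in the total order.\<close>
      have "n x = 0"
      proof (rule ccontr)
        assume "n x \<noteq> 0"
        then consider j where "j < N" "x = nth_elem S E' j" | "Z (Some x) \<subseteq> Z (Some ?p)"
          using high[OF lessI iN] unfolding monomial_along_def by blast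
        then show False
        proof cases
          case 1
          then show False using False nth_elem(1)[OF E'] by simp
        next
          case 2
          then show False using refines_le[OF r 2] x linear_order_facts(2)[OF linear[OF r]] by blast
        qed
      qed
      then show ?thesis using chain_valuation_outside[OF E' False] by simp
    qed
    ultimately show ?thesis unfolding lex_le_def by blast
  qed
  then have qv: "quasi_valuation S r ?G = ?w" using quasi_valuation_eqI[OF r E(1), of ?G] val_eq by simp
  have "?G \<in> carrier (coordinate_ring S (var_cone S)) - {\<zero>\<^bsub>coordinate_ring S (var_cone S)\<^esub>}"
    using carrier_nz[OF monomial_poly, of "var_cone S"] monomial_nz[of "Some top_elem"] by (simp add: cone_top)
  then have "quasi_valuation S r ?G \<in> Gamma S r" unfolding Gamma_def by (rule imageI)
  then show ?thesis unfolding qv .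
qed

end

section \<open>Fibres of a non-negative degree map\<close>

text \<open>Such a map turns real solutions of rational linear equations into rational ones.\<close>

lemma rational_retraction:
  "\<exists>h :: real \<Rightarrow> rat. (\<forall>x y. h (x + y) = h x + h y) \<and> (\<forall>n x. h (real n * x) = of_nat n * h x) \<and> (\<forall>n. h (real n) = of_nat n)"
proof -
  interpret V: vector_space "\<lambda>(q::rat) (x::real). of_rat q * x"
    by unfold_locales (auto simp: of_rat_add of_rat_mult algebra_simps)
  have ind: "V.independent {1}" by (simp add: V.dependent_single)
  \<comment> \<open>The reals as a rational vector space with a basis that contains 1; the
    retraction is the coordinate along 1.\<close>
  let ?B = "V.extend_basis {1}"
  note B = V.independent_extend_basis[OF ind] V.span_extend_basis[OF ind]
  define h where "h x = V.representation ?B x 1" for x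
  have add: "h (x + y) = h x + h y" for x y unfolding h_def using B by (simp add: V.representation_add)
  have scale: "h (of_rat q * x) = q * h x" for q x unfolding h_def using B by (simp add: V.representation_scale)
  have "1 \<in> ?B" using V.extend_basis_superset[OF ind] by auto
  then have one: "h 1 = 1" unfolding h_def using V.representation_basis[OF B(1)] by simp
  show ?thesis
    using add scale[of "of_nat _"] scale[of "of_nat _" 1] one by (intro exI[of _ h]) simp
qed

text \<open>Take the intersection of all faces through \<open>x\<close>. If \<open>x\<close> were on
  its relative boundary, a supporting hyperplane would cut out a smaller face through
  \<open>x\<close>.\<close>

lemma exists_minimal_face:
  fixes K :: "'v::euclidean_space set"
  assumes "convex K" "x \<in> K" shows "\<exists>\<tau>. \<tau> face_of K \<and> x \<in> rel_interior \<tau>"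
proof -
  let ?A = "{T. T face_of K \<and> x \<in> T}"
  define \<tau> where "\<tau> = \<Inter> ?A"
  have "K \<in> ?A" using assms by (simp add: face_of_refl)
  then have \<tau>: "\<tau> face_of K" unfolding \<tau>_def by (intro face_of_Inter) auto
  have x: "x \<in> \<tau>" by (simp add: \<tau>_def)
  have "x \<in> rel_interior \<tau>"
  proof (rule ccontr)
    assume "x \<notin> rel_interior \<tau>"
    then obtain a where a: "\<And>y. y \<in> \<tau> \<Longrightarrow> a \<bullet> x \<le> a \<bullet> y" "\<And>y. y \<in> rel_interior \<tau> \<Longrightarrow> a \<bullet> x < a \<bullet> y"
      using supporting_hyperplane_rel_boundary[OF face_of_imp_convex[OF \<tau>] x] by metis
    have "\<tau> \<inter> {y. a \<bullet> y = a \<bullet> x} face_of \<tau>" using a(1) by (intro face_of_Int_supporting_hyperplane_ge face_of_imp_convex[OF \<tau>])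
    then have "\<tau> \<inter> {y. a \<bullet> y = a \<bullet> x} face_of K" using \<tau> by (rule face_of_trans)
    then have "\<tau> \<subseteq> {y. a \<bullet> y = a \<bullet> x}" using x unfolding \<tau>_def by auto
    moreover have "rel_interior \<tau> \<noteq> {}" using x rel_interior_eq_empty[OF face_of_imp_convex[OF \<tau>]] by auto
    ultimately show False using a(2) rel_interior_subset[of \<tau>] by fastforce
  qed
  then show ?thesis using \<tau> by blast
qed

text \<open>The orthogonal complement of the kernel inside \<open>W\<close> is mapped injectively
  and has the same image as \<open>W\<close>.\<close>

lemma rank_nullity:
  fixes L :: "'v::euclidean_space \<Rightarrow> 'w::euclidean_space"
  assumes L: "linear L" and W: "subspace W"
  shows "dim {x \<in> W. L x = 0} + dim (L ` W) = dim W"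
proof -
  interpret L: linear L by (rule L)
  let ?K = "{x \<in> W. L x = 0}"
  let ?U = "{y \<in> W. \<forall>x\<in>?K. orthogonal x y}"
  have K: "subspace ?K" using W by (auto simp: subspace_def L.zero L.add L.scale)
  have U: "subspace ?U" using W by (auto simp: subspace_def orthogonal_def inner_add_right)
  have "dim ?U + dim ?K = dim W" by (rule dim_subspace_orthogonal_to_vectors[OF K W]) auto
  moreover have "L ` W = L ` ?U"
  proof
    show "L ` W \<subseteq> L ` ?U"
    proof
      fix b assume "b \<in> L ` W"
      then obtain x where x: "x \<in> W" "b = L x" by blast
      obtain y z where yz: "y \<in> span ?K" "\<And>w. w \<in> span ?K \<Longrightarrow> orthogonal z w" "x = y + z"
        using orthogonal_subspace_decomp_exists[of ?K x] by metis
      have y: "y \<in> ?K" using yz(1) K by (metis (no_types, lifting) span_eq_iff)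
      have "z = x - y" using yz(3) by simp
      then have "z \<in> W" using x(1) y W by (auto intro: subspace_diff)
      moreover have "orthogonal u z" if "u \<in> ?K" for u using yz(2)[OF span_base[OF that]] by (simp add: orthogonal_commute)
      ultimately have "z \<in> ?U" by simp
      moreover have "L z = b" using yz(3) y x(2) by (simp add: L.add)
      ultimately show "b \<in> L ` ?U" by (intro image_eqI[of b L z]) simp_all
    qed
  qed auto
  moreover have "inj_on L (span ?U)"
  proof -
    have "span ?U = ?U" using U by (simp add: span_eq_iff)
    moreover have "inj_on L ?U"
    proof (rule inj_onI)
      fix x y assume x: "x \<in> ?U" and y: "y \<in> ?U" and eq: "L x = L y"
      have d: "x - y \<in> ?U" using U x y by (rule subspace_diff)
      then have "x - y \<in> ?K" using eq by (simp add: L.diff)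
      then have "orthogonal (x - y) (x - y)" using d by blast
      then show "x = y" by (simp add: orthogonal_def)
    qed
    ultimately show ?thesis by (simp only:)
  qed
  then have "dim (L ` ?U) = dim ?U" by (rule dim_image_eq[OF L])
  ultimately show ?thesis by simp
qed

lemma centre_in_open_segment:
  fixes x v :: "'v::real_vector"
  assumes "v \<noteq> 0" shows "x \<in> open_segment (x + v) (x - v)"
  unfolding in_segment
proof (intro conjI exI[of _ "1/2"])
  show "x + v \<noteq> x - v"
  proof
    assume "x + v = x - v"
    then have "2 *\<^sub>R v = 0" unfolding scaleR_2 by (simp add: algebra_simps)
    then show False using assms by simp
  qed
  have "(1/2) *\<^sub>R (x + v) + (1/2) *\<^sub>R (x - v) = (1/2) *\<^sub>R (x + x)" by (simp flip: scaleR_add_right)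
  then show "x = (1 - 1/2) *\<^sub>R (x + v) + (1/2) *\<^sub>R (x - v)" by simp
qed auto

section \<open>Cone and fibre of a family of degree vectors\<close>

locale degree_vectors =
  fixes g :: "'a::finite \<Rightarrow> real ^ 'm::finite" and d :: "real ^ 'm"
  assumes g_nat: "\<exists>n. g p $ i = real n" and g_nonzero: "g p \<noteq> 0" and d_nat: "\<exists>n. d $ i = real n"
begin

definition lin :: "real ^ 'a \<Rightarrow> real ^ 'm" where
  "lin a = (\<Sum>p\<in>UNIV. a $ p *\<^sub>R g p)"

definition orth :: "'a set \<Rightarrow> (real ^ 'a) set" where
  "orth C = {a. (\<forall>p. 0 \<le> a $ p) \<and> (\<forall>p. p \<notin> C \<longrightarrow> a $ p = 0)}"

definition P :: "'a set \<Rightarrow> (real ^ 'a) set" where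
  "P C = {a \<in> orth C. lin a = d}"

definition K :: "'a set \<Rightarrow> (real ^ 'm) set" where
  "K C = lin ` orth C"

definition supp :: "'a set \<Rightarrow> 'a set" where
  "supp C = {p. \<exists>a\<in>P C. a $ p \<noteq> 0}"

definition ray :: "'a \<Rightarrow> (real ^ 'm) set" where
  "ray p = {c *\<^sub>R g p | c. c \<ge> 0}"

lemma linear_lin: "linear lin"
  by (rule linearI) (simp_all add: lin_def scaleR_add_left sum.distrib scaleR_sum_right)

interpretation lin: linear lin by (rule linear_lin)

lemma lin_axis: "lin (c *\<^sub>R axis p 1) = c *\<^sub>R g p"
proof -
  have "lin (c *\<^sub>R axis p 1) = (\<Sum>q\<in>UNIV. if q = p then c *\<^sub>R g p else 0)"
    unfolding lin_def by (intro sum.cong) (auto simp: axis_def)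
  then show ?thesis by simp
qed

lemma orth_add: "a \<in> orth C \<Longrightarrow> b \<in> orth C \<Longrightarrow> a + b \<in> orth C"
  and orth_scale: "a \<in> orth C \<Longrightarrow> 0 \<le> c \<Longrightarrow> c *\<^sub>R a \<in> orth C"
  and orth_zero: "0 \<in> orth C"
  and orth_axis: "p \<in> C \<Longrightarrow> 0 \<le> c \<Longrightarrow> c *\<^sub>R axis p 1 \<in> orth C"
  and orth_mono: "C \<subseteq> C' \<Longrightarrow> a \<in> orth C \<Longrightarrow> a \<in> orth C'"
  by (auto simp: orth_def axis_def)

lemma K_add: "x \<in> K C \<Longrightarrow> y \<in> K C \<Longrightarrow> x + y \<in> K C"
  unfolding K_def by (auto simp flip: lin.add intro: orth_add)

lemma K_scale: "x \<in> K C \<Longrightarrow> 0 \<le> c \<Longrightarrow> c *\<^sub>R x \<in> K C"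
  unfolding K_def by (auto simp flip: lin.scale intro: orth_scale)

lemma K_zero: "0 \<in> K C"
  unfolding K_def using orth_zero lin.zero by (metis imageI)

lemma K_generator: "p \<in> C \<Longrightarrow> g p \<in> K C"
  unfolding K_def using orth_axis[of p C 1] lin_axis[of 1 p] by (metis imageI scaleR_one zero_le_one)

lemma K_mono: "C \<subseteq> C' \<Longrightarrow> K C \<subseteq> K C'"
  unfolding K_def using orth_mono by blast

lemma convex_K: "convex (K C)"
  unfolding convex_def by (auto intro: K_add K_scale)

lemma K_least:
  assumes T: "0 \<in> T" "\<And>x y. x \<in> T \<Longrightarrow> y \<in> T \<Longrightarrow> x + y \<in> T" "\<And>c x. 0 \<le> c \<Longrightarrow> x \<in> T \<Longrightarrow> c *\<^sub>R x \<in> T"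
    and g: "\<And>p. p \<in> C \<Longrightarrow> g p \<in> T"
  shows "K C \<subseteq> T"
proof
  fix x assume "x \<in> K C"
  then obtain a where a: "a \<in> orth C" "x = lin a" unfolding K_def by blast
  have summand: "a $ p *\<^sub>R g p \<in> T" for p
    using a(1) T(1) T(3)[OF _ g] by (cases "p \<in> C") (auto simp: orth_def)
  have "sum (\<lambda>p. a $ p *\<^sub>R g p) Q \<in> T" for Q
    by (induction Q rule: infinite_finite_induct) (auto intro: T summand)
  then show "x \<in> T" by (simp add: a(2) lin_def)
qed

lemma g_nonneg: "0 \<le> g p $ i"
  using g_nat[of p i] by auto

lemma g_large: "\<exists>i. 1 \<le> g p $ i"
proof -
  obtain i where i: "g p $ i \<noteq> 0" using g_nonzero[of p] by (auto simp: vec_eq_iff)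
  obtain n where n: "g p $ i = real n" using g_nat by blast
  have "1 \<le> real n" using i n by (cases n) auto
  then show ?thesis using n by (intro exI[of _ i]) simp
qed

lemma lin_component: "lin a $ i = (\<Sum>p\<in>UNIV. a $ p * g p $ i)"
  by (simp add: lin_def)

text \<open>The vectors \<open>g p\<close> are non-negative and each has a positive entry, so no
  cancellation is possible.\<close>

lemma pointed:
  assumes "a \<in> orth C" "lin a = 0" shows "a = 0"
proof -
  have "a $ p = 0" for p
  proof -
    obtain i where i: "1 \<le> g p $ i" using g_large by blast
    have "(\<Sum>q\<in>UNIV. a $ q * g q $ i) = 0" using assms(2) by (simp flip: lin_component)
    then have "a $ p * g p $ i = 0"
      by (subst (asm) sum_nonneg_eq_0_iff) (use assms(1) g_nonneg in \<open>auto simp: orth_def\<close>)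
    then show ?thesis using i by simp
  qed
  then show ?thesis by (simp add: vec_eq_iff)
qed

lemma convex_P: "convex (P C)"
proof -
  have "u *\<^sub>R a + v *\<^sub>R b \<in> P C" if "a \<in> P C" "b \<in> P C" "0 \<le> u" "0 \<le> v" "u + v = 1" for a b u v
    using that by (auto simp: P_def lin.add lin.scale simp flip: scaleR_add_left intro!: orth_add orth_scale)
  then show ?thesis by (auto simp: convex_def)
qed

text \<open>Some entry of \<open>g p\<close> is at least 1, so \<open>a $ p\<close> is bounded by an
  entry of \<open>d\<close>.\<close>

lemma compact_P: "compact (P C)"
proof (rule compact_eq_bounded_closed[THEN iffD2], rule conjI)
  let ?b = "\<chi> p. (\<Sum>i\<in>UNIV. d $ i)"
  have d0: "0 \<le> d $ i" for i using d_nat[of i] by auto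
  have "a $ p \<le> (\<Sum>i\<in>UNIV. d $ i)" if a: "a \<in> P C" for a p
  proof -
    obtain i where i: "1 \<le> g p $ i" using g_large by blast
    have nn: "0 \<le> a $ q" for q using a by (simp add: P_def orth_def)
    have "a $ p \<le> a $ p * g p $ i" using mult_left_mono[OF i nn[of p]] by simp
    also have "\<dots> \<le> (\<Sum>q\<in>UNIV. a $ q * g q $ i)" by (rule member_le_sum) (auto intro: mult_nonneg_nonneg nn g_nonneg)
    also have "\<dots> = d $ i" using a by (simp add: P_def flip: lin_component)
    also have "\<dots> \<le> (\<Sum>i\<in>UNIV. d $ i)" by (rule member_le_sum) (auto intro: d0)
    finally show ?thesis .
  qed
  then have "P C \<subseteq> cbox 0 ?b" by (auto simp: mem_box_cart P_def orth_def)
  then show "bounded (P C)" by (rule bounded_subset[OF bounded_cbox])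
  have "P C = (\<Inter>p. {a. 0 \<le> a $ p}) \<inter> (\<Inter>p\<in>-C. {a. a $ p = 0}) \<inter> {a. lin a = d}"
    by (auto simp: P_def orth_def)
  moreover have "closed {a. lin a = d}"
    by (intro closed_Collect_eq continuous_intros linear_continuous_on linear_linear[THEN iffD2] linear_lin)
  ultimately show "closed (P C)" by (auto intro!: closed_Int closed_INT closed_Collect_le closed_Collect_eq continuous_intros)
qed

lemma P_mono: "C \<subseteq> C' \<Longrightarrow> P C \<subseteq> P C'"
  using orth_mono by (auto simp: P_def)

lemma P_restrict: "a \<in> P C \<Longrightarrow> (\<And>p. a $ p \<noteq> 0 \<Longrightarrow> p \<in> C') \<Longrightarrow> a \<in> P C'"
  by (auto simp: P_def orth_def)

lemma supp_subset: "supp C \<subseteq> C"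
  by (auto simp: supp_def P_def orth_def)

lemma P_supp: "P (supp C) = P C"
proof
  show "P C \<subseteq> P (supp C)" using P_restrict[of _ C "supp C"] by (auto simp: supp_def)
qed (rule P_mono[OF supp_subset])

lemma P_nonempty: "P C \<noteq> {} \<longleftrightarrow> d \<in> K C"
  by (auto simp: P_def K_def)

text \<open>Coordinates are non-negative, so the support of a midpoint is the union of both
  supports; averaging over the coordinates gives a point with the largest support.\<close>

lemma full_support:
  assumes F: "convex F" "F \<subseteq> P C" "F \<noteq> {}"
  shows "\<exists>b\<in>F. \<forall>p. (\<exists>a\<in>F. a $ p \<noteq> 0) \<longrightarrow> 0 < b $ p"
proof -
  have nn: "0 \<le> a $ p" if "a \<in> F" for a p using that F(2) by (auto simp: P_def orth_def)
  have "\<exists>b\<in>F. \<forall>p\<in>Q. (\<exists>a\<in>F. a $ p \<noteq> 0) \<longrightarrow> 0 < b $ p" if "finite Q" for Q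
    using that
  proof (induction Q rule: finite_induct)
    case (insert q Q)
    then obtain b where b: "b \<in> F" "\<forall>p\<in>Q. (\<exists>a\<in>F. a $ p \<noteq> 0) \<longrightarrow> 0 < b $ p" by blast
    show ?case
    proof (cases "\<exists>a\<in>F. a $ q \<noteq> 0")
      case True
      then obtain a where a: "a \<in> F" "a $ q \<noteq> 0" by blast
      let ?c = "(1/2) *\<^sub>R b + (1/2) *\<^sub>R a"
      have "?c \<in> F" by (rule convexD[OF F(1) b(1) a(1)]) auto
      moreover have "0 < ?c $ p" if "p \<in> insert q Q" "\<exists>a\<in>F. a $ p \<noteq> 0" for p
      proof (cases "p = q")
        case True
        have "0 < a $ q" using a nn[OF a(1), of q] by simp
        then show ?thesis using nn[OF b(1), of q] True by simp
      next
        case False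
        then have "0 < b $ p" using b(2) that by blast
        then show ?thesis using nn[OF a(1), of p] by simp
      qed
      ultimately show ?thesis by (intro bexI[of _ ?c]) blast
    next
      case False
      then show ?thesis using b by (intro bexI[of _ b]) auto
    qed
  qed (use F(3) in blast)
  from this[of UNIV] show ?thesis by simp
qed

text \<open>Only strictly positive coordinates are moved. The smallest quotient of coordinate and
  speed is a step that keeps all of them non-negative.\<close>

lemma perturb:
  assumes b: "b \<in> P C" and v: "\<And>p. v $ p \<noteq> 0 \<Longrightarrow> 0 < b $ p" "lin v = 0"
  shows "\<exists>e>0. b + e *\<^sub>R v \<in> P C"
proof -
  have nn: "0 \<le> b $ p" for p using b by (simp add: P_def orth_def)
  define e where "e = (if v = 0 then 1 else Min ((\<lambda>p. b $ p / \<bar>v $ p\<bar>) ` {p. v $ p \<noteq> 0}))"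
  have "e > 0"
  proof (cases "v = 0")
    case False
    then have "{p. v $ p \<noteq> 0} \<noteq> {}" by (auto simp: vec_eq_iff)
    then show ?thesis using False v(1) by (simp add: e_def)
  qed (simp add: e_def)
  moreover have "0 \<le> b $ p + e * v $ p" for p
  proof (cases "v $ p = 0")
    case False
    then have "e \<le> b $ p / \<bar>v $ p\<bar>" by (auto simp: e_def intro!: Min_le)
    then have "e * \<bar>v $ p\<bar> \<le> b $ p" using False by (simp add: pos_le_divide_eq)
    moreover have "- (e * v $ p) \<le> e * \<bar>v $ p\<bar>" using \<open>e > 0\<close> by (metis abs_ge_minus_self abs_mult abs_of_pos)
    ultimately show ?thesis by simp
  qed (use nn in simp)
  moreover have "b $ p + e * v $ p = 0" if "p \<notin> C" for p
    using b v(1)[of p] that by (auto simp: P_def orth_def)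
  moreover have "lin (b + e *\<^sub>R v) = d" using b v(2) by (simp add: lin.add lin.scale P_def)
  ultimately show ?thesis by (intro exI[of _ e]) (simp add: P_def orth_def)
qed

text \<open>A face of the cone is a cone: a non-zero \<open>x\<close> lies inside the segment from 0
  to any larger multiple of \<open>x\<close>, so both ends belong to the face.\<close>

lemma face_cone:
  assumes \<tau>: "\<tau> face_of K C" and ne: "\<tau> \<noteq> {}"
  shows "0 \<in> \<tau>" "0 \<le> c \<Longrightarrow> x \<in> \<tau> \<Longrightarrow> c *\<^sub>R x \<in> \<tau>" "x \<in> \<tau> \<Longrightarrow> y \<in> \<tau> \<Longrightarrow> x + y \<in> \<tau>"
proof -
  have mem: "x \<in> K C" if "x \<in> \<tau>" for x using that face_of_imp_subset[OF \<tau>] by blast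
  have big: "0 \<in> \<tau> \<and> s *\<^sub>R x \<in> \<tau>" if x: "x \<in> \<tau>" and s: "s > 1" for x s
  proof (cases "x = 0")
    case False
    have "x = (1 - 1 / s) *\<^sub>R 0 + (1 / s) *\<^sub>R (s *\<^sub>R x)" using s by simp
    moreover have "0 < 1 / s" "1 / s < 1" "0 \<noteq> s *\<^sub>R x" using s False by auto
    ultimately have "x \<in> open_segment 0 (s *\<^sub>R x)" unfolding in_segment by blast
    moreover have "s *\<^sub>R x \<in> K C" using K_scale[OF mem[OF x]] s by simp
    ultimately show ?thesis using face_ofD[OF \<tau> _ K_zero _ x] by blast
  qed (use x in simp)
  obtain x0 where "x0 \<in> \<tau>" using ne by blast
  then show 0: "0 \<in> \<tau>" using big[of x0 2] by simp
  show scale: "c *\<^sub>R x \<in> \<tau>" if "0 \<le> c" "x \<in> \<tau>" for c x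
  proof (cases "c > 1")
    case False
    then have "(1 - c) *\<^sub>R 0 + c *\<^sub>R x \<in> \<tau>" using convexD[OF face_of_imp_convex[OF \<tau>] 0 that(2), of "1 - c" c] that(1) by simp
    then show ?thesis by simp
  qed (use big that in blast)
  show "x + y \<in> \<tau>" if "x \<in> \<tau>" "y \<in> \<tau>" for x y
  proof -
    have "(1/2) *\<^sub>R x + (1/2) *\<^sub>R y \<in> \<tau>" using convexD[OF face_of_imp_convex[OF \<tau>] that, of "1/2" "1/2"] by simp
    then have "2 *\<^sub>R ((1/2) *\<^sub>R x + (1/2) *\<^sub>R y) \<in> \<tau>" by (rule scale[rotated]) simp
    then show ?thesis by (simp add: scaleR_add_right)
  qed
qed

text \<open>\<open>x + y\<close> is the midpoint of \<open>2 *\<^sub>R x\<close> and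
  \<open>2 *\<^sub>R y\<close>.\<close>

lemma face_summand:
  assumes \<tau>: "\<tau> face_of K C" and x: "x \<in> K C" "y \<in> K C" "x + y \<in> \<tau>"
  shows "x \<in> \<tau>"
proof -
  have ne: "\<tau> \<noteq> {}" using x by blast
  have "2 *\<^sub>R x \<in> \<tau>"
  proof (cases "x = y")
    case True
    then show ?thesis using x(3) by (simp add: scaleR_2)
  next
    case False
    have "x + y = (1 - 1/2) *\<^sub>R (2 *\<^sub>R x) + (1/2) *\<^sub>R (2 *\<^sub>R y)" by simp
    then have "x + y \<in> open_segment (2 *\<^sub>R x) (2 *\<^sub>R y)" unfolding in_segment
      using False by (intro conjI exI[of _ "1/2"]) auto
    then show ?thesis using face_ofD[OF \<tau> _ K_scale[OF x(1)] K_scale[OF x(2)] x(3)] by simp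
  qed
  then have "(1/2) *\<^sub>R (2 *\<^sub>R x) \<in> \<tau>" by (rule face_cone(2)[OF \<tau> ne, rotated]) simp
  then show ?thesis by simp
qed

lemma face_support:
  assumes \<tau>: "\<tau> face_of K C" and a: "a \<in> orth C" "lin a \<in> \<tau>" "a $ p \<noteq> 0"
  shows "g p \<in> \<tau>"
proof -
  have p: "p \<in> C" and pos: "0 < a $ p" using a by (auto simp: orth_def less_le)
  let ?b = "a - a $ p *\<^sub>R axis p 1"
  have "?b \<in> orth C" using a(1) p by (auto simp: orth_def axis_def)
  then have b: "lin ?b \<in> K C" unfolding K_def by (rule imageI)
  have gp: "a $ p *\<^sub>R g p \<in> K C" using K_scale[OF K_generator[OF p]] pos by simp
  have "a $ p *\<^sub>R g p + lin ?b = lin a" by (simp add: lin.diff lin_axis)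
  then have "a $ p *\<^sub>R g p + lin ?b \<in> \<tau>" using a(2) by (simp only:)
  then have ap: "a $ p *\<^sub>R g p \<in> \<tau>" by (rule face_summand[OF \<tau> gp b])
  then have ne: "\<tau> \<noteq> {}" by blast
  from ap have "(1 / a $ p) *\<^sub>R (a $ p *\<^sub>R g p) \<in> \<tau>" by (rule face_cone(2)[OF \<tau> ne, rotated]) (simp add: pos less_imp_le)
  then show ?thesis using pos by simp
qed

lemma face_generated:
  assumes \<tau>: "\<tau> face_of K C" and ne: "\<tau> \<noteq> {}"
  shows "K {p \<in> C. g p \<in> \<tau>} = \<tau>"
proof
  show "K {p \<in> C. g p \<in> \<tau>} \<subseteq> \<tau>" by (rule K_least) (auto intro: face_cone[OF \<tau> ne])
  show "\<tau> \<subseteq> K {p \<in> C. g p \<in> \<tau>}"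
  proof
    fix x assume x: "x \<in> \<tau>"
    then have "x \<in> K C" using face_of_imp_subset[OF \<tau>] by blast
    then obtain a where a: "a \<in> orth C" "x = lin a" by (auto simp: K_def)
    have "g p \<in> \<tau>" if "a $ p \<noteq> 0" for p using face_support[OF \<tau> a(1) _ that] x a(2) by simp
    then have "a \<in> orth {p \<in> C. g p \<in> \<tau>}" using a(1) by (auto simp: orth_def)
    then show "x \<in> K {p \<in> C. g p \<in> \<tau>}" using a(2) by (auto simp: K_def)
  qed
qed

lemma g_in_ray: "g p \<in> ray p"
  unfolding ray_def by (intro CollectI exI[of _ 1]) simp

lemma aff_dim_ray: "aff_dim (ray p) = 1"
proof -
  have 0: "0 \<in> ray p" unfolding ray_def by (intro CollectI exI[of _ 0]) simp
  note 1 = g_in_ray[of p]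
  have "ray p \<subseteq> span {g p}" by (auto simp: ray_def span_singleton)
  moreover have "{g p} \<subseteq> span (ray p)" using 1 span_base by auto
  ultimately have "span (ray p) = span {g p}" by (metis span_subspace span_minimal subspace_span subset_antisym span_mono span_span)
  then have "dim (ray p) = dim {g p}" by (metis dim_span)
  also have "\<dots> = 1" using g_nonzero[of p] by simp
  finally show ?thesis using aff_dim_zero[of "ray p"] hull_inc[OF 0] by simp
qed

text \<open>A minimal subset of the generators that still generates the face consists of edges.\<close>

lemma face_edges:
  assumes \<tau>: "\<tau> face_of K C" and ne: "\<tau> \<noteq> {}"
  shows "K {p \<in> C. ray p edge_of \<tau>} = \<tau>"
proof
  let ?E = "{p \<in> C. ray p edge_of \<tau>}"
  have gE: "g p \<in> \<tau>" if "ray p edge_of \<tau>" for p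
    using edge_of_imp_subset[OF that] g_in_ray by blast
  show "K ?E \<subseteq> \<tau>" by (rule K_least) (auto intro: face_cone[OF \<tau> ne] gE)
  have fin: "finite {G. G \<subseteq> C \<and> K G = \<tau>}" by simp
  have "{p \<in> C. g p \<in> \<tau>} \<in> {G. G \<subseteq> C \<and> K G = \<tau>}" using face_generated[OF \<tau> ne] by simp
  then have "{G. G \<subseteq> C \<and> K G = \<tau>} \<noteq> {}" by (metis empty_iff)
  from finite_has_minimal[OF fin this] obtain G where G0: "G \<in> {G. G \<subseteq> C \<and> K G = \<tau>}"
    and G1: "\<forall>G'\<in>{G. G \<subseteq> C \<and> K G = \<tau>}. G' \<subseteq> G \<longrightarrow> G = G'" by (rule bexE)
  have G: "G \<subseteq> C" "K G = \<tau>" using G0 by auto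
  have "ray p edge_of \<tau>" if p: "p \<in> G" for p
  proof -
    \<comment> \<open>Otherwise \<open>p\<close> could be removed from the minimal generating set
      \<open>G\<close>.\<close>
    have notin: "g p \<notin> K (G - {p})"
    proof
      assume gp: "g p \<in> K (G - {p})"
      have "g q \<in> K (G - {p})" if "q \<in> G" for q using gp K_generator[of q "G - {p}"] that by (cases "q = p") auto
      then have "K G \<subseteq> K (G - {p})" by (intro K_least) (auto intro: K_zero K_add K_scale)
      then have "K (G - {p}) = K G" by (rule subset_antisym[OF K_mono[OF Diff_subset]])
      then have "K (G - {p}) = \<tau>" using G(2) by simp
      then show False using G1 G(1) p by blast
    qed
    have "ray p face_of \<tau>" unfolding face_of_def
    proof (intro conjI ballI impI)
      show "ray p \<subseteq> \<tau>" using K_scale[OF K_generator[OF p]] G(2) by (auto simp: ray_def)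
      show "convex (ray p)" unfolding convex_def
      proof (intro ballI allI impI)
        fix x y u v :: real and x' y' assume "x' \<in> ray p" "y' \<in> ray p" "0 \<le> u" "0 \<le> v"
        then obtain c c' where "x' = c *\<^sub>R g p" "y' = c' *\<^sub>R g p" "0 \<le> c" "0 \<le> c'" by (auto simp: ray_def)
        then have "u *\<^sub>R x' + v *\<^sub>R y' = (u * c + v * c') *\<^sub>R g p" "0 \<le> u * c + v * c'" using \<open>0 \<le> u\<close> \<open>0 \<le> v\<close> by (auto simp: scaleR_add_left)
        then show "u *\<^sub>R x' + v *\<^sub>R y' \<in> ray p" by (auto simp: ray_def)
      qed
      have both: "x \<in> ray p \<and> y \<in> ray p" if x: "x \<in> \<tau>" and y: "y \<in> \<tau>" and z: "z \<in> ray p" "z \<in> open_segment x y" for x y z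
      proof -
        obtain t where t: "0 < t" "t < 1" "z = (1 - t) *\<^sub>R x + t *\<^sub>R y" using z(2) by (auto simp: in_segment)
        obtain c where c: "z = c *\<^sub>R g p" "0 \<le> c" using z(1) by (auto simp: ray_def)
        obtain a where a: "a \<in> orth G" "x = lin a" using x G(2) by (auto simp: K_def)
        obtain b where b: "b \<in> orth G" "y = lin b" using y G(2) by (auto simp: K_def)
        let ?s = "(1 - t) *\<^sub>R a + t *\<^sub>R b"
        have s: "?s \<in> orth G" using a(1) b(1) t by (intro orth_add orth_scale) auto
        have lin_s: "lin ?s = c *\<^sub>R g p" using t(3) c(1) a(2) b(2) by (simp add: lin.add lin.scale)
        let ?r = "?s - ?s $ p *\<^sub>R axis p 1"
        have r: "?r \<in> orth (G - {p})" using s by (auto simp: orth_def axis_def)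
        have lin_r: "lin ?r = (c - ?s $ p) *\<^sub>R g p" unfolding lin.diff lin_s lin_axis by (simp add: scaleR_diff_left)
        \<comment> \<open>If the combination used \<open>p\<close> with a coefficient below
          \<open>c\<close>, the difference would express \<open>g p\<close> by the other
          generators.\<close>
        have le: "c \<le> ?s $ p"
        proof (rule ccontr)
          assume "\<not> c \<le> ?s $ p"
          then have pos: "0 < c - ?s $ p" by simp
          have "lin ?r \<in> K (G - {p})" using r by (auto simp: K_def)
          then have "(1 / (c - ?s $ p)) *\<^sub>R lin ?r \<in> K (G - {p})" using pos by (intro K_scale) auto
          then show False using notin pos unfolding lin_r by simp
        qed
        \<comment> \<open>The other generators together with the surplus of \<open>p\<close> sum to
          zero, so by pointedness all these coefficients vanish and both ends lie on the
          ray.\<close>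
        let ?q = "?r + (?s $ p - c) *\<^sub>R axis p 1"
        have "?q \<in> orth G" using orth_mono[OF _ r, of G] le p by (intro orth_add orth_axis) auto
        moreover have "lin ?q = 0" unfolding lin.add lin_r lin_axis by (simp flip: scaleR_add_left)
        ultimately have q0: "?q = 0" by (rule pointed)
        have s0: "?s $ q = 0" if "q \<noteq> p" for q
          using arg_cong[OF q0, of "\<lambda>v. v $ q"] that by (simp add: axis_def)
        have "a $ q = 0 \<and> b $ q = 0" if "q \<noteq> p" for q
        proof -
          have "0 \<le> (1 - t) * a $ q" "0 \<le> t * b $ q" using a(1) b(1) t by (auto simp: orth_def)
          moreover have "(1 - t) * a $ q + t * b $ q = 0" using s0[OF that] by simp
          ultimately have "(1 - t) * a $ q = 0" "t * b $ q = 0" by linarith+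
          then show ?thesis using t by simp
        qed
        then have "a = a $ p *\<^sub>R axis p 1" "b = b $ p *\<^sub>R axis p 1" by (auto simp: vec_eq_iff axis_def)
        then have "x = a $ p *\<^sub>R g p" "y = b $ p *\<^sub>R g p" using a(2) b(2) lin_axis by metis+
        then show ?thesis using a(1) b(1) by (auto simp: ray_def orth_def)
      qed
      show "x \<in> ray p" "y \<in> ray p" if "x \<in> \<tau>" "y \<in> \<tau>" "z \<in> ray p" "z \<in> open_segment x y" for x y z
        using both[OF that] by simp_all
    qed
    then show ?thesis by (simp add: edge_of_def aff_dim_ray)
  qed
  then have "G \<subseteq> ?E" using G(1) by blast
  then show "\<tau> \<subseteq> K ?E" using K_mono G(2) by blast
qed

lemma supp_eq:
  assumes \<tau>: "\<tau> face_of K C" and d: "d \<in> rel_interior \<tau>"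
  shows "supp C = {p \<in> C. g p \<in> \<tau>}"
proof (intro equalityI subsetI)
  have d\<tau>: "d \<in> \<tau>" using d rel_interior_subset by blast
  fix p assume "p \<in> supp C"
  then obtain a where "a \<in> orth C" "lin a = d" "a $ p \<noteq> 0" "p \<in> C" using supp_subset by (auto simp: supp_def P_def)
  then show "p \<in> {p \<in> C. g p \<in> \<tau>}" using face_support[OF \<tau>] d\<tau> by auto
next
  have d\<tau>: "d \<in> \<tau>" using d rel_interior_subset by blast
  fix p assume p: "p \<in> {p \<in> C. g p \<in> \<tau>}"
  obtain T where T: "open T" "d \<in> T" "T \<inter> affine hull \<tau> \<subseteq> \<tau>" using d by (auto simp: mem_rel_interior)
  obtain e where e: "e > 0" "ball d e \<subseteq> T" using T(1,2) openE by blast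
  define c where "c = e / (2 * norm (g p))"
  have c: "c > 0" using e(1) g_nonzero[of p] by (simp add: c_def)
  have "norm (c *\<^sub>R g p) < e" using e(1) g_nonzero[of p] by (simp add: c_def)
  then have "d - c *\<^sub>R g p \<in> T" using e(2) by (auto simp: dist_norm)
  moreover have "d - c *\<^sub>R g p \<in> affine hull \<tau>"
  proof -
    have hull: "x \<in> affine hull \<tau>" if "x \<in> \<tau>" for x using that by (rule hull_inc)
    have "d + c *\<^sub>R (0 - g p) \<in> affine hull \<tau>"
      by (rule mem_affine_3_minus[OF affine_affine_hull]) (use hull d\<tau> p face_cone(1)[OF \<tau>] in auto)
    then show ?thesis by simp
  qed
  ultimately have "d - c *\<^sub>R g p \<in> K C" using T(3) face_of_imp_subset[OF \<tau>] by blast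
  then obtain a where a: "a \<in> orth C" "d - c *\<^sub>R g p = lin a" by (auto simp: K_def)
  let ?b = "a + c *\<^sub>R axis p 1"
  have "?b \<in> P C" using a p c by (auto simp: P_def lin.add lin_axis intro!: orth_add orth_axis simp flip: a(2))
  moreover have "?b $ p > 0" using a(1) c by (auto simp: orth_def axis_def intro: add_nonneg_pos)
  ultimately show "p \<in> supp C" unfolding supp_def by force
qed

text \<open>The edge generators span the whole face, so \<open>\<tau>\<close> is the cone of this
  subset with \<open>d\<close> in its relative interior, and all generators of the subset lie in
  \<open>\<tau>\<close>.\<close>

lemma supp_edges:
  assumes \<tau>: "\<tau> face_of K C" and d: "d \<in> rel_interior \<tau>"
  shows "supp {p \<in> C. ray p edge_of \<tau>} = {p \<in> C. ray p edge_of \<tau>}"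
proof -
  let ?E = "{p \<in> C. ray p edge_of \<tau>}"
  have ne: "\<tau> \<noteq> {}" using d rel_interior_subset by blast
  have K: "K ?E = \<tau>" by (rule face_edges[OF \<tau> ne])
  have "\<tau> face_of K ?E" unfolding K using face_of_refl[OF face_of_imp_convex[OF \<tau>]] .
  from supp_eq[OF this d] show ?thesis using K_generator[of _ ?E] unfolding K by auto
qed

lemma supp_empty: "P C = {} \<Longrightarrow> supp C = {}"
  by (simp add: supp_def)

lemma P_face: assumes "C \<subseteq> C'" shows "P C face_of P C'"
  unfolding face_of_def
proof (intro conjI ballI impI)
  show "P C \<subseteq> P C'" by (rule P_mono[OF assms])
  show "convex (P C)" by (rule convex_P)
  have "a \<in> P C \<and> b \<in> P C" if a: "a \<in> P C'" and b: "b \<in> P C'" and x: "x \<in> P C" "x \<in> open_segment a b" for a b x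
  proof -
    obtain t where t: "0 < t" "t < 1" "x = (1 - t) *\<^sub>R a + t *\<^sub>R b" using x(2) by (auto simp: in_segment)
    have "a $ p = 0 \<and> b $ p = 0" if "p \<notin> C" for p
    proof -
      have "0 \<le> (1 - t) * a $ p" "0 \<le> t * b $ p" using a b t by (auto simp: P_def orth_def)
      moreover have "(1 - t) * a $ p + t * b $ p = 0" using x(1) that t(3) by (auto simp: P_def orth_def)
      ultimately have "(1 - t) * a $ p = 0" "t * b $ p = 0" by linarith+
      then show ?thesis using t by simp
    qed
    then show ?thesis using P_restrict[OF a, of C] P_restrict[OF b, of C] by blast
  qed
  then show "a \<in> P C" "b \<in> P C" if "a \<in> P C'" "b \<in> P C'" "x \<in> P C" "x \<in> open_segment a b" for a b x
    using that by blast+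
qed

lemma P_faces:
  assumes F: "F face_of P C" and ne: "F \<noteq> {}"
  shows "\<exists>E\<subseteq>C. F = P E \<and> supp E = E"
proof -
  let ?E = "{p. \<exists>a\<in>F. a $ p \<noteq> 0}"
  have FP: "F \<subseteq> P C" using face_of_imp_subset[OF F] .
  have sub: "?E \<subseteq> C" using FP by (auto simp: P_def orth_def)
  have FE: "F \<subseteq> P ?E" using FP P_restrict[of _ C ?E] by blast
  obtain b where b: "b \<in> F" "\<forall>p. (\<exists>a\<in>F. a $ p \<noteq> 0) \<longrightarrow> 0 < b $ p" using full_support[OF face_of_imp_convex[OF F] FP ne] by blast
  have "P ?E \<subseteq> F"
  proof
    fix a assume a: "a \<in> P ?E"
    show "a \<in> F"
    proof (cases "a = b")
      case False
      have pos: "0 < b $ p" if "(b - a) $ p \<noteq> 0" for p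
      proof -
        have "a $ q = 0" if "q \<notin> ?E" for q using a that unfolding P_def orth_def by simp
        then have "p \<in> ?E" using \<open>(b - a) $ p \<noteq> 0\<close> b(1) by fastforce
        then show ?thesis using b(2) by simp
      qed
      have "lin (b - a) = 0" using a b(1) FE by (auto simp: lin.diff P_def)
      from perturb[OF subsetD[OF FP b(1)] pos this] obtain e where e: "e > 0" "b + e *\<^sub>R (b - a) \<in> P C" by blast
      \<comment> \<open>\<open>?c\<close> extends the segment from \<open>a\<close> to
        \<open>b\<close> slightly beyond \<open>b\<close>, which therefore is an inner point; the
        face property yields \<open>a\<close>.\<close>
      let ?c = "b + e *\<^sub>R (b - a)" and ?t = "1 / (1 + e)"
      have te: "?t * e = 1 - ?t" using e(1) by (simp add: field_simps)
      have "(1 - ?t) *\<^sub>R a + ?t *\<^sub>R ?c = (1 - ?t) *\<^sub>R a + ?t *\<^sub>R b + (?t * e) *\<^sub>R (b - a)"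
        by (simp add: scaleR_add_right)
      also have "\<dots> = b" unfolding te by (simp add: algebra_simps)
      finally have eq: "b = (1 - ?t) *\<^sub>R a + ?t *\<^sub>R ?c" ..
      have t01: "0 < ?t" "?t < 1" using e(1) by auto
      have "a \<noteq> ?c"
      proof
        assume "a = ?c"
        then have "(1 + e) *\<^sub>R (b - a) = 0" by (simp add: algebra_simps)
        then show False using e(1) False by simp
      qed
      then have "b \<in> open_segment a ?c" unfolding in_segment by (intro conjI exI[of _ ?t] t01 eq)
      moreover have "a \<in> P C" using a P_mono[OF sub] by blast
      ultimately show ?thesis using face_ofD[OF F _ _ e(2) b(1)] by blast
    qed (use b in simp)
  qed
  then have "F = P ?E" using FE by blast
  moreover have "supp ?E = ?E" unfolding supp_def using \<open>F = P ?E\<close> by blast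
  ultimately show ?thesis using sub by (intro exI[of _ ?E]) blast
qed

lemma aff_dim_K: "aff_dim (K E) = int (dim (g ` E))"
proof -
  have "span (K E) = span (g ` E)"
  proof
    have "K E \<subseteq> span (g ` E)" by (rule K_least) (auto intro: span_zero span_add span_scale span_base)
    then show "span (K E) \<subseteq> span (g ` E)" by (rule span_minimal) (rule subspace_span)
    show "span (g ` E) \<subseteq> span (K E)" by (rule span_mono) (auto intro: K_generator)
  qed
  then have "dim (K E) = dim (g ` E)" by (metis dim_span)
  then show ?thesis using aff_dim_zero[of "K E"] hull_inc[OF K_zero] by simp
qed

text \<open>At a point that is positive on all of \<open>E\<close>, every direction supported on
  \<open>E\<close> in the kernel of \<open>lin\<close> is admissible. So the dimension is that of
  this kernel, and rank-nullity applies.\<close>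

lemma aff_dim_P:
  assumes E: "supp E = E" and ne: "P E \<noteq> {}"
  shows "aff_dim (P E) = int (card E) - int (dim (g ` E))"
proof -
  let ?W = "{v :: real ^ 'a. \<forall>p. p \<notin> E \<longrightarrow> v $ p = 0}"
  let ?N = "{v \<in> ?W. lin v = 0}"
  have W: "subspace ?W" by (auto simp: subspace_def)
  have N: "subspace ?N" by (auto simp: subspace_def lin.zero lin.add lin.scale)
  obtain b where b: "b \<in> P E" "\<forall>p. (\<exists>a\<in>P E. a $ p \<noteq> 0) \<longrightarrow> 0 < b $ p"
    using full_support[OF convex_P subset_refl ne] by blast
  have bpos: "0 < b $ p" if "p \<in> E" for p
  proof -
    have "p \<in> supp E" using that E by simp
    then show ?thesis using b(2) unfolding supp_def by simp
  qed
  have "(\<lambda>x. x - b) ` P E \<subseteq> ?N" using b(1) by (auto simp: P_def orth_def lin.diff)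
  moreover have "?N \<subseteq> span ((\<lambda>x. x - b) ` P E)"
  proof
    fix v assume v: "v \<in> ?N"
    then have pos: "0 < b $ p" if "v $ p \<noteq> 0" for p using bpos[of p] that by blast
    have "lin v = 0" using v by simp
    from perturb[OF b(1) pos this] obtain e where e: "e > 0" "b + e *\<^sub>R v \<in> P E" by blast
    then have "(b + e *\<^sub>R v) - b \<in> span ((\<lambda>x. x - b) ` P E)" by (intro span_base imageI)
    then have "e *\<^sub>R v \<in> span ((\<lambda>x. x - b) ` P E)" by simp
    from span_scale[OF this, of "1 / e"] show "v \<in> span ((\<lambda>x. x - b) ` P E)" using e(1) by simp
  qed
  ultimately have span: "span ((\<lambda>x. x - b) ` P E) = ?N"
    by (intro subset_antisym[OF span_minimal[OF _ N]])
  have "dim ((\<lambda>x. x - b) ` P E) = dim ?N"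
    using dim_span[of "(\<lambda>x. x - b) ` P E"] unfolding span by (rule sym)
  then have "aff_dim (P E) = int (dim ?N)" using aff_dim_eq_dim_subtract[of b "P E"] hull_inc[OF b(1)] by simp
  moreover have "dim ?N + dim (lin ` ?W) = dim ?W" by (rule rank_nullity[OF linear_lin W])
  moreover have "dim ?W = card E" unfolding dim_vec_eq[symmetric] by (rule dim_substandard_cart)
  moreover have "dim (lin ` ?W) = dim (g ` E)"
  proof -
    have "lin ` ?W = span (g ` E)"
    proof
      have "a $ p *\<^sub>R g p \<in> span (g ` E)" if "a \<in> ?W" for a p
        using that by (cases "p \<in> E") (auto intro: span_scale span_base span_zero)
      then show "lin ` ?W \<subseteq> span (g ` E)" unfolding lin_def by (auto intro!: span_sum)
      have "g p \<in> lin ` ?W" if "p \<in> E" for p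
        using that lin_axis[of 1 p] by (intro image_eqI[of _ _ "axis p 1"]) (auto simp: axis_def)
      then show "span (g ` E) \<subseteq> lin ` ?W" by (intro span_minimal linear_subspace_image[OF linear_lin W]) auto
    qed
    then show ?thesis by simp
  qed
  ultimately show ?thesis by simp
qed

lemma extreme_rational:
  assumes x: "x extreme_point_of P C" shows "x $ p \<in> \<rat>"
proof -
  have xP: "x \<in> P C" using x by (simp add: extreme_point_of_def)
  obtain h :: "real \<Rightarrow> rat" where "(\<forall>x y. h (x + y) = h x + h y) \<and> (\<forall>n x. h (real n * x) = of_nat n * h x) \<and> (\<forall>n. h (real n) = of_nat n)"
    using rational_retraction by (rule exE)
  then have h: "\<And>x y. h (x + y) = h x + h y" "\<And>n x. h (real n * x) = of_nat n * h x" "\<And>n. h (real n) = of_nat n" by simp_all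
  have h0: "h 0 = 0" using h(3)[of 0] by simp
  have h_sum: "h (sum f Q) = (\<Sum>q\<in>Q. h (f q))" for f :: "'a \<Rightarrow> real" and Q
    by (induction Q rule: infinite_finite_induct) (auto simp: h0 h(1))
  \<comment> \<open>The entries of the \<open>g p\<close> and of \<open>d\<close> are natural
    numbers, so applying \<open>h\<close> to each coordinate gives another solution of the same
    equations, with zeros preserved. It may have negative coordinates, but the difference to
    \<open>x\<close> is still a direction in which \<open>x\<close> can be moved both ways.\<close>
  define y where "y = (\<chi> p. real_of_rat (h (x $ p)))"
  have "lin y $ i = d $ i" for i
  proof -
    have "\<forall>p. \<exists>n. g p $ i = real n" using g_nat by blast
    from choice[OF this] obtain n where n: "g p $ i = real (n p)" for p by blast
    obtain k where k: "d $ i = real k" using d_nat by blast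
    have "y $ p * g p $ i = real_of_rat (h (x $ p * g p $ i))" for p
      using h(2)[of "n p" "x $ p"] by (simp add: y_def n of_rat_mult mult.commute)
    then have "lin y $ i = real_of_rat (\<Sum>p\<in>UNIV. h (x $ p * g p $ i))"
      unfolding lin_component by (simp add: of_rat_sum)
    also have "(\<Sum>p\<in>UNIV. h (x $ p * g p $ i)) = h (lin x $ i)" unfolding lin_component h_sum ..
    also have "lin x $ i = real k" using xP k by (simp add: P_def)
    finally show ?thesis using h(3)[of k] k by simp
  qed
  then have "lin y = lin x" using xP by (simp add: vec_eq_iff P_def)
  then have lin0: "lin (y - x) = 0" by (simp add: lin.diff)
  have pos: "0 < x $ p" if "(y - x) $ p \<noteq> 0" for p
  proof -
    have "x $ p \<noteq> 0" using that by (auto simp: y_def h0)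
    then show ?thesis using xP by (auto simp: P_def orth_def less_le)
  qed
  have "y = x"
  proof (rule ccontr)
    assume ne: "y \<noteq> x"
    let ?v = "y - x"
    obtain e where e: "e > 0" "x + e *\<^sub>R ?v \<in> P C" using perturb[OF xP pos lin0] by blast
    have pos': "0 < x $ p" if "(- ?v) $ p \<noteq> 0" for p using pos[of p] that by simp
    have "lin (- ?v) = 0" unfolding lin.neg lin0 by simp
    from perturb[OF xP pos' this] obtain e' where e': "e' > 0" "x + e' *\<^sub>R (- ?v) \<in> P C" by blast
    define m where "m = min e e'"
    have m: "0 < m" "m \<le> e" "m \<le> e'" using e e' by (auto simp: m_def)
    have in1: "x + s *\<^sub>R w \<in> P C" if "x + t *\<^sub>R w \<in> P C" "0 < s" "s \<le> t" for s t w
    proof -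
      have "(1 - s / t) *\<^sub>R x + (s / t) *\<^sub>R (x + t *\<^sub>R w) \<in> P C" using that by (intro convexD[OF convex_P xP that(1)]) auto
      moreover have "(1 - s / t) *\<^sub>R x + (s / t) *\<^sub>R (x + t *\<^sub>R w) = x + s *\<^sub>R w" using that by (simp add: algebra_simps)
      ultimately show ?thesis by simp
    qed
    have "x + m *\<^sub>R ?v \<in> P C" "x + m *\<^sub>R (- ?v) \<in> P C" using in1[OF e(2)] in1[OF e'(2)] m by blast+
    moreover have "x \<in> open_segment (x + m *\<^sub>R ?v) (x - m *\<^sub>R ?v)" using m(1) ne by (intro centre_in_open_segment) simp
    moreover have "x + m *\<^sub>R (- ?v) = x - m *\<^sub>R ?v" by (simp only: scaleR_minus_right diff_conv_add_uminus)
    ultimately show False using x unfolding extreme_point_of_def by (simp only:)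
  qed
  moreover have "y $ p \<in> \<rat>" by (simp add: y_def)
  ultimately show ?thesis by simp
qed

text \<open>A real coefficient \<open>t\<close> is approximated by the floor of \<open>n * t\<close>
  divided by \<open>n\<close>; division by zero gives the harmless value 0 at
  \<open>n = 0\<close>.\<close>

lemma convex_closure_rational:
  fixes U :: "(real ^ 'n) set"
  assumes U: "\<And>x y q. x \<in> U \<Longrightarrow> y \<in> U \<Longrightarrow> q \<in> \<rat> \<Longrightarrow> 0 \<le> q \<Longrightarrow> q \<le> 1 \<Longrightarrow> (1 - q) *\<^sub>R x + q *\<^sub>R y \<in> U"
  shows "convex (closure U)"
  unfolding convex_alt
proof (intro ballI allI impI)
  fix x y :: "real ^ 'n" and t :: real
  assume x: "x \<in> closure U" and y: "y \<in> closure U" and t: "0 \<le> t \<and> t \<le> 1"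
  obtain X where X: "\<And>n. X n \<in> U" "X \<longlonglongrightarrow> x" using x unfolding closure_sequential by blast
  obtain Y where Y: "\<And>n. Y n \<in> U" "Y \<longlonglongrightarrow> y" using y unfolding closure_sequential by blast
  define q where "q n = of_int \<lfloor>real n * t\<rfloor> / real n" for n
  have q0: "0 \<le> q n" for n using t by (simp add: q_def)
  have q1: "q n \<le> 1" for n
  proof (cases "n = 0")
    case False
    have "of_int \<lfloor>real n * t\<rfloor> \<le> real n * t" by simp
    also have "\<dots> \<le> real n" using t by (simp add: mult_left_le)
    finally show ?thesis using False by (simp add: q_def)
  qed (simp add: q_def)
  have "q \<longlonglongrightarrow> t"
  proof (rule tendsto_sandwich)
    show "\<forall>\<^sub>F n in sequentially. t - 1 / real n \<le> q n"
    proof (rule eventually_sequentiallyI)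
      fix n :: nat assume "1 \<le> n"
      then have "t - 1 / real n = (real n * t - 1) / real n" by (simp add: field_simps)
      also have "\<dots> \<le> q n" unfolding q_def by (rule divide_right_mono) linarith+
      finally show "t - 1 / real n \<le> q n" .
    qed
    show "\<forall>\<^sub>F n in sequentially. q n \<le> t"
    proof (rule eventually_sequentiallyI)
      fix n :: nat assume "1 \<le> n"
      then show "q n \<le> t" by (simp add: q_def field_simps)
    qed
    show "(\<lambda>n. t - 1 / real n) \<longlonglongrightarrow> t" using tendsto_diff[OF tendsto_const lim_inverse_n', of t] by simp
  qed simp
  then have "(\<lambda>n. (1 - q n) *\<^sub>R X n + q n *\<^sub>R Y n) \<longlonglongrightarrow> (1 - t) *\<^sub>R x + t *\<^sub>R y"
    by (intro tendsto_intros X Y)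
  moreover have "(1 - q n) *\<^sub>R X n + q n *\<^sub>R Y n \<in> U" for n
    using q0 q1 by (intro U X Y) (auto simp: q_def)
  ultimately show "(1 - t) *\<^sub>R x + t *\<^sub>R y \<in> closure U" unfolding closure_sequential
    by (intro exI[of _ "\<lambda>n. (1 - q n) *\<^sub>R X n + q n *\<^sub>R Y n"]) simp
qed

text \<open>The closure of the rational points is convex and contains the extreme points, whose
  convex hull is the whole fibre.\<close>

lemma P_closure: "closure {x \<in> P C. \<forall>p. x $ p \<in> \<rat>} = P C"
proof
  let ?U = "{x \<in> P C. \<forall>p. x $ p \<in> \<rat>}"
  show "closure ?U \<subseteq> P C" by (rule closure_minimal) (auto intro: compact_imp_closed compact_P)
  have "convex (closure ?U)"
    by (rule convex_closure_rational) (auto intro!: convexD[OF convex_P] Rats_add Rats_mult Rats_diff)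
  moreover have "{x. x extreme_point_of P C} \<subseteq> closure ?U"
    using extreme_rational closure_subset[of ?U] by (auto simp: extreme_point_of_def)
  ultimately have "convex hull {x. x extreme_point_of P C} \<subseteq> closure ?U" by (rule hull_minimal[rotated])
  then show "P C \<subseteq> closure ?U" using Krein_Milman_Minkowski[OF compact_P convex_P] by simp
qed

end

section \<open>The Newton-Okounkov polytopes\<close>

lemma common_denominator:
  assumes "finite Q" "\<And>p. p \<in> Q \<Longrightarrow> x p \<in> \<rat> \<and> 0 \<le> x p"
  shows "\<exists>n\<ge>1. \<forall>p\<in>Q. \<exists>k. real n * x p = real k"
  using assms
proof (induction Q rule: finite_induct)
  case (insert q Q)
  then obtain n where n: "1 \<le> n" "\<forall>p\<in>Q. \<exists>k. real n * x p = real k" by auto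
  have "x q \<in> \<rat>" using insert.prems[of q] by simp
  then obtain a b :: nat where ab: "b \<noteq> 0" "\<bar>x q\<bar> = real a / real b" by (rule Rats_abs_nat_div_natE)
  have "0 \<le> x q" using insert.prems[of q] by simp
  then have eq: "x q = real a / real b" using ab(2) by linarith
  have "real (b * n) * x q = real (a * n)" unfolding eq using ab(1) by simp
  moreover have "\<exists>k. real (b * n) * x p = real k" if p: "p \<in> Q" for p
  proof -
    obtain k where k: "real n * x p = real k" using bspec[OF n(2) p] by (rule exE)
    have "real (b * n) * x p = real b * (real n * x p)" by (simp add: mult.assoc)
    also have "\<dots> = real (b * k)" unfolding k by simp
    finally show ?thesis by (rule exI)
  qed
  ultimately have "\<forall>p\<in>insert q Q. \<exists>k. real (b * n) * x p = real k" by blast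
  moreover have "1 \<le> b * n" using n(1) ab(1) by simp
  ultimately show ?case by blast
qed auto

context degree_vectors
begin

lemma P_subset_iff: "P C \<subseteq> P C' \<longleftrightarrow> supp C \<subseteq> supp C'"
proof
  show "P C \<subseteq> P C' \<Longrightarrow> supp C \<subseteq> supp C'" by (auto simp: supp_def)
  show "supp C \<subseteq> supp C' \<Longrightarrow> P C \<subseteq> P C'" using P_mono[of "supp C" "supp C'"] by (simp add: P_supp)
qed

lemma supp_supp: "supp (supp C) = supp C"
  unfolding supp_def[of "supp C"] P_supp by (simp add: supp_def)

lemma polytope_dim_P: "polytope_dim (P C) = int (card (supp C)) - polytope_dim (K (supp C))"
proof -
  have K: "polytope_dim (K (supp C)) = int (dim (g ` supp C))" by (simp add: polytope_dim_def aff_dim_K)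
  show ?thesis
  proof (cases "P C = {}")
    case True
    \<comment> \<open>The support is empty and the cone it spans is the origin, so the formula reads
      0 = 0 with the convention of \<open>polytope_dim\<close>.\<close>
    then show ?thesis using supp_empty[OF True] by (simp add: aff_dim_K polytope_dim_def)
  next
    case False
    have "aff_dim (P C) = int (card (supp C)) - int (dim (g ` supp C))"
      using aff_dim_P[OF supp_supp] False by (simp add: P_supp)
    moreover have "aff_dim (P C) \<ge> 0" using False aff_dim_negative_iff[of "P C"] by linarith
    ultimately show ?thesis unfolding K by (simp add: polytope_dim_def)
  qed
qed

lemma integral_multiple:
  assumes "x \<in> P C" "\<And>p. x $ p \<in> \<rat>"
  shows "\<exists>n\<ge>1. \<exists>k. real n *\<^sub>R x = (\<chi> p. real (k p)) \<and> (\<forall>p. k p \<noteq> 0 \<longrightarrow> p \<in> C) \<and> lin (real n *\<^sub>R x) = real n *\<^sub>R d"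
proof -
  have nn: "0 \<le> x $ p" for p using assms(1) by (simp add: P_def orth_def)
  have "\<exists>n\<ge>1. \<forall>p\<in>UNIV. \<exists>k. real n * x $ p = real k"
    by (rule common_denominator) (use assms(2) nn in auto)
  then obtain n where n: "1 \<le> n" "\<forall>p. \<exists>k. real n * x $ p = real k" by auto
  from choice[OF n(2)] obtain k where k: "\<And>p. real n * x $ p = real (k p)" by blast
  have "real n *\<^sub>R x = (\<chi> p. real (k p))" by (simp add: vec_eq_iff k)
  moreover have "p \<in> C" if "k p \<noteq> 0" for p
  proof -
    have "x $ p \<noteq> 0" using k[of p] that by auto
    then show ?thesis using assms(1) by (auto simp: P_def orth_def)
  qed
  moreover have "lin (real n *\<^sub>R x) = real n *\<^sub>R d"
    using assms(1) linear_scale[OF linear_lin, of "real n" x] by (simp add: P_def)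
  ultimately show ?thesis using n(1) by blast
qed

end

context seshadri
begin

section \<open>Transfer to the values of the stratification\<close>

context
  fixes r :: "('a \<times> 'a) set" and d :: "'m \<Rightarrow> nat" assumes refines: "refines_order S r"
begin

interpretation dv: degree_vectors "extr_degree S" "real_degree d"
proof
  show "\<exists>n. extr_degree S p $ i = real n" "\<exists>n. real_degree d $ i = real n" for p i
    by (auto simp: extr_degree_def real_degree_def)
  show "extr_degree S p \<noteq> 0" for p
    using deg_nonzero[of p] by (auto simp: extr_degree_def multidegree_extr real_degree_def vec_eq_iff fun_eq_iff)
qed

lemma degree_map_lin: "degree_map S = dv.lin"
  by (simp add: fun_eq_iff degree_map_def dv.lin_def)

lemma degree_ray_eq: "degree_ray S p = dv.ray p"
  by (simp add: degree_ray_def dv.ray_def)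

lemma Gamma_on_orth: "a \<in> Gamma_on S r C \<Longrightarrow> a \<in> dv.orth C"
  using Gamma_nonneg[OF refines] by (auto simp: Gamma_on_def dv.orth_def)

lemma Gamma_onI: "poset_chain S C \<Longrightarrow> (\<And>p. k p \<noteq> 0 \<Longrightarrow> p \<in> C) \<Longrightarrow> (\<chi> p. real (k p)) \<in> Gamma_on S r C"
  using monomial_in_Gamma[OF refines, of C k] by (auto simp: Gamma_on_def)

text \<open>One inclusion holds because values are non-negative and supported on \<open>C\<close>,
  the other because each single extremal function has a unit vector as its value.\<close>

lemma degree_cone_eq:
  assumes C: "poset_chain S C" shows "degree_cone S r C = dv.K C"
proof
  have "convex_cone (dv.K C)" by (auto simp: convex_cone_iff intro: dv.K_zero dv.K_add dv.K_scale)
  moreover have "degree_map S ` Gamma_on S r C \<subseteq> dv.K C"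
    using Gamma_on_orth by (auto simp: dv.K_def degree_map_lin)
  ultimately show "degree_cone S r C \<subseteq> dv.K C" unfolding degree_cone_def by (intro hull_minimal)
  have cone: "convex_cone (degree_cone S r C)" unfolding degree_cone_def by (rule convex_cone_convex_cone_hull)
  show "dv.K C \<subseteq> degree_cone S r C"
  proof (rule dv.K_least)
    fix p assume p: "p \<in> C"
    have "(\<chi> q. real (if q = p then 1 else 0)) \<in> Gamma_on S r C" by (rule Gamma_onI[OF C]) (use p in \<open>auto split: if_splits\<close>)
    moreover have "(\<chi> q. real (if q = p then 1 else 0)) = 1 *\<^sub>R axis p 1" by (auto simp: vec_eq_iff axis_def)
    ultimately have "1 *\<^sub>R axis p 1 \<in> Gamma_on S r C" by simp
    then have "degree_map S (1 *\<^sub>R axis p 1) \<in> degree_cone S r C" unfolding degree_cone_def by (intro hull_inc imageI)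
    then show "extr_degree S p \<in> degree_cone S r C" unfolding degree_map_lin dv.lin_axis by simp
  qed (use cone in \<open>auto simp: convex_cone_iff\<close>)
qed

lemma NO_polytope_eq:
  assumes C: "poset_chain S C" shows "NO_polytope S r d C = dv.P C"
proof -
  let ?U = "\<Union>n\<in>{1::nat..}. {(1 / real n) *\<^sub>R a | a. a \<in> Gamma_on S r C \<and> degree_map S a = real n *\<^sub>R real_degree d}"
  have "?U \<subseteq> dv.P C"
  proof
    fix x assume "x \<in> ?U"
    then obtain n a where na: "1 \<le> n" "x = (1 / real n) *\<^sub>R a" "a \<in> Gamma_on S r C" "dv.lin a = real n *\<^sub>R real_degree d"
      by (auto simp: degree_map_lin)
    have "x \<in> dv.orth C" unfolding na(2) by (intro dv.orth_scale Gamma_on_orth na(3)) simp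
    moreover have "dv.lin x = real_degree d" unfolding na(2) linear_scale[OF dv.linear_lin] na(4) using na(1) by simp
    ultimately show "x \<in> dv.P C" by (simp add: dv.P_def)
  qed
  moreover have "{x \<in> dv.P C. \<forall>p. x $ p \<in> \<rat>} \<subseteq> ?U"
  proof
    fix x assume "x \<in> {x \<in> dv.P C. \<forall>p. x $ p \<in> \<rat>}"
    then obtain n k where nk: "1 \<le> n" "real n *\<^sub>R x = (\<chi> p. real (k p))" "\<And>p. k p \<noteq> 0 \<Longrightarrow> p \<in> C"
      "dv.lin (real n *\<^sub>R x) = real n *\<^sub>R real_degree d" using dv.integral_multiple[of x C] by auto
    have "real n *\<^sub>R x \<in> Gamma_on S r C" unfolding nk(2) by (rule Gamma_onI[OF C nk(3)])
    moreover have "x = (1 / real n) *\<^sub>R (real n *\<^sub>R x)" using nk(1) by simp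
    ultimately show "x \<in> ?U" using nk(1,4) unfolding degree_map_lin
      by (intro UN_I[of n] CollectI exI[of _ "real n *\<^sub>R x"] conjI) simp_all
  qed
  from closure_mono[OF this] have "dv.P C \<subseteq> closure ?U" unfolding dv.P_closure .
  ultimately show ?thesis unfolding NO_polytope_def
    by (intro subset_antisym closure_minimal compact_imp_closed dv.compact_P)
qed

lemma minimal_face:
  assumes C: "poset_chain S C" and d: "real_degree d \<in> dv.K C"
  shows "minimal_face S r d C face_of dv.K C" "real_degree d \<in> rel_interior (minimal_face S r d C)"
proof -
  have "\<exists>!\<tau>. \<tau> face_of dv.K C \<and> real_degree d \<in> rel_interior \<tau>"
    using exists_minimal_face[OF dv.convex_K d] face_of_eq by blast
  from theI'[OF this] show "minimal_face S r d C face_of dv.K C" "real_degree d \<in> rel_interior (minimal_face S r d C)"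
    by (simp_all add: minimal_face_def degree_cone_eq[OF C])
qed

lemma subchain_eq: "poset_chain S C \<Longrightarrow>
    subchain S r d C = (if real_degree d \<in> dv.K C then {p \<in> C. dv.ray p edge_of minimal_face S r d C} else {})"
  by (simp add: subchain_def degree_cone_eq degree_ray_eq)

text \<open>The edges generate the minimal face, so each element of the subchain has a positive
  coordinate at some point of the polytope of the subchain. Hence members of the complex are
  recovered from their polytopes.\<close>

lemma supp_subchain:
  assumes C: "poset_chain S C" shows "dv.supp (subchain S r d C) = subchain S r d C"
proof (cases "real_degree d \<in> dv.K C")
  case True
  then show ?thesis using dv.supp_edges[OF minimal_face[OF C True]] by (simp add: subchain_eq[OF C])
next
  case False
  then show ?thesis using dv.supp_subset[of "{}"] by (simp add: subchain_eq[OF C])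
qed

text \<open>The subchain collects the edges of the minimal face, the support all degrees in it;
  \<open>degrees_on_edges\<close> is what identifies the two.\<close>

lemma subchain_supp:
  assumes M: "poset_chain S M" "degrees_on_edges S r d M" and C: "C \<subseteq> M"
  shows "subchain S r d C = dv.supp C"
proof -
  have chain: "poset_chain S C" using M(1) C by (auto simp: poset_chain_def)
  show ?thesis
  proof (cases "real_degree d \<in> dv.K C")
    case True
    have "dv.ray p edge_of minimal_face S r d C \<longleftrightarrow> extr_degree S p \<in> minimal_face S r d C" if p: "p \<in> C" for p
    proof
      show "extr_degree S p \<in> minimal_face S r d C" if "dv.ray p edge_of minimal_face S r d C"
        using edge_of_imp_subset[OF that] dv.g_in_ray[of p] by blast
      show "dv.ray p edge_of minimal_face S r d C" if "extr_degree S p \<in> minimal_face S r d C"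
        using M(2) C p True that by (simp add: degrees_on_edges_def degree_cone_eq[OF chain] degree_ray_eq)
    qed
    then show ?thesis using dv.supp_eq[OF minimal_face[OF chain True]] True by (auto simp: subchain_eq[OF chain])
  next
    case False
    then show ?thesis using dv.supp_empty[of C] dv.P_nonempty[of C] by (auto simp: subchain_eq[OF chain])
  qed
qed

lemma extreme_in_rational_span:
  assumes C: "poset_chain S C" and x: "x extreme_point_of dv.P C"
  shows "x \<in> rational_span (value_lattice S r d C)"
proof -
  interpret I: module "\<lambda>k::int. (*\<^sub>R) (of_int k) :: real ^ 'a \<Rightarrow> real ^ 'a"
    by unfold_locales (auto simp: algebra_simps)
  interpret Q: module "\<lambda>k::rat. (*\<^sub>R) (of_rat k) :: real ^ 'a \<Rightarrow> real ^ 'a"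
    by unfold_locales (auto simp: algebra_simps of_rat_add of_rat_mult)
  have "x \<in> dv.P C" using x by (simp add: extreme_point_of_def)
  from dv.integral_multiple[OF this dv.extreme_rational[OF x]]
  obtain n k where nk: "1 \<le> n" "real n *\<^sub>R x = (\<chi> p. real (k p))" "\<forall>p. k p \<noteq> 0 \<longrightarrow> p \<in> C"
    "dv.lin (real n *\<^sub>R x) = real n *\<^sub>R real_degree d" by (elim exE conjE) (rule that)
  have "real n *\<^sub>R x \<in> Gamma_on S r C" unfolding nk(2) by (rule Gamma_onI[OF C nk(3)[rule_format]])
  then have "real n *\<^sub>R x \<in> value_lattice S r d C"
    unfolding value_lattice_def using nk(4) by (intro I.span_base) (auto simp: degree_map_lin)
  then have "of_rat (1 / of_nat n) *\<^sub>R (real n *\<^sub>R x) \<in> rational_span (value_lattice S r d C)"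
    unfolding rational_span_def by (intro Q.span_scale Q.span_base)
  moreover have "of_rat (1 / of_nat n) *\<^sub>R (real n *\<^sub>R x) = x" using nk(1) by (simp add: of_rat_divide)
  ultimately show ?thesis by simp
qed

context
  fixes M assumes M: "poset_chain S M" "degrees_on_edges S r d M"
begin

lemma subchains: "C \<subseteq> M \<Longrightarrow> poset_chain S C"
  using M(1) by (auto simp: poset_chain_def)

lemma complex_supp:
  assumes "E \<in> subchain_complex S r d" shows "dv.supp E = E"
  using assms supp_subchain by (auto simp: subchain_complex_def)

lemma order_embedding:
  assumes "C \<subseteq> M" "C' \<subseteq> M"
  shows "NO_polytope S r d C \<subseteq> NO_polytope S r d C' \<longleftrightarrow> subchain S r d C \<subseteq> subchain S r d C'"
  using assms by (simp add: NO_polytope_eq subchains subchain_supp[OF M] dv.P_subset_iff)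

lemma complex_order_embedding:
  assumes "C \<in> {C \<in> subchain_complex S r d. C \<subseteq> M}" "C' \<in> {C \<in> subchain_complex S r d. C \<subseteq> M}"
  shows "C \<subseteq> C' \<longleftrightarrow> NO_polytope S r d C \<subseteq> NO_polytope S r d C'"
  using assms by (simp add: NO_polytope_eq subchains dv.P_subset_iff complex_supp)

lemma faces_bijection:
  assumes d: "d \<noteq> (\<lambda>_. 0)"
  shows "bij_betw (NO_polytope S r d) {C \<in> subchain_complex S r d. C \<subseteq> M} {F. F face_of NO_polytope S r d M}"
  unfolding bij_betw_def
proof
  show "inj_on (NO_polytope S r d) {C \<in> subchain_complex S r d. C \<subseteq> M}"
    by (rule inj_onI) (use complex_order_embedding in blast)
  show "NO_polytope S r d ` {C \<in> subchain_complex S r d. C \<subseteq> M} = {F. F face_of NO_polytope S r d M}"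
  proof (intro equalityI subsetI)
    fix F assume "F \<in> NO_polytope S r d ` {C \<in> subchain_complex S r d. C \<subseteq> M}"
    then show "F \<in> {F. F face_of NO_polytope S r d M}"
      using dv.P_face by (auto simp: NO_polytope_eq subchains M(1))
  next
    fix F assume "F \<in> {F. F face_of NO_polytope S r d M}"
    then have F: "F face_of dv.P M" by (simp add: NO_polytope_eq M(1))
    have "\<exists>E\<subseteq>M. F = dv.P E \<and> dv.supp E = E"
    proof (cases "F = {}")
      case True
      \<comment> \<open>For non-zero \<open>d\<close> the empty chain has an empty polytope, so the
        empty face is attained.\<close>
      have "a \<notin> dv.P {}" for a
      proof
        assume "a \<in> dv.P {}"
        then have "a = 0" "dv.lin a = real_degree d" by (auto simp: dv.P_def dv.orth_def vec_eq_iff)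
        then have "real_degree d = 0" using linear_0[OF dv.linear_lin] by simp
        then show False using d by (auto simp: real_degree_def vec_eq_iff fun_eq_iff)
      qed
      then show ?thesis using True dv.supp_subset[of "{}"] by (intro exI[of _ "{}"]) auto
    next
      case False
      then show ?thesis using dv.P_faces[OF F] by blast
    qed
    then obtain E where E: "E \<subseteq> M" "F = dv.P E" "dv.supp E = E" by blast
    have "subchain S r d E = E" using subchain_supp[OF M E(1)] E(3) by simp
    then have "E \<in> subchain_complex S r d" unfolding subchain_complex_def using subchains[OF E(1)] by (metis imageI mem_Collect_eq)
    moreover have "NO_polytope S r d E = F" using NO_polytope_eq subchains[OF E(1)] E(2) by simp
    ultimately show "F \<in> NO_polytope S r d ` {C \<in> subchain_complex S r d. C \<subseteq> M}" using E(1) by blast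
  qed
qed

lemma face_dimension_vertices:
  assumes C: "C \<subseteq> M"
  shows "NO_polytope S r d C face_of NO_polytope S r d M"
    and "polytope_dim (NO_polytope S r d C) =
      int (card (subchain S r d C)) - polytope_dim (degree_cone S r (subchain S r d C))"
    and "x extreme_point_of NO_polytope S r d C \<Longrightarrow> x \<in> rational_span (value_lattice S r d C)"
proof -
  note eq = NO_polytope_eq[OF subchains[OF C]] NO_polytope_eq[OF M(1)]
  show "NO_polytope S r d C face_of NO_polytope S r d M" unfolding eq by (rule dv.P_face[OF C])
  have "subchain S r d C = dv.supp C" by (rule subchain_supp[OF M C])
  moreover have "dv.supp C \<subseteq> M" using dv.supp_subset C by blast
  ultimately show "polytope_dim (NO_polytope S r d C) =
      int (card (subchain S r d C)) - polytope_dim (degree_cone S r (subchain S r d C))"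
    using dv.polytope_dim_P[of C] by (simp add: eq degree_cone_eq subchains)
  show "x extreme_point_of NO_polytope S r d C \<Longrightarrow> x \<in> rational_span (value_lattice S r d C)"
    unfolding eq by (rule extreme_in_rational_span[OF subchains[OF C]])
qed

end

end

end

text \<open>For \<open>d = 0\<close> the polytope of every chain is the origin, since the degrees
  are non-negative and non-zero; the empty face is then not the polytope of a chain, hence the
  condition on \<open>d\<close> in the second part.\<close>

theorem proposition7p3:
  fixes S :: "('k::alg_closed_field, 'v::ab_group_add, 'm::finite, 'a::finite) stratification"
    and r :: "('a \<times> 'a) set" and d :: "'m \<Rightarrow> nat" and M :: "'a set"
  assumes "seshadri_stratification S"
    and "has_divisorial_valuations S"
    and "refines_order S r"
    and "maximal_chain S M"
    and "degrees_on_edges S r d M"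
  shows "(\<forall>C D. C \<subseteq> M \<and> D \<subseteq> M \<longrightarrow>
            (NO_polytope S r d C \<subseteq> NO_polytope S r d D \<longleftrightarrow> subchain S r d C \<subseteq> subchain S r d D)) \<and>
         (d \<noteq> (\<lambda>_. 0) \<longrightarrow>
            bij_betw (NO_polytope S r d) {C \<in> subchain_complex S r d. C \<subseteq> M}
              {F. F face_of NO_polytope S r d M} \<and>
            (\<forall>C\<in>{C \<in> subchain_complex S r d. C \<subseteq> M}. \<forall>D\<in>{C \<in> subchain_complex S r d. C \<subseteq> M}.
               C \<subseteq> D \<longleftrightarrow> NO_polytope S r d C \<subseteq> NO_polytope S r d D)) \<and>
         (\<forall>C. C \<subseteq> M \<longrightarrow>
            NO_polytope S r d C face_of NO_polytope S r d M \<and>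
            polytope_dim (NO_polytope S r d C) =
              int (card (subchain S r d C)) - polytope_dim (degree_cone S r (subchain S r d C)) \<and>
            (\<forall>x. x extreme_point_of NO_polytope S r d C \<longrightarrow>
               x \<in> rational_span (value_lattice S r d C)))"
proof -
  interpret seshadri S using assms(1,2) by unfold_locales
  have M: "poset_chain S M" using assms(4) by (simp add: maximal_chain_def)
  note facts = order_embedding[OF assms(3) M assms(5)] faces_bijection[OF assms(3) M assms(5)]
    complex_order_embedding[OF assms(3) M assms(5)] face_dimension_vertices[OF assms(3) M assms(5)]
  show ?thesis by (intro conjI allI ballI impI; (elim conjE)?; rule facts; assumption)
qed

end
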